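(* Consider two weak solutions $(v,\omega_1,\omega)$ and $(v^*,\omega_1^*,\omega^* )$ to the equations of motion corresponding to initial data $(v_0,\omega_{10},\omega_0)$ and $(v_0^*,\omega_{10}^*,\omega_0^* )$, respectively. Suppose that there exists a time $T>0$ such that $$v^*\in L^p(0,T;L^q(L)),\qquad \frac2p+\frac3q=1,\quad\text{for some }q>3.$$ Then the following properties hold. a) There exists a positive constant $c$ depending only on $\|v^*\|_{L^\infty(0,T;L^2(L))}$, $\|v^*\|_{L^p(0,T;L^q(L))}$, $\max_{t\in[0,T]}|\omega_1^*(t)|$ and $\max_{t\in[0,T]}|\omega^*(t)|$ such that $$\|v(t)-v^*(t)\|_{L^2(L)}+|\omega_1(t)-\omega_1^*(t)|+|\omega(t)-\omega^*(t)|\le c\left(\|v_0-v_0^*\|_{L^2(L)}+|\omega_{10}-\omega_{10}^*|+|\omega_0-\omega_0^*|\right)\quad\text{for all }t\in[0,T].$$ b) If $(v_0,\omega_{10},\omega_0)=(v_0^*,\omega_{10}^*,\omega_0^* )$, then $(v,\omega_1,\omega)=(v^*,\omega_1^*,\omega^* )$ a.e. in $[0,T]\times L$.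
   Context: Geometry and constants. $V\subset\mathbb R^3$ is a bounded domain containing $\overline{B_R}$, where $B_R$ is the open ball of radius $R>0$ centered at the origin $G$. Put $B_2:=B_R$ (homogeneous rigid ball of mass $m$), $L:=V\setminus\overline{B_R}$ (region of the liquid, assumed of class $C^2$), $C:=\partial V$, $S:=\partial B_R$, and let $n$ be the outward unit normal to $\partial L$. The rigid body $B_1=V_1\setminus\overline V$ ($V_1$ a bounded domain, $\overline V\subset V_1$) surrounds the cavity $V$. Constants: liquid density $\rho>0$, viscosity $\mu>0$, $\lambda:=\frac25mR^2$. $I_B$ is the (constant, symmetric, positive definite) inertia tensor of $B_1$ with respect to $G$; $I_L$ is given by $\beta\cdot I_L\cdot\gamma=\rho\int_L(x\times\beta)\cdot(x\times\gamma)\,dV$ for $\beta,\gamma\in\mathbb R^3$; $I:=I_L+I_B+\lambda\mathbf 1$. The point $G$ is the center of mass of $B_1$ plus liquid, and the reference axes are directed along the eigenvectors of $I_L+I_B$. Equations of motion. For the relative liquid velocity $v$, pressure $p$, angular velocity $\omega_1$ of $B_1$ and relative angular velocity $\omega$ of the ball (angular velocity of $B_2$ minus that of $B_1$), with $T(v,p)=-p\mathbf 1+2\mu D(v)$, $D(v)=\frac12(\nabla v+(\nabla v)^T)$, $\omega_R=-I^{-1}\cdot[\rho\int_Lx\times v\,dV+\lambda\omega]$: $\rho(\partial_tv+\dot\omega_1\times x+v\cdot\nabla v+2\omega_1\times v)=\frac\rho2\nabla|\omega_1\times x|^2+\operatorname{div}T(v,p)$ and $\operatorname{div}v=0$ in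 $L\times(0,\infty)$; $I\cdot(\dot\omega_1-\dot\omega_R)+\omega_1\times I\cdot(\omega_1-\omega_R)=0$ and $\lambda(\dot\omega+\dot\omega_1+\omega_1\times\omega)=-\int_Sx\times T(v,p)\cdot n\,d\sigma$ in $(0,\infty)$; $v=0$ on $C$, $v=\omega\times x$ on $S$. Spaces. $\mathcal D_R(V)$ is the set of divergence-free $u\in C_0^\infty(V)$ (vector fields) such that $u=\omega_u\times x$ in a neighborhood of $B_2$ for some $\omega_u\in\mathbb R^3$. Let $\tilde\rho=\rho$ on $L$ and $\tilde\rho=\frac{15\lambda}{8\pi R^5}$ on $B_2$; $(u,w):=\int_V\tilde\rho\,u\cdot w=\int_L\rho\,u\cdot w+\lambda\,\omega_u\cdot\omega_w$ and $\|u\|_2:=(u,u)^{1/2}$. $\mathcal H_2(V)$ is the completion of $\mathcal D_R(V)$ in $\|\cdot\|_2$, equivalently $\{u\in L^2(V):u=\omega_u\times x\text{ on }B_2\text{ for some }\omega_u\in\mathbb R^3,\ \operatorname{div}u=0\text{ in }V,\ u\cdot n=0\text{ on }C\}$. $\mathcal H^1_2(V)$ is the completion of $\mathcal D_R(V)$ in the norm $(\|u\|_2^2+2\mu\|D(u)\|_{L^2(V)}^2)^{1/2}$, equivalently $\{u\in W^{1,2}_0(V):\operatorname{div}u=0,\ u=\omega_u\times x\text{ on }B_2\text{ for some }\omega_u\in\mathbb R^3\}$. Functionals. $b(w):=-I^{-1}\cdot\int_V\tilde\rho\,x\times w=-I^{-1}\cdot(\rho\int_Lx\times w+\lambda\omega_w)\in\mathbb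 R^3$; $\mathcal E(w):=\|w\|_2^2-b(w)\cdot I\cdot b(w)$; $(u,w)_B:=(u,w)-b(u)\cdot I\cdot b(w)$. Weak solution. A triple $(v,\omega_1,\omega)$ is a weak solution if, with $\tilde v:=v$ in $L$ and $\tilde v:=\omega\times x$ in $B_2$: (1) $\tilde v\in C_w([0,\infty);\mathcal H_2(V))\cap L^\infty(0,\infty;\mathcal H_2(V))\cap L^2(0,\infty;\mathcal H^1_2(V))$ ($C_w$ denotes weak continuity in time); (2) $\Omega:=\omega_1-b(\tilde v)\in C^0([0,\infty))\cap C^1((0,\infty))$; (3) for all $\varphi\in\mathcal H^1_2(V)$ and all $t\in[0,\infty)$, $(\tilde v(t),\varphi)_B+2\mu\int_0^t\int_VD(\tilde v):D(\varphi)\,dV\,d\tau+b(\varphi)\cdot\int_0^t[\Omega+b(\tilde v)]\times I\cdot\Omega\,d\tau+\int_0^t\int_V\tilde\rho[\tilde v\cdot\nabla\tilde v+2(\Omega+b(\tilde v))\times\tilde v]\cdot\varphi\,dV\,d\tau=(\tilde v(0),\varphi)_B$, and $I\cdot\Omega(t)+\int_0^t[\Omega+b(\tilde v)]\times I\cdot\Omega\,d\tau=I\cdot\Omega(0)$ for all $t\in[0,\infty)$; (4) (strong energy inequality) $\mathcal E(\tilde v(t))+\Omega(t)\cdot I\cdot\Omega(t)+4\mu\int_s^t\|D(\tilde v(\tau))\|_{L^2(L)}^2d\tau\le\mathcal E(\tilde v(s))+\Omega(s)\cdot I\cdot\Omega(s)$ for all $t\ge s$ and a.a. $s\ge0$ including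 $s=0$. The solution corresponds to initial data $(v_0,\omega_{10},\omega_0)$ if $v(0)=v_0$, $\omega_1(0)=\omega_{10}$, $\omega(0)=\omega_0$. *)

theory Defs
  imports "HOL-Analysis.Analysis" "HOL-Probability.Essential_Supremum"
begin

section \<open>Smooth functions and domains of class \<open>C\<^sup>2\<close>\<close>

text \<open>Only used for open \<open>A\<close>.\<close>

primrec Ck_on :: "nat \<Rightarrow> 'a::euclidean_space set \<Rightarrow> ('a \<Rightarrow> 'b::real_normed_vector) \<Rightarrow> bool" where
  "Ck_on 0 A f = continuous_on A f"
| "Ck_on (Suc k) A f =
     ((\<forall>x\<in>A. f differentiable (at x)) \<and>
      (\<forall>e\<in>Basis. Ck_on k A (\<lambda>x. frechet_derivative f (at x) e)))"

text \<open>\<open>C\<^sub>0\<^sup>\<infinity>(A)\<close>; test functions are extended by zero to the whole space.\<close>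

definition test_function :: "'a::euclidean_space set \<Rightarrow> ('a \<Rightarrow> 'b::real_normed_vector) \<Rightarrow> bool" where
  "test_function A f \<longleftrightarrow>
     (\<forall>k. Ck_on k UNIV f) \<and>
     compact (closure {x. f x \<noteq> 0}) \<and> closure {x. f x \<noteq> 0} \<subseteq> A"

text \<open>Near each boundary point, in suitable orthonormal coordinates \<open>y = Q x\<close>, the
  set is the region above the graph of a \<open>C\<^sup>2\<close> function of \<open>(y\<^sub>1, y\<^sub>2)\<close>.\<close>

definition C2_domain :: "(real^3) set \<Rightarrow> bool" where
  "C2_domain A \<longleftrightarrow>
     open A \<and> connected A \<and>
     (\<forall>x0 \<in> frontier A. \<exists>r>0. \<exists>Q :: real^3 \<Rightarrow> real^3. \<exists>g :: real \<times> real \<Rightarrow> real.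
        orthogonal_transformation Q \<and> Ck_on 2 UNIV g \<and>
        A \<inter> ball x0 r = {x \<in> ball x0 r. g (Q x $ 1, Q x $ 2) < Q x $ 3})"


section \<open>Lebesgue and Bochner spaces\<close>

text \<open>Elements of all function spaces are represented by functions; equality in the
  space is equality almost everywhere.\<close>

definition Lq_space :: "real \<Rightarrow> 'a::euclidean_space set \<Rightarrow> ('a \<Rightarrow> 'b::euclidean_space) set" where
  "Lq_space q A = {f. f \<in> borel_measurable (lebesgue_on A) \<and>
                      integrable (lebesgue_on A) (\<lambda>x. norm (f x) powr q)}"

definition Lq_norm :: "real \<Rightarrow> 'a::euclidean_space set \<Rightarrow> ('a \<Rightarrow> 'b::euclidean_space) \<Rightarrow> real" where
  "Lq_norm q A f = (\<integral>x. norm (f x) powr q \<partial>lebesgue_on A) powr (1 / q)"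

type_synonym field3 = "real^3 \<Rightarrow> real^3"

text \<open>Bochner spaces over a time interval \<open>J\<close> with values in a space \<open>X\<close> of vector
  fields normed by \<open>N\<close>. Strong measurability: a.e. limit in norm of simple functions.\<close>

definition strongly_measurable ::
    "real set \<Rightarrow> field3 set \<Rightarrow> (field3 \<Rightarrow> real) \<Rightarrow> (real \<Rightarrow> field3) \<Rightarrow> bool" where
  "strongly_measurable J X N u \<longleftrightarrow>
     (\<exists>s. (\<forall>n::nat. finite (s n ` J) \<and> s n ` J \<subseteq> X \<and>
                    (\<forall>y. {t \<in> J. s n t = y} \<in> sets lebesgue)) \<and>
          (AE t in lebesgue_on J. (\<lambda>n. N (\<lambda>x. s n t x - u t x)) \<longlonglongrightarrow> 0))"

definition Bochner_Lp ::
    "real \<Rightarrow> real set \<Rightarrow> field3 set \<Rightarrow> (field3 \<Rightarrow> real) \<Rightarrow> (real \<Rightarrow> field3) set" where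
  "Bochner_Lp p J X N = {u. (AE t in lebesgue_on J. u t \<in> X) \<and> strongly_measurable J X N u \<and>
                            integrable (lebesgue_on J) (\<lambda>t. N (u t) powr p)}"

definition Bochner_Lp_norm ::
    "real \<Rightarrow> real set \<Rightarrow> (field3 \<Rightarrow> real) \<Rightarrow> (real \<Rightarrow> field3) \<Rightarrow> real" where
  "Bochner_Lp_norm p J N u = (\<integral>t. N (u t) powr p \<partial>lebesgue_on J) powr (1 / p)"

definition Bochner_Linf ::
    "real set \<Rightarrow> field3 set \<Rightarrow> (field3 \<Rightarrow> real) \<Rightarrow> (real \<Rightarrow> field3) set" where
  "Bochner_Linf J X N = {u. (AE t in lebesgue_on J. u t \<in> X) \<and> strongly_measurable J X N u \<and>
                            esssup (lebesgue_on J) (\<lambda>t. ereal (N (u t))) < \<infinity>}"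

definition Bochner_Linf_norm ::
    "real set \<Rightarrow> (field3 \<Rightarrow> real) \<Rightarrow> (real \<Rightarrow> field3) \<Rightarrow> real" where
  "Bochner_Linf_norm J N u = real_of_ereal (esssup (lebesgue_on J) (\<lambda>t. ereal (N (u t))))"


section \<open>Weak gradients\<close>

text \<open>Convention: \<open>G x $ i $ j = \<partial>\<^sub>j u\<^sub>i\<close>, so that \<open>G x *v w = w \<cdot> \<nabla> u\<close>.\<close>

definition is_weak_gradient :: "(real^3) set \<Rightarrow> field3 \<Rightarrow> (real^3 \<Rightarrow> real^3^3) \<Rightarrow> bool" where
  "is_weak_gradient A u G \<longleftrightarrow>
     (\<forall>K. compact K \<and> K \<subseteq> A \<longrightarrow> integrable (lebesgue_on K) u \<and> integrable (lebesgue_on K) G) \<and>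
     (\<forall>\<psi> :: real^3 \<Rightarrow> real. test_function A \<psi> \<longrightarrow>
        (\<forall>i j. (\<integral>x. u x $ i * frechet_derivative \<psi> (at x) (axis j 1) \<partial>lebesgue_on A)
             = - (\<integral>x. G x $ i $ j * \<psi> x \<partial>lebesgue_on A)))"

definition weak_gradient :: "(real^3) set \<Rightarrow> field3 \<Rightarrow> real^3 \<Rightarrow> real^3^3" where
  "weak_gradient A u = (SOME G. is_weak_gradient A u G)"

definition sym_gradient :: "(real^3) set \<Rightarrow> field3 \<Rightarrow> real^3 \<Rightarrow> real^3^3" where
  "sym_gradient A u x = (1/2) *\<^sub>R (weak_gradient A u x + transpose (weak_gradient A u x))"

definition W12 :: "(real^3) set \<Rightarrow> field3 set" where
  "W12 A = {u \<in> Lq_space 2 A. \<exists>G \<in> Lq_space 2 A. is_weak_gradient A u G}"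


section \<open>The mechanical system\<close>

text \<open>The mass distribution of the outer rigid body \<open>B\<^sub>1\<close> is a finite Borel measure
  carried by \<open>B\<^sub>1\<close>.\<close>

record gap_system =
  cavity :: "(real^3) set"           \<comment> \<open>\<open>V\<close>\<close>
  outer_hull :: "(real^3) set"       \<comment> \<open>\<open>V\<^sub>1\<close>\<close>
  body_mass :: "(real^3) measure"    \<comment> \<open>mass distribution of \<open>B\<^sub>1\<close>\<close>
  radius :: real                     \<comment> \<open>\<open>R\<close>\<close>
  ball_mass :: real                  \<comment> \<open>\<open>m\<close>\<close>
  fluid_density :: real              \<comment> \<open>\<open>\<rho>\<close>\<close>
  viscosity :: real                  \<comment> \<open>\<open>\<mu>\<close>\<close>

definition liquid :: "gap_system \<Rightarrow> (real^3) set" where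
  "liquid S = cavity S - cball 0 (radius S)"

definition outer_body :: "gap_system \<Rightarrow> (real^3) set" where
  "outer_body S = outer_hull S - closure (cavity S)"

definition ball_inertia :: "gap_system \<Rightarrow> real" where  \<comment> \<open>\<open>\<lambda>\<close>\<close>
  "ball_inertia S = 2/5 * ball_mass S * (radius S)\<^sup>2"

context includes cross3_syntax
begin

text \<open>The matrix of the bilinear form
  \<open>(\<beta>, \<gamma>) \<mapsto> \<integral> (x \<times> \<beta>) \<cdot> (x \<times> \<gamma>) dM\<close>.\<close>

definition inertia_tensor :: "(real^3) measure \<Rightarrow> real^3^3" where
  "inertia_tensor M = (\<chi> i j. \<integral>x. (x \<times> axis i 1) \<bullet> (x \<times> axis j 1) \<partial>M)"

definition inertia_L :: "gap_system \<Rightarrow> real^3^3" where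
  "inertia_L S = fluid_density S *\<^sub>R inertia_tensor (lebesgue_on (liquid S))"

definition inertia_B :: "gap_system \<Rightarrow> real^3^3" where
  "inertia_B S = inertia_tensor (body_mass S)"

definition total_inertia :: "gap_system \<Rightarrow> real^3^3" where
  "total_inertia S = inertia_L S + inertia_B S + ball_inertia S *\<^sub>R mat 1"

text \<open>The last two conditions place the center of mass of \<open>B\<^sub>1\<close> plus liquid at the
  origin and the axes along eigenvectors of \<open>I\<^sub>L + I\<^sub>B\<close>.\<close>

definition admissible :: "gap_system \<Rightarrow> bool" where
  "admissible S \<longleftrightarrow>
     0 < radius S \<and> 0 < ball_mass S \<and> 0 < fluid_density S \<and> 0 < viscosity S \<and>
     open (cavity S) \<and> connected (cavity S) \<and> bounded (cavity S) \<and>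
     cball 0 (radius S) \<subseteq> cavity S \<and>
     C2_domain (liquid S) \<and>
     open (outer_hull S) \<and> connected (outer_hull S) \<and> bounded (outer_hull S) \<and>
     closure (cavity S) \<subseteq> outer_hull S \<and>
     sets (body_mass S) = sets borel \<and> finite_measure (body_mass S) \<and>
     emeasure (body_mass S) (- outer_body S) = 0 \<and>
     (\<forall>\<beta>. \<beta> \<noteq> 0 \<longrightarrow> 0 < \<beta> \<bullet> (inertia_B S *v \<beta>)) \<and>
     fluid_density S *\<^sub>R (\<integral>x. x \<partial>lebesgue_on (liquid S)) + (\<integral>x. x \<partial>body_mass S) = 0 \<and>
     (\<forall>i j. i \<noteq> j \<longrightarrow> (inertia_L S + inertia_B S) $ i $ j = 0)"


section \<open>Function spaces and functionals\<close>

text \<open>A neighbourhood of \<open>B\<^sub>2\<close> means one of its closure, the open ball being a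
  neighbourhood of itself.\<close>

definition D_R :: "gap_system \<Rightarrow> field3 set" where
  "D_R S = {u. test_function (cavity S) u \<and> (\<forall>x. trace (jacobian u (at x)) = 0) \<and>
               (\<exists>\<omega> U. open U \<and> cball 0 (radius S) \<subseteq> U \<and> (\<forall>x\<in>U. u x = \<omega> \<times> x))}"

definition density_tilde :: "gap_system \<Rightarrow> real^3 \<Rightarrow> real" where
  "density_tilde S x = (if x \<in> liquid S then fluid_density S
                        else 15 * ball_inertia S / (8 * pi * radius S ^ 5))"

definition inner2 :: "gap_system \<Rightarrow> field3 \<Rightarrow> field3 \<Rightarrow> real" where
  "inner2 S u w = (\<integral>x. density_tilde S x * (u x \<bullet> w x) \<partial>lebesgue_on (cavity S))"

definition norm2 :: "gap_system \<Rightarrow> field3 \<Rightarrow> real" where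
  "norm2 S u = sqrt (inner2 S u u)"

definition norm12 :: "gap_system \<Rightarrow> field3 \<Rightarrow> real" where
  "norm12 S u = sqrt ((norm2 S u)\<^sup>2 + 2 * viscosity S *
                      (Lq_norm 2 (cavity S) (sym_gradient (cavity S) u))\<^sup>2)"

text \<open>The completions of \<open>D_R\<close> in the two norms, realised inside \<open>L\<^sup>2(V)\<close> and
  \<open>W\<^sup>1\<^sup>,\<^sup>2(V)\<close>.\<close>

definition H2 :: "gap_system \<Rightarrow> field3 set" where
  "H2 S = {u \<in> Lq_space 2 (cavity S).
             \<exists>\<phi>. (\<forall>n::nat. \<phi> n \<in> D_R S) \<and> (\<lambda>n. norm2 S (\<lambda>x. \<phi> n x - u x)) \<longlonglongrightarrow> 0}"

definition H12 :: "gap_system \<Rightarrow> field3 set" where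
  "H12 S = {u \<in> W12 (cavity S).
             \<exists>\<phi>. (\<forall>n::nat. \<phi> n \<in> D_R S) \<and> (\<lambda>n. norm12 S (\<lambda>x. \<phi> n x - u x)) \<longlonglongrightarrow> 0}"

text \<open>\<open>C\<^sub>w([0,\<infinity>); H\<^sub>2(V))\<close>: by the Riesz theorem the bounded functionals on the Hilbert
  space are the inner products with its elements.\<close>

definition weakly_continuous_H2 :: "gap_system \<Rightarrow> (real \<Rightarrow> field3) \<Rightarrow> bool" where
  "weakly_continuous_H2 S u \<longleftrightarrow>
     (\<forall>t\<ge>0. u t \<in> H2 S) \<and> (\<forall>\<phi>\<in>H2 S. continuous_on {0..} (\<lambda>t. inner2 S (u t) \<phi>))"

definition b_vec :: "gap_system \<Rightarrow> field3 \<Rightarrow> real^3" where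
  "b_vec S w = - (matrix_inv (total_inertia S) *v
                  (\<integral>x. density_tilde S x *\<^sub>R (x \<times> w x) \<partial>lebesgue_on (cavity S)))"

definition energy :: "gap_system \<Rightarrow> field3 \<Rightarrow> real" where
  "energy S w = (norm2 S w)\<^sup>2 - b_vec S w \<bullet> (total_inertia S *v b_vec S w)"

definition inner_B :: "gap_system \<Rightarrow> field3 \<Rightarrow> field3 \<Rightarrow> real" where
  "inner_B S u w = inner2 S u w - b_vec S u \<bullet> (total_inertia S *v b_vec S w)"


section \<open>Weak solutions\<close>

text \<open>The values of the extended velocity outside \<open>V\<close> are irrelevant.\<close>

definition extend :: "gap_system \<Rightarrow> (real \<Rightarrow> field3) \<Rightarrow> (real \<Rightarrow> real^3) \<Rightarrow> real \<Rightarrow> field3" where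
  "extend S v \<omega> t x = (if x \<in> cball 0 (radius S) then \<omega> t \<times> x else v t x)"

definition Omega ::
    "gap_system \<Rightarrow> (real \<Rightarrow> field3) \<Rightarrow> (real \<Rightarrow> real^3) \<Rightarrow> (real \<Rightarrow> real^3) \<Rightarrow> real \<Rightarrow> real^3" where
  "Omega S v \<omega>1 \<omega> t = \<omega>1 t - b_vec S (extend S v \<omega> t)"

definition momentum_identities :: "gap_system \<Rightarrow> (real \<Rightarrow> field3) \<Rightarrow> (real \<Rightarrow> real^3) \<Rightarrow> bool" where
  "momentum_identities S u W \<longleftrightarrow>
     (\<forall>\<phi>\<in>H12 S. \<forall>t\<ge>0.
        inner_B S (u t) \<phi>
        + 2 * viscosity S * (\<integral>\<tau>. (\<integral>x. sym_gradient (cavity S) (u \<tau>) x \<bullet> sym_gradient (cavity S) \<phi> x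
                                     \<partial>lebesgue_on (cavity S)) \<partial>lebesgue_on {0..t})
        + b_vec S \<phi> \<bullet> (\<integral>\<tau>. (W \<tau> + b_vec S (u \<tau>)) \<times> (total_inertia S *v W \<tau>) \<partial>lebesgue_on {0..t})
        + (\<integral>\<tau>. (\<integral>x. density_tilde S x *
                    ((weak_gradient (cavity S) (u \<tau>) x *v u \<tau> x
                      + 2 *\<^sub>R ((W \<tau> + b_vec S (u \<tau>)) \<times> u \<tau> x)) \<bullet> \<phi> x)
                  \<partial>lebesgue_on (cavity S)) \<partial>lebesgue_on {0..t})
        = inner_B S (u 0) \<phi>) \<and>
     (\<forall>t\<ge>0.
        total_inertia S *v W t
        + (\<integral>\<tau>. (W \<tau> + b_vec S (u \<tau>)) \<times> (total_inertia S *v W \<tau>) \<partial>lebesgue_on {0..t})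
        = total_inertia S *v W 0)"

definition energy_inequality ::
    "gap_system \<Rightarrow> (real \<Rightarrow> field3) \<Rightarrow> (real \<Rightarrow> real^3) \<Rightarrow> real \<Rightarrow> real \<Rightarrow> bool" where
  "energy_inequality S u W s t \<longleftrightarrow>
     energy S (u t) + W t \<bullet> (total_inertia S *v W t)
       + 4 * viscosity S *
         (\<integral>\<tau>. (Lq_norm 2 (liquid S) (sym_gradient (cavity S) (u \<tau>)))\<^sup>2 \<partial>lebesgue_on {s..t})
     \<le> energy S (u s) + W s \<bullet> (total_inertia S *v W s)"

definition weak_solution ::
    "gap_system \<Rightarrow> (real \<Rightarrow> field3) \<Rightarrow> (real \<Rightarrow> real^3) \<Rightarrow> (real \<Rightarrow> real^3) \<Rightarrow> bool" where
  "weak_solution S v \<omega>1 \<omega> \<longleftrightarrow>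
     (let u = extend S v \<omega>; W = Omega S v \<omega>1 \<omega> in
        weakly_continuous_H2 S u \<and>
        u \<in> Bochner_Linf {0<..} (H2 S) (norm2 S) \<and>
        u \<in> Bochner_Lp 2 {0<..} (H12 S) (norm12 S) \<and>
        continuous_on {0..} W \<and> W C1_differentiable_on {0<..} \<and>
        momentum_identities S u W \<and>
        (\<forall>t\<ge>0. energy_inequality S u W 0 t) \<and>
        (AE s in lebesgue_on {0..}. \<forall>t\<ge>s. energy_inequality S u W s t))"

definition has_initial_data ::
    "gap_system \<Rightarrow> (real \<Rightarrow> field3) \<Rightarrow> (real \<Rightarrow> real^3) \<Rightarrow> (real \<Rightarrow> real^3) \<Rightarrow>
     field3 \<Rightarrow> real^3 \<Rightarrow> real^3 \<Rightarrow> bool" where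
  "has_initial_data S v \<omega>1 \<omega> v0 \<omega>10 \<omega>0 \<longleftrightarrow>
     (AE x in lebesgue_on (liquid S). v 0 x = v0 x) \<and> \<omega>1 0 = \<omega>10 \<and> \<omega> 0 = \<omega>0"

end

end

theory Submission imports Defs begin

text \<open>Two solutions \<open>u\<close> and \<open>u*\<close> are compared through the energy \<open>y\<close> of their
 difference \<open>w = u - u*\<close>, to which the quadratic form of \<open>Z = W - W*\<close> is added. Expanding \<open>y\<close>
 gives the two energies and a cross term. The energy inequalities control the energies; the cross
 term must be shown to satisfy an exact balance, although neither solution is smooth enough to
 be used as a test field for the other one.

 The balance is obtained without mollifying the equations. On a short interval from \<open>r\<close> to \<open>t\<close>
 the equation of \<open>u\<close> is tested with the frozen field \<open>u*(t)\<close> and the equation of \<open>u*\<close> with \<open>u(r)\<close>. The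
 error made by freezing is controlled by the modulus of continuity in the mean that every strongly
 measurable Bochner function has (\<open>bochner_modulus\<close>). Summing the errors over a grid whose
 offset is chosen by averaging shows that the defect of the balance vanishes
 (\<open>almost_constant\<close>, \<open>P_modulus\<close>). The Serrin condition enters through \<open>serrin_bound\<close>: it makes
 the convective terms integrable in time.

 After cancellation (\<open>K_eq\<close>) the only terms left are the dissipation of \<open>w\<close>, a Coriolis term, a gyroscopic term
 and \<open>tri w w u*\<close>. Young's inequality absorbs the last one into the dissipation at the
 cost of a factor \<open>||u*||_q ^ p\<close>, integrable in time (\<open>difference_form_bound\<close>). Gronwall's inequality then
 bounds \<open>y(t)\<close> by a multiple of \<open>y(0)\<close>. Finally \<open>y\<close> is equivalent to the square of the distance in
 the theorem because the inertia of the outer body makes the energy coercive (\<open>energy_coercive\<close>,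
 \<open>norm_equivalence\<close>); uniqueness is the case of vanishing initial distance.

 The spaces are completions of smooth test fields, so that Korn's identity, the Sobolev inequality
 and the skew symmetry of \<open>tri\<close> are proved for test fields by integration by parts and then passed to
 the limit.\<close>

section \<open>Smooth functions, bumps and integration by parts\<close>

abbreviation Leb :: "'a::euclidean_space set => 'a measure" where "Leb == lebesgue_on"
abbreviation (input) seq_limit :: "(nat => 'a::topological_space) => 'a => bool" (infix "---->" 60) where
 "X ----> L == (X \<longlongrightarrow> L) sequentially"

definition smooth :: "('a::euclidean_space => 'b::real_normed_vector) => bool" where
 "smooth f \<longleftrightarrow> (ALL k. Ck_on k UNIV f)"

definition pd :: "'a::euclidean_space => ('a => 'b::real_normed_vector) => 'a => 'b" where
 "pd e f x = frechet_derivative f (at x) e"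

lemma Ck_on_SucD: "Ck_on (Suc k) UNIV f ==> Ck_on k UNIV f"
proof (induction k arbitrary: f)
 case 0
 then show ?case
 by (auto simp: differentiable_imp_continuous_within continuous_on_eq_continuous_within)
next
 case (Suc k)
 then show ?case by simp
qed

lemma smooth_differentiable: "smooth f ==> f differentiable (at x)"
 unfolding smooth_def by (metis Ck_on.simps(2) UNIV_I)

lemma smooth_pd: "smooth f ==> e \<in> Basis ==> smooth (pd e f)"
 unfolding smooth_def pd_def by (metis Ck_on.simps(2))

lemma smooth_continuous: "smooth f ==> continuous_on A f"
 unfolding smooth_def by (metis Ck_on.simps(1) continuous_on_subset subset_UNIV)

lemma smooth_has_derivative: "smooth f ==> (f has_derivative (%h. pd h f x)) (at x)"
 unfolding pd_def using smooth_differentiable frechet_derivative_works by metis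

text \<open>Smoothness is the largest class of differentiable functions closed under partial derivatives, which
 permits proofs by exhibiting an invariant set of functions.\<close>

lemma smooth_coinduct:
 assumes "P f"
 and "!!g. P g ==> (ALL x. g differentiable (at x)) & (ALL e:Basis. P (pd e g))"
 shows "smooth f"
proof -
 have "P g ==> Ck_on k UNIV g" for k g
 proof (induction k arbitrary: g)
 case 0
 with assms(2) show ?case
 by (simp add: differentiable_imp_continuous_within continuous_on_eq_continuous_within)
 next
 case (Suc k)
 with assms(2)[OF Suc.prems] show ?case by (simp add: pd_def[abs_def])
 qed
 with assms(1) show ?thesis by (simp add: smooth_def)
qed

lemma pd_eqI: "(f has_derivative D) (at x) ==> pd e f x = D e"
 unfolding pd_def using frechet_derivative_at by metis

lemma Ck_on_add:
 "Ck_on k UNIV f ==> Ck_on k UNIV g ==> Ck_on k UNIV (%x. f x + g x)"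
proof (induction k arbitrary: f g)
 case 0
 then show ?case by (simp add: continuous_on_add)
next
 case (Suc k)
 have "pd e (%x. f x + g x) = (%x. pd e f x + pd e g x)" for e
 using Suc.prems by (auto intro!: ext pd_eqI derivative_intros simp: frechet_derivative_works[symmetric] pd_def)
 then show ?case using Suc by (simp add: pd_def[abs_def])
qed

lemma Ck_on_mult:
 fixes f g :: "'a::euclidean_space => real"
 shows "Ck_on k UNIV f ==> Ck_on k UNIV g ==> Ck_on k UNIV (%x. f x * g x)"
proof (induction k arbitrary: f g)
 case 0
 then show ?case by (simp add: continuous_on_mult)
next
 case (Suc k)
 have "pd e (%x. f x * g x) = (%x. f x * pd e g x + pd e f x * g x)" for e
 using Suc.prems by (auto intro!: ext pd_eqI derivative_eq_intros simp: frechet_derivative_works[symmetric] pd_def)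
 moreover have "Ck_on k UNIV f" "Ck_on k UNIV g" using Suc.prems Ck_on_SucD by blast+
 ultimately show ?case using Suc by (simp add: pd_def[abs_def] Ck_on_add)
qed

lemma Ck_on_linear_image:
 assumes "bounded_linear L"
 shows "Ck_on k UNIV f ==> Ck_on k UNIV (%x. L (f x))"
proof (induction k arbitrary: f)
 case 0
 then show ?case by (simp add: bounded_linear.continuous_on[OF assms])
next
 case (Suc k)
 have "((%x. L (f x)) has_derivative (%h. L (pd h f x))) (at x)" for x
 using Suc.prems
 by (auto intro!: bounded_linear.has_derivative[OF assms] simp: frechet_derivative_works[symmetric] pd_def)
 moreover from this have "pd e (%x. L (f x)) = (%x. L (pd e f x))" for e
 by (auto intro!: ext pd_eqI)
 ultimately show ?case using Suc by (auto simp: pd_def[abs_def] differentiable_def)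
qed

lemma smooth_add: "smooth f ==> smooth g ==> smooth (%x. f x + g x)"
 by (simp add: smooth_def Ck_on_add)

lemma smooth_mult: "smooth f ==> smooth g ==> smooth (%x. f x * g x)"
 for f g :: "'a::euclidean_space => real"
 by (simp add: smooth_def Ck_on_mult)

lemma smooth_linear_image: "bounded_linear L ==> smooth f ==> smooth (%x. L (f x))"
 by (simp add: smooth_def Ck_on_linear_image)

lemma smooth_diff: "smooth f ==> smooth g ==> smooth (%x. f x - g x)"
 using smooth_add[of f "%x. - g x"] smooth_linear_image[OF bounded_linear_minus[OF bounded_linear_ident], of g]
 by simp

lemma smooth_const: "smooth (%x. c)"
 by (rule smooth_coinduct[where P = "%g. EX c. g = (%x. c)"]) (auto simp: pd_def[abs_def])

lemma smooth_prod: "finite I ==> (!!i. i \<in> I ==> smooth (f i)) ==> smooth (%x. \<Prod>i\<in>I. f i x :: real)"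
 by (induction I rule: finite_induct) (auto intro: smooth_const smooth_mult)

lemma pd_add: "smooth f ==> smooth g ==> pd e (%x. f x + g x) x = pd e f x + pd e g x"
 by (rule pd_eqI) (auto intro!: derivative_intros smooth_has_derivative)

lemma pd_diff: "smooth f ==> smooth g ==> pd e (%x. f x - g x) x = pd e f x - pd e g x"
 by (rule pd_eqI) (auto intro!: derivative_intros smooth_has_derivative)

lemma pd_mult: "smooth f ==> smooth g ==>
 pd e (%x. f x * g x) x = f x * pd e g x + pd e f x * g x"
 for f g :: "'a::euclidean_space => real"
 by (rule pd_eqI) (auto intro!: derivative_eq_intros smooth_has_derivative)

lemma pd_linear_image: "bounded_linear L ==> smooth f ==> pd e (%x. L (f x)) x = L (pd e f x)"
 by (intro pd_eqI bounded_linear.has_derivative[of L] smooth_has_derivative)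

text \<open>The class \<open>p(1/t) exp(-1/t)\<close>, extended by zero to \<open>t \<le> 0\<close>, contains the derivatives of its members;
 the polynomial factor makes it invariant, so that its members are smooth.\<close>

definition flat_exp :: "real poly => real => real" where
 "flat_exp p t = (if 0 < t then poly p (1 / t) * exp (- (1 / t)) else 0)"

lemma flat_exp_tendsto_0: "((%t. poly p (1 / t) * exp (- (1 / t))) \<longlongrightarrow> (0::real)) (at_right 0)"
proof -
 have "((%s. poly p s / exp s) \<longlongrightarrow> (0::real)) at_top" for p
 proof (induction p)
 case 0
 then show ?case by simp
 next
 case (pCons a p)
 have "((%s. poly (monom 1 1 * p) s / exp s) \<longlongrightarrow> (0::real)) at_top"
 proof -
 have "((%s. \<Sum>i\<le>degree p. coeff p i * (s ^ Suc i / exp s)) \<longlongrightarrow> (\<Sum>i\<le>degree p. coeff p i * 0)) at_top"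
 by (intro tendsto_sum tendsto_mult tendsto_const tendsto_power_div_exp_0)
 then show ?thesis
 by (simp add: poly_monom) (simp add: poly_altdef sum_distrib_left sum_divide_distrib mult_ac)
 qed
 moreover have "((%s. a * (s ^ 0 / exp s)) \<longlongrightarrow> a * 0) at_top"
 by (intro tendsto_mult tendsto_const tendsto_power_div_exp_0)
 ultimately have "((%s. a * (s ^ 0 / exp s) + poly (monom 1 1 * p) s / exp s) \<longlongrightarrow> a * 0 + 0) at_top"
 by (intro tendsto_add)
 then show ?case by (simp add: poly_monom add_divide_distrib)
 qed
 from filterlim_compose[OF this filterlim_inverse_at_top_right]
 show ?thesis by (simp add: exp_minus divide_inverse o_def)
qed

lemma flat_exp_has_derivative:
 "(flat_exp p has_real_derivative flat_exp ([:0, 0, 1:] * (p - pderiv p)) t) (at t)"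
proof -
 consider "t < 0" | "t = 0" | "t > 0" by linarith
 then show ?thesis
 proof cases
 case 1
 have "((%t. 0) has_real_derivative 0) (at t)" by simp
 then have "(flat_exp p has_real_derivative 0) (at t)"
 by (rule DERIV_cong_ev[THEN iffD1, rotated -1, OF _])
 (use 1 eventually_nhds_in_open[of "{..<0}" t] in \<open>auto simp: flat_exp_def elim!: eventually_mono\<close>)
 with 1 show ?thesis by (simp add: flat_exp_def)
 next
 case 2
 have "((%h. (flat_exp p (0 + h) - flat_exp p 0) / h) \<longlongrightarrow> 0) (at 0)"
 proof (rule filterlim_split_at)
 show "((%h. (flat_exp p (0 + h) - flat_exp p 0) / h) \<longlongrightarrow> 0) (at_left 0)"
 by (rule tendsto_eventually) (auto simp: flat_exp_def eventually_at_filter)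
 have "\<forall>\<^sub>F h in at_right 0. poly (pCons 0 p) (1 / h) * exp (- (1 / h)) =
 (flat_exp p (0 + h) - flat_exp p 0) / h"
 by (auto simp: flat_exp_def eventually_at_filter)
 from Lim_transform_eventually[OF flat_exp_tendsto_0 this]
 show "((%h. (flat_exp p (0 + h) - flat_exp p 0) / h) \<longlongrightarrow> 0) (at_right 0)" .
 qed
 with 2 show ?thesis by (simp add: DERIV_def flat_exp_def)
 next
 case 3
 have "((%t. poly p (1 / t) * exp (- (1 / t))) has_real_derivative
 flat_exp ([:0, 0, 1:] * (p - pderiv p)) t) (at t)"
 using 3 by (auto intro!: derivative_eq_intros simp: flat_exp_def field_simps power2_eq_square)
 then show ?thesis
 by (rule DERIV_cong_ev[THEN iffD1, rotated -1, OF _])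
 (use 3 eventually_nhds_in_open[of "{0<..}" t] in \<open>auto simp: flat_exp_def elim!: eventually_mono\<close>)
 qed
qed

lemma smooth_flat_exp_affine:
 fixes c :: "'a::euclidean_space"
 shows "smooth (%x. flat_exp p (c \<bullet> x + b))"
proof (rule smooth_coinduct[where P = "%g. EX a p. g = (%x. a * flat_exp p (c \<bullet> x + b))"])
 show "EX a q. (%x. flat_exp p (c \<bullet> x + b)) = (%x. a * flat_exp q (c \<bullet> x + b))"
 by (rule exI[of _ 1]) auto
next
 fix g :: "'a => real" assume "EX a p. g = (%x. a * flat_exp p (c \<bullet> x + b))"
 then obtain a p where g: "g = (%x. a * flat_exp p (c \<bullet> x + b))" by blast
 let ?q = "[:0, 0, 1:] * (p - pderiv p)"
 have d: "(g has_derivative (%h. a * (flat_exp ?q (c \<bullet> x + b) * (c \<bullet> h)))) (at x)" for x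
 proof -
 have "((%x. flat_exp p (c \<bullet> x + b)) has_derivative (%h. flat_exp ?q (c \<bullet> x + b) * (c \<bullet> h))) (at x)"
 by (rule has_derivative_compose[where f = "%x. c \<bullet> x + b" and f' = "%h. c \<bullet> h" and g = "flat_exp p"])
 (auto intro!: derivative_eq_intros simp del: mult_pCons_left
 intro: flat_exp_has_derivative[unfolded has_field_derivative_def])
 then show ?thesis unfolding g by (auto intro!: derivative_eq_intros)
 qed
 have "pd e g = (%x. (a * (c \<bullet> e)) * flat_exp ?q (c \<bullet> x + b))" for e
 using pd_eqI[OF d] by (auto simp: fun_eq_iff)
 with d show "(ALL x. g differentiable at x) &
 (ALL e:Basis. EX a p. pd e g = (%x. a * flat_exp p (c \<bullet> x + b)))"
 by (metis differentiable_def)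
qed

text \<open>Test functions converging boundedly to the indicator of a box. They are all that is needed to test
 against indicators in the fundamental lemma.\<close>

definition box_bump :: "nat => 'a::euclidean_space => 'a => 'a => real" where
 "box_bump n a b x =
 (\<Prod>e\<in>Basis. flat_exp 1 (Suc n * (x \<bullet> e - a \<bullet> e)) * flat_exp 1 (Suc n * (b \<bullet> e - x \<bullet> e)))"

lemma smooth_box_bump: "smooth (box_bump n a b)"
proof -
 have "smooth (%x::'a. flat_exp 1 (Suc n * (x \<bullet> e - a \<bullet> e)))" for e
 using smooth_flat_exp_affine[of 1 "real (Suc n) *\<^sub>R e" "- (Suc n * (a \<bullet> e))"]
 by (simp add: right_diff_distrib inner_commute)
 moreover have "smooth (%x::'a. flat_exp 1 (Suc n * (b \<bullet> e - x \<bullet> e)))" for e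
 using smooth_flat_exp_affine[of 1 "- real (Suc n) *\<^sub>R e" "Suc n * (b \<bullet> e)"]
 by (simp add: right_diff_distrib inner_commute algebra_simps)
 ultimately show ?thesis
 unfolding box_bump_def[abs_def] by (intro smooth_prod smooth_mult) auto
qed

lemma flat_exp_1_bounds: "0 <= flat_exp 1 t" "flat_exp 1 t <= 1"
 by (auto simp: flat_exp_def)

lemma box_bump_bounds: "0 <= box_bump n a b x" "box_bump n a b x <= 1"
 unfolding box_bump_def
 by (auto intro!: prod_nonneg prod_le_1 mult_le_one flat_exp_1_bounds mult_nonneg_nonneg)

lemma box_bump_support: "x ~: box a b ==> box_bump n a b x = 0"
proof -
 assume "x ~: box a b"
 then obtain e where "e \<in> Basis" "x \<bullet> e <= a \<bullet> e \<or> b \<bullet> e <= x \<bullet> e"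
 by (auto simp: mem_box not_less)
 then show ?thesis
 unfolding box_bump_def by (intro prod_zero bexI[of _ e]) (auto simp: flat_exp_def zero_less_mult_iff)
qed

lemma box_bump_tendsto: "(%n. box_bump n a b x) ----> indicator (box a b) x"
proof (cases "x \<in> box a b")
 case True
 have "(%n. flat_exp 1 (Suc n * s)) ----> 1" if "s > 0" for s :: real
 proof -
 have "(%n. exp (- ((1 / s) * inverse (real (Suc n))))) ----> exp (- ((1 / s) * 0))"
 by (intro tendsto_exp tendsto_minus tendsto_mult tendsto_const LIMSEQ_inverse_real_of_nat)
 then show ?thesis using that by (simp add: flat_exp_def divide_inverse mult_ac del: of_nat_Suc)
 qed
 then have "(%n. box_bump n a b x) ----> (\<Prod>e\<in>(Basis::'a set). 1 * 1)"
 using True unfolding box_bump_def by (intro tendsto_prod tendsto_mult) (auto simp: mem_box)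
 with True show ?thesis by simp
qed (simp add: box_bump_support)

lemma test_function_iff:
 "test_function A f \<longleftrightarrow> smooth f & compact (closure {x. f x ~= 0}) & closure {x. f x ~= 0} \<subseteq> A"
 by (simp add: test_function_def smooth_def)

lemma test_functionI:
 assumes "smooth f" "compact K" "K \<subseteq> A" "!!x. x ~: K ==> f x = 0"
 shows "test_function A f"
proof -
 have "closure {x. f x ~= 0} \<subseteq> K"
 using assms by (intro closure_minimal compact_imp_closed) auto
 moreover from this have "closure {x. f x ~= 0} = K \<inter> closure {x. f x ~= 0}" by blast
 then have "compact (closure {x. f x ~= 0})"
 using compact_Int_closed[OF assms(2), of "closure {x. f x ~= 0}"] by simp
 ultimately show ?thesis using assms by (auto simp: test_function_iff)
qed

lemma test_functionE:
 assumes "test_function A f"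
 obtains K where "smooth f" "compact K" "K \<subseteq> A" "!!x. x ~: K ==> f x = 0"
 by (rule that[of "closure {x. f x ~= 0}"])
 (use assms closure_subset[of "{x. f x ~= 0}"] in \<open>auto simp: test_function_iff\<close>)

lemma test_function_box_bump: "cbox a b \<subseteq> A ==> test_function A (box_bump n a b)"
 by (rule test_functionI[where K = "cbox a b"])
 (use box_subset_cbox[of a b] in \<open>auto simp: smooth_box_bump intro!: box_bump_support\<close>)

lemma AE_zero_if_boxes_zero:
 fixes f :: "'a::euclidean_space => real"
 assumes f: "integrable lborel f" and z: "!!a b. (LINT x|lborel. indicator (box a b) x * f x) = 0"
 shows "AE x in lborel. f x = 0"
proof -
 have [measurable]: "f \<in> borel_measurable borel" using borel_measurable_integrable[OF f] by simp
 let ?p = "%x. ennreal (f x)" and ?n = "%x. ennreal (- f x)"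
 have "density lborel ?p = density lborel ?n"
 proof (rule measure_eqI_generator_eq[where \<Omega> = UNIV and E = "range (%(a, b). box a b::'a set)"
 and A = "%n::nat. box (- (real n *\<^sub>R One)) (real n *\<^sub>R One)"])
 show "Int_stable (range (%(a, b). box a b::'a set))"
 by (auto simp: Int_stable_def box_Int_box)
 show "sets (density lborel ?p) = sigma_sets UNIV (range (%(a, b). box a b::'a set))"
 "sets (density lborel ?n) = sigma_sets UNIV (range (%(a, b). box a b::'a set))"
 by (simp_all add: borel_eq_box)
 show "(\<Union>n. box (- (real n *\<^sub>R One)) (real n *\<^sub>R One)) = (UNIV :: 'a set)"
 unfolding UN_box_eq_UNIV by simp
 have i: "integrable lborel (%x. indicator X x * f x)" if "X \<in> sets borel" for X
 using integrable_mult_indicator[OF _ f, of X] that by simp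
 have fin: "(\<integral>\<^sup>+x. ennreal (indicator X x * f x) \<partial>lborel) < \<infinity>" if "X \<in> sets borel" for X
 using i[OF that] unfolding real_integrable_def by (simp add: less_top)
 have ind: "indicator X x * ?p x = ennreal (indicator X x * f x)"
 "indicator X x * ?n x = ennreal (- (indicator X x * f x))" for X x
 by (auto split: split_indicator)
 show "emeasure (density lborel ?p) (box (- (real n *\<^sub>R One)) (real n *\<^sub>R One)) ~= \<infinity>" for n
 using fin[of "box (- (real n *\<^sub>R One)) (real n *\<^sub>R One)"]
 by (simp add: emeasure_density mult.commute[of _ "indicator _ _"] ind less_top)
 fix X :: "'a set" assume "X \<in> range (%(a, b). box a b::'a set)"
 then obtain a b where X: "X = box a b" by auto
 have "real_of_ereal 0 = 0" by simp
 have 1: "(\<integral>\<^sup>+x. ennreal (indicator X x * f x) \<partial>lborel) = ennreal (enn2real (\<integral>\<^sup>+x. ennreal (indicator X x * f x) \<partial>lborel))"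
 "(\<integral>\<^sup>+x. ennreal (-(indicator X x * f x)) \<partial>lborel) = ennreal (enn2real (\<integral>\<^sup>+x. ennreal (-(indicator X x * f x)) \<partial>lborel))"
 using i[of X] X unfolding real_integrable_def by (simp_all add: less_top)
 have "enn2real (\<integral>\<^sup>+x. ennreal (indicator X x * f x) \<partial>lborel) = enn2real (\<integral>\<^sup>+x. ennreal (-(indicator X x * f x)) \<partial>lborel)"
 using real_lebesgue_integral_def[OF i[of X]] z[of a b] X by simp
 with 1 show "emeasure (density lborel ?p) X = emeasure (density lborel ?n) X"
 using X by (simp add: emeasure_density mult.commute[of _ "indicator _ _"] ind)
 qed (auto)
 then have "AE x in lborel. ?p x = ?n x"
 using sigma_finite_measure.density_unique_iff[OF sigma_finite_lborel, of ?p ?n] by simp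
 then show ?thesis
 proof eventually_elim
 case (elim x)
 then show ?case by (cases "f x \<ge> 0") (auto simp: ennreal_neg ennreal_eq_0_iff)
 qed
qed

lemma test_function_integrable:
 fixes f :: "'a::euclidean_space => real"
 assumes "test_function A f" "continuous_on UNIV g"
 shows "integrable lborel (%x. f x * g x)"
proof -
 obtain K where K: "smooth f" "compact K" "!!x. x ~: K ==> f x = 0"
 using assms(1) by (rule test_functionE) blast
 have "integrable lborel (%x. indicator K x *\<^sub>R (f x * g x))"
 using K(1,2) assms(2)
 by (intro borel_integrable_compact continuous_on_mult smooth_continuous continuous_on_subset[OF assms(2)]) auto
 moreover have "(%x. indicator K x *\<^sub>R (f x * g x)) = (%x. f x * g x)"
 using K(3) by (auto simp: indicator_def fun_eq_iff)
 ultimately show ?thesis by simp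
qed

lemma test_function_UNIV: "test_function A f ==> test_function UNIV f"
 by (simp add: test_function_iff)

lemma test_function_smooth: "test_function A f ==> smooth f"
 by (simp add: test_function_iff)

lemma test_function_mult:
 fixes f g :: "'a::euclidean_space => real"
 assumes "test_function A f" "smooth g" shows "test_function A (%x. f x * g x)"
proof -
 obtain K where K: "smooth f" "compact K" "K \<subseteq> A" "!!x. x ~: K ==> f x = 0"
 using assms(1) by (rule test_functionE) blast
 show ?thesis
 by (rule test_functionI[OF smooth_mult[OF K(1) assms(2)] K(2,3)]) (simp add: K(4))
qed

lemma test_function_diff:
 assumes "test_function A f" "test_function A g" shows "test_function A (%x. f x - g x)"
proof -
 obtain K where K: "smooth f" "compact K" "K \<subseteq> A" "!!x. x ~: K ==> f x = 0"
 using assms(1) by (rule test_functionE) blast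
 obtain L where L: "smooth g" "compact L" "L \<subseteq> A" "!!x. x ~: L ==> g x = 0"
 using assms(2) by (rule test_functionE) blast
 show ?thesis
 by (rule test_functionI[where K = "K \<union> L"]) (use K L in \<open>auto intro: smooth_diff\<close>)
qed

lemma test_function_linear_image:
 assumes "bounded_linear L" "test_function A f" shows "test_function A (%x. L (f x))"
proof -
 interpret bounded_linear L by fact
 obtain K where K: "smooth f" "compact K" "K \<subseteq> A" "!!x. x ~: K ==> f x = 0"
 using assms(2) by (rule test_functionE) blast
 show ?thesis
 by (rule test_functionI[OF smooth_linear_image[OF assms(1) K(1)] K(2,3)]) (simp add: K(4) zero)
qed

lemma test_function_pd:
 assumes "test_function A f" "e \<in> Basis" shows "test_function A (pd e f)"
proof -
 let ?K = "closure {x. f x ~= 0}"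
 have K: "smooth f" "compact ?K" "?K \<subseteq> A"
 using assms(1) by (auto simp: test_function_iff)
 have "pd e f x = 0" if "x ~: ?K" for x
 proof -
 have "open (- ?K)" by auto
 then have "\<forall>\<^sub>F y in at x. f y = 0"
 using that closure_subset[of "{x. f x ~= 0}"] eventually_at_topological[of _ x UNIV] by (metis (mono_tags, lifting) ComplI Compl_iff mem_Collect_eq subsetD)
 moreover have "f x = 0" using that closure_subset[of "{x. f x ~= 0}"] by blast
 ultimately have "(f has_derivative (%_. 0)) (at x)"
 by (intro has_derivative_transform_eventually[where f = "%_. 0", OF has_derivative_const])
 (auto elim!: eventually_mono)
 then show ?thesis by (simp add: pd_eqI)
 qed
 then show ?thesis
 by (intro test_functionI[OF smooth_pd[OF K(1) assms(2)] K(2,3)])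
qed

lemma has_derivative_shift:
 assumes "(f has_derivative D) (at (x + c))"
 shows "((%x. f (x + c)) has_derivative D) (at x)"
proof -
 have "((%x. x + c) has_derivative (%h. h)) (at x)"
 by (auto intro!: derivative_eq_intros)
 from has_derivative_compose[OF this assms] show ?thesis .
qed

lemma pd_shift: "smooth f ==> pd e (%x. f (x + c)) x = pd e f (x + c)"
 by (intro pd_eqI has_derivative_shift smooth_has_derivative)

lemma smooth_shift: "smooth f ==> smooth (%x. f (x + c))"
proof (rule smooth_coinduct[where P = "%g. EX f. smooth f & g = (%x. f (x + c))"])
 show "EX fa. smooth fa & (%x. f (x + c)) = (%x. fa (x + c))" if "smooth f" using that by blast
 fix g :: "'a => 'b" assume "EX f. smooth f & g = (%x. f (x + c))"
 then obtain f where f: "smooth f" "g = (%x. f (x + c))" by blast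
 then have "pd e g = (%x. pd e f (x + c))" for e using pd_shift[OF f(1)] by auto
 then show "(ALL x. g differentiable at x) & (ALL e:Basis. EX f. smooth f & pd e g = (%x. f (x + c)))"
 using f smooth_pd smooth_has_derivative has_derivative_shift unfolding differentiable_def by blast
qed

lemma test_function_shift:
 assumes "test_function UNIV f" shows "test_function UNIV (%x. f (x + c))"
proof -
 obtain K where K: "smooth f" "compact K" "!!x. x ~: K ==> f x = 0"
 using assms(1) by (rule test_functionE) blast
 show ?thesis
 proof (rule test_functionI[where K = "(%x. x - c) ` K"])
 show "smooth (%x. f (x + c))" using K smooth_shift by blast
 show "compact ((%x. x - c) ` K)"
 using K(2) by (intro compact_continuous_image continuous_intros)
 show "f (x + c) = 0" if "x ~: (%x. x - c) ` K" for x
 proof (rule K(3))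
 show "x + c ~: K" using that by (metis add_diff_cancel_right' image_eqI)
 qed
 qed auto
qed

lemma lborel_integral_shift:
 fixes f :: "'a::euclidean_space => real"
 assumes "f \<in> borel_measurable borel"
 shows "(LINT x|lborel. f (x + c)) = (LINT x|lborel. f x)"
proof -
 have "(LINT x|lborel. f x) = (LINT x|distr lborel borel ((+) c). f x)"
 by (simp add: lborel_distr_plus)
 also have "... = (LINT x|lborel. f (x + c))"
 using assms by (subst integral_distr) (auto simp: add.commute)
 finally show ?thesis by simp
qed

lemma difference_quotient_tendsto:
 fixes f :: "'a::euclidean_space => real" and h :: "nat => real"
 assumes f: "test_function UNIV f" and e: "e \<in> Basis" and g: "continuous_on UNIV g"
 and h: "h ----> 0" "!!n. h n ~= 0" "!!n. \<bar>h n\<bar> <= 1"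
 shows "(%n. \<integral>x. (f (x + h n *\<^sub>R e) - f x) / h n * g x \<partial>lborel) ----> (LINT x|lborel. pd e f x * g x)"
proof -
 obtain K where K: "smooth f" "compact K" "!!x. x ~: K ==> f x = 0"
 using f by (rule test_functionE) blast
 obtain r where r: "!!x. x \<in> K ==> norm x <= r"
 using compact_imp_bounded[OF K(2)] by (auto simp: bounded_iff)
 have "bounded (pd e f ` cball 0 (r + 2))"
 by (intro compact_imp_bounded compact_continuous_image smooth_continuous smooth_pd K e compact_cball)
 then obtain B where "ALL x:cball 0 (r + 2). \<bar>pd e f x\<bar> <= B"
 by (auto simp: bounded_iff)
 then have B: "!!x. norm x <= r + 2 ==> \<bar>pd e f x\<bar> <= B" by auto
 have ball: "integrable lborel (%x. indicator (cball 0 (r + 1)) x *\<^sub>R (B * \<bar>g x\<bar>))"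
 by (intro borel_integrable_compact compact_cball continuous_intros continuous_on_subset[OF g]) auto
 have [measurable]: "f \<in> borel_measurable borel" "g \<in> borel_measurable borel" "pd e f \<in> borel_measurable borel"
 using g smooth_continuous[OF K(1)] smooth_continuous[OF smooth_pd[OF K(1) e]]
 by (auto intro: borel_measurable_continuous_onI)
 show ?thesis
 proof (rule integral_dominated_convergence[where w = "%x. indicator (cball 0 (r + 1)) x *\<^sub>R (B * \<bar>g x\<bar>)"])
 show "AE x in lborel. (%n. (f (x + h n *\<^sub>R e) - f x) / h n * g x) ----> pd e f x * g x"
 proof (intro AE_I2 tendsto_intros)
 fix x
 have "((%s. f (x + s *\<^sub>R e)) has_derivative (%s. pd (s *\<^sub>R e) f x)) (at 0)"
 by (rule has_derivative_compose[where f = "%s. x + s *\<^sub>R e" and g = f])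
 (auto intro!: derivative_eq_intros smooth_has_derivative K)
 moreover have "(%s. pd (s *\<^sub>R e) f x) = (*) (pd e f x)"
 using linear_frechet_derivative[OF smooth_differentiable[OF K(1)], of x]
 by (auto simp: pd_def linear_cmul mult.commute)
 ultimately have "((%s. f (x + s *\<^sub>R e)) has_real_derivative pd e f x) (at 0)"
 by (simp add: has_field_derivative_def)
 then have "((%s. (f (x + s *\<^sub>R e) - f x) / s) \<longlongrightarrow> pd e f x) (at 0)"
 by (simp add: DERIV_def)
 then show "(%n. (f (x + h n *\<^sub>R e) - f x) / h n) ----> pd e f x"
 by (rule filterlim_compose) (use h in \<open>auto simp: filterlim_at\<close>)
 qed
 show "AE x in lborel. norm ((f (x + h n *\<^sub>R e) - f x) / h n * g x)
 <= indicator (cball 0 (r + 1)) x *\<^sub>R (B * \<bar>g x\<bar>)" for n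
 proof (intro AE_I2)
 fix x
 have he: "norm (h n *\<^sub>R e) <= 1" using h(3)[of n] e by simp
 show "norm ((f (x + h n *\<^sub>R e) - f x) / h n * g x) <= indicator (cball 0 (r + 1)) x *\<^sub>R (B * \<bar>g x\<bar>)"
 proof (cases "norm x <= r + 1")
 case False
 then have "x ~: K" using r by fastforce
 moreover have "x + h n *\<^sub>R e ~: K"
 proof
 assume "x + h n *\<^sub>R e \<in> K"
 from r[OF this] norm_triangle_ineq4[of "x + h n *\<^sub>R e" "h n *\<^sub>R e"] he False show False by simp
 qed
 ultimately show ?thesis using K(3) False by simp
 next
 case True
 have "norm (f (x + h n *\<^sub>R e) - f x) <= B * norm ((x + h n *\<^sub>R e) - x)"
 proof -
 let ?phi = "%s. f (x + s *\<^sub>R (h n *\<^sub>R e))"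
 have d: "(?phi has_derivative (%t. t * (h n * pd e f (x + s *\<^sub>R (h n *\<^sub>R e))))) (at s within {0..1})" for s
 proof -
 have "(?phi has_derivative (%t. pd (t *\<^sub>R (h n *\<^sub>R e)) f (x + s *\<^sub>R (h n *\<^sub>R e)))) (at s within {0..1})"
 by (rule has_derivative_compose[where f = "%s. x + s *\<^sub>R (h n *\<^sub>R e)" and g = f])
 (auto intro!: derivative_eq_intros smooth_has_derivative K)
 then show ?thesis
 using linear_frechet_derivative[OF smooth_differentiable[OF K(1)]]
 by (simp add: pd_def linear_cmul mult.assoc)
 qed
 have "norm (?phi 1 - ?phi 0) <= (\<bar>h n\<bar> * B) * norm (1 - 0 :: real)"
 proof (rule differentiable_bound[where S = "{0..1}"])
 fix s :: real assume s: "s \<in> {0..1}"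
 have "norm (s *\<^sub>R (h n *\<^sub>R e)) <= 1" using s he
 by (metis abs_of_nonneg atLeastAtMost_iff mult_le_one norm_ge_zero norm_scaleR)
 then have "\<bar>pd e f (x + s *\<^sub>R (h n *\<^sub>R e))\<bar> <= B"
 using True norm_triangle_ineq[of x "s *\<^sub>R (h n *\<^sub>R e)"] by (intro B) linarith
 then show "onorm (%t. t * (h n * pd e f (x + s *\<^sub>R (h n *\<^sub>R e)))) <= \<bar>h n\<bar> * B"
 using mult_right_mono[of "\<bar>pd e f (x + s *\<^sub>R (h n *\<^sub>R e))\<bar>" B "\<bar>t\<bar> * \<bar>h n\<bar>" for t]
 by (intro onorm_bound) (auto simp: abs_mult mult_ac intro!: mult_nonneg_nonneg dual_order.trans[OF _ abs_ge_zero])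
 qed (use d in auto)
 then show ?thesis using e by (simp add: mult.commute)
 qed
 then have "\<bar>f (x + h n *\<^sub>R e) - f x\<bar> / \<bar>h n\<bar> <= B"
 using e h(2)[of n] by (simp add: divide_le_eq)
 from mult_right_mono[OF this abs_ge_zero[of "g x"]] show ?thesis using True by (simp add: abs_mult)
 qed
 qed
 qed (use ball in \<open>auto\<close>)
qed

text \<open>The integral of a difference quotient vanishes by translation invariance; dominated convergence
 passes to the derivative, and no iterated integral is needed.\<close>

lemma integral_pd_eq_0:
 fixes f :: "'a::euclidean_space => real"
 assumes f: "test_function UNIV f" and e: "e \<in> Basis"
 shows "(LINT x|lborel. pd e f x) = 0"
proof -
 let ?h = "%n. inverse (real (Suc n))"
 have [measurable]: "f \<in> borel_measurable borel"
 using smooth_continuous[OF test_function_smooth[OF f]] by (auto intro: borel_measurable_continuous_onI)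
 have int: "integrable lborel f" and ints: "integrable lborel (%x. f (x + c))" for c
 using test_function_integrable[OF f, of "%_. 1"]
 test_function_integrable[OF test_function_shift[OF f, of c], of "%_. 1"] by auto
 have "(%n. \<integral>x. (f (x + ?h n *\<^sub>R e) - f x) / ?h n * 1 \<partial>lborel) ----> (LINT x|lborel. pd e f x * 1)"
 by (rule difference_quotient_tendsto[OF f e _ LIMSEQ_inverse_real_of_nat]) (auto simp: field_simps)
 moreover have "(LINT x|lborel. (f (x + ?h n *\<^sub>R e) - f x) / ?h n * 1) = 0" for n
 using int ints[of "?h n *\<^sub>R e"] lborel_integral_shift[of f "?h n *\<^sub>R e"]
 by (simp del: of_nat_Suc)
 ultimately show ?thesis using LIMSEQ_unique[OF tendsto_const] by fastforce
qed

lemma integration_by_parts: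
 fixes f g :: "'a::euclidean_space => real"
 assumes f: "test_function UNIV f" and g: "smooth g" and e: "e \<in> Basis"
 shows "(LINT x|lborel. pd e f x * g x) = - (LINT x|lborel. f x * pd e g x)"
proof -
 have "0 = (LINT x|lborel. f x * pd e g x + pd e f x * g x)"
 using integral_pd_eq_0[OF test_function_mult[OF f g] e] pd_mult[OF test_function_smooth[OF f] g]
 by simp
 also have "... = (LINT x|lborel. f x * pd e g x) + (LINT x|lborel. pd e f x * g x)"
 by (intro Bochner_Integration.integral_add test_function_integrable[OF f]
 test_function_integrable[OF test_function_pd[OF f e]] smooth_continuous smooth_pd g e)
 finally show ?thesis by simp
qed

text \<open>Two integrations by parts exchange the derivatives of a product. Applied to \<open>\<partial>\<^sub>i u\<^sub>j \<partial>\<^sub>j u\<^sub>i\<close> this is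
 what turns the square of the divergence into the mixed term of Korn's identity.\<close>

lemma integral_pd_commute:
 fixes f g :: "'a::euclidean_space => real"
 assumes f: "test_function UNIV f" and g: "test_function UNIV g" and i: "i \<in> Basis" and j: "j \<in> Basis"
 shows "(LINT x|lborel. pd i f x * pd j g x) = (LINT x|lborel. pd j f x * pd i g x)"
proof -
 let ?h = "%n. inverse (real (Suc n))"
 let ?f = "%n x. inverse (?h n) * (f (x + ?h n *\<^sub>R i) - f x)"
 note sf = test_function_smooth[OF f] and sg = test_function_smooth[OF g]
 have h: "?h n ~= 0" "\<bar>?h n\<bar> <= 1" for n by (auto simp: field_simps)
 have tf: "test_function UNIV (?f n)" for n
 by (rule test_function_linear_image[OF bounded_linear_mult_right test_function_diff[OF test_function_shift[OF f] f]])
 have pdf: "pd j (?f n) x = (pd j f (x + ?h n *\<^sub>R i) - pd j f x) / ?h n" for n x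
 using sf smooth_shift[OF sf]
 by (simp add: pd_linear_image[OF bounded_linear_mult_right] smooth_diff pd_diff pd_shift divide_inverse del: of_nat_Suc)
 have "(LINT x|lborel. (f (x + ?h n *\<^sub>R i) - f x) / ?h n * pd j g x)
 = - (LINT x|lborel. (pd j f (x + ?h n *\<^sub>R i) - pd j f x) / ?h n * g x)" for n
 using integration_by_parts[OF tf sg j, of n] pdf
 by (simp add: divide_inverse mult_ac del: of_nat_Suc)
 moreover have "(%n. \<integral>x. (f (x + ?h n *\<^sub>R i) - f x) / ?h n * pd j g x \<partial>lborel) ----> (LINT x|lborel. pd i f x * pd j g x)"
 by (rule difference_quotient_tendsto[OF f i _ LIMSEQ_inverse_real_of_nat h])
 (intro smooth_continuous smooth_pd sg j)
 moreover have "(%n. - (LINT x|lborel. (pd j f (x + ?h n *\<^sub>R i) - pd j f x) / ?h n * g x)) ----> - (LINT x|lborel. pd i (pd j f) x * g x)"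
 by (intro tendsto_minus difference_quotient_tendsto[OF test_function_pd[OF f j] i _ LIMSEQ_inverse_real_of_nat h])
 (intro smooth_continuous sg)
 moreover have "- (LINT x|lborel. pd i (pd j f) x * g x) = (LINT x|lborel. pd j f x * pd i g x)"
 using integration_by_parts[OF test_function_pd[OF f j] sg i] by simp
 ultimately show ?thesis using LIMSEQ_unique by fastforce
qed

lemma AE_zero_if_boxes_zero_lebesgue:
 fixes f :: "'a::euclidean_space => real"
 assumes f: "integrable lebesgue f" and z: "!!a b. (LINT x|lebesgue. indicator (box a b) x * f x) = 0"
 shows "AE x in lebesgue. f x = 0"
proof -
 obtain g where g: "g \<in> borel_measurable lborel" "AE x in lborel. f x = g x"
 using completion_ex_borel_measurable_real[of f lborel] f by auto
 have [measurable]: "g \<in> borel_measurable lebesgue" using g(1) by (rule measurable_completion)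
 have g': "AE x in lebesgue. f x = g x" using g(2) by (rule AE_completion)
 have "integrable lebesgue g"
 by (rule integrable_cong_AE_imp[OF f]) (use g' in auto)
 then have "integrable lborel g" using g(1) by (simp add: integrable_completion)
 moreover have "(LINT x|lborel. indicator (box a b) x * g x) = 0" for a b
 proof -
 have "(LINT x|lborel. indicator (box a b) x * g x) = (LINT x|lebesgue. indicator (box a b) x * g x)"
 using g(1) by (subst integral_completion) auto
 also have "... = (LINT x|lebesgue. indicator (box a b) x * f x)"
 by (rule integral_cong_AE; (intro borel_measurable_times borel_measurable_indicator)?)
 (use f g' in auto)
 finally show ?thesis using z by simp
 qed
 ultimately have "AE x in lebesgue. g x = 0" using AE_zero_if_boxes_zero AE_completion by blast
 with g' show ?thesis by eventually_elim simp
qed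

lemma fundamental_lemma_variations:
 fixes g :: "'a::euclidean_space => real"
 assumes A: "open A" and loc: "!!K. compact K ==> K \<subseteq> A ==> integrable (Leb K) g"
 and z: "!!psi. test_function A psi ==> (LINT x|Leb A. g x * psi x) = 0"
 shows "AE x in Leb A. g x = 0"
proof -
 have [simp]: "A \<in> sets lebesgue" using A by auto
 have on_box: "AE x in lebesgue. x \<in> box c d --> g x = 0" if cd: "cbox c d \<subseteq> A" for c d
 proof -
 have int: "integrable lebesgue (%x. indicator (cbox c d) x * g x)"
 using loc[OF compact_cbox cd] by (simp add: integrable_restrict_space)
 have ibox: "integrable lebesgue (%x. indicator (box c d) x * g x)"
 proof -
 have "integrable lebesgue (%x. indicator (box c d) x *\<^sub>R (indicator (cbox c d) x * g x))"
 by (rule integrable_mult_indicator[OF _ int]) auto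
 moreover have "(%x. indicator (box c d) x *\<^sub>R (indicator (cbox c d) x * g x)) = (%x. indicator (box c d) x * g x)"
 using box_subset_cbox[of c d] by (auto simp: indicator_def fun_eq_iff)
 ultimately show ?thesis by simp
 qed
 have "AE x in lebesgue. indicator (box c d) x * g x = 0"
 proof (rule AE_zero_if_boxes_zero_lebesgue[OF ibox])
 fix a b
 obtain a' b' where ab: "box a b \<inter> box c d = box a' b'" unfolding box_Int_box by blast
 show "(LINT x|lebesgue. indicator (box a b) x * (indicator (box c d) x * g x)) = 0"
 proof (cases "box a' b' = {}")
 case True
 then have "indicator (box a b) x * (indicator (box c d) x * g x) = 0" for x
 using ab by (auto simp: indicator_def)
 then show ?thesis by (simp only: integral_zero)
 next
 case False
 have "cbox a' b' = closure (box a' b')" using False by (simp add: closure_box)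
 also have "... \<subseteq> cbox c d"
 using ab box_subset_cbox[of c d] by (intro closure_minimal) auto
 finally have sub: "cbox a' b' \<subseteq> cbox c d" .
 have [measurable]: "box_bump n a' b' \<in> borel_measurable lebesgue" for n
 by (intro measurable_completion)
 (auto intro!: borel_measurable_continuous_onI smooth_continuous smooth_box_bump)
 have "(%n. \<integral>x. box_bump n a' b' x * (indicator (cbox c d) x * g x) \<partial>lebesgue)
 ----> (LINT x|lebesgue. indicator (box a' b') x * (indicator (cbox c d) x * g x))"
 proof (rule integral_dominated_convergence[where w = "%x. \<bar>indicator (cbox c d) x * g x\<bar>"])
 show "AE x in lebesgue. norm (box_bump n a' b' x * (indicator (cbox c d) x * g x))
 <= \<bar>indicator (cbox c d) x * g x\<bar>" for n
 using box_bump_bounds[of n a' b'] by (auto simp: abs_mult intro!: mult_left_le_one_le)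
 show "(%x. indicator (box a' b') x * (indicator (cbox c d) x * g x)) \<in> borel_measurable lebesgue"
 by (intro borel_measurable_times[OF borel_measurable_indicator] borel_measurable_integrable[OF int]) auto
 show "(%x. box_bump n a' b' x * (indicator (cbox c d) x * g x)) \<in> borel_measurable lebesgue" for n
 by (intro borel_measurable_times borel_measurable_integrable[OF int]) measurable
 qed (use int in \<open>auto intro!: tendsto_intros box_bump_tendsto\<close>)
 moreover have "(LINT x|lebesgue. box_bump n a' b' x * (indicator (cbox c d) x * g x)) = 0" for n
 proof -
 have "(LINT x|lebesgue. box_bump n a' b' x * (indicator (cbox c d) x * g x))
 = (LINT x|lebesgue. indicator A x *\<^sub>R (g x * box_bump n a' b' x))"
 using sub cd box_bump_support[of _ a' b' n] box_subset_cbox[of a' b']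
 by (intro Bochner_Integration.integral_cong) (auto simp: indicator_def)
 also have "... = 0"
 using z[OF test_function_box_bump[OF order_trans[OF sub cd], of n]]
 by (simp add: integral_restrict_space)
 finally show ?thesis .
 qed
 ultimately have "(LINT x|lebesgue. indicator (box a' b') x * (indicator (cbox c d) x * g x)) = 0"
 using LIMSEQ_unique[OF tendsto_const] by fastforce
 moreover have "(%x. indicator (box a b) x * (indicator (box c d) x * g x))
 = (%x. indicator (box a' b') x * (indicator (cbox c d) x * g x))"
 using ab box_subset_cbox[of c d] by (auto simp: indicator_def fun_eq_iff)
 ultimately show ?thesis by (simp only:)
 qed
 qed
 then show ?thesis by eventually_elim (auto simp: indicator_def split: if_splits)
 qed
 obtain D where D: "countable D" "D \<subseteq> Pow A" "!!X. X \<in> D ==> EX a b. X = cbox a b" "\<Union>D = A"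
 using open_countable_Union_open_cbox[OF A] by metis
 have "AE x in lebesgue. ALL X:D. x \<in> X --> g x = 0"
 proof (subst AE_ball_countable[OF D(1)], intro ballI)
 fix X assume "X \<in> D"
 then obtain a b where X: "X = cbox a b" "cbox a b \<subseteq> A" using D by blast
 have "cbox a b - box a b \<in> null_sets lebesgue"
 using negligible_frontier_interval[of a b] by (simp add: negligible_iff_null_sets)
 then have "AE x in lebesgue. x ~: cbox a b - box a b" by (rule AE_not_in)
 with on_box[OF X(2)] show "AE x in lebesgue. x \<in> X --> g x = 0"
 unfolding X by eventually_elim auto
 qed
 then have "AE x in lebesgue. x \<in> A --> g x = 0" by eventually_elim (use D in auto)
 then show ?thesis by (simp add: AE_restrict_space_iff)
qed

lemma weighted_am_gm3:
 fixes x y z :: real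
 assumes "0 < a" "0 < b" "0 < c" "a + b + c = 1" "0 <= x" "0 <= y" "0 <= z"
 shows "x powr a * y powr b * z powr c <= a * x + b * y + c * z"
proof (cases "x = 0 \<or> y = 0 \<or> z = 0")
 case True
 then show ?thesis using assms by auto
next
 case False
 then have p: "0 < x" "0 < y" "0 < z" using assms by auto
 let ?w = "y powr (b / (b + c)) * z powr (c / (b + c))"
 have w: "?w <= b / (b + c) * y + c / (b + c) * z"
 by (rule Youngs_inequality_0) (use assms p in \<open>auto simp: add_divide_distrib[symmetric]\<close>)
 have wp: "0 < ?w" using p by simp
 have "x powr a * y powr b * z powr c = x powr a * ?w powr (b + c)"
 using assms by (simp add: powr_mult powr_powr)
 also have "... <= a * x + (b + c) * ?w"
 by (rule Youngs_inequality_0) (use assms p wp in auto)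
 also have "... <= a * x + (b + c) * (b / (b + c) * y + c / (b + c) * z)"
 using assms by (intro add_mono mult_left_mono w) auto
 also have "... = a * x + b * y + c * z"
 using assms by (simp add: distrib_left)
 finally show ?thesis .
qed

section \<open>The Sobolev inequality in three dimensions\<close>

lemma Hoelder3:
 fixes f g h :: "'a => real"
 assumes f: "integrable M f" and g: "integrable M g" and h: "integrable M h"
 and nn: "!!x. 0 <= f x" "!!x. 0 <= g x" "!!x. 0 <= h x"
 and abc: "0 < a" "0 < b" "0 < c" "a + b + c = 1"
 shows "integrable M (%x. f x powr a * g x powr b * h x powr c)"
 and "(LINT x|M. f x powr a * g x powr b * h x powr c)
 <= (LINT x|M. f x) powr a * (LINT x|M. g x) powr b * (LINT x|M. h x) powr c"
proof -
 have [measurable]: "f \<in> borel_measurable M" "g \<in> borel_measurable M" "h \<in> borel_measurable M"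
 using f g h by auto
 let ?k = "%x. f x powr a * g x powr b * h x powr c"
 let ?F = "\<integral>x. f x \<partial>M" and ?G = "\<integral>x. g x \<partial>M" and ?H = "\<integral>x. h x \<partial>M"
 have FGH: "0 <= ?F" "0 <= ?G" "0 <= ?H" using nn by (auto intro: integral_nonneg_AE)
 show int: "integrable M ?k"
 by (rule Bochner_Integration.integrable_bound[where f = "%x. a * f x + b * g x + c * h x"])
 (use f g h abc weighted_am_gm3[OF abc nn] nn in \<open>auto intro!: AE_I2 simp: abs_mult\<close>)
 show "(LINT x|M. ?k x) <= ?F powr a * ?G powr b * ?H powr c"
 proof (cases "?F = 0 \<or> ?G = 0 \<or> ?H = 0")
 case True
 then have "AE x in M. f x = 0 \<or> g x = 0 \<or> h x = 0"
 using integral_nonneg_eq_0_iff_AE[OF f] integral_nonneg_eq_0_iff_AE[OF g]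
 integral_nonneg_eq_0_iff_AE[OF h] nn by (auto elim!: eventually_mono)
 then have "AE x in M. ?k x = 0" by eventually_elim (use abc in auto)
 then have "(LINT x|M. ?k x) = 0"
 by (subst integral_cong_AE[where g = "%_. 0"]) auto
 then show ?thesis by simp
 next
 case False
 then have p: "0 < ?F" "0 < ?G" "0 < ?H" using FGH by auto
 let ?P = "?F powr a * ?G powr b * ?H powr c"
 have P: "0 < ?P" using p by simp
 have "(LINT x|M. ?k x) <= (LINT x|M. ?P * (a * (f x / ?F) + b * (g x / ?G) + c * (h x / ?H)))"
 proof (rule integral_mono[OF int])
 show "integrable M (%x. ?P * (a * (f x / ?F) + b * (g x / ?G) + c * (h x / ?H)))"
 using f g h by auto
 fix x
 have "?k x / ?P <= a * (f x / ?F) + b * (g x / ?G) + c * (h x / ?H)"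
 using weighted_am_gm3[OF abc, of "f x / ?F" "g x / ?G" "h x / ?H"] nn p FGH
 by (simp add: powr_divide)
 then show "?k x <= ?P * (a * (f x / ?F) + b * (g x / ?G) + c * (h x / ?H))"
 using P by (simp add: pos_divide_le_eq mult.commute)
 qed
 also have "... = ?P * (a * (?F / ?F) + b * (?G / ?G) + c * (?H / ?H))"
 using f g h by simp
 also have "... = ?P" using p abc by simp
 finally show ?thesis .
 qed
qed

definition esqrt :: "ennreal => ennreal" where
 "esqrt x = (if x = top then top else ennreal (sqrt (enn2real x)))"

lemma measurable_esqrt [measurable]: "esqrt \<in> borel_measurable borel"
 unfolding esqrt_def[abs_def] by measurable

lemma esqrt_power2 [simp]: "(esqrt x)\<^sup>2 = x"
 by (cases x) (auto simp: esqrt_def ennreal_power)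

lemma ennreal_power2_le_imp_le: "x\<^sup>2 <= y\<^sup>2 ==> x <= y" for x y :: ennreal
proof (cases x; cases y)
 fix r s assume "x\<^sup>2 <= y\<^sup>2" "x = ennreal r" "0 <= r" "y = ennreal s" "0 <= s"
 then show "x <= y" by (auto simp: ennreal_power ennreal_le_iff intro: power2_le_imp_le)
qed (auto simp: ennreal_power top_power_ennreal top_unique)

text \<open>Gagliardo's step: a function bounded by a product of three functions, each independent of one
 coordinate, is integrated by applying Cauchy and Schwarz one variable at a time.\<close>

lemma loomis_whitney:
 fixes g1 g2 g3 :: "real \<times> real => ennreal"
 assumes [measurable]: "g1 \<in> borel_measurable (borel \<Otimes>\<^sub>M borel)" "g2 \<in> borel_measurable (borel \<Otimes>\<^sub>M borel)"
 "g3 \<in> borel_measurable (borel \<Otimes>\<^sub>M borel)"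
 shows "(\<integral>\<^sup>+x. \<integral>\<^sup>+y. \<integral>\<^sup>+z. esqrt (g1 (y, z)) * esqrt (g2 (x, z)) * esqrt (g3 (x, y)) \<partial>lborel \<partial>lborel \<partial>lborel)\<^sup>2
 <= (\<integral>\<^sup>+y. \<integral>\<^sup>+z. g1 (y, z) \<partial>lborel \<partial>lborel) * (\<integral>\<^sup>+x. \<integral>\<^sup>+z. g2 (x, z) \<partial>lborel \<partial>lborel)
 * (\<integral>\<^sup>+x. \<integral>\<^sup>+y. g3 (x, y) \<partial>lborel \<partial>lborel)"
 (is "?L\<^sup>2 <= _")
proof -
 define A where "A z = (\<integral>\<^sup>+x. g2 (x, z) \<partial>lborel)" for z
 define B where "B y = (\<integral>\<^sup>+x. g3 (x, y) \<partial>lborel)" for y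
 have [measurable]: "A \<in> borel_measurable borel" "B \<in> borel_measurable borel"
 unfolding A_def[abs_def] B_def[abs_def] by measurable
 have in1: "(\<integral>\<^sup>+x. esqrt (g2 (x, z)) * esqrt (g3 (x, y)) \<partial>lborel) <= esqrt (A z) * esqrt (B y)" for y z
 proof (rule ennreal_power2_le_imp_le)
 have "(\<integral>\<^sup>+x. esqrt (g2 (x, z)) * esqrt (g3 (x, y)) \<partial>lborel)\<^sup>2
 <= (\<integral>\<^sup>+x. (esqrt (g2 (x, z)))\<^sup>2 \<partial>lborel) * (\<integral>\<^sup>+x. (esqrt (g3 (x, y)))\<^sup>2 \<partial>lborel)"
 by (intro Cauchy_Schwarz_nn_integral) measurable
 also have "... = (esqrt (A z) * esqrt (B y))\<^sup>2"
 by (simp add: A_def B_def power_mult_distrib)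
 finally show "(\<integral>\<^sup>+x. esqrt (g2 (x, z)) * esqrt (g3 (x, y)) \<partial>lborel)\<^sup>2 <= (esqrt (A z) * esqrt (B y))\<^sup>2" .
 qed
 have "?L = (\<integral>\<^sup>+y. \<integral>\<^sup>+x. \<integral>\<^sup>+z. esqrt (g1 (y, z)) * esqrt (g2 (x, z)) * esqrt (g3 (x, y)) \<partial>lborel \<partial>lborel \<partial>lborel)"
 by (rule lborel_pair.Fubini') measurable
 also have "... = (\<integral>\<^sup>+y. \<integral>\<^sup>+z. \<integral>\<^sup>+x. esqrt (g1 (y, z)) * esqrt (g2 (x, z)) * esqrt (g3 (x, y)) \<partial>lborel \<partial>lborel \<partial>lborel)"
 by (intro nn_integral_cong lborel_pair.Fubini') measurable
 also have "... = (\<integral>\<^sup>+y. \<integral>\<^sup>+z. esqrt (g1 (y, z)) * (\<integral>\<^sup>+x. esqrt (g2 (x, z)) * esqrt (g3 (x, y)) \<partial>lborel) \<partial>lborel \<partial>lborel)"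
 by (simp add: nn_integral_cmult[symmetric] mult.assoc)
 also have "... <= (\<integral>\<^sup>+y. \<integral>\<^sup>+z. esqrt (g1 (y, z)) * (esqrt (A z) * esqrt (B y)) \<partial>lborel \<partial>lborel)"
 by (intro nn_integral_mono mult_left_mono in1) auto
 also have "... = (\<integral>\<^sup>+p. esqrt (g1 p) * (esqrt (A (snd p)) * esqrt (B (fst p))) \<partial>(lborel \<Otimes>\<^sub>M lborel))"
 by (subst lborel.nn_integral_fst[symmetric]) (auto simp: split_def)
 finally have "?L\<^sup>2 <= (\<integral>\<^sup>+p. esqrt (g1 p) * (esqrt (A (snd p)) * esqrt (B (fst p))) \<partial>(lborel \<Otimes>\<^sub>M lborel))\<^sup>2"
 by (rule power_mono) auto
 also have "... <= (\<integral>\<^sup>+p. (esqrt (g1 p))\<^sup>2 \<partial>(lborel \<Otimes>\<^sub>M lborel))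
 * (\<integral>\<^sup>+p. (esqrt (A (snd p)) * esqrt (B (fst p)))\<^sup>2 \<partial>(lborel \<Otimes>\<^sub>M lborel))"
 by (intro Cauchy_Schwarz_nn_integral) measurable
 also have "(\<integral>\<^sup>+p. (esqrt (g1 p))\<^sup>2 \<partial>(lborel \<Otimes>\<^sub>M lborel)) = (\<integral>\<^sup>+y. \<integral>\<^sup>+z. g1 (y, z) \<partial>lborel \<partial>lborel)"
 by (subst lborel.nn_integral_fst[symmetric]) auto
 also have "(\<integral>\<^sup>+p. (esqrt (A (snd p)) * esqrt (B (fst p)))\<^sup>2 \<partial>(lborel \<Otimes>\<^sub>M lborel))
 = (\<integral>\<^sup>+y. \<integral>\<^sup>+z. A z * B y \<partial>lborel \<partial>lborel)"
 by (subst lborel.nn_integral_fst[symmetric]) (auto simp: power_mult_distrib)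
 also have "... = (\<integral>\<^sup>+z. A z \<partial>lborel) * (\<integral>\<^sup>+y. B y \<partial>lborel)"
 by (simp add: nn_integral_multc nn_integral_cmult)
 also have "(\<integral>\<^sup>+z. A z \<partial>lborel) = (\<integral>\<^sup>+x. \<integral>\<^sup>+z. g2 (x, z) \<partial>lborel \<partial>lborel)"
 unfolding A_def by (rule lborel_pair.Fubini') measurable
 also have "(\<integral>\<^sup>+y. B y \<partial>lborel) = (\<integral>\<^sup>+x. \<integral>\<^sup>+y. g3 (x, y) \<partial>lborel \<partial>lborel)"
 unfolding B_def by (rule lborel_pair.Fubini') measurable
 finally show ?thesis by (simp add: mult.assoc)
qed

lemma measurable_vector3 [measurable]:
 "(%(a, b, c). vector [a, b, c] :: real^3) \<in> borel_measurable (borel \<Otimes>\<^sub>M (borel \<Otimes>\<^sub>M borel))"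
proof -
 have "(%(a, b, c). vector [a, b, c] :: real^3) = (%p. fst p *\<^sub>R axis 1 1 + fst (snd p) *\<^sub>R axis 2 1 + snd (snd p) *\<^sub>R axis 3 1)"
 by (auto simp: fun_eq_iff vec_eq_iff forall_3 axis_def)
 then show ?thesis by simp
qed

lemma inj_axis: "inj (%i::3. axis i (1::real))"
proof (rule injI)
 fix i j :: 3 assume "axis i (1::real) = axis j 1"
 then have "(axis i (1::real)) $ i = axis j 1 $ i" by (rule arg_cong)
 then show "i = j" by (simp add: axis_def split: if_splits)
qed

lemma prod_Basis3:
 fixes F :: "real^3 => real"
 shows "prod F Basis = F (axis 1 1) * F (axis 2 1) * F (axis 3 1)"
proof -
 have B: "(Basis :: (real^3) set) = (%i. axis i 1) ` UNIV" by (auto simp: Basis_vec_def)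
 have "prod F (range (%i. axis i 1)) = prod (F \<circ> (%i. axis i 1)) UNIV"
 by (rule prod.reindex[OF inj_axis])
 also have "... = F (axis 1 1) * F (axis 2 1) * F (axis 3 1)"
 unfolding UNIV_3 by (simp add: mult.assoc)
 finally show ?thesis unfolding B .
qed

lemma lborel_vec3: "(lborel :: (real^3) measure)
 = distr (lborel \<Otimes>\<^sub>M (lborel \<Otimes>\<^sub>M lborel)) borel (%(a, b, c). vector [a, b, c])"
proof (rule lborel_eqI)
 fix l u :: "real^3" assume le: "!!b. b \<in> Basis ==> l \<bullet> b <= u \<bullet> b"
 have le': "l $ i <= u $ i" for i using le[of "axis i 1"] by (simp add: inner_axis axis_in_Basis_iff)
 have pre: "(%(a, b, c). vector [a, b, c]) -` box l u \<inter> space (lborel \<Otimes>\<^sub>M (lborel \<Otimes>\<^sub>M lborel))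
 = {l $ 1 <..< u $ 1} \<times> {l $ 2 <..< u $ 2} \<times> {l $ 3 <..< u $ 3}"
 by (auto simp: box_def Basis_vec_def inner_axis forall_3 space_pair_measure)
 have "emeasure (distr (lborel \<Otimes>\<^sub>M (lborel \<Otimes>\<^sub>M lborel)) borel (%(a, b, c). vector [a, b, c])) (box l u)
 = emeasure (lborel \<Otimes>\<^sub>M (lborel \<Otimes>\<^sub>M lborel)) ({l $ 1 <..< u $ 1} \<times> {l $ 2 <..< u $ 2} \<times> {l $ 3 <..< u $ 3})"
 by (subst emeasure_distr) (auto simp: pre)
 also have "... = ennreal (u $ 1 - l $ 1) * (ennreal (u $ 2 - l $ 2) * ennreal (u $ 3 - l $ 3))"
 proof -
 have "emeasure (lborel \<Otimes>\<^sub>M (lborel \<Otimes>\<^sub>M lborel)) ({l $ 1 <..< u $ 1} \<times> ({l $ 2 <..< u $ 2} \<times> {l $ 3 <..< u $ 3}))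
 = emeasure lborel {l $ 1 <..< u $ 1} * emeasure (lborel \<Otimes>\<^sub>M lborel) ({l $ 2 <..< u $ 2} \<times> {l $ 3 <..< u $ 3})"
 by (rule sigma_finite_measure.emeasure_pair_measure_Times)
 (auto simp: lborel_prod intro: sigma_finite_lborel)
 moreover have "emeasure (lborel \<Otimes>\<^sub>M lborel) ({l $ 2 <..< u $ 2} \<times> {l $ 3 <..< u $ 3})
 = emeasure lborel {l $ 2 <..< u $ 2} * emeasure lborel {l $ 3 <..< u $ 3}"
 by (rule lborel.emeasure_pair_measure_Times) auto
 ultimately show ?thesis using le' by simp
 qed
 also have "... = ennreal ((u $ 1 - l $ 1) * (u $ 2 - l $ 2) * (u $ 3 - l $ 3))"
 using le' by (simp add: ennreal_mult mult.assoc)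
 also have "(u $ 1 - l $ 1) * (u $ 2 - l $ 2) * (u $ 3 - l $ 3) = (\<Prod>b\<in>Basis. (u - l) \<bullet> b)"
 by (simp add: prod_Basis3 inner_axis)
 finally show "emeasure (distr (lborel \<Otimes>\<^sub>M (lborel \<Otimes>\<^sub>M lborel)) borel (%(a, b, c). vector [a, b, c])) (box l u)
 = ennreal (\<Prod>b\<in>Basis. (u - l) \<bullet> b)" .
qed auto

lemma nn_integral_vec3:
 fixes f :: "real^3 => ennreal"
 assumes [measurable]: "f \<in> borel_measurable borel"
 shows "(\<integral>\<^sup>+x. f x \<partial>lborel) = (\<integral>\<^sup>+a. \<integral>\<^sup>+b. \<integral>\<^sup>+c. f (vector [a, b, c]) \<partial>lborel \<partial>lborel \<partial>lborel)"
proof -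
 have m: "(%p. f (case p of (a, b, c) => vector [a, b, c])) \<in> borel_measurable (borel \<Otimes>\<^sub>M (borel \<Otimes>\<^sub>M borel))"
 by (rule measurable_compose[OF measurable_vector3 assms])
 have "(\<integral>\<^sup>+x. f x \<partial>lborel) = (\<integral>\<^sup>+p. f (case p of (a, b, c) => vector [a, b, c]) \<partial>(lborel \<Otimes>\<^sub>M (lborel \<Otimes>\<^sub>M lborel)))"
 by (subst lborel_vec3, subst nn_integral_distr) auto
 also have "... = (\<integral>\<^sup>+a. \<integral>\<^sup>+q. f (case (a, q) of (a, b, c) => vector [a, b, c]) \<partial>(lborel \<Otimes>\<^sub>M lborel) \<partial>lborel)"
 by (subst sigma_finite_measure.nn_integral_fst[symmetric])
 (use m in \<open>auto simp: lborel_prod borel_prod intro: sigma_finite_lborel\<close>)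
 also have "... = (\<integral>\<^sup>+a. \<integral>\<^sup>+b. \<integral>\<^sup>+c. f (vector [a, b, c]) \<partial>lborel \<partial>lborel \<partial>lborel)"
 proof (intro nn_integral_cong)
 fix a :: real
 have [measurable]: "(%q. f (case (a, q) of (a, b, c) => vector [a, b, c])) \<in> borel_measurable (lborel \<Otimes>\<^sub>M lborel)"
 by measurable
 show "(\<integral>\<^sup>+q. f (case (a, q) of (a, b, c) => vector [a, b, c]) \<partial>(lborel \<Otimes>\<^sub>M lborel))
 = (\<integral>\<^sup>+b. \<integral>\<^sup>+c. f (vector [a, b, c]) \<partial>lborel \<partial>lborel)"
 by (subst lborel.nn_integral_fst[symmetric]) auto
 qed
 finally show ?thesis .
qed

lemma abs_le_nn_integral_deriv:
 fixes phi phi' :: "real => real"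
 assumes d: "!!t. (phi has_real_derivative phi' t) (at t)" and c: "continuous_on UNIV phi'"
 and r: "!!t. \<bar>t\<bar> > r ==> phi t = 0"
 shows "ennreal \<bar>phi x\<bar> <= (\<integral>\<^sup>+t. ennreal \<bar>phi' t\<bar> \<partial>lborel)"
proof -
 show ?thesis
 proof (cases "x <= - \<bar>r\<bar> - 1")
 case True
 then have "phi x = 0" by (intro r) auto
 then show ?thesis by simp
 next
 case False
 let ?a = "- \<bar>r\<bar> - 1"
 have "(LINT t|lborel. phi' t * indicator {?a..x} t) = phi x - phi ?a"
 by (rule integral_FTC_Icc_real) (use d c False in \<open>auto intro: continuous_on_interior\<close>)
 moreover have "phi ?a = 0" by (intro r) auto
 ultimately have eq: "\<bar>phi x\<bar> = \<bar>\<integral>t. phi' t * indicator {?a..x} t \<partial>lborel\<bar>" by simp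
 have "integrable lborel (%t. indicator {?a..x} t *\<^sub>R phi' t)"
 by (intro borel_integrable_compact continuous_on_subset[OF c]) auto
 then have int: "integrable lborel (%t. phi' t * indicator {?a..x} t)" by (simp add: mult.commute)
 have "ennreal \<bar>\<integral>t. phi' t * indicator {?a..x} t \<partial>lborel\<bar> <= (\<integral>\<^sup>+t. ennreal (norm (phi' t * indicator {?a..x} t)) \<partial>lborel)"
 using integral_norm_bound_ennreal[OF int] by simp
 also have "... <= (\<integral>\<^sup>+t. ennreal \<bar>phi' t\<bar> \<partial>lborel)"
 by (intro nn_integral_mono) (auto split: split_indicator)
 finally have "ennreal \<bar>\<integral>t. phi' t * indicator {?a..x} t \<partial>lborel\<bar> <= (\<integral>\<^sup>+t. ennreal \<bar>phi' t\<bar> \<partial>lborel)" .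
 then show ?thesis by (simp only: eq)
 qed
qed

text \<open>The previous inequality is applied to \<open>u ^ 4\<close>, which is bounded along every coordinate line by the
 integral of \<open>4 |u|^3 |\<partial>\<^sub>i u|\<close>; Cauchy and Schwarz bring back the sixth power.\<close>

lemma sobolev_L6:
 fixes f :: "real^3 => real"
 assumes f: "test_function UNIV f"
 shows "(LINT x|lborel. f x ^ 6) <= 4096 * (\<Prod>i\<in>UNIV. \<integral>x. (pd (axis i 1) f x)\<^sup>2 \<partial>lborel)"
proof -
 obtain K where K: "smooth f" "compact K" "!!x. x ~: K ==> f x = 0"
 using f by (rule test_functionE) blast
 obtain r where r: "!!x. x \<in> K ==> norm x <= r"
 using compact_imp_bounded[OF K(2)] by (auto simp: bounded_iff)
 have basis: "axis i 1 \<in> (Basis :: (real^3) set)" for i by (simp add: axis_in_Basis_iff)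
 have cf: "continuous_on UNIV f" and cp: "continuous_on UNIV (pd (axis i 1) f)" for i
 by (intro smooth_continuous smooth_pd K basis)+
 have [measurable]: "f \<in> borel_measurable borel" "pd (axis i 1) f \<in> borel_measurable borel" for i
 using cf cp by (auto intro: borel_measurable_continuous_onI)
 define D where "D i x = 4 * \<bar>f x\<bar> ^ 3 * \<bar>pd (axis i 1) f x\<bar>" for i x
 have [measurable]: "D i \<in> borel_measurable borel" for i unfolding D_def[abs_def] by measurable
 have line: "ennreal (f x ^ 4) <= (\<integral>\<^sup>+t. ennreal (D i (x + (t - x $ i) *\<^sub>R axis i 1)) \<partial>lborel)" for i x
 proof -
 let ?l = "%t. x + (t - x $ i) *\<^sub>R axis i 1"
 have l: "(?l has_derivative (%h. h *\<^sub>R axis i 1)) (at t)" for t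
 by (auto intro!: derivative_eq_intros)
 have fl: "((%t. f (?l t)) has_real_derivative pd (axis i 1) f (?l t)) (at t)" for t
 proof -
 have "((%t. f (?l t)) has_derivative (%h. pd (h *\<^sub>R axis i 1) f (?l t))) (at t)"
 by (rule has_derivative_compose[OF l smooth_has_derivative[OF K(1)]])
 moreover have "(%h. pd (h *\<^sub>R axis i 1) f (?l t)) = (*) (pd (axis i 1) f (?l t))"
 using linear_frechet_derivative[OF smooth_differentiable[OF K(1)], of "?l t"]
 by (auto simp: pd_def linear_cmul mult.commute)
 ultimately show ?thesis by (simp add: has_field_derivative_def)
 qed
 have "((%t. f (?l t) ^ 4) has_real_derivative 4 * f (?l t) ^ 3 * pd (axis i 1) f (?l t)) (at t)" for t
 by (auto intro!: derivative_eq_intros fl)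
 moreover have "continuous_on UNIV (%t. 4 * f (?l t) ^ 3 * pd (axis i 1) f (?l t))"
 by (intro continuous_intros continuous_on_compose2[OF cf] continuous_on_compose2[OF cp]) auto
 moreover have "f (?l t) ^ 4 = 0" if "\<bar>t\<bar> > r" for t
 proof -
 have "?l t $ i = t" by (simp add: axis_def)
 then have "\<bar>t\<bar> <= norm (?l t)" using component_le_norm_cart[of "?l t" i] by simp
 then have "?l t ~: K" using r[of "?l t"] that by auto
 then show ?thesis by (simp add: K(3))
 qed
 ultimately have "ennreal \<bar>f (?l (x $ i)) ^ 4\<bar> <= (\<integral>\<^sup>+t. ennreal \<bar>4 * f (?l t) ^ 3 * pd (axis i 1) f (?l t)\<bar> \<partial>lborel)"
 by (rule abs_le_nn_integral_deriv)
 then show ?thesis by (simp add: D_def abs_mult power_abs)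
 qed
 define g1 where "g1 = (%(y, z). \<integral>\<^sup>+t. ennreal (D 1 (vector [t, y, z])) \<partial>lborel)"
 define g2 where "g2 = (%(x, z). \<integral>\<^sup>+t. ennreal (D 2 (vector [x, t, z])) \<partial>lborel)"
 define g3 where "g3 = (%(x, y). \<integral>\<^sup>+t. ennreal (D 3 (vector [x, y, t])) \<partial>lborel)"
 have v: "(%p. (vector [a p, b p, c p] :: real^3)) \<in> borel_measurable M"
 if "a \<in> borel_measurable M" "b \<in> borel_measurable M" "c \<in> borel_measurable M" for a b c and M :: "'x measure"
 proof -
 have "(%p. (vector [a p, b p, c p] :: real^3)) = (%p. a p *\<^sub>R axis 1 1 + b p *\<^sub>R axis 2 1 + c p *\<^sub>R axis 3 1)"
 by (auto simp: fun_eq_iff vec_eq_iff forall_3 axis_def)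
 then show ?thesis using that by simp
 qed
 have mD: "(%p. ennreal (D i (vector [a p, b p, c p]))) \<in> borel_measurable M"
 if "a \<in> borel_measurable M" "b \<in> borel_measurable M" "c \<in> borel_measurable M" for a b c i and M :: "'x measure"
 using measurable_compose[OF v[OF that] \<open>D i \<in> borel_measurable borel\<close>] by simp
 have [measurable]: "g1 \<in> borel_measurable (borel \<Otimes>\<^sub>M borel)" "g2 \<in> borel_measurable (borel \<Otimes>\<^sub>M borel)"
 "g3 \<in> borel_measurable (borel \<Otimes>\<^sub>M borel)"
 unfolding g1_def g2_def g3_def split_def
 by (rule lborel.borel_measurable_nn_integral, unfold split_def, rule mD; measurable)+
 define S where "S = (\<integral>\<^sup>+x. ennreal (f x ^ 6) \<partial>lborel)"
 have mf: "(%x. ennreal (f x ^ 6)) \<in> borel_measurable borel" by measurable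
 have pt: "ennreal (f (vector [x, y, z]) ^ 6) <= esqrt (g1 (y, z)) * esqrt (g2 (x, z)) * esqrt (g3 (x, y))" for x y z
 proof (rule ennreal_power2_le_imp_le)
 let ?v = "vector [x, y, z] :: real^3"
 have "?v + (t - ?v $ 1) *\<^sub>R axis 1 1 = vector [t, y, z]" "?v + (t - ?v $ 2) *\<^sub>R axis 2 1 = vector [x, t, z]"
 "?v + (t - ?v $ 3) *\<^sub>R axis 3 1 = vector [x, y, t]" for t
 by (auto simp: vec_eq_iff forall_3 axis_def)
 then have "ennreal (f ?v ^ 4) <= g1 (y, z)" "ennreal (f ?v ^ 4) <= g2 (x, z)" "ennreal (f ?v ^ 4) <= g3 (x, y)"
 using line[of ?v 1] line[of ?v 2] line[of ?v 3] by (simp_all add: g1_def g2_def g3_def)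
 then have "ennreal (f ?v ^ 4) * ennreal (f ?v ^ 4) * ennreal (f ?v ^ 4) <= g1 (y, z) * g2 (x, z) * g3 (x, y)"
 by (intro mult_mono) auto
 also have "ennreal (f ?v ^ 4) * ennreal (f ?v ^ 4) * ennreal (f ?v ^ 4) = (ennreal (f ?v ^ 6))\<^sup>2"
 by (simp add: ennreal_mult[symmetric] ennreal_power power_add[symmetric] power_mult[symmetric])
 finally show "(ennreal (f ?v ^ 6))\<^sup>2 <= (esqrt (g1 (y, z)) * esqrt (g2 (x, z)) * esqrt (g3 (x, y)))\<^sup>2"
 by (simp add: power_mult_distrib)
 qed
 have I1: "(\<integral>\<^sup>+y. \<integral>\<^sup>+z. g1 (y, z) \<partial>lborel \<partial>lborel) = (\<integral>\<^sup>+x. ennreal (D 1 x) \<partial>lborel)"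
 proof -
 have "(\<integral>\<^sup>+x. ennreal (D 1 x) \<partial>lborel) = (\<integral>\<^sup>+x. \<integral>\<^sup>+y. \<integral>\<^sup>+z. ennreal (D 1 (vector [x, y, z])) \<partial>lborel \<partial>lborel \<partial>lborel)"
 by (rule nn_integral_vec3) measurable
 also have "... = (\<integral>\<^sup>+y. \<integral>\<^sup>+x. \<integral>\<^sup>+z. ennreal (D 1 (vector [x, y, z])) \<partial>lborel \<partial>lborel \<partial>lborel)"
 by (rule lborel_pair.Fubini', unfold split_def, rule lborel.borel_measurable_nn_integral, unfold split_def, rule mD; measurable)
 also have "... = (\<integral>\<^sup>+y. \<integral>\<^sup>+z. \<integral>\<^sup>+x. ennreal (D 1 (vector [x, y, z])) \<partial>lborel \<partial>lborel \<partial>lborel)"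
 by (rule nn_integral_cong, rule lborel_pair.Fubini', unfold split_def, rule mD; measurable)
 finally show ?thesis by (simp add: g1_def)
 qed
 have I2: "(\<integral>\<^sup>+x. \<integral>\<^sup>+z. g2 (x, z) \<partial>lborel \<partial>lborel) = (\<integral>\<^sup>+x. ennreal (D 2 x) \<partial>lborel)"
 proof -
 have "(\<integral>\<^sup>+x. ennreal (D 2 x) \<partial>lborel) = (\<integral>\<^sup>+x. \<integral>\<^sup>+y. \<integral>\<^sup>+z. ennreal (D 2 (vector [x, y, z])) \<partial>lborel \<partial>lborel \<partial>lborel)"
 by (rule nn_integral_vec3) measurable
 also have "... = (\<integral>\<^sup>+x. \<integral>\<^sup>+z. \<integral>\<^sup>+y. ennreal (D 2 (vector [x, y, z])) \<partial>lborel \<partial>lborel \<partial>lborel)"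
 by (rule nn_integral_cong, rule lborel_pair.Fubini', unfold split_def, rule mD; measurable)
 finally show ?thesis by (simp add: g2_def)
 qed
 have I3: "(\<integral>\<^sup>+x. \<integral>\<^sup>+y. g3 (x, y) \<partial>lborel \<partial>lborel) = (\<integral>\<^sup>+x. ennreal (D 3 x) \<partial>lborel)"
 by (subst nn_integral_vec3) (auto simp: g3_def)
 have "S = (\<integral>\<^sup>+x. \<integral>\<^sup>+y. \<integral>\<^sup>+z. ennreal (f (vector [x, y, z]) ^ 6) \<partial>lborel \<partial>lborel \<partial>lborel)"
 unfolding S_def by (rule nn_integral_vec3[OF mf])
 also have "... <= (\<integral>\<^sup>+x. \<integral>\<^sup>+y. \<integral>\<^sup>+z. esqrt (g1 (y, z)) * esqrt (g2 (x, z)) * esqrt (g3 (x, y)) \<partial>lborel \<partial>lborel \<partial>lborel)"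
 by (intro nn_integral_mono pt)
 finally have "S\<^sup>2 <= (\<integral>\<^sup>+x. \<integral>\<^sup>+y. \<integral>\<^sup>+z. esqrt (g1 (y, z)) * esqrt (g2 (x, z)) * esqrt (g3 (x, y)) \<partial>lborel \<partial>lborel \<partial>lborel)\<^sup>2"
 by (rule power_mono) auto
 also have "... <= (\<integral>\<^sup>+y. \<integral>\<^sup>+z. g1 (y, z) \<partial>lborel \<partial>lborel) * (\<integral>\<^sup>+x. \<integral>\<^sup>+z. g2 (x, z) \<partial>lborel \<partial>lborel)
 * (\<integral>\<^sup>+x. \<integral>\<^sup>+y. g3 (x, y) \<partial>lborel \<partial>lborel)"
 by (rule loomis_whitney) measurable
 finally have S2: "S\<^sup>2 <= (\<integral>\<^sup>+x. ennreal (D 1 x) \<partial>lborel) * (\<integral>\<^sup>+x. ennreal (D 2 x) \<partial>lborel) * (\<integral>\<^sup>+x. ennreal (D 3 x) \<partial>lborel)"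
 by (simp only: I1 I2 I3)
 define s where "s = (LINT x|lborel. f x ^ 6)"
 define d where "d i = (LINT x|lborel. (pd (axis i 1) f x)\<^sup>2)" for i :: 3
 have ints: "integrable lborel (%x. f x ^ 6)"
 using test_function_integrable[OF f, of "%x. f x ^ 5"] cf
 by (simp add: continuous_intros power_Suc[symmetric] del: power_Suc)
 have intd: "integrable lborel (%x. (pd (axis i 1) f x)\<^sup>2)" for i
 using test_function_integrable[OF test_function_pd[OF f basis] cp, of i] by (simp add: power2_eq_square)
 have Ss: "S = ennreal s" unfolding S_def s_def using ints by (rule nn_integral_eq_integral) auto
 have Dd: "(\<integral>\<^sup>+x. ennreal (D i x) \<partial>lborel)\<^sup>2 <= ennreal (16 * s * d i)" for i
 proof -
 have "(\<integral>\<^sup>+x. ennreal (D i x) \<partial>lborel) = (\<integral>\<^sup>+x. ennreal (4 * \<bar>f x\<bar> ^ 3) * ennreal \<bar>pd (axis i 1) f x\<bar> \<partial>lborel)"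
 by (simp add: D_def ennreal_mult)
 then have "(\<integral>\<^sup>+x. ennreal (D i x) \<partial>lborel)\<^sup>2
 <= (\<integral>\<^sup>+x. (ennreal (4 * \<bar>f x\<bar> ^ 3))\<^sup>2 \<partial>lborel) * (\<integral>\<^sup>+x. (ennreal \<bar>pd (axis i 1) f x\<bar>)\<^sup>2 \<partial>lborel)"
 by (simp only:) (intro Cauchy_Schwarz_nn_integral; measurable)
 also have "(\<integral>\<^sup>+x. (ennreal (4 * \<bar>f x\<bar> ^ 3))\<^sup>2 \<partial>lborel) = (\<integral>\<^sup>+x. ennreal (16 * f x ^ 6) \<partial>lborel)"
 by (intro nn_integral_cong) (simp add: ennreal_power power_mult_distrib power_mult[symmetric])
 also have "... = ennreal (16 * s)"
 by (subst nn_integral_eq_integral) (use ints in \<open>auto simp: s_def\<close>)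
 also have "(\<integral>\<^sup>+x. (ennreal \<bar>pd (axis i 1) f x\<bar>)\<^sup>2 \<partial>lborel) = (\<integral>\<^sup>+x. ennreal ((pd (axis i 1) f x)\<^sup>2) \<partial>lborel)"
 by (simp add: ennreal_power)
 also have "... = ennreal (d i)"
 by (subst nn_integral_eq_integral) (use intd in \<open>auto simp: d_def\<close>)
 also have "ennreal (16 * s) * ennreal (d i) = ennreal (16 * s * d i)"
 by (rule ennreal_mult[symmetric]) (auto simp: s_def d_def)
 finally show ?thesis .
 qed
 have nn: "0 <= s" "0 <= d i" for i by (auto simp: s_def d_def)
 have "(S\<^sup>2)\<^sup>2 <= ((\<integral>\<^sup>+x. ennreal (D 1 x) \<partial>lborel) * (\<integral>\<^sup>+x. ennreal (D 2 x) \<partial>lborel) * (\<integral>\<^sup>+x. ennreal (D 3 x) \<partial>lborel))\<^sup>2"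
 using S2 by (rule power_mono) auto
 also have "... <= ennreal (16 * s * d 1) * ennreal (16 * s * d 2) * ennreal (16 * s * d 3)"
 unfolding power_mult_distrib by (intro mult_mono Dd) auto
 also have "... = ennreal (4096 * s ^ 3 * (d 1 * d 2 * d 3))"
 using nn by (simp add: ennreal_mult[symmetric] power3_eq_cube mult_ac)
 finally have "ennreal (s ^ 4) <= ennreal (4096 * s ^ 3 * (d 1 * d 2 * d 3))"
 using nn by (simp add: Ss ennreal_power power_mult[symmetric])
 then have "s ^ 4 <= 4096 * s ^ 3 * (d 1 * d 2 * d 3)"
 using nn by (subst (asm) ennreal_le_iff) auto
 then have "s ^ 3 * s <= s ^ 3 * (4096 * (d 1 * d 2 * d 3))" by (simp add: power_numeral_reduce mult_ac)
 then have "s <= 4096 * (d 1 * d 2 * d 3)"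
 using nn by (cases "s = 0") (auto simp: mult_le_cancel_left)
 then show ?thesis unfolding UNIV_3 by (simp add: s_def d_def mult_ac)
qed

section \<open>Square integrable functions\<close>

definition sqint :: "'a measure => ('a => 'b::euclidean_space) => bool" where
 "sqint M f \<longleftrightarrow> f \<in> borel_measurable M & integrable M (%x. (norm (f x))\<^sup>2)"

definition l2 :: "'a measure => ('a => 'b::euclidean_space) => real" where
 "l2 M f = sqrt (LINT x|M. (norm (f x))\<^sup>2)"

lemma l2_nonneg [simp]: "0 <= l2 M f" by (simp add: l2_def)

lemma l2_power2: "(l2 M f)\<^sup>2 = (LINT x|M. (norm (f x))\<^sup>2)"
 by (simp add: l2_def)

lemma sqintD: "sqint M f ==> f \<in> borel_measurable M" "sqint M f ==> integrable M (%x. (norm (f x))\<^sup>2)"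
 by (auto simp: sqint_def)

lemma integrable_norm_mult:
 assumes f: "sqint M f" and g: "sqint M g"
 shows "integrable M (%x. norm (f x) * norm (g x))"
proof (rule Bochner_Integration.integrable_bound)
 show "integrable M (%x. (norm (f x))\<^sup>2 + (norm (g x))\<^sup>2)"
 using f g by (auto simp: sqint_def)
 show "AE x in M. norm (norm (f x) * norm (g x)) <= norm ((norm (f x))\<^sup>2 + (norm (g x))\<^sup>2)"
 proof (intro AE_I2)
 fix x
 have "2 * (norm (f x) * norm (g x)) <= (norm (f x))\<^sup>2 + (norm (g x))\<^sup>2"
 using sum_squares_bound[of "norm (f x)" "norm (g x)"] by simp
 moreover have "0 <= norm (f x) * norm (g x)" by simp
 ultimately have "norm (f x) * norm (g x) <= (norm (f x))\<^sup>2 + (norm (g x))\<^sup>2" by linarith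
 then show "norm (norm (f x) * norm (g x)) <= norm ((norm (f x))\<^sup>2 + (norm (g x))\<^sup>2)" by simp
 qed
 show "(%x. norm (f x) * norm (g x)) \<in> borel_measurable M"
 using sqintD(1)[OF f] sqintD(1)[OF g] by measurable
qed

lemma nn_integral_norm_power2:
 "sqint M h ==> (\<integral>\<^sup>+x. (ennreal (norm (h x)))\<^sup>2 \<partial>M) = ennreal ((l2 M h)\<^sup>2)"
 using nn_integral_eq_integral[OF sqintD(2)] by (simp add: ennreal_power l2_power2)

lemma l2_cauchy_schwarz:
 assumes f: "sqint M f" and g: "sqint M g"
 shows "(LINT x|M. norm (f x) * norm (g x)) <= l2 M f * l2 M g"
proof -
 have [measurable]: "f \<in> borel_measurable M" "g \<in> borel_measurable M"
 using f g by (auto simp: sqint_def)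
 let ?I = "\<integral>x. norm (f x) * norm (g x) \<partial>M"
 have "(\<integral>\<^sup>+x. ennreal (norm (f x)) * ennreal (norm (g x)) \<partial>M)\<^sup>2
 <= (\<integral>\<^sup>+x. (ennreal (norm (f x)))\<^sup>2 \<partial>M) * (\<integral>\<^sup>+x. (ennreal (norm (g x)))\<^sup>2 \<partial>M)"
 by (rule Cauchy_Schwarz_nn_integral) measurable
 moreover have "(\<integral>\<^sup>+x. ennreal (norm (f x)) * ennreal (norm (g x)) \<partial>M) = ennreal ?I"
 using nn_integral_eq_integral[OF integrable_norm_mult[OF f g]] by (simp add: ennreal_mult)
 moreover note nn_integral_norm_power2[OF f] nn_integral_norm_power2[OF g]
 moreover have "(ennreal ?I)\<^sup>2 = ennreal (?I\<^sup>2)"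
 by (simp add: ennreal_power)
 moreover have "ennreal ((l2 M f)\<^sup>2) * ennreal ((l2 M g)\<^sup>2) = ennreal ((l2 M f * l2 M g)\<^sup>2)"
 by (simp add: ennreal_mult power_mult_distrib)
 ultimately have "ennreal (?I\<^sup>2) <= ennreal ((l2 M f * l2 M g)\<^sup>2)"
 by (simp only:)
 then have "?I\<^sup>2 <= (l2 M f * l2 M g)\<^sup>2" by (subst (asm) ennreal_le_iff) auto
 then show ?thesis by (rule power2_le_imp_le) simp
qed

lemma integrable_inner:
 assumes f: "sqint M f" and g: "sqint M g"
 shows "integrable M (%x. f x \<bullet> g x)"
 by (rule Bochner_Integration.integrable_bound[OF integrable_norm_mult[OF f g]])
 (use sqintD(1)[OF f] sqintD(1)[OF g] Cauchy_Schwarz_ineq2 in auto)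

lemma abs_integral_inner_le:
 assumes f: "sqint M f" and g: "sqint M g"
 shows "\<bar>\<integral>x. f x \<bullet> g x \<partial>M\<bar> <= l2 M f * l2 M g"
proof -
 have "norm (LINT x|M. f x \<bullet> g x) <= (LINT x|M. norm (f x \<bullet> g x))"
 by (rule integral_norm_bound)
 also have "... <= (LINT x|M. norm (f x) * norm (g x))"
 by (rule integral_mono[OF integrable_norm[OF integrable_inner[OF f g]] integrable_norm_mult[OF f g]])
 (simp add: Cauchy_Schwarz_ineq2)
 finally show ?thesis using l2_cauchy_schwarz[OF f g] unfolding real_norm_def by linarith
qed

lemma sqint_zero [simp]: "sqint M (%x. 0)" by (simp add: sqint_def)

lemma sqint_add:
 assumes f: "sqint M f" and g: "sqint M g"
 shows "sqint M (%x. f x + g x)"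
proof -
 have [measurable]: "f \<in> borel_measurable M" "g \<in> borel_measurable M"
 using f g by (auto simp: sqint_def)
 have m: "(%x. f x + g x) \<in> borel_measurable M" by measurable
 have "integrable M (%x. (norm (f x))\<^sup>2 + (norm (g x))\<^sup>2 + 2 * (f x \<bullet> g x))"
 using f g integrable_inner[OF f g] by (auto simp: sqint_def)
 moreover have "(%x. (norm (f x))\<^sup>2 + (norm (g x))\<^sup>2 + 2 * (f x \<bullet> g x)) = (%x. (norm (f x + g x))\<^sup>2)"
 by (simp add: power2_norm_eq_inner inner_add inner_commute algebra_simps)
 ultimately show ?thesis using m by (simp add: sqint_def)
qed

lemma sqint_linear_image:
 assumes L: "bounded_linear L" and f: "sqint M f"
 shows "sqint M (%x. L (f x))"
proof -
 obtain K where K: "!!x. norm (L x) <= norm x * K" using bounded_linear.bounded[OF L] by blast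
 have [measurable]: "f \<in> borel_measurable M" "L \<in> borel_measurable borel"
 using f linear_continuous_on[OF L, of UNIV] by (auto simp: sqint_def intro: borel_measurable_continuous_onI)
 have "integrable M (%x. (norm (L (f x)))\<^sup>2)"
 proof (rule Bochner_Integration.integrable_bound)
 show "integrable M (%x. K\<^sup>2 * (norm (f x))\<^sup>2)" using f by (auto simp: sqint_def)
 show "AE x in M. norm ((norm (L (f x)))\<^sup>2) <= norm (K\<^sup>2 * (norm (f x))\<^sup>2)"
 using power_mono[OF K norm_ge_zero, of _ 2] by (auto simp: power_mult_distrib mult.commute)
 qed measurable
 then show ?thesis by (simp add: sqint_def)
qed

lemma sqint_scaleR: "sqint M f ==> sqint M (%x. c *\<^sub>R f x)"
 by (rule sqint_linear_image[OF bounded_linear_scaleR_right])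

lemma sqint_diff: "sqint M f ==> sqint M g ==> sqint M (%x. f x - g x)"
 using sqint_add[of M f "%x. - g x"] sqint_scaleR[of M g "-1"] by simp

lemma l2_scaleR: "l2 M (%x. c *\<^sub>R f x) = \<bar>c\<bar> * l2 M f"
 by (simp add: l2_def power_mult_distrib real_sqrt_mult)

lemma l2_minus_commute: "l2 M (%x. f x - g x) = l2 M (%x. g x - f x)"
 by (simp add: l2_def norm_minus_commute)

lemma l2_triangle:
 assumes f: "sqint M f" and g: "sqint M g"
 shows "l2 M (%x. f x + g x) <= l2 M f + l2 M g"
proof (rule power2_le_imp_le)
 have "(l2 M (%x. f x + g x))\<^sup>2 = (LINT x|M. (norm (f x))\<^sup>2 + (norm (g x))\<^sup>2 + 2 * (f x \<bullet> g x))"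
 unfolding l2_power2 by (simp add: power2_norm_eq_inner inner_add inner_commute algebra_simps)
 also have "... = (l2 M f)\<^sup>2 + (l2 M g)\<^sup>2 + 2 * (LINT x|M. f x \<bullet> g x)"
 using f g integrable_inner[OF f g] by (simp add: l2_power2 sqint_def)
 also have "... <= (l2 M f + l2 M g)\<^sup>2"
 using abs_integral_inner_le[OF f g] by (simp add: power2_sum)
 finally show "(l2 M (%x. f x + g x))\<^sup>2 <= (l2 M f + l2 M g)\<^sup>2" .
qed simp

lemma l2_triangle_diff:
 assumes "sqint M f" "sqint M g"
 shows "l2 M (%x. f x - g x) <= l2 M f + l2 M g"
 using l2_triangle[OF assms(1) sqint_scaleR[OF assms(2), of "-1"]] l2_scaleR[of M "-1" g] by simp

lemma l2_le_diff:
 assumes "sqint M f" "sqint M g"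
 shows "l2 M f <= l2 M (%x. f x - g x) + l2 M g"
 using l2_triangle[OF sqint_diff[OF assms] assms(2)] by simp

lemma l2_triangle3:
 assumes "sqint M f" "sqint M g" "sqint M h"
 shows "l2 M (%x. f x - h x) <= l2 M (%x. f x - g x) + l2 M (%x. g x - h x)"
 using l2_triangle[OF sqint_diff[OF assms(1,2)] sqint_diff[OF assms(2,3)]] by simp

lemma l2_mono:
 assumes "sqint M f" "sqint M g" "AE x in M. norm (f x) <= norm (g x)"
 shows "l2 M f <= l2 M g"
 unfolding l2_def real_sqrt_le_iff
 by (rule integral_mono_AE) (use assms in \<open>auto simp: sqint_def elim!: eventually_mono intro: power_mono\<close>)

lemma l2_cong_AE:
 assumes "f \<in> borel_measurable M" "g \<in> borel_measurable M" "AE x in M. f x = g x"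
 shows "l2 M f = l2 M g"
 unfolding l2_def using assms by (intro arg_cong[where f = sqrt] integral_cong_AE) auto

lemma sqint_cong_AE:
 assumes "sqint M f" "g \<in> borel_measurable M" "AE x in M. f x = g x"
 shows "sqint M g"
proof -
 have "integrable M (%x. (norm (g x))\<^sup>2)"
 by (rule integrable_cong_AE_imp[OF sqintD(2)[OF assms(1)]]) (use assms in auto)
 with assms show ?thesis by (simp add: sqint_def)
qed

lemma fatou_real:
 fixes h :: "nat => 'a => real"
 assumes int: "!!n. integrable M (h n)" and nn: "!!n x. 0 <= h n x" and le: "!!n. (LINT x|M. h n x) <= B n"
 and B: "B ----> b" and m: "g \<in> borel_measurable M" and lim: "AE x in M. (%n. h n x) ----> g x"
 and g0: "!!x. 0 <= g x"
 shows "integrable M g" "(LINT x|M. g x) <= b"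
proof -
 have [measurable]: "h n \<in> borel_measurable M" for n using int by auto
 note m[measurable]
 have "0 <= B n" for n
 by (rule order_trans[OF Bochner_Integration.integral_nonneg le[of n]]) (rule nn)
 then have b: "0 <= b" using B by (intro LIMSEQ_le_const[OF B]) auto
 have "(\<integral>\<^sup>+x. ennreal (g x) \<partial>M) = (\<integral>\<^sup>+x. liminf (%n. ennreal (h n x)) \<partial>M)"
 proof (rule nn_integral_cong_AE)
 show "AE x in M. ennreal (g x) = liminf (%n. ennreal (h n x))"
 using lim
 proof eventually_elim
 case (elim x)
 then have "(%n. ennreal (h n x)) ----> ennreal (g x)" by (rule tendsto_ennrealI)
 then show ?case by (simp add: lim_imp_Liminf)
 qed
 qed
 also have "... <= liminf (%n. \<integral>\<^sup>+x. ennreal (h n x) \<partial>M)"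
 by (rule nn_integral_liminf) measurable
 also have "... <= liminf (%n. ennreal (B n))"
 proof (intro Liminf_mono always_eventually allI)
 fix n
 have "(\<integral>\<^sup>+x. ennreal (h n x) \<partial>M) = ennreal (LINT x|M. h n x)"
 by (rule nn_integral_eq_integral[OF int]) (simp add: nn)
 then show "(\<integral>\<^sup>+x. ennreal (h n x) \<partial>M) <= ennreal (B n)"
 by (simp add: ennreal_leI le)
 qed
 also have "... = ennreal b"
 by (rule lim_imp_Liminf) (auto intro: tendsto_ennrealI B)
 finally have *: "(\<integral>\<^sup>+x. ennreal (g x) \<partial>M) <= ennreal b" .
 show "integrable M g"
 by (rule integrableI_bounded) (use * g0 in \<open>auto intro: le_less_trans\<close>)
 from nn_integral_eq_integral[OF this] * g0 b show "(LINT x|M. g x) <= b" by simp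
qed

text \<open>A subsequence with summable increments converges almost everywhere, and Fatou's lemma identifies
 the limit. The statement concerns functions, not classes, because the spaces consist of functions.\<close>

lemma l2_complete:
 fixes f :: "nat => 'a => 'b::euclidean_space"
 assumes fin: "finite_measure M" and f: "!!n. sqint M (f n)"
 and cauchy: "!!e. 0 < e ==> EX N. \<forall>m\<ge>N. \<forall>n\<ge>N. l2 M (%x. f m x - f n x) < e"
 shows "EX g. sqint M g & (%n. l2 M (%x. f n x - g x)) ----> 0"
proof -
 interpret finite_measure M by fact
 have [measurable]: "f n \<in> borel_measurable M" for n using f by (simp add: sqint_def)
 have one: "sqint M (%x. 1::real)" by (simp add: sqint_def)
 have L1: "integrable M h" "(LINT x|M. norm (h x)) <= l2 M h * l2 M (%x. 1::real)" if "sqint M h" for h :: "'a => 'b"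
 using integrable_norm_mult[OF that one] l2_cauchy_schwarz[OF that one] sqintD(1)[OF that]
 by (auto simp: integrable_norm_iff)
 have "EX N. \<forall>i\<ge>N. \<forall>j\<ge>N. (LINT x|M. norm (f i x - f j x)) < e" if e: "e > 0" for e
 proof -
 let ?c = "l2 M (%x. 1::real)"
 obtain N where N: "\<forall>m\<ge>N. \<forall>n\<ge>N. l2 M (%x. f m x - f n x) < e / (?c + 1)"
 using cauchy[of "e / (?c + 1)"] e by (auto simp: add_nonneg_pos)
 have "(LINT x|M. norm (f i x - f j x)) < e" if "i \<ge> N" "j \<ge> N" for i j
 proof -
 have c1: "0 < ?c + 1" by (simp add: add_nonneg_pos)
 have "(LINT x|M. norm (f i x - f j x)) <= l2 M (%x. f i x - f j x) * ?c"
 by (intro L1 sqint_diff f)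
 also have "... <= e / (?c + 1) * ?c"
 using N that by (intro mult_right_mono) (auto intro: less_imp_le)
 also have "... < e" using e c1 by (simp add: field_simps)
 finally show ?thesis .
 qed
 then show ?thesis by blast
 qed
 then obtain r where r: "strict_mono r" "AE x in M. Cauchy (%i. f (r i) x)"
 using cauchy_L1_AE_cauchy_subseq[of M f] L1(1)[OF f] by metis
 define g where "g x = lim (%i. f (r i) x)" for x
 have [measurable]: "g \<in> borel_measurable M" unfolding g_def[abs_def] by measurable
 have lim: "AE x in M. (%i. f (r i) x) ----> g x"
 using r(2) by eventually_elim (auto simp: g_def Cauchy_convergent_iff convergent_LIMSEQ_iff)
 have main: "integrable M (%x. (norm (f n x - g x))\<^sup>2) & (LINT x|M. (norm (f n x - g x))\<^sup>2) <= e\<^sup>2"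
 if e: "0 < e" and N: "\<forall>m\<ge>N. \<forall>n\<ge>N. l2 M (%x. f m x - f n x) < e" and n: "n \<ge> N" for e N n
 proof -
 have lim': "AE x in M. (%i. (norm (f n x - f (r (i + N)) x))\<^sup>2) ----> (norm (f n x - g x))\<^sup>2"
 using lim by eventually_elim (intro tendsto_intros LIMSEQ_ignore_initial_segment)
 have le: "(LINT x|M. (norm (f n x - f (r (i + N)) x))\<^sup>2) <= e\<^sup>2" for i
 proof -
 have "r (i + N) \<ge> N" using seq_suble[OF r(1), of "i + N"] by simp
 then have "l2 M (%x. f n x - f (r (i + N)) x) <= e" using N n by (auto intro: less_imp_le)
 then have "(l2 M (%x. f n x - f (r (i + N)) x))\<^sup>2 <= e\<^sup>2" by (rule power_mono) simp
 then show ?thesis by (simp add: l2_power2)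
 qed
 have int: "integrable M (%x. (norm (f n x - f (r (i + N)) x))\<^sup>2)" for i
 by (intro sqintD(2) sqint_diff f)
 show ?thesis
 by (rule conjI; rule fatou_real[OF int _ le tendsto_const _ lim']) auto
 qed
 have d: "sqint M (%x. f n x - g x)" if "\<forall>m\<ge>n. \<forall>k\<ge>n. l2 M (%x. f m x - f k x) < 1" for n
 using main[of 1 n n] that by (simp add: sqint_def)
 obtain N where N: "\<forall>m\<ge>N. \<forall>n\<ge>N. l2 M (%x. f m x - f n x) < 1" using cauchy[of 1] by auto
 have g: "sqint M g" using sqint_diff[OF f d[OF N], of N] by simp
 moreover have "(%n. l2 M (%x. f n x - g x)) ----> 0"
 proof (rule LIMSEQ_I)
 fix e :: real assume e: "0 < e"
 obtain N where N: "\<forall>m\<ge>N. \<forall>n\<ge>N. l2 M (%x. f m x - f n x) < e / 2" using cauchy[of "e / 2"] e by auto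
 have "l2 M (%x. f n x - g x) < e" if "n \<ge> N" for n
 proof -
 have "(l2 M (%x. f n x - g x))\<^sup>2 <= (e / 2)\<^sup>2"
 using conjunct2[OF main[OF _ N that]] e unfolding l2_power2 by simp
 then have "l2 M (%x. f n x - g x) <= e / 2" by (rule power2_le_imp_le) (use e in simp)
 then show ?thesis using e by linarith
 qed
 then show "EX no. \<forall>n\<ge>no. norm (l2 M (%x. f n x - g x) - 0) < e"
 by (intro exI[of _ N]) simp
 qed
 ultimately show ?thesis by (intro exI[of _ g] conjI)
qed

lemma Lq_space_2_iff: "f \<in> Lq_space 2 A \<longleftrightarrow> sqint (Leb A) f"
 by (simp add: Lq_space_def sqint_def)

lemma Lq_norm_2: "Lq_norm 2 A f = l2 (Leb A) f"
 by (simp add: Lq_norm_def l2_def powr_half_sqrt)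

lemma borel_measurable_lebesgue_on_AE:
 fixes f g :: "'a::euclidean_space => 'b::euclidean_space"
 assumes A: "A \<in> sets lebesgue" and f: "f \<in> borel_measurable (Leb A)" and ae: "AE x in Leb A. f x = g x"
 shows "g \<in> borel_measurable (Leb A)"
proof -
 have "(%x. if x \<in> A then f x else 0) \<in> borel_measurable lebesgue"
 using borel_measurable_if[OF A] f by blast
 moreover have "AE x in lebesgue. (if x \<in> A then f x else 0) = (if x \<in> A then g x else 0)"
 using ae A by (auto simp: AE_restrict_space_iff elim!: eventually_mono)
 ultimately have "(%x. if x \<in> A then g x else 0) \<in> borel_measurable lebesgue"
 by (rule borel_measurable_AE)
 then show ?thesis using borel_measurable_if[OF A] by blast
qed

section \<open>Weak gradients\<close>

lemma integrable_mult_test_function: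
 fixes g psi :: "'a::euclidean_space => real"
 assumes loc: "!!K. compact K ==> K \<subseteq> A ==> integrable (Leb K) g"
 and t: "test_function A psi" and A: "A \<in> sets lebesgue"
 shows "integrable (Leb A) (%x. g x * psi x)"
proof -
 obtain K where K: "smooth psi" "compact K" "K \<subseteq> A" "!!x. x ~: K ==> psi x = 0"
 using t by (rule test_functionE) blast
 have Ks: "K \<in> sets lebesgue" using K(2) by (simp add: lmeasurable_compact fmeasurableD)
 obtain B where B: "!!x. x \<in> K ==> \<bar>psi x\<bar> <= B"
 using compact_imp_bounded[OF compact_continuous_image[OF smooth_continuous[OF K(1)] K(2)]]
 by (auto simp: bounded_iff)
 have m: "psi \<in> borel_measurable (Leb K)"
 by (rule continuous_imp_measurable_on_sets_lebesgue[OF smooth_continuous[OF K(1)] Ks])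
 have "integrable (Leb K) (%x. g x * psi x)"
 proof (rule Bochner_Integration.integrable_bound[where f = "%x. B * g x"])
 show "integrable (Leb K) (%x. B * g x)" using loc[OF K(2,3)] by simp
 show "AE x in Leb K. norm (g x * psi x) <= norm (B * g x)"
 proof (intro AE_I2)
 fix x assume "x \<in> space (Leb K)"
 then have "\<bar>psi x\<bar> <= \<bar>B\<bar>" using B[of x] by simp
 then show "norm (g x * psi x) <= norm (B * g x)"
 using mult_right_mono[of "\<bar>psi x\<bar>" "\<bar>B\<bar>" "\<bar>g x\<bar>"] by (simp add: abs_mult mult.commute)
 qed
 qed (use loc[OF K(2,3)] m in auto)
 then have "integrable lebesgue (%x. indicator K x *\<^sub>R (g x * psi x))"
 using Ks by (simp add: integrable_restrict_space)
 also have "(%x. indicator K x *\<^sub>R (g x * psi x)) = (%x. indicator A x *\<^sub>R (g x * psi x))"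
 using K(3,4) by (auto simp: indicator_def fun_eq_iff)
 finally show ?thesis using A by (simp add: integrable_restrict_space)
qed

lemma is_weak_gradientD:
 assumes "is_weak_gradient A u G"
 shows "compact K ==> K \<subseteq> A ==> integrable (Leb K) (%x. u x $ i)"
 "compact K ==> K \<subseteq> A ==> integrable (Leb K) (%x. G x $ i $ j)"
 "test_function A psi ==> (LINT x|Leb A. u x $ i * pd (axis j 1) psi x) = - (LINT x|Leb A. G x $ i $ j * psi x)"
proof -
 note w = assms[unfolded is_weak_gradient_def]
 show "integrable (Leb K) (%x. u x $ i)" if "compact K" "K \<subseteq> A"
 using conjunct1[OF conjunct1[OF w, rule_format, OF conjI[OF that]]]
 by (rule integrable_bounded_linear[OF bounded_linear_vec_nth])
 show "integrable (Leb K) (%x. G x $ i $ j)" if "compact K" "K \<subseteq> A"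
 using conjunct2[OF conjunct1[OF w, rule_format, OF conjI[OF that]]]
 by (rule integrable_bounded_linear[OF bounded_linear_compose[OF bounded_linear_vec_nth bounded_linear_vec_nth]])
 show "(LINT x|Leb A. u x $ i * pd (axis j 1) psi x) = - (LINT x|Leb A. G x $ i $ j * psi x)"
 if "test_function A psi"
 using conjunct2[OF w, rule_format, OF that, of i j] by (simp add: pd_def)
qed

lemma is_weak_gradient_diff:
 assumes A: "open A" and u: "is_weak_gradient A u G" and w: "is_weak_gradient A w H"
 shows "is_weak_gradient A (%x. u x - w x) (%x. G x - H x)"
 unfolding is_weak_gradient_def
proof (intro conjI allI impI)
 have As: "A \<in> sets lebesgue" using A by auto
 fix K assume "compact K & K \<subseteq> A"
 then show "integrable (Leb K) (%x. u x - w x)" "integrable (Leb K) (%x. G x - H x)"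
 using u w by (auto simp: is_weak_gradient_def)
next
 have As: "A \<in> sets lebesgue" using A by auto
 fix psi :: "real^3 => real" and i j :: 3 assume t: "test_function A psi"
 have tp: "test_function A (pd (axis j 1) psi)"
 by (rule test_function_pd[OF t]) (simp add: axis_in_Basis_iff)
 have "(LINT x|Leb A. (u x - w x) $ i * pd (axis j 1) psi x)
 = (LINT x|Leb A. u x $ i * pd (axis j 1) psi x) - (LINT x|Leb A. w x $ i * pd (axis j 1) psi x)"
 using integrable_mult_test_function[OF is_weak_gradientD(1)[OF u] tp As, of i]
 integrable_mult_test_function[OF is_weak_gradientD(1)[OF w] tp As, of i]
 by (simp add: left_diff_distrib)
 also have "... = - ((LINT x|Leb A. G x $ i $ j * psi x) - (LINT x|Leb A. H x $ i $ j * psi x))"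
 using is_weak_gradientD(3)[OF u t] is_weak_gradientD(3)[OF w t] by simp
 also have "... = - (LINT x|Leb A. (G x - H x) $ i $ j * psi x)"
 using integrable_mult_test_function[OF is_weak_gradientD(2)[OF u] t As, of i j]
 integrable_mult_test_function[OF is_weak_gradientD(2)[OF w] t As, of i j]
 by (simp add: left_diff_distrib)
 finally show "(LINT x|Leb A. (u x - w x) $ i * frechet_derivative psi (at x) (axis j 1))
 = - (LINT x|Leb A. (G x - H x) $ i $ j * psi x)"
 by (simp add: pd_def)
qed

text \<open>The chosen weak gradient is a Hilbert choice; uniqueness makes it usable.\<close>

lemma weak_gradient_unique:
 assumes A: "open A" and G: "is_weak_gradient A u G" and H: "is_weak_gradient A u H"
 shows "AE x in Leb A. G x = H x"
proof -
 have d: "is_weak_gradient A (%x. 0) (%x. G x - H x)"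
 using is_weak_gradient_diff[OF A G H] by simp
 have "AE x in Leb A. (G x - H x) $ i $ j = 0" for i j
 by (rule fundamental_lemma_variations[OF A is_weak_gradientD(2)[OF d]])
 (use is_weak_gradientD(3)[OF d] in auto)
 then have "AE x in Leb A. ALL i j. (G x - H x) $ i $ j = 0"
 by (simp add: AE_all_countable)
 then show ?thesis by eventually_elim (simp add: vec_eq_iff)
qed

definition grad :: "field3 => real^3 => real^3^3" where
 "grad u x = (\<chi> i j. pd (axis j 1) u x $ i)"

lemma grad_nth: "smooth u ==> grad u x $ i $ j = pd (axis j 1) (%x. u x $ i) x"
 unfolding grad_def using pd_linear_image[OF bounded_linear_vec_nth, of u] by simp

lemma lebesgue_on_integral_eq_lborel:
 fixes f :: "'a::euclidean_space => real"
 assumes A: "A \<in> sets lebesgue" and f: "f \<in> borel_measurable borel" and z: "!!x. x ~: A ==> f x = 0"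
 shows "(LINT x|Leb A. f x) = (LINT x|lborel. f x)" "integrable (Leb A) f \<longleftrightarrow> integrable lborel f"
proof -
 have e: "(%x. indicator A x * f x) = f" using z by (auto simp: indicator_def fun_eq_iff)
 show "(LINT x|Leb A. f x) = (LINT x|lborel. f x)"
 using A f by (simp add: integral_restrict_space e integral_completion)
 show "integrable (Leb A) f \<longleftrightarrow> integrable lborel f"
 using A f by (simp add: integrable_restrict_space e integrable_completion)
qed

lemma continuous_grad: "smooth u ==> continuous_on S (grad u)"
 unfolding grad_def[abs_def]
 by (intro continuous_on_vec_lambda bounded_linear.continuous_on[OF bounded_linear_vec_nth] smooth_continuous smooth_pd)
 (auto simp: axis_in_Basis_iff)

lemma is_weak_gradient_grad:
 assumes A: "open A" and u: "test_function UNIV u"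
 shows "is_weak_gradient A u (grad u)"
 unfolding is_weak_gradient_def
proof (intro conjI allI impI)
 have su: "smooth u" using u by (rule test_function_smooth)
 fix K assume "compact K & K \<subseteq> A"
 then have K: "compact K" by simp
 have *: "integrable (Leb K) f" if "continuous_on UNIV f" for f :: "real^3 => 'z::euclidean_space"
 proof -
 have "integrable lborel (%x. indicator K x *\<^sub>R f x)"
 by (rule borel_integrable_compact[OF K continuous_on_subset[OF that]]) auto
 then have "integrable lebesgue (%x. indicator K x *\<^sub>R f x)"
 by (simp add: integrable_completion)
 then show ?thesis using K by (subst integrable_restrict_space) (auto simp: lmeasurable_compact fmeasurableD)
 qed
 show "integrable (Leb K) u" "integrable (Leb K) (grad u)"
 by (intro * smooth_continuous su continuous_grad)+
next
 have su: "smooth u" using u by (rule test_function_smooth)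
 have As: "A \<in> sets lebesgue" using A by auto
 fix psi :: "real^3 => real" and i j :: 3 assume t: "test_function A psi"
 have e: "axis j 1 \<in> (Basis :: (real^3) set)" by (simp add: axis_in_Basis_iff)
 have sui: "smooth (%x. u x $ i)" by (rule smooth_linear_image[OF bounded_linear_vec_nth su])
 have z: "psi x = 0" "pd (axis j 1) psi x = 0" if "x ~: A" for x
 using t test_function_pd[OF t e] that by (auto elim!: test_functionE)
 have m: "continuous_on UNIV f ==> f \<in> borel_measurable borel" for f :: "real^3 => real"
 by (rule borel_measurable_continuous_onI)
 have "(LINT x|Leb A. u x $ i * pd (axis j 1) psi x) = (LINT x|lborel. u x $ i * pd (axis j 1) psi x)"
 by (intro lebesgue_on_integral_eq_lborel As m continuous_intros smooth_continuous sui smooth_pd e test_function_smooth[OF t])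
 (simp add: z)
 also have "... = - (LINT x|lborel. grad u x $ i $ j * psi x)"
 using integration_by_parts[OF test_function_UNIV[OF t] sui e] grad_nth[OF su]
 by (simp add: mult.commute)
 also have "(LINT x|lborel. grad u x $ i $ j * psi x) = (LINT x|Leb A. grad u x $ i $ j * psi x)"
 by (intro lebesgue_on_integral_eq_lborel(1)[symmetric] As m continuous_intros smooth_continuous
 test_function_smooth[OF t] bounded_linear.continuous_on[OF bounded_linear_vec_nth] continuous_grad su)
 (simp add: z)
 finally show "(LINT x|Leb A. u x $ i * frechet_derivative psi (at x) (axis j 1))
 = - (LINT x|Leb A. grad u x $ i $ j * psi x)"
 by (simp add: pd_def)
qed

section \<open>Second moments of a ball\<close>

lemma integrable_cball:
 fixes f :: "real^3 => 'b::euclidean_space"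
 assumes "continuous_on UNIV f"
 shows "integrable (Leb (cball 0 R)) f"
proof -
 have "integrable lborel (%x. indicator (cball 0 R) x *\<^sub>R f x)"
 by (rule borel_integrable_compact[OF compact_cball continuous_on_subset[OF assms]]) auto
 then have "integrable lebesgue (%x. indicator (cball 0 R) x *\<^sub>R f x)"
 by (simp add: integrable_completion)
 then show ?thesis by (subst integrable_restrict_space) auto
qed

lemma integral_cball_orthogonal:
 fixes f :: "real^3 => real" and Q :: "real^3 => real^3"
 assumes Q: "orthogonal_transformation Q" and f: "continuous_on UNIV f"
 shows "(LINT x|Leb (cball 0 R). f (Q x)) = (LINT x|Leb (cball 0 R). f x)"
proof -
 let ?B = "cball 0 R :: (real^3) set"
 let ?F = "%x. f x *\<^sub>R (axis 1 1 :: real^3)"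
 have lin: "linear Q" using Q by (rule orthogonal_transformation_linear)
 have cQ: "continuous_on UNIV Q" using lin linear_conv_bounded_linear linear_continuous_on by blast
 have fQ: "continuous_on UNIV (%x. f (Q x))"
 using continuous_on_compose2[OF f cQ] by simp
 have QB: "Q ` ?B = ?B"
 using image_orthogonal_transformation_cball[OF Q, of 0 R] orthogonal_transformation_linear[OF Q] by (simp add: linear_0)
 have det: "\<bar>det (matrix Q)\<bar> = 1"
 using det_orthogonal_matrix[of "matrix Q"] Q orthogonal_transformation_matrix[of Q] by auto
 have ai: "?F absolutely_integrable_on Q ` ?B"
 proof -
 have "integrable (Leb ?B) ?F" by (intro integrable_cball continuous_intros f)
 then have "integrable lebesgue (%x. indicator ?B x *\<^sub>R ?F x)" by (subst (asm) integrable_restrict_space) auto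
 then show ?thesis unfolding QB set_integrable_def .
 qed
 have "integral (Q ` ?B) ?F = \<bar>det (matrix Q)\<bar> *\<^sub>R integral ?B (?F \<circ> Q)"
 by (rule integral_change_of_variables_linear[OF lin]) (use ai in blast)
 then have "integral ?B ?F = integral ?B (%x. ?F (Q x))" by (simp add: QB det o_def)
 moreover have "integral ?B (%x. h x *\<^sub>R (axis 1 1 :: real^3)) = (LINT x|Leb ?B. h x) *\<^sub>R axis 1 1"
 if "continuous_on UNIV h" for h
 proof -
 have "(LINT x|Leb ?B. h x *\<^sub>R (axis 1 1 :: real^3)) = (LINT x|Leb ?B. h x) *\<^sub>R axis 1 1"
 by (rule integral_scaleR_left) (use integrable_cball[OF that] in auto)
 moreover have "(LINT x|Leb ?B. h x *\<^sub>R (axis 1 1 :: real^3)) = integral ?B (%x. h x *\<^sub>R (axis 1 1 :: real^3))"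
 by (rule lebesgue_integral_eq_integral) (auto intro!: integrable_cball continuous_intros that)
 ultimately show ?thesis by simp
 qed
 ultimately show ?thesis using f fQ by (simp add: axis_eq_0_iff)
qed

lemma cball_moment_offdiag:
 assumes "i ~= j" shows "(LINT x|Leb (cball (0::real^3) R). x $ i * x $ j) = 0"
proof -
 define Q :: "real^3 => real^3" where "Q x = (\<chi> k. if k = i then - x $ k else x $ k)" for x
 have Q: "orthogonal_transformation Q"
 unfolding orthogonal_transformation
 proof (intro conjI allI)
 show "linear Q" by (rule linearI) (auto simp: Q_def vec_eq_iff)
 show "norm (Q v) = norm v" for v
 unfolding norm_vec_def L2_set_def by (intro arg_cong[where f = sqrt] sum.cong) (auto simp: Q_def)
 qed
 have "(LINT x|Leb (cball (0::real^3) R). Q x $ i * Q x $ j) = (LINT x|Leb (cball (0::real^3) R). x $ i * x $ j)"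
 by (rule integral_cball_orthogonal[OF Q]) (auto intro!: continuous_intros)
 then show ?thesis using assms by (simp add: Q_def)
qed

lemma cball_moment_swap:
 "(LINT x|Leb (cball (0::real^3) R). x $ i * x $ i) = (LINT x|Leb (cball (0::real^3) R). x $ j * x $ j)"
proof -
 define Q :: "real^3 => real^3" where "Q x = (\<chi> k. x $ (Transposition.transpose i j k))" for x
 have Q: "orthogonal_transformation Q"
 unfolding orthogonal_transformation
 proof (intro conjI allI)
 show "linear Q" by (rule linearI) (auto simp: Q_def vec_eq_iff)
 show "norm (Q v) = norm v" for v
 proof -
 have "(\<Sum>k\<in>UNIV. (norm (v $ Transposition.transpose i j k))\<^sup>2) = (\<Sum>k\<in>UNIV. (norm (v $ k))\<^sup>2)"
 by (rule sum.reindex_bij_betw[OF bij_transpose])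
 then show ?thesis unfolding norm_vec_def L2_set_def by (simp add: Q_def)
 qed
 qed
 have "(LINT x|Leb (cball (0::real^3) R). Q x $ i * Q x $ i) = (LINT x|Leb (cball (0::real^3) R). x $ i * x $ i)"
 by (rule integral_cball_orthogonal[OF Q]) (auto intro!: continuous_intros)
 then show ?thesis by (simp add: Q_def)
qed

text \<open>Layer-cake integration of the squared norm, using the volume of balls.\<close>

lemma cball_norm_moment:
 assumes R: "0 < R"
 shows "(LINT x|Leb (cball (0::real^3) R). (norm x)\<^sup>2) = 4 / 5 * pi * R ^ 5"
proof -
 let ?B = "cball (0::real^3) R"
 have sq: "ennreal (t\<^sup>2) = (\<integral>\<^sup>+r. ennreal (2 * r) * indicator {0..<t} r \<partial>lborel)" if t: "0 <= t" for t :: real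
 proof -
 have "(\<integral>\<^sup>+r. ennreal (2 * r) * indicator {0..t} r \<partial>lborel) = ennreal (t\<^sup>2 - 0\<^sup>2)"
 by (rule nn_integral_FTC_Icc) (use t in \<open>auto intro!: derivative_eq_intros continuous_intros\<close>)
 moreover have "(\<integral>\<^sup>+r. ennreal (2 * r) * indicator {0..t} r \<partial>lborel) = (\<integral>\<^sup>+r. ennreal (2 * r) * indicator {0..<t} r \<partial>lborel)"
 by (rule nn_integral_cong_AE) (use AE_lborel_singleton[of t] in \<open>eventually_elim, auto simp: indicator_def\<close>)
 ultimately show ?thesis by simp
 qed
 have shell: "emeasure lborel {x \<in> ?B. r < norm x} = ennreal (4 / 3 * pi * (R ^ 3 - r ^ 3))"
 if r: "0 <= r" "r <= R" for r
 proof -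
 have "{x \<in> ?B. r < norm x} = ?B - cball 0 r" by auto
 then have "emeasure lborel {x \<in> ?B. r < norm x} = emeasure lborel ?B - emeasure lborel (cball (0::real^3) r)"
 using r emeasure_Diff[of lborel "cball (0::real^3) r" ?B] emeasure_lborel_cball_finite[of "0::real^3" r]
 by (simp add: subset_iff less_top)
 also have "... = ennreal (4 / 3 * pi * R ^ 3) - ennreal (4 / 3 * pi * r ^ 3)"
 using r R by (simp add: emeasure_cball unit_ball_vol_3)
 also have "... = ennreal (4 / 3 * pi * (R ^ 3 - r ^ 3))"
 using r by (simp add: ennreal_minus right_diff_distrib)
 finally show ?thesis .
 qed
 have "(\<integral>\<^sup>+x. ennreal ((norm x)\<^sup>2) * indicator ?B x \<partial>lborel)
 = (\<integral>\<^sup>+x. \<integral>\<^sup>+r. ennreal (2 * r) * indicator {0..<norm x} r * indicator ?B x \<partial>lborel \<partial>lborel)"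
 by (simp add: sq nn_integral_multc)
 also have "... = (\<integral>\<^sup>+x. \<integral>\<^sup>+r. ennreal (2 * r) * indicator {0..R} r * indicator {x \<in> ?B. r < norm x} x \<partial>lborel \<partial>lborel)"
 by (intro nn_integral_cong) (auto simp: indicator_def)
 also have "... = (\<integral>\<^sup>+r. \<integral>\<^sup>+x. ennreal (2 * r) * indicator {0..R} r * indicator {x \<in> ?B. r < norm x} x \<partial>lborel \<partial>lborel)"
 proof (rule lborel_pair.Fubini')
 have "(%p :: real \<times> (real^3). indicator {x \<in> ?B. fst p < norm x} (snd p) :: ennreal) = indicator {p. norm (snd p) <= R & fst p < norm (snd p)}"
 by (auto simp: indicator_def fun_eq_iff)
 moreover have "{p :: real \<times> (real^3). norm (snd p) <= R & fst p < norm (snd p)} \<in> sets (borel \<Otimes>\<^sub>M borel)"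
 proof -
 have "{p :: real \<times> (real^3). norm (snd p) <= R} \<inter> {p. fst p < norm (snd p)} \<in> sets borel"
 by (intro sets.Int borel_closed borel_open closed_Collect_le open_Collect_less continuous_intros)
 then show ?thesis unfolding borel_prod by (simp add: Int_def)
 qed
 ultimately show "(%(r, x). ennreal (2 * r) * indicator {0..R} r * indicator {x \<in> ?B. r < norm x} x) \<in> borel_measurable (lborel \<Otimes>\<^sub>M lborel)"
 unfolding split_def by (auto intro!: borel_measurable_times_ennreal)
 qed
 also have "... = (\<integral>\<^sup>+r. ennreal (2 * r) * indicator {0..R} r * emeasure lborel {x \<in> ?B. r < norm x} \<partial>lborel)"
 by (intro nn_integral_cong nn_integral_cmult_indicator) measurable
 also have "... = (\<integral>\<^sup>+r. ennreal (2 * r * (4 / 3 * pi * (R ^ 3 - r ^ 3))) * indicator {0..R} r \<partial>lborel)"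
 proof (intro nn_integral_cong)
 fix r
 show "ennreal (2 * r) * indicator {0..R} r * emeasure lborel {x \<in> ?B. r < norm x}
 = ennreal (2 * r * (4 / 3 * pi * (R ^ 3 - r ^ 3))) * indicator {0..R} r"
 proof (cases "0 <= r & r <= R")
 case True
 then have "0 <= 4 / 3 * pi * (R ^ 3 - r ^ 3)" by (simp add: power_mono)
 then have "ennreal (2 * r) * ennreal (4 / 3 * pi * (R ^ 3 - r ^ 3)) = ennreal (2 * r * (4 / 3 * pi * (R ^ 3 - r ^ 3)))"
 using True by (intro ennreal_mult[symmetric]) auto
 moreover have "indicator {0..R} r = (1::ennreal)" using True by simp
 moreover have "emeasure lborel {x \<in> ?B. r < norm x} = ennreal (4 / 3 * pi * (R ^ 3 - r ^ 3))"
 using True by (intro shell) auto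
 ultimately show ?thesis by (simp only: mult_1_right)
 qed (auto simp: indicator_def)
 qed
 also have "... = ennreal ((4 / 3 * pi * (R ^ 3 * R\<^sup>2 - 2 / 5 * R ^ 5)) - (4 / 3 * pi * (R ^ 3 * 0\<^sup>2 - 2 / 5 * 0 ^ 5)))"
 proof (rule nn_integral_FTC_Icc[where F = "%r. 4 / 3 * pi * (R ^ 3 * r\<^sup>2 - 2 / 5 * r ^ 5)"])
 show "((%r. 4 / 3 * pi * (R ^ 3 * r\<^sup>2 - 2 / 5 * r ^ 5)) has_real_derivative 2 * r * (4 / 3 * pi * (R ^ 3 - r ^ 3))) (at r)" for r
 by (auto intro!: derivative_eq_intros simp: algebra_simps power_numeral_reduce)
 show "0 <= 2 * r * (4 / 3 * pi * (R ^ 3 - r ^ 3))" if "r \<in> {0..R}" for r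
 using that by (auto intro!: mult_nonneg_nonneg power_mono)
 qed (use R in \<open>auto intro!: continuous_intros\<close>)
 also have "... = ennreal (4 / 5 * pi * R ^ 5)"
 by (rule arg_cong[where f = ennreal]) (simp add: algebra_simps power_numeral_reduce)
 finally have nn: "(\<integral>\<^sup>+x. ennreal ((norm x)\<^sup>2) * indicator ?B x \<partial>lborel) = ennreal (4 / 5 * pi * R ^ 5)" .
 have mB: "(%x. indicator ?B x * (norm x)\<^sup>2) \<in> borel_measurable lborel"
 by (intro borel_measurable_times borel_measurable_indicator) auto
 have "(LINT x|Leb ?B. (norm x)\<^sup>2) = (LINT x|lborel. indicator ?B x * (norm x)\<^sup>2)"
 using integral_completion[OF mB] by (simp add: integral_restrict_space)
 also have "... = enn2real (\<integral>\<^sup>+x. ennreal (indicator ?B x * (norm x)\<^sup>2) \<partial>lborel)"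
 using mB by (intro integral_eq_nn_integral) auto
 also have "(\<integral>\<^sup>+x. ennreal (indicator ?B x * (norm x)\<^sup>2) \<partial>lborel) = (\<integral>\<^sup>+x. ennreal ((norm x)\<^sup>2) * indicator ?B x \<partial>lborel)"
 by (intro nn_integral_cong) (auto simp: indicator_def)
 finally show ?thesis using nn R by simp
qed

lemma cball_moments:
 assumes R: "0 < R"
 shows "(LINT x|Leb (cball (0::real^3) R). x $ i * x $ j) = (if i = j then 4 / 15 * pi * R ^ 5 else 0)"
proof -
 have "(LINT x|Leb (cball (0::real^3) R). (norm x)\<^sup>2)
 = (LINT x|Leb (cball (0::real^3) R). x $ 1 * x $ 1 + x $ 2 * x $ 2 + x $ 3 * x $ 3)"
 by (simp add: power2_norm_eq_inner inner_vec_def sum_3)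
 also have "... = (LINT x|Leb (cball (0::real^3) R). x $ 1 * x $ 1) + (LINT x|Leb (cball (0::real^3) R). x $ 2 * x $ 2)
 + (LINT x|Leb (cball (0::real^3) R). x $ 3 * x $ 3)"
 by (subst Bochner_Integration.integral_add integrable_cball; (intro integrable_cball continuous_intros Bochner_Integration.integrable_add)?; simp)+
 also have "... = 3 * (LINT x|Leb (cball (0::real^3) R). x $ i * x $ i)"
 using cball_moment_swap[of R 1 i] cball_moment_swap[of R 2 i] cball_moment_swap[of R 3 i] by simp
 finally show ?thesis using cball_norm_moment[OF R] cball_moment_offdiag[of i j R] by auto
qed

lemma integral_cball_linear_form:
 fixes L :: "real^3 => real^3"
 assumes R: "0 < R" and L: "linear L"
 shows "(LINT x|Leb (cball 0 R). x \<bullet> L x) = 4 / 15 * pi * R ^ 5 * (\<Sum>i\<in>UNIV. L (axis i 1) $ i)"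
proof -
 have e: "x \<bullet> L x = (\<Sum>i\<in>UNIV. \<Sum>j\<in>UNIV. L (axis j 1) $ i * (x $ i * x $ j))" for x
 proof -
 have "x = (\<Sum>j\<in>UNIV. x $ j *\<^sub>R axis j 1)" using basis_expansion[of x] by (simp add: scalar_mult_eq_scaleR)
 then have "L x = L (\<Sum>j\<in>UNIV. x $ j *\<^sub>R axis j 1)" by simp
 also have "... = (\<Sum>j\<in>UNIV. x $ j *\<^sub>R L (axis j 1))"
 using L by (simp add: linear_sum linear_cmul)
 finally show ?thesis by (simp add: inner_vec_def sum_distrib_left mult_ac)
 qed
 have int: "integrable (Leb (cball 0 R)) (%x::real^3. x $ i * x $ j)" for i j
 by (intro integrable_cball continuous_intros)
 have "(LINT x|Leb (cball 0 R). x \<bullet> L x)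
 = (\<Sum>i\<in>UNIV. \<Sum>j\<in>UNIV. L (axis j 1) $ i * (LINT x|Leb (cball (0::real^3) R). x $ i * x $ j))"
 unfolding e using int by simp
 also have "... = (\<Sum>i\<in>UNIV. L (axis i 1) $ i * (4 / 15 * pi * R ^ 5))"
 unfolding cball_moments[OF R] by (simp add: sum.delta' if_distrib cong: if_cong)
 finally show ?thesis by (simp add: sum_distrib_left mult_ac)
qed

section \<open>The kinetic energy\<close>

locale gap =
 fixes S :: gap_system
 assumes adm: "admissible S"
begin

abbreviation V :: "(real^3) set" where "V \<equiv> cavity S"
abbreviation R :: real where "R \<equiv> radius S"
abbreviation lam :: real where "lam \<equiv> ball_inertia S"
abbreviation J :: "real^3^3" where "J \<equiv> total_inertia S"
abbreviation MV :: "(real^3) measure" where "MV \<equiv> Leb V"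
abbreviation Ml :: "(real^3) measure" where "Ml \<equiv> Leb (liquid S)"
abbreviation MB :: "(real^3) measure" where "MB \<equiv> Leb (cball 0 R)"
abbreviation rot :: "real^3 => field3" where "rot beta \<equiv> (%x. cross3 beta x)"
abbreviation dens :: "real^3 => real" where "dens \<equiv> density_tilde S"
abbreviation ball_density :: real where "ball_density \<equiv> 15 * lam / (8 * pi * R ^ 5)"

lemma pos: "0 < R" "0 < fluid_density S" "0 < viscosity S" "0 < lam" "0 < ball_density"
 using adm by (auto simp: admissible_def ball_inertia_def)

lemma V: "open V" "bounded V" "cball 0 R \<subseteq> V"
 using adm by (auto simp: admissible_def)

lemma V_lmeasurable: "V \<in> lmeasurable" "V \<in> sets lebesgue"
 using V by (auto intro: lmeasurable_open fmeasurableD)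

lemma liquid: "open (liquid S)" "liquid S \<in> sets lebesgue" "liquid S \<inter> cball 0 R = {}" "liquid S \<union> cball 0 R = V"
proof -
 show "open (liquid S)" unfolding liquid_def using V by (intro open_Diff) auto
 then show "liquid S \<in> sets lebesgue" by auto
qed (use V in \<open>auto simp: liquid_def\<close>)

lemma finite_MV: "finite_measure MV"
 by (rule finite_measure_lebesgue_on[OF V_lmeasurable(1)])

lemma integral_split:
 fixes f :: "real^3 => 'b::euclidean_space"
 assumes f: "integrable MV f"
 shows "integrable Ml f" "integrable MB f" "(LINT x|MV. f x) = (LINT x|Ml. f x) + (LINT x|MB. f x)"
proof -
 have i: "integrable lebesgue (%x. indicator V x *\<^sub>R f x)"
 using f V_lmeasurable by (simp add: integrable_restrict_space)
 have i2: "integrable lebesgue (%x. indicator A x *\<^sub>R f x)" if "A \<subseteq> V" "A \<in> sets lebesgue" for A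
 proof -
 have "integrable lebesgue (%x. indicator A x *\<^sub>R (indicator V x *\<^sub>R f x))"
 by (rule integrable_mult_indicator[OF that(2) i])
 also have "(%x. indicator A x *\<^sub>R (indicator V x *\<^sub>R f x)) = (%x. indicator A x *\<^sub>R f x)"
 using that(1) by (auto simp: indicator_def fun_eq_iff)
 finally show ?thesis .
 qed
 have iL: "integrable lebesgue (%x. indicator (liquid S) x *\<^sub>R f x)"
 by (rule i2) (use liquid in auto)
 have iB: "integrable lebesgue (%x. indicator (cball 0 R) x *\<^sub>R f x)"
 by (rule i2) (use V in auto)
 show "integrable Ml f" "integrable MB f"
 using iL iB liquid by (simp_all add: integrable_restrict_space)
 have "(%x. indicator V x *\<^sub>R f x) = (%x. indicator (liquid S) x *\<^sub>R f x + indicator (cball 0 R) x *\<^sub>R f x)"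
 using liquid V by (auto simp: indicator_def fun_eq_iff)
 then show "(LINT x|MV. f x) = (LINT x|Ml. f x) + (LINT x|MB. f x)"
 using iL iB liquid V_lmeasurable by (simp add: integral_restrict_space)
qed

lemma sqint_split:
 assumes "sqint MV f" shows "sqint Ml f" "sqint MB f" "(l2 MV f)\<^sup>2 = (l2 Ml f)\<^sup>2 + (l2 MB f)\<^sup>2"
proof -
 note i = integral_split[OF sqintD(2)[OF assms]]
 have "f \<in> borel_measurable Ml" "f \<in> borel_measurable MB"
 using measurable_restrict_mono[OF sqintD(1)[OF assms]] V by (auto simp: liquid_def)
 then show "sqint Ml f" "sqint MB f" using i by (auto simp: sqint_def)
 show "(l2 MV f)\<^sup>2 = (l2 Ml f)\<^sup>2 + (l2 MB f)\<^sup>2" using i by (simp add: l2_power2)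
qed

lemma dens_ball: "x \<in> cball 0 R ==> dens x = ball_density"
 by (auto simp: density_tilde_def liquid_def)

lemma dens_liquid: "x \<in> liquid S ==> dens x = fluid_density S"
 by (auto simp: density_tilde_def)

definition dmax :: real where "dmax = max (fluid_density S) ball_density"
definition dmin :: real where "dmin = min (fluid_density S) ball_density"

lemma dens_bounds: "dmin <= dens x" "dens x <= dmax" "0 < dmin" "0 < dmax" "0 < dens x"
 using pos by (auto simp: dmin_def dmax_def density_tilde_def)

lemma measurable_dens [measurable]: "dens \<in> borel_measurable MV"
proof -
 have "dens = (%x. if x \<in> liquid S then fluid_density S else ball_density)"
 by (auto simp: density_tilde_def fun_eq_iff)
 moreover have "(%x. if x \<in> liquid S then fluid_density S else ball_density) \<in> borel_measurable MV"
 by (intro measurable_If_set) (use liquid V_lmeasurable in \<open>auto simp: sets_restrict_space_iff\<close>)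
 ultimately show ?thesis by simp
qed

lemma integrable_dens:
 fixes f :: "real^3 => real"
 assumes f: "integrable MV f"
 shows "integrable MV (%x. dens x * f x)"
proof (rule Bochner_Integration.integrable_bound[where f = "%x. dmax * f x"])
 show "AE x in MV. norm (dens x * f x) <= norm (dmax * f x)"
 proof (intro AE_I2)
 fix x
 have "\<bar>dens x\<bar> <= \<bar>dmax\<bar>" using dens_bounds(2)[of x] dens_bounds(4) dens_bounds(5)[of x] by simp
 then show "norm (dens x * f x) <= norm (dmax * f x)"
 using mult_right_mono[of "\<bar>dens x\<bar>" "\<bar>dmax\<bar>" "\<bar>f x\<bar>"] by (simp add: abs_mult)
 qed
qed (use f in auto)

lemma integral_dens_bound:
 fixes f g :: "real^3 => real"
 assumes f: "f \<in> borel_measurable MV" and g: "integrable MV g" and le: "!!x. \<bar>f x\<bar> <= g x"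
 shows "\<bar>\<integral>x. dens x * f x \<partial>MV\<bar> <= dmax * (LINT x|MV. g x)"
proof -
 have fi: "integrable MV f"
 by (rule Bochner_Integration.integrable_bound[OF g f]) (use le in \<open>auto intro!: AE_I2 intro: order_trans[OF _ abs_ge_self]\<close>)
 have "norm (LINT x|MV. dens x * f x) <= (LINT x|MV. norm (dens x * f x))"
 by (rule integral_norm_bound)
 also have "... <= (LINT x|MV. dmax * g x)"
 proof (rule integral_mono[OF integrable_norm[OF integrable_dens[OF fi]]])
 show "integrable MV (%x. dmax * g x)" using g by simp
 show "norm (dens x * f x) <= dmax * g x" for x
 using mult_mono[OF dens_bounds(2) le, of x x] dens_bounds(4) dens_bounds(5)[of x] by (simp add: abs_mult)
 qed
 finally show ?thesis by simp
qed

lemma inner2_integrable: "sqint MV u ==> sqint MV w ==> integrable MV (%x. dens x * (u x \<bullet> w x))"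
 by (intro integrable_dens integrable_inner)

lemma inner2_commute: "inner2 S u w = inner2 S w u"
 by (simp add: inner2_def inner_commute)

lemma inner2_add: "sqint MV u ==> sqint MV w ==> sqint MV z ==>
 inner2 S (%x. u x + w x) z = inner2 S u z + inner2 S w z"
 using inner2_integrable[of u z] inner2_integrable[of w z]
 by (simp add: inner2_def inner_add_left distrib_left)

lemma inner2_diff: "sqint MV u ==> sqint MV w ==> sqint MV z ==>
 inner2 S (%x. u x - w x) z = inner2 S u z - inner2 S w z"
 using inner2_integrable[of u z] inner2_integrable[of w z]
 by (simp add: inner2_def inner_diff_left right_diff_distrib)

lemma inner2_bound:
 assumes "sqint MV u" "sqint MV w" shows "\<bar>inner2 S u w\<bar> <= dmax * (l2 MV u * l2 MV w)"
proof -
 have "\<bar>inner2 S u w\<bar> <= dmax * (LINT x|MV. norm (u x) * norm (w x))"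
 unfolding inner2_def
 by (rule integral_dens_bound)
 (use assms in \<open>auto intro: integrable_norm_mult borel_measurable_integrable[OF integrable_inner] Cauchy_Schwarz_ineq2\<close>)
 also have "... <= dmax * (l2 MV u * l2 MV w)"
 using l2_cauchy_schwarz[OF assms] dens_bounds(4) by (intro mult_left_mono) auto
 finally show ?thesis .
qed

lemma inner2_self_ge: "sqint MV u ==> dmin * (l2 MV u)\<^sup>2 <= inner2 S u u"
proof -
 assume u: "sqint MV u"
 have "(LINT x|MV. dmin * (norm (u x))\<^sup>2) <= inner2 S u u"
 unfolding inner2_def power2_norm_eq_inner[symmetric]
 by (rule integral_mono) (use sqintD(2)[OF u] dens_bounds in \<open>auto intro: integrable_dens mult_right_mono\<close>)
 then show ?thesis by (simp add: l2_power2)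
qed

lemma inner2_self_nonneg: "0 <= inner2 S u u"
 unfolding inner2_def using less_imp_le[OF dens_bounds(5)]
 by (intro Bochner_Integration.integral_nonneg) auto

lemma norm2_power2: "(norm2 S u)\<^sup>2 = inner2 S u u"
 unfolding norm2_def using inner2_self_nonneg by simp

lemma inner2_split:
 assumes "sqint MV u" "sqint MV w"
 shows "inner2 S u w = fluid_density S * (LINT x|Ml. u x \<bullet> w x) + ball_density * (LINT x|MB. u x \<bullet> w x)"
proof -
 have "inner2 S u w = (LINT x|Ml. dens x * (u x \<bullet> w x)) + (LINT x|MB. dens x * (u x \<bullet> w x))"
 unfolding inner2_def by (rule integral_split(3)[OF inner2_integrable[OF assms]])
 also have "(LINT x|Ml. dens x * (u x \<bullet> w x)) = (LINT x|Ml. fluid_density S * (u x \<bullet> w x))"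
 by (intro Bochner_Integration.integral_cong) (auto simp: dens_liquid)
 also have "(LINT x|MB. dens x * (u x \<bullet> w x)) = (LINT x|MB. ball_density * (u x \<bullet> w x))"
 by (intro Bochner_Integration.integral_cong) (auto simp: dens_ball)
 finally show ?thesis by simp
qed

lemma linear_cross: "linear (cross3 beta)" "bounded_linear (cross3 beta)"
proof -
 show "linear (cross3 beta)" by (rule linearI) (auto simp: cross3_simps)
 then show "bounded_linear (cross3 beta)" by (simp add: linear_conv_bounded_linear)
qed

lemma sqint_continuous:
 fixes f :: "real^3 => 'b::euclidean_space"
 assumes "continuous_on UNIV f" shows "sqint MV f"
proof -
 obtain r where "ALL x:V. norm x <= r" using V(2) by (auto simp: bounded_iff)
 then have r: "V \<subseteq> cball 0 r" by auto
 have "integrable lborel (%x. indicator (cball 0 r) x *\<^sub>R (norm (f x))\<^sup>2)"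
 by (intro borel_integrable_compact compact_cball continuous_intros continuous_on_subset[OF assms]) auto
 then have "integrable lebesgue (%x. indicator (cball 0 r) x *\<^sub>R (norm (f x))\<^sup>2)"
 by (simp add: integrable_completion)
 from integrable_mult_indicator[OF V_lmeasurable(2) this]
 have "integrable lebesgue (%x. indicator V x *\<^sub>R (indicator (cball 0 r) x *\<^sub>R (norm (f x))\<^sup>2))" .
 also have "(%x. indicator V x *\<^sub>R (indicator (cball 0 r) x *\<^sub>R (norm (f x))\<^sup>2)) = (%x. indicator V x *\<^sub>R (norm (f x))\<^sup>2)"
 using r by (auto simp: indicator_def fun_eq_iff)
 finally have "integrable MV (%x. (norm (f x))\<^sup>2)" using V_lmeasurable by (simp add: integrable_restrict_space)
 moreover have "f \<in> borel_measurable MV"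
 by (rule continuous_imp_measurable_on_sets_lebesgue[OF continuous_on_subset[OF assms]]) (use V_lmeasurable in auto)
 ultimately show ?thesis by (simp add: sqint_def)
qed

lemma sqint_rot: "sqint MV (rot beta)"
 by (intro sqint_continuous linear_continuous_on linear_cross)

text \<open>Because of this identity the uniform density \<open>ball_density\<close> gives a rigid rotation the kinetic energy of
 the ball, so that both bodies fit into one inner product.\<close>

lemma integral_ball_rot: "(LINT x|MB. rot beta x \<bullet> rot \<gamma> x) = 8 / 15 * pi * R ^ 5 * (beta \<bullet> \<gamma>)"
proof -
 have "(LINT x|MB. rot beta x \<bullet> rot \<gamma> x) = (LINT x|MB. x \<bullet> - (cross3 beta (cross3 \<gamma> x)))"
 by (intro Bochner_Integration.integral_cong) (auto simp: cross3_simps)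
 also have "... = 4 / 15 * pi * R ^ 5 * (\<Sum>i\<in>UNIV. (- (cross3 beta (cross3 \<gamma> (axis i 1)))) $ i)"
 by (rule integral_cball_linear_form[OF pos(1)]) (rule linearI; auto simp: cross3_simps)
 also have "(\<Sum>i\<in>UNIV. (- (cross3 beta (cross3 \<gamma> (axis i 1)))) $ i) = 2 * (beta \<bullet> \<gamma>)"
 by (simp add: sum_3 cross3_simps axis_def)
 finally show ?thesis by simp
qed

lemma ball_density_moment: "ball_density * (8 / 15 * pi * R ^ 5) = lam"
 using pos(1) by (simp add: field_simps)

lemma inertia_tensor_inner:
 assumes "!!i j. integrable M (%x. cross3 x (axis i 1) \<bullet> cross3 x (axis j 1))"
 shows "beta \<bullet> (inertia_tensor M *v \<gamma>) = (LINT x|M. cross3 x beta \<bullet> cross3 x \<gamma>)"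
proof -
 have e: "cross3 x beta \<bullet> cross3 x \<gamma> = (\<Sum>i\<in>UNIV. \<Sum>j\<in>UNIV. beta $ i * (cross3 x (axis i 1) \<bullet> cross3 x (axis j 1) * \<gamma> $ j))" for x
 by (simp add: sum_3 cross3_simps axis_def)
 show ?thesis
 unfolding e using assms
 by (simp add: inner_vec_def matrix_vector_mult_def inertia_tensor_def sum_distrib_left)
qed

lemma inertia_L_inner: "beta \<bullet> (inertia_L S *v \<gamma>) = fluid_density S * (LINT x|Ml. rot beta x \<bullet> rot \<gamma> x)"
proof -
 have "beta \<bullet> (inertia_tensor Ml *v \<gamma>) = (LINT x|Ml. cross3 x beta \<bullet> cross3 x \<gamma>)"
 proof (rule inertia_tensor_inner)
 fix i j
 have "integrable Ml (%x. rot (axis i 1) x \<bullet> rot (axis j 1) x)"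
 by (intro integral_split integrable_inner sqint_rot)
 then show "integrable Ml (%x. cross3 x (axis i 1) \<bullet> cross3 x (axis j 1))"
 by (simp add: cross_skew[of _ "axis _ 1"])
 qed
 then show ?thesis
 by (simp add: inertia_L_def scaleR_matrix_vector_assoc[symmetric] cross_skew[of _ beta] cross_skew[of _ \<gamma>])
qed

lemma inner2_rot: "inner2 S (rot beta) (rot \<gamma>) = beta \<bullet> (inertia_L S *v \<gamma>) + lam * (beta \<bullet> \<gamma>)"
proof -
 have "ball_density * (8 / 15 * pi * R ^ 5 * (beta \<bullet> \<gamma>)) = lam * (beta \<bullet> \<gamma>)"
 using arg_cong[OF ball_density_moment, of "%z. z * (beta \<bullet> \<gamma>)"] by (simp only: mult.assoc)
 then show ?thesis
 unfolding inner2_split[OF sqint_rot sqint_rot] inertia_L_inner integral_ball_rot by (simp only:)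
qed

lemma J_inner: "beta \<bullet> (J *v \<gamma>) = inner2 S (rot beta) (rot \<gamma>) + beta \<bullet> (inertia_B S *v \<gamma>)"
 unfolding inner2_rot total_inertia_def
 by (simp add: matrix_vector_mult_add_rdistrib inner_add_right scaleR_matrix_vector_assoc[symmetric] algebra_simps)

lemma inertia_B_sym: "beta \<bullet> (inertia_B S *v \<gamma>) = \<gamma> \<bullet> (inertia_B S *v beta)"
proof -
 have "inertia_B S $ i $ j = inertia_B S $ j $ i" for i j
 by (simp add: inertia_B_def inertia_tensor_def inner_commute)
 then show ?thesis
 by (simp add: inner_vec_def matrix_vector_mult_def sum_3 algebra_simps)
qed

lemma J_sym: "beta \<bullet> (J *v \<gamma>) = \<gamma> \<bullet> (J *v beta)"
 unfolding J_inner using inertia_B_sym[of beta \<gamma>] inner2_commute[of "rot beta" "rot \<gamma>"] by simp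

lemma inertia_B_pos: "\<exists>c>0. ALL beta. c * (norm beta)\<^sup>2 <= beta \<bullet> (inertia_B S *v beta)"
proof -
 let ?f = "%beta. beta \<bullet> (inertia_B S *v beta)"
 have "EX x:sphere (0::real^3) 1. ALL y:sphere 0 1. ?f x <= ?f y"
 proof (rule continuous_attains_inf)
 show "sphere (0::real^3) 1 ~= {}" using norm_axis_1[of 1] by (auto simp: sphere_def dist_norm intro!: exI[of _ "axis 1 1"])
 show "continuous_on (sphere 0 1) ?f"
 by (intro continuous_intros)
 qed auto
 then obtain x where x: "norm x = 1" "!!y. norm y = 1 ==> ?f x <= ?f y" by auto
 have "x ~= 0" using x by auto
 then have "0 < ?f x" using adm by (auto simp: admissible_def)
 moreover have "?f x * (norm beta)\<^sup>2 <= ?f beta" for beta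
 proof (cases "beta = 0")
 case False
 let ?y = "inverse (norm beta) *\<^sub>R beta"
 have "?f x <= ?f ?y" using False by (intro x) simp
 also have "?f ?y = (inverse (norm beta))\<^sup>2 * ?f beta"
 by (simp add: matrix_vector_mult_scaleR power2_eq_square)
 finally show ?thesis using False by (simp add: field_simps power_inverse)
 qed simp
 ultimately show ?thesis by blast
qed

lemma J_lower: "lam * (norm beta)\<^sup>2 <= beta \<bullet> (J *v beta)"
proof -
 have "0 <= fluid_density S * (LINT x|Ml. rot beta x \<bullet> rot beta x)"
 using pos by (intro mult_nonneg_nonneg Bochner_Integration.integral_nonneg) auto
 then have "0 <= beta \<bullet> (inertia_L S *v beta)" by (simp add: inertia_L_inner)
 moreover have "0 <= beta \<bullet> (inertia_B S *v beta)" using inertia_B_pos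
 by (meson less_imp_le mult_nonneg_nonneg order_trans zero_le_power2)
 ultimately show ?thesis unfolding J_inner inner2_rot by (simp add: power2_norm_eq_inner)
qed

lemma J_bound: "\<exists>C>0. ALL beta. norm (J *v beta) <= C * norm beta"
proof -
 obtain C where C: "C > 0" "!!beta. norm (J *v beta) <= norm beta * C"
 using bounded_linear.pos_bounded[OF matrix_vector_mul_bounded_linear[of J]] by blast
 then show ?thesis by (intro exI[of _ C]) (auto simp: mult.commute)
qed

lemma J_inverse: "J *v (matrix_inv J *v x) = x"
proof -
 have "invertible J"
 unfolding invertible_left_inverse matrix_left_invertible_ker
 proof (intro allI impI)
 fix x assume "J *v x = 0"
 then have "lam * (norm x)\<^sup>2 <= 0" using J_lower[of x] by simp
 then show "x = 0" using pos by (simp add: mult_le_0_iff)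
 qed
 then have "J ** matrix_inv J = mat 1" unfolding invertible_def matrix_inv_def by (metis (mono_tags, lifting) someI_ex)
 then show ?thesis by (simp add: matrix_vector_mul_assoc)
qed

lemma integrable_angular:
 assumes w: "sqint MV w" shows "integrable MV (%x. dens x *\<^sub>R cross3 x (w x))"
proof -
 have "integrable MV (%x. (dens x *\<^sub>R cross3 x (w x)) \<bullet> axis i 1)" for i
 proof -
 have "integrable MV (%x. dens x * (rot (axis i 1) x \<bullet> w x))"
 by (rule inner2_integrable[OF sqint_rot w])
 also have "(%x. dens x * (rot (axis i 1) x \<bullet> w x)) = (%x. (dens x *\<^sub>R cross3 x (w x)) \<bullet> axis i 1)"
 by (auto simp: fun_eq_iff cross3_simps axis_def)
 finally show ?thesis .
 qed
 then have "integrable MV (%x. (dens x *\<^sub>R cross3 x (w x)) \<bullet> e)" if "e \<in> Basis" for e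
 using that by (auto simp: Basis_vec_def)
 then have "integrable MV (%x. \<Sum>e\<in>Basis. ((dens x *\<^sub>R cross3 x (w x)) \<bullet> e) *\<^sub>R e)"
 by (intro Bochner_Integration.integrable_sum integrable_scaleR_left)
 then show ?thesis by (simp only: euclidean_representation)
qed

lemma J_b_vec: "sqint MV w ==> beta \<bullet> (J *v b_vec S w) = - inner2 S (rot beta) w"
proof -
 assume w: "sqint MV w"
 have "J *v b_vec S w = - (LINT x|MV. dens x *\<^sub>R cross3 x (w x))"
 using linear_neg[OF matrix_vector_mul_linear[of J]] by (simp add: b_vec_def J_inverse)
 then have "beta \<bullet> (J *v b_vec S w) = - (LINT x|MV. beta \<bullet> (dens x *\<^sub>R cross3 x (w x)))"
 using integral_inner_right[OF integrable_angular[OF w], of beta] by simp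
 also have "(LINT x|MV. beta \<bullet> (dens x *\<^sub>R cross3 x (w x))) = inner2 S (rot beta) w"
 unfolding inner2_def by (intro Bochner_Integration.integral_cong) (auto simp: cross3_simps)
 finally show ?thesis .
qed

lemma b_vec_diff: "sqint MV u ==> sqint MV w ==> b_vec S (%x. u x - w x) = b_vec S u - b_vec S w"
proof -
 assume u: "sqint MV u" and w: "sqint MV w"
 have "(%x. dens x *\<^sub>R cross3 x (u x - w x)) = (%x. dens x *\<^sub>R cross3 x (u x) - dens x *\<^sub>R cross3 x (w x))"
 by (auto simp: fun_eq_iff cross3_simps)
 then show ?thesis
 unfolding b_vec_def using integrable_angular[OF u] integrable_angular[OF w]
 by (simp add: matrix_vector_mult_diff_distrib)
qed

lemma inner_B_commute: "inner_B S u w = inner_B S w u"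
 using J_sym[of "b_vec S u" "b_vec S w"] inner2_commute[of u w] by (simp add: inner_B_def)

lemma inner_B_diff: "sqint MV u ==> sqint MV w ==> sqint MV z ==>
 inner_B S (%x. u x - w x) z = inner_B S u z - inner_B S w z"
 by (simp add: inner_B_def inner2_diff b_vec_diff inner_diff_left)

lemma energy_eq: "energy S w = inner_B S w w"
 by (simp add: energy_def inner_B_def norm2_power2)

lemma b_vec_bound: "\<exists>C>0. ALL w. sqint MV w --> norm (b_vec S w) <= C * l2 MV w"
proof -
 obtain K where K: "!!beta. l2 MV (rot beta) <= K * norm beta" "0 < K"
 proof -
 obtain r where r: "r > 0" "ALL x:V. norm x <= r" using V(2) unfolding bounded_pos by blast
 have "l2 MV (rot beta) <= (r * l2 MV (%x. 1 :: real) + 1) * norm beta" for beta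
 proof -
 have "l2 MV (rot beta) <= l2 MV (%x. (r * norm beta) *\<^sub>R (1::real))"
 proof (rule l2_mono[OF sqint_rot sqint_continuous])
 show "AE x in MV. norm (rot beta x) <= norm ((r * norm beta) *\<^sub>R (1::real))"
 proof (intro AE_I2)
 fix x assume "x \<in> space MV"
 then have "norm x <= r" using r by auto
 have "(norm (rot beta x))\<^sup>2 <= (norm beta * norm x)\<^sup>2"
 using norm_cross_dot[of beta x] by (metis le_add_same_cancel1 zero_le_power2)
 then have "norm (rot beta x) <= norm beta * norm x" by (rule power2_le_imp_le) simp
 also have "... <= norm beta * r" using \<open>norm x <= r\<close> by (intro mult_left_mono) auto
 finally show "norm (rot beta x) <= norm ((r * norm beta) *\<^sub>R (1::real))"
 using r by (simp add: mult.commute)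
 qed
 qed (intro continuous_intros)
 also have "... = r * norm beta * l2 MV (%x. 1 :: real)" using r by (subst l2_scaleR) simp
 also have "... <= (r * l2 MV (%x. 1 :: real) + 1) * norm beta"
 by (simp add: algebra_simps)
 finally show ?thesis .
 qed
 moreover have "0 < r * l2 MV (%x. 1 :: real) + 1" using r by (intro add_nonneg_pos) auto
 ultimately show ?thesis by (rule that)
 qed
 have "norm (b_vec S w) <= (dmax * K / lam) * l2 MV w" if w: "sqint MV w" for w
 proof (cases "b_vec S w = 0")
 case False
 let ?b = "b_vec S w"
 have "lam * (norm ?b)\<^sup>2 <= - inner2 S (rot ?b) w"
 using J_lower[of ?b] J_b_vec[OF w, of ?b] by simp
 also have "... <= dmax * (l2 MV (rot ?b) * l2 MV w)"
 using inner2_bound[OF sqint_rot w, of ?b] by simp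
 also have "... <= dmax * (K * norm ?b * l2 MV w)"
 using K dens_bounds(4) by (intro mult_left_mono mult_right_mono) auto
 finally have "norm ?b * (lam * norm ?b) <= norm ?b * (dmax * K * l2 MV w)"
 by (simp add: power2_eq_square mult_ac)
 then have "lam * norm ?b <= dmax * K * l2 MV w" using False by simp
 then show ?thesis using pos by (simp add: field_simps)
 qed (use K dens_bounds pos in auto)
 moreover have "0 < dmax * K / lam" using K dens_bounds pos by auto
 ultimately show ?thesis by blast
qed

text \<open>Coercivity: the inertia of the outer body makes the energy dominate the square of the norm.\<close>

lemma energy_coercive: "\<exists>c>0. ALL w. sqint MV w --> c * (l2 MV w)\<^sup>2 <= energy S w"
proof -
 obtain cB where cB: "0 < cB" "!!beta. cB * (norm beta)\<^sup>2 <= beta \<bullet> (inertia_B S *v beta)" using inertia_B_pos by blast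
 obtain CJ where CJ: "0 < CJ" "!!beta. norm (J *v beta) <= CJ * norm beta" using J_bound by blast
 define theta where "theta = cB / CJ"
 have theta: "0 < theta" using cB CJ by (simp add: theta_def)
 have JC: "beta \<bullet> (J *v beta) <= CJ * (norm beta)\<^sup>2" for beta
 proof -
 have "beta \<bullet> (J *v beta) <= norm beta * norm (J *v beta)" by (rule norm_cauchy_schwarz)
 also have "... <= norm beta * (CJ * norm beta)" by (intro mult_left_mono CJ) auto
 finally show ?thesis by (simp add: power2_eq_square mult_ac)
 qed
 have main: "theta * inner2 S w w <= (1 + theta) * energy S w" if w: "sqint MV w" for w
 proof -
 let ?b = "b_vec S w"
 define a where "a = ?b \<bullet> (J *v ?b)"
 have a0: "0 <= a" using J_lower[of ?b] pos by (simp add: a_def order_trans[rotated])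
 have rb: "inner2 S (rot ?b) (rot ?b) <= (1 - theta) * a"
 proof -
 have "theta * a <= theta * (CJ * (norm ?b)\<^sup>2)" unfolding a_def using JC theta by (intro mult_left_mono) auto
 also have "... = cB * (norm ?b)\<^sup>2" using CJ by (simp add: theta_def)
 also have "... <= ?b \<bullet> (inertia_B S *v ?b)" by (rule cB)
 finally show ?thesis using J_inner[of ?b ?b] by (simp add: a_def algebra_simps)
 qed
 have e: "energy S w = inner2 S w w - a" by (simp add: energy_def norm2_power2 a_def)
 have am: "a = - inner2 S (rot ?b) w" using J_b_vec[OF w] by (simp add: a_def)
 \<comment> \<open>expand the square of \<open>w + rot b\<close>\<close>
 have "0 <= inner2 S (%x. w x + rot ?b x) (%x. w x + rot ?b x)" by (rule inner2_self_nonneg)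
 also have "... = inner2 S w w - 2 * a + inner2 S (rot ?b) (rot ?b)"
 using w sqint_rot[of ?b] sqint_add[OF w sqint_rot[of ?b]] am
 inner2_commute[of w "%x. w x + rot ?b x"] inner2_commute[of "rot ?b" "%x. w x + rot ?b x"] inner2_commute[of w "rot ?b"]
 by (simp add: inner2_add)
 finally have "0 <= inner2 S w w - 2 * a + (1 - theta) * a" using rb by linarith
 then have *: "(1 + theta) * a <= inner2 S w w" by (simp add: algebra_simps)
 then show ?thesis by (simp add: e algebra_simps)
 qed
 have "theta * dmin / (1 + theta) * (l2 MV w)\<^sup>2 <= energy S w" if w: "sqint MV w" for w
 proof -
 have "theta * (dmin * (l2 MV w)\<^sup>2) <= theta * inner2 S w w"
 using inner2_self_ge[OF w] theta by (intro mult_left_mono) auto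
 also have "... <= (1 + theta) * energy S w" by (rule main[OF w])
 finally show ?thesis using theta by (simp add: pos_divide_le_eq mult_ac)
 qed
 moreover have "0 < theta * dmin / (1 + theta)" using theta dens_bounds by simp
 ultimately show ?thesis by blast
qed

end

section \<open>Test fields\<close>

lemma axis_Basis: "axis i 1 \<in> (Basis :: (real^3) set)"
 by (simp add: axis_in_Basis_iff)

lemma norm_matrix_power2: "(norm (A :: real^3^3))\<^sup>2 = (\<Sum>i\<in>UNIV. \<Sum>j\<in>UNIV. (A $ i $ j)\<^sup>2)"
 unfolding power2_norm_eq_inner by (simp add: inner_vec_def power2_eq_square)

lemma norm_vec3_power2: "(norm (x :: real^3))\<^sup>2 = (\<Sum>i\<in>UNIV. (x $ i)\<^sup>2)"
 unfolding power2_norm_eq_inner by (simp add: inner_vec_def power2_eq_square)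

text \<open>The symmetric part of a matrix.\<close>

definition msym :: "real^3^3 => real^3^3" where
 "msym A = (1/2) *\<^sub>R (A + transpose A)"

lemma msym_nth: "msym A $ i $ j = (A $ i $ j + A $ j $ i) / 2"
 by (simp add: msym_def transpose_def)

lemma bounded_linear_msym: "bounded_linear msym"
proof -
 have "linear msym"
 by (rule linearI) (auto simp: vec_eq_iff msym_nth algebra_simps add_divide_distrib)
 then show ?thesis by (simp add: linear_conv_bounded_linear)
qed

lemma msym_diff: "msym (A - B) = msym A - msym B"
 using bounded_linear_msym by (rule bounded_linear.linear[THEN linear_diff])

lemma norm_msym_power2: "2 * (norm (msym A))\<^sup>2 = (norm A)\<^sup>2 + (\<Sum>i\<in>UNIV. \<Sum>j\<in>UNIV. A $ i $ j * A $ j $ i)"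
 unfolding norm_matrix_power2 msym_nth by (simp add: sum_3 power2_eq_square field_simps)

context gap
begin

lemma D_R_D:
 assumes "u \<in> D_R S"
 shows "test_function V u" "test_function UNIV u" "smooth u" "(\<Sum>i\<in>UNIV. pd (axis i 1) u x $ i) = 0"
 "EX omega U. open U & cball 0 R \<subseteq> U & (ALL x:U. u x = cross3 omega x)"
proof -
 show t: "test_function V u" using assms by (simp add: D_R_def)
 show "test_function UNIV u" using t by (rule test_function_UNIV)
 show "smooth u" using t by (rule test_function_smooth)
 have "trace (jacobian u (at x)) = 0" using assms by (simp add: D_R_def)
 then show "(\<Sum>i\<in>UNIV. pd (axis i 1) u x $ i) = 0"
 by (simp add: trace_def jacobian_def matrix_def pd_def)
 show "EX omega U. open U & cball 0 R \<subseteq> U & (ALL x:U. u x = cross3 omega x)"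
 using assms by (simp add: D_R_def)
qed

lemma D_R_diff:
 assumes "u \<in> D_R S" "w \<in> D_R S" shows "(%x. u x - w x) \<in> D_R S"
proof -
 obtain omega U where U: "open U" "cball 0 R \<subseteq> U" "ALL x:U. u x = cross3 omega x" using D_R_D(5)[OF assms(1)] by blast
 obtain omega' U' where U': "open U'" "cball 0 R \<subseteq> U'" "ALL x:U'. w x = cross3 omega' x" using D_R_D(5)[OF assms(2)] by blast
 have "trace (jacobian (%x. u x - w x) (at x)) = 0" for x
 proof -
 have "trace (jacobian (%x. u x - w x) (at x)) = (\<Sum>i\<in>UNIV. pd (axis i 1) (%x. u x - w x) x $ i)"
 by (simp add: trace_def jacobian_def matrix_def pd_def)
 also have "... = 0"
 using D_R_D(4)[OF assms(1), of x] D_R_D(4)[OF assms(2), of x]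
 by (simp add: pd_diff[OF D_R_D(3)[OF assms(1)] D_R_D(3)[OF assms(2)]] sum_subtractf)
 finally show ?thesis .
 qed
 moreover have "EX omega U. open U & cball 0 R \<subseteq> U & (ALL x:U. u x - w x = cross3 omega x)"
 by (rule exI[of _ "omega - omega'"], rule exI[of _ "U \<inter> U'"]) (use U U' in \<open>auto simp: cross3_simps\<close>)
 ultimately show ?thesis
 using test_function_diff[OF D_R_D(1)[OF assms(1)] D_R_D(1)[OF assms(2)]] by (simp add: D_R_def)
qed

abbreviation Gd :: "field3 => real^3 => real^3^3" where "Gd \<equiv> weak_gradient V"
abbreviation Dd :: "field3 => real^3 => real^3^3" where "Dd \<equiv> sym_gradient V"

lemma Dd_eq: "Dd u = (%x. msym (Gd u x))"
 by (auto simp: sym_gradient_def msym_def)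

lemma Gd_is_weak_gradient: "is_weak_gradient V u G ==> is_weak_gradient V u (Gd u)"
 using someI[of "is_weak_gradient V u" G] unfolding weak_gradient_def by blast

lemma AE_Gd_eq: "is_weak_gradient V u G ==> AE x in MV. Gd u x = G x"
 using weak_gradient_unique[OF V(1) Gd_is_weak_gradient] by blast

lemma Gd_test: "u \<in> D_R S ==> AE x in MV. Gd u x = grad u x"
 by (intro AE_Gd_eq is_weak_gradient_grad V D_R_D(2))

lemma sqint_cong_AE_MV:
 fixes f g :: "real^3 => 'b::euclidean_space"
 assumes "sqint MV f" "AE x in MV. g x = f x"
 shows "sqint MV g" "l2 MV g = l2 MV f"
proof -
 have ae: "AE x in MV. f x = g x" using assms(2) by eventually_elim simp
 have m: "g \<in> borel_measurable MV"
 by (rule borel_measurable_lebesgue_on_AE[OF V_lmeasurable(2) sqintD(1)[OF assms(1)] ae])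
 show "sqint MV g" by (rule sqint_cong_AE[OF assms(1) m ae])
 show "l2 MV g = l2 MV f" by (rule l2_cong_AE[OF m sqintD(1)[OF assms(1)] assms(2)])
qed

lemma test_integral_eq_lborel:
 fixes f :: "real^3 => real"
 assumes "continuous_on UNIV f" "!!x. x ~: V ==> f x = 0"
 shows "(LINT x|MV. f x) = (LINT x|lborel. f x)"
 by (rule lebesgue_on_integral_eq_lborel(1)[OF V_lmeasurable(2) borel_measurable_continuous_onI[OF assms(1)] assms(2)])

lemma D_R_component:
 assumes "u \<in> D_R S"
 shows "test_function V (%x. u x $ i)" "test_function UNIV (%x. u x $ i)"
 "x ~: V ==> u x = 0" "x ~: V ==> grad u x = 0"
proof -
 show "test_function V (%x. u x $ i)"
 by (rule test_function_linear_image[OF bounded_linear_vec_nth D_R_D(1)[OF assms]])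
 then show "test_function UNIV (%x. u x $ i)" by (rule test_function_UNIV)
 show "u x = 0" if "x ~: V" using D_R_D(1)[OF assms] that by (auto elim!: test_functionE)
 show "grad u x = 0" if "x ~: V"
 proof -
 have "pd (axis j 1) u x = 0" for j
 using test_function_pd[OF D_R_D(1)[OF assms] axis_Basis, of j] that by (auto elim!: test_functionE)
 then show ?thesis by (simp add: grad_def vec_eq_iff)
 qed
qed

lemma grad_component: "u \<in> D_R S ==> grad u x $ i $ j = pd (axis j 1) (%x. u x $ i) x"
 by (rule grad_nth[OF D_R_D(3)])

lemma sqint_grad: "u \<in> D_R S ==> sqint MV (grad u)"
 by (intro sqint_continuous continuous_grad D_R_D)

lemma sqint_D_R: "u \<in> D_R S ==> sqint MV u"
 by (intro sqint_continuous smooth_continuous D_R_D)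

lemma integrable_pd_mult:
 assumes "u \<in> D_R S"
 shows "integrable lborel (%x. pd (axis j 1) (%x. u x $ i) x * pd (axis k 1) (%x. u x $ l) x)"
 by (intro test_function_integrable[OF test_function_pd[OF D_R_component(2)[OF assms] axis_Basis]]
 smooth_continuous smooth_pd test_function_smooth[OF D_R_component(2)[OF assms]] axis_Basis)

text \<open>For divergence-free fields the mixed products \<open>\<partial>\<^sub>i u\<^sub>j \<partial>\<^sub>j u\<^sub>i\<close> integrate to zero, hence the
 symmetric gradient carries exactly half of the squared norm of the gradient.\<close>

lemma korn_test:
 assumes u: "u \<in> D_R S"
 shows "(l2 MV (Gd u))\<^sup>2 = 2 * (l2 MV (Dd u))\<^sup>2"
proof -
 let ?p = "%i j x. pd (axis j 1) (%x. u x $ i) x"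
 have D: "AE x in MV. Dd u x = msym (grad u x)"
 using Gd_test[OF u] by eventually_elim (simp add: Dd_eq)
 have sg: "sqint MV (%x. msym (grad u x))" by (rule sqint_linear_image[OF bounded_linear_msym sqint_grad[OF u]])
 have cross: "(LINT x|MV. (\<Sum>i\<in>UNIV. \<Sum>j\<in>UNIV. grad u x $ i $ j * grad u x $ j $ i)) = 0"
 proof -
 have "(LINT x|MV. (\<Sum>i\<in>UNIV. \<Sum>j\<in>UNIV. grad u x $ i $ j * grad u x $ j $ i))
 = (LINT x|lborel. (\<Sum>i\<in>UNIV. \<Sum>j\<in>UNIV. grad u x $ i $ j * grad u x $ j $ i))"
 by (rule test_integral_eq_lborel)
 (use D_R_component(4)[OF u] in \<open>auto intro!: continuous_intros bounded_linear.continuous_on[OF bounded_linear_vec_nth] continuous_grad D_R_D[OF u]\<close>)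
 also have "... = (\<Sum>i\<in>UNIV. \<Sum>j\<in>UNIV. \<integral>x. ?p i j x * ?p j i x \<partial>lborel)"
 by (simp add: grad_component[OF u] integrable_pd_mult[OF u])
 also have "... = (\<Sum>i\<in>UNIV. \<Sum>j\<in>UNIV. \<integral>x. ?p i i x * ?p j j x \<partial>lborel)"
 by (intro sum.cong refl integral_pd_commute D_R_component(2)[OF u] axis_Basis)
 also have "... = (LINT x|lborel. (\<Sum>i\<in>UNIV. \<Sum>j\<in>UNIV. ?p i i x * ?p j j x))"
 by (simp add: integrable_pd_mult[OF u])
 also have "... = (LINT x|lborel. (\<Sum>i\<in>UNIV. ?p i i x) * (\<Sum>j\<in>UNIV. ?p j j x))"
 by (simp add: sum_product)
 also have "... = 0"
 using D_R_D(4)[OF u] by (simp add: grad_component[OF u, symmetric] grad_def)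
 finally show ?thesis .
 qed
 have sq: "integrable MV (%x. (norm (grad u x))\<^sup>2)" using sqint_grad[OF u] by (rule sqintD)
 have cr: "integrable MV (%x. \<Sum>i\<in>UNIV. \<Sum>j\<in>UNIV. grad u x $ i $ j * grad u x $ j $ i)"
 proof -
 have "integrable MV (%x. 2 * (norm (msym (grad u x)))\<^sup>2 - (norm (grad u x))\<^sup>2)"
 using sq sqintD(2)[OF sg] by auto
 then show ?thesis by (simp add: norm_msym_power2)
 qed
 have "2 * (l2 MV (Dd u))\<^sup>2 = 2 * (l2 MV (%x. msym (grad u x)))\<^sup>2"
 using sqint_cong_AE_MV(2)[OF sg D] by simp
 also have "... = (LINT x|MV. 2 * (norm (msym (grad u x)))\<^sup>2)" by (simp add: l2_power2)
 also have "... = (LINT x|MV. (norm (grad u x))\<^sup>2)"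
 unfolding norm_msym_power2 using sq cr cross by simp
 also have "... = (l2 MV (Gd u))\<^sup>2"
 using sqint_cong_AE_MV(2)[OF sqint_grad[OF u] Gd_test[OF u]] by (simp add: l2_power2)
 finally show ?thesis by simp
qed

lemma power6_sum_le: "(norm (x::real^3)) ^ 6 <= 9 * (\<Sum>i\<in>UNIV. (x $ i) ^ 6)"
proof -
 have cubes: "(a + b + c) ^ 3 <= 9 * (a ^ 3 + b ^ 3 + c ^ 3)" if "0 <= a" "0 <= b" "0 <= c" for a b c :: real
 proof -
 have two: "(s + t) * (s - t)\<^sup>2 \<ge> 0" if "0 <= s" "0 <= t" for s t :: real using that by simp
 have "9 * (a ^ 3 + b ^ 3 + c ^ 3) - (a + b + c) ^ 3 = 3 * ((a + b) * (a - b)\<^sup>2 + (b + c) * (b - c)\<^sup>2 + (a + c) * (a - c)\<^sup>2) + (a + b + c) * ((a - b)\<^sup>2 + (b - c)\<^sup>2 + (a - c)\<^sup>2)"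
 by (simp add: power3_eq_cube power2_eq_square algebra_simps)
 moreover have "0 <= (a + b + c) * ((a - b)\<^sup>2 + (b - c)\<^sup>2 + (a - c)\<^sup>2)" using that by (intro mult_nonneg_nonneg) auto
 moreover have "0 <= 3 * ((a + b) * (a - b)\<^sup>2 + (b + c) * (b - c)\<^sup>2 + (a + c) * (a - c)\<^sup>2)"
 by (intro mult_nonneg_nonneg add_nonneg_nonneg) (use that in auto)
 ultimately have "0 <= 9 * (a ^ 3 + b ^ 3 + c ^ 3) - (a + b + c) ^ 3" by (simp only: add_nonneg_nonneg)
 then show ?thesis by simp
 qed
 have "(norm x) ^ 6 = ((norm x)\<^sup>2) ^ 3" by (simp flip: power_mult)
 also have "... = ((x $ 1)\<^sup>2 + (x $ 2)\<^sup>2 + (x $ 3)\<^sup>2) ^ 3" by (simp add: norm_vec3_power2 sum_3)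
 also have "... <= 9 * (((x $ 1)\<^sup>2) ^ 3 + ((x $ 2)\<^sup>2) ^ 3 + ((x $ 3)\<^sup>2) ^ 3)" by (rule cubes) auto
 also have "... = 9 * (\<Sum>i\<in>UNIV. (x $ i) ^ 6)" by (simp add: sum_3 flip: power_mult)
 finally show ?thesis .
qed

lemma sobolev_test:
 assumes u: "u \<in> D_R S"
 shows "integrable MV (%x. (norm (u x)) ^ 6)" "(LINT x|MV. (norm (u x)) ^ 6) <= 110592 * (l2 MV (Gd u)) ^ 6"
proof -
 have cu: "continuous_on UNIV u" by (intro smooth_continuous D_R_D u)
 have int: "integrable MV f" if "continuous_on UNIV f" for f :: "real^3 => real"
 using integrable_norm_mult[OF sqint_continuous[OF that] sqint_continuous[of "%_. 1::real"]] sqintD(1)[OF sqint_continuous[OF that]]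
 by (simp add: integrable_norm_iff integrable_abs_iff)
 show "integrable MV (%x. (norm (u x)) ^ 6)" by (intro int continuous_intros cu)
 have ci: "continuous_on UNIV (%x. (u x $ i) ^ 6)" for i
 by (intro continuous_intros bounded_linear.continuous_on[OF bounded_linear_vec_nth] cu)
 define E where "E = (l2 MV (Gd u))\<^sup>2"
 have E: "E = (LINT x|MV. (norm (grad u x))\<^sup>2)"
 using sqint_cong_AE_MV(2)[OF sqint_grad[OF u] Gd_test[OF u]] by (simp add: E_def l2_power2)
 have one: "(LINT x|lborel. (pd (axis j 1) (%x. u x $ i) x)\<^sup>2) <= E" for i j
 proof -
 have "(LINT x|lborel. (pd (axis j 1) (%x. u x $ i) x)\<^sup>2) = (LINT x|MV. (grad u x $ i $ j)\<^sup>2)"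
 unfolding grad_component[OF u, symmetric]
 by (rule test_integral_eq_lborel[symmetric])
 (use D_R_component(4)[OF u] in \<open>auto intro!: continuous_intros bounded_linear.continuous_on[OF bounded_linear_vec_nth] continuous_grad D_R_D[OF u]\<close>)
 also have "... <= E" unfolding E
 proof (rule integral_mono)
 show "integrable MV (%x. (grad u x $ i $ j)\<^sup>2)"
 by (intro int continuous_intros bounded_linear.continuous_on[OF bounded_linear_vec_nth] continuous_grad D_R_D[OF u])
 show "integrable MV (%x. (norm (grad u x))\<^sup>2)" using sqint_grad[OF u] by (rule sqintD)
 show "(grad u x $ i $ j)\<^sup>2 <= (norm (grad u x))\<^sup>2" for x
 proof -
 have "\<bar>grad u x $ i $ j\<bar> <= norm (grad u x)"
 using component_le_norm_cart[of "grad u x $ i" j] Finite_Cartesian_Product.norm_nth_le[of "grad u x" i] by linarith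
 then show ?thesis by (metis abs_le_square_iff abs_norm_cancel)
 qed
 qed
 finally show ?thesis .
 qed
 have six: "(LINT x|MV. (u x $ i) ^ 6) <= 4096 * E ^ 3" for i
 proof -
 have "(LINT x|MV. (u x $ i) ^ 6) = (LINT x|lborel. (u x $ i) ^ 6)"
 by (rule test_integral_eq_lborel[OF ci]) (simp add: D_R_component(3)[OF u])
 also have "... <= 4096 * (\<Prod>j\<in>UNIV. \<integral>x. (pd (axis j 1) (%x. u x $ i) x)\<^sup>2 \<partial>lborel)"
 by (rule sobolev_L6[OF D_R_component(2)[OF u]])
 also have "... <= 4096 * (\<Prod>j\<in>(UNIV::3 set). E)"
 by (intro mult_left_mono prod_mono) (use one in auto)
 also have "... = 4096 * E ^ 3" by simp
 finally show ?thesis .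
 qed
 have "(LINT x|MV. (norm (u x)) ^ 6) <= (LINT x|MV. 9 * (\<Sum>i\<in>UNIV. (u x $ i) ^ 6))"
 by (intro integral_mono power6_sum_le int continuous_intros ci cu)
 also have "... = 9 * (\<Sum>i\<in>UNIV. \<integral>x. (u x $ i) ^ 6 \<partial>MV)"
 using int[OF ci] by simp
 also have "... <= 9 * (\<Sum>i\<in>(UNIV::3 set). 4096 * E ^ 3)"
 by (intro mult_left_mono sum_mono six) auto
 also have "... = 110592 * (l2 MV (Gd u)) ^ 6" by (simp add: E_def flip: power_mult)
 finally show "(LINT x|MV. (norm (u x)) ^ 6) <= 110592 * (l2 MV (Gd u)) ^ 6" .
qed

lemma grad_ball:
 assumes "open U" "ALL x:U. u x = cross3 omega x" "x \<in> U"
 shows "grad u x *v y = cross3 omega y"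
proof -
 have "(cross3 omega has_derivative cross3 omega) (at x)"
 by (rule bounded_linear_imp_has_derivative[OF linear_cross(2)])
 then have "(u has_derivative cross3 omega) (at x)"
 by (rule has_derivative_transform_within_open[OF _ assms(1,3)]) (use assms(2) in auto)
 then have "pd e u x = cross3 omega e" for e by (rule pd_eqI)
 then have "grad u x = (\<chi> i j. cross3 omega (axis j 1) $ i)" by (simp add: grad_def)
 then show ?thesis
 by (simp add: vec_eq_iff forall_3 matrix_vector_mult_def sum_3 cross3_simps axis_def)
qed

lemma Dd_test_ball:
 assumes u: "u \<in> D_R S" and x: "x \<in> cball 0 R" shows "msym (grad u x) = 0"
proof -
 obtain omega U where U: "open U" "cball 0 R \<subseteq> U" "ALL x:U. u x = cross3 omega x" using D_R_D(5)[OF u] by blast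
 have "grad u x *v y = cross3 omega y" for y using grad_ball[OF U(1,3)] U(2) x by blast
 then have "grad u x $ i $ j = cross3 omega (axis j 1) $ i" for i j
 by (metis matrix_vector_mult_basis column_def vec_lambda_beta)
 then show ?thesis by (simp add: vec_eq_iff forall_3 msym_nth cross3_simps axis_def)
qed

text \<open>The convective form; the density is piecewise constant, and on the ball all fields are rigid.\<close>

definition tri :: "field3 => field3 => field3 => real" where
 "tri a u w = (LINT x|MV. dens x * ((Gd u x *v a x) \<bullet> w x))"

text \<open>Skew symmetry in the last two arguments. The density jumps across the sphere, but the flux of the transporting field
 through the sphere vanishes because that field is a rotation near the ball. This is seen by
 splitting off the constant density of the liquid: the remainder is an integral over the ball, and for
 three rotations it vanishes.\<close>

lemma tri_test:
 assumes a: "a \<in> D_R S" and u: "u \<in> D_R S" and w: "w \<in> D_R S"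
 shows "tri a u w = - tri a w u"
proof -
 have cont: "continuous_on UNIV a" "continuous_on UNIV u" "continuous_on UNIV w"
 "continuous_on UNIV (grad u)" "continuous_on UNIV (grad w)"
 by (intro smooth_continuous continuous_grad D_R_D a u w)+
 have comp: "continuous_on UNIV f ==> continuous_on UNIV (%x. f x $ i)" for f :: "real^3 => 'z::real_normed_vector^3" and i
 by (intro bounded_linear.continuous_on[OF bounded_linear_vec_nth])
 have expand: "(A *v y) \<bullet> z = (\<Sum>i\<in>UNIV. \<Sum>j\<in>UNIV. A $ i $ j * y $ j * z $ i)" for A :: "real^3^3" and y z
 by (simp add: matrix_vector_mult_def inner_vec_def sum_distrib_right)
 have ctri: "continuous_on UNIV (%x. (G x *v a x) \<bullet> z x)" if "continuous_on UNIV G" "continuous_on UNIV z" for G :: "real^3 => real^3^3" and z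
 unfolding expand by (intro continuous_intros comp that cont)
 have int: "integrable MV f" if "continuous_on UNIV f" for f :: "real^3 => real"
 using integrable_norm_mult[OF sqint_continuous[OF that] sqint_continuous[of "%_. 1::real"]] sqintD(1)[OF sqint_continuous[OF that]]
 by (simp add: integrable_norm_iff integrable_abs_iff)
 have eq: "tri a u w = (LINT x|MV. dens x * ((grad u x *v a x) \<bullet> w x))" if u: "u \<in> D_R S" and w: "w \<in> D_R S" for u w
 proof -
 have cu: "continuous_on UNIV (grad u)" "continuous_on UNIV w" by (intro smooth_continuous continuous_grad D_R_D u w)+
 have m: "(%x. dens x * ((grad u x *v a x) \<bullet> w x)) \<in> borel_measurable MV"
 by (rule borel_measurable_integrable[OF integrable_dens[OF int[OF ctri[OF cu]]]])
 have ae: "AE x in MV. dens x * ((grad u x *v a x) \<bullet> w x) = dens x * ((Gd u x *v a x) \<bullet> w x)"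
 using Gd_test[OF u] by eventually_elim simp
 have m': "(%x. dens x * ((Gd u x *v a x) \<bullet> w x)) \<in> borel_measurable MV"
 by (rule borel_measurable_lebesgue_on_AE[OF V_lmeasurable(2) m ae])
 have ae': "AE x in MV. dens x * ((Gd u x *v a x) \<bullet> w x) = dens x * ((grad u x *v a x) \<bullet> w x)"
 using Gd_test[OF u] by eventually_elim simp
 show ?thesis unfolding tri_def by (rule integral_cong_AE[OF m' m ae'])
 qed
 define h where "h x = (grad u x *v a x) \<bullet> w x + (grad w x *v a x) \<bullet> u x" for x
 have ch: "continuous_on UNIV h" unfolding h_def[abs_def] by (intro continuous_intros ctri cont)
 note ih = int[OF ch]
 have "tri a u w + tri a w u = (LINT x|MV. dens x * h x)"
 unfolding eq[OF u w] eq[OF w u] h_def distrib_left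
 by (intro Bochner_Integration.integral_add[symmetric] integrable_dens int ctri cont)
 also have "... = (LINT x|Ml. dens x * h x) + (LINT x|MB. dens x * h x)"
 by (rule integral_split(3)[OF integrable_dens[OF ih]])
 also have "(LINT x|Ml. dens x * h x) = (LINT x|Ml. fluid_density S * h x)"
 by (intro Bochner_Integration.integral_cong) (auto simp: dens_liquid)
 also have "(LINT x|MB. dens x * h x) = (LINT x|MB. ball_density * h x)"
 by (intro Bochner_Integration.integral_cong) (auto simp: dens_ball)
 finally have sum: "tri a u w + tri a w u
 = fluid_density S * (LINT x|MV. h x) + (ball_density - fluid_density S) * (LINT x|MB. h x)"
 using integral_split(3)[OF ih] by (simp add: algebra_simps)
 have hB: "(LINT x|MB. h x) = 0"
 proof -
 obtain oa U where U: "open U" "cball 0 R \<subseteq> U" "ALL x:U. a x = cross3 oa x" using D_R_D(5)[OF a] by blast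
 obtain ou U' where U': "open U'" "cball 0 R \<subseteq> U'" "ALL x:U'. u x = cross3 ou x" using D_R_D(5)[OF u] by blast
 obtain ow U'' where U'': "open U''" "cball 0 R \<subseteq> U''" "ALL x:U''. w x = cross3 ow x" using D_R_D(5)[OF w] by blast
 let ?L = "%x. - (cross3 ow (cross3 ou (cross3 oa x))) - cross3 ou (cross3 ow (cross3 oa x))"
 have "(LINT x|MB. h x) = (LINT x|MB. x \<bullet> ?L x)"
 proof (intro Bochner_Integration.integral_cong refl)
 fix x assume "x \<in> space MB"
 then have x: "x \<in> U" "x \<in> U'" "x \<in> U''" using U U' U'' by auto
 have "h x = cross3 ou (cross3 oa x) \<bullet> cross3 ow x + cross3 ow (cross3 oa x) \<bullet> cross3 ou x"
 unfolding h_def using x U(3) U'(3) U''(3) grad_ball[OF U'(1,3) x(2)] grad_ball[OF U''(1,3) x(3)] by simp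
 also have "... = x \<bullet> ?L x" by (simp add: cross3_simps)
 finally show "h x = x \<bullet> ?L x" .
 qed
 also have "... = 4 / 15 * pi * R ^ 5 * (\<Sum>i\<in>UNIV. ?L (axis i 1) $ i)"
 by (rule integral_cball_linear_form[OF pos(1)]) (rule linearI; auto simp: cross3_simps)
 also have "(\<Sum>i\<in>UNIV. ?L (axis i 1) $ i) = 0"
 by (simp add: sum_3 cross3_simps axis_def)
 finally show ?thesis by simp
 qed
 have hV: "(LINT x|MV. h x) = 0"
 proof -
 let ?ai = "%j x. a x $ j"
 define f where "f x = (\<Sum>i\<in>UNIV. u x $ i * w x $ i)" for x
 have sf: "smooth f" unfolding f_def[abs_def] sum_3
 by (intro smooth_add smooth_mult test_function_smooth[OF D_R_component(2)] u w)
 have pdf: "pd (axis j 1) f x = (\<Sum>i\<in>UNIV. u x $ i * grad w x $ i $ j + grad u x $ i $ j * w x $ i)" for j x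
 unfolding f_def[abs_def] sum_3
 using test_function_smooth[OF D_R_component(2)[OF u]] test_function_smooth[OF D_R_component(2)[OF w]]
 by (simp add: pd_add pd_mult smooth_add smooth_mult grad_component u w)
 have hf: "h x = (\<Sum>j\<in>UNIV. ?ai j x * pd (axis j 1) f x)" for x
 unfolding h_def expand pdf by (simp add: sum_3 algebra_simps)
 have "(LINT x|MV. h x) = (LINT x|lborel. h x)"
 by (rule test_integral_eq_lborel[OF ch]) (simp add: hf D_R_component(3)[OF a])
 also have "... = (\<Sum>j\<in>UNIV. \<integral>x. ?ai j x * pd (axis j 1) f x \<partial>lborel)"
 unfolding hf by (intro Bochner_Integration.integral_sum test_function_integrable[OF D_R_component(2)[OF a]] smooth_continuous smooth_pd sf axis_Basis)
 also have "... = (\<Sum>j\<in>UNIV. - (LINT x|lborel. pd (axis j 1) (?ai j) x * f x))"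
 by (intro sum.cong refl) (simp add: integration_by_parts[OF D_R_component(2)[OF a] sf axis_Basis])
 also have "... = - (LINT x|lborel. (\<Sum>j\<in>UNIV. pd (axis j 1) (?ai j) x * f x))"
 by (subst Bochner_Integration.integral_sum)
 (auto simp: sum_negf intro!: test_function_integrable[OF test_function_pd[OF D_R_component(2)[OF a] axis_Basis]] smooth_continuous sf)
 also have "(%x. \<Sum>j\<in>UNIV. pd (axis j 1) (?ai j) x * f x) = (%x. 0)"
 using D_R_D(4)[OF a] by (simp add: grad_component[OF a, symmetric] grad_def flip: sum_distrib_right)
 finally show ?thesis by simp
 qed
 show ?thesis using sum hB hV by simp
qed

end

context gap
begin

section \<open>The energy space\<close>

lemma l2_tendsto_zero_sandwich:
 "(!!n. 0 <= f n) ==> (!!n. f n <= g n) ==> g ----> (0::real) ==> f ----> 0"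
 by (rule tendsto_sandwich[OF always_eventually always_eventually tendsto_const]) auto

lemma W12_iff: "u \<in> W12 V \<longleftrightarrow> sqint MV u & (EX G. sqint MV G & is_weak_gradient V u G)"
 by (auto simp: W12_def Lq_space_2_iff)

lemma W12_D:
 assumes "u \<in> W12 V"
 shows "sqint MV u" "is_weak_gradient V u (Gd u)" "sqint MV (Gd u)" "sqint MV (Dd u)"
proof -
 obtain G where G: "sqint MV G" "is_weak_gradient V u G" and u: "sqint MV u"
 using assms by (auto simp: W12_iff)
 show "sqint MV u" by fact
 show "is_weak_gradient V u (Gd u)" by (rule Gd_is_weak_gradient[OF G(2)])
 show s: "sqint MV (Gd u)" by (rule sqint_cong_AE_MV(1)[OF G(1) AE_Gd_eq[OF G(2)]])
 show "sqint MV (Dd u)" unfolding Dd_eq by (rule sqint_linear_image[OF bounded_linear_msym s])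
qed

lemma W12_I: "sqint MV u ==> sqint MV G ==> is_weak_gradient V u G ==> u \<in> W12 V"
 by (auto simp: W12_iff)

lemma W12_diff:
 assumes "u \<in> W12 V" "w \<in> W12 V"
 shows "(%x. u x - w x) \<in> W12 V" "AE x in MV. Gd (%x. u x - w x) x = Gd u x - Gd w x"
 "AE x in MV. Dd (%x. u x - w x) x = Dd u x - Dd w x"
proof -
 note g = is_weak_gradient_diff[OF V(1) W12_D(2)[OF assms(1)] W12_D(2)[OF assms(2)]]
 show "(%x. u x - w x) \<in> W12 V"
 by (rule W12_I[OF sqint_diff[OF W12_D(1)[OF assms(1)] W12_D(1)[OF assms(2)]]
 sqint_diff[OF W12_D(3)[OF assms(1)] W12_D(3)[OF assms(2)]] g])
 show *: "AE x in MV. Gd (%x. u x - w x) x = Gd u x - Gd w x" by (rule AE_Gd_eq[OF g])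
 show "AE x in MV. Dd (%x. u x - w x) x = Dd u x - Dd w x"
 unfolding Dd_eq using * by eventually_elim (simp add: msym_diff)
qed

lemma l2_Gd_diff: "u \<in> W12 V ==> w \<in> W12 V ==> l2 MV (Gd (%x. u x - w x)) = l2 MV (%x. Gd u x - Gd w x)"
 by (intro sqint_cong_AE_MV(2)[OF _ W12_diff(2)] sqint_diff W12_D)

lemma l2_Dd_diff: "u \<in> W12 V ==> w \<in> W12 V ==> l2 MV (Dd (%x. u x - w x)) = l2 MV (%x. Dd u x - Dd w x)"
 by (intro sqint_cong_AE_MV(2)[OF _ W12_diff(3)] sqint_diff W12_D)

lemma D_R_W12: "u \<in> D_R S ==> u \<in> W12 V"
 by (rule W12_I[OF sqint_D_R sqint_grad is_weak_gradient_grad[OF V(1) D_R_D(2)]])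

lemma norm_msym_le: "norm (msym A) <= norm A"
proof -
 have "norm (transpose A) = norm A"
 by (rule power2_eq_imp_eq) (auto simp: norm_matrix_power2 transpose_def sum_3)
 then have "norm (A + transpose A) <= 2 * norm A" using norm_triangle_ineq[of A "transpose A"] by simp
 then show ?thesis by (simp add: msym_def)
qed

lemma l2_Dd_le: "u \<in> W12 V ==> l2 MV (Dd u) <= l2 MV (Gd u)"
 by (intro l2_mono W12_D) (auto simp: Dd_eq norm_msym_le)

lemma norm12_power2: "(norm12 S u)\<^sup>2 = (norm2 S u)\<^sup>2 + 2 * viscosity S * (l2 MV (Dd u))\<^sup>2"
 using pos by (simp add: norm12_def Lq_norm_2)

lemma norm12_nonneg [simp]: "0 <= norm12 S u" "0 <= norm2 S u"
 using pos inner2_self_nonneg[of u] by (auto simp: norm12_def norm2_def)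

lemma l2_le_norm2: "sqint MV u ==> l2 MV u <= norm2 S u / sqrt dmin"
proof -
 assume u: "sqint MV u"
 have "(sqrt dmin * l2 MV u)\<^sup>2 <= (norm2 S u)\<^sup>2"
 using inner2_self_ge[OF u] dens_bounds(3) by (simp add: norm2_power2 power_mult_distrib)
 then have "sqrt dmin * l2 MV u <= norm2 S u" by (rule power2_le_imp_le) simp
 then show ?thesis using dens_bounds(3) by (simp add: pos_le_divide_eq mult.commute)
qed

lemma norm2_le_l2: "sqint MV u ==> norm2 S u <= sqrt dmax * l2 MV u"
proof -
 assume u: "sqint MV u"
 have "(norm2 S u)\<^sup>2 <= (sqrt dmax * l2 MV u)\<^sup>2"
 using inner2_bound[OF u u, folded power2_eq_square] inner2_self_nonneg[of u] dens_bounds(4)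
 by (simp add: norm2_power2 power_mult_distrib)
 then show ?thesis by (rule power2_le_imp_le) (use dens_bounds(4) in simp)
qed

lemma norm2_le_norm12: "norm2 S u <= norm12 S u"
 by (rule power2_le_imp_le) (use norm12_power2[of u] pos in auto)

lemma Dd_le_norm12: "l2 MV (Dd u) <= norm12 S u / sqrt (2 * viscosity S)"
proof -
 have "(sqrt (2 * viscosity S) * l2 MV (Dd u))\<^sup>2 <= (norm12 S u)\<^sup>2"
 using norm12_power2[of u] pos by (simp add: power_mult_distrib)
 then have "sqrt (2 * viscosity S) * l2 MV (Dd u) <= norm12 S u" by (rule power2_le_imp_le) simp
 then show ?thesis using pos by (simp add: pos_le_divide_eq mult.commute)
qed

lemma l2_tendsto_integral:
 fixes f :: "nat => real^3 => 'b::euclidean_space" and q :: "real^3 => real"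
 assumes f: "!!n. sqint MV (f n)" "sqint MV h" "(%n. l2 MV (%x. f n x - h x)) ----> 0"
 and q: "continuous_on UNIV q" and L: "linear L" and L1: "!!z. \<bar>L z\<bar> <= norm z"
 shows "(%n. \<integral>x. L (f n x) * q x \<partial>MV) ----> (LINT x|MV. L (h x) * q x)"
 proof -
 have bL: "bounded_linear L" using L by (simp add: linear_conv_bounded_linear)
 have sq: "sqint MV q" by (rule sqint_continuous[OF q])
 have d: "norm ((LINT x|MV. L (f n x) * q x) - (LINT x|MV. L (h x) * q x)) <= l2 MV (%x. f n x - h x) * l2 MV q" for n
 proof -
 note sL = sqint_linear_image[OF bL f(1)[of n]] sqint_linear_image[OF bL f(2)]
 have "(LINT x|MV. L (f n x) * q x) - (LINT x|MV. L (h x) * q x) = (LINT x|MV. L (f n x - h x) \<bullet> q x)"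
 using integrable_inner[OF sL(1) sq] integrable_inner[OF sL(2) sq] L
 by (simp add: linear_diff left_diff_distrib)
 also have "norm ... <= l2 MV (%x. L (f n x - h x)) * l2 MV q"
 unfolding real_norm_def by (intro abs_integral_inner_le sq sqint_linear_image[OF bL] sqint_diff f)
 also have "... <= l2 MV (%x. f n x - h x) * l2 MV q"
 by (intro mult_right_mono l2_mono sqint_linear_image[OF bL] sqint_diff f) (auto simp: L1)
 finally show ?thesis .
 qed
 have "(%n. l2 MV (%x. f n x - h x) * l2 MV q) ----> 0"
 by (rule tendsto_mult_left_zero[OF f(3)])
 then have "(%n. (LINT x|MV. L (f n x) * q x) - (LINT x|MV. L (h x) * q x)) ----> 0"
 by (rule Lim_null_comparison[OF always_eventually[OF allI[OF d]]])
 then show ?thesis by (simp add: LIM_zero_iff)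
 qed

lemma is_weak_gradient_limit:
 assumes phi: "!!n. is_weak_gradient V (phi n) (G n)" "!!n. sqint MV (phi n)" "!!n. sqint MV (G n)"
 and u: "sqint MV u" and g: "sqint MV g"
 and lu: "(%n. l2 MV (%x. phi n x - u x)) ----> 0" and lg: "(%n. l2 MV (%x. G n x - g x)) ----> 0"
 shows "is_weak_gradient V u g"
 unfolding is_weak_gradient_def
proof (intro conjI allI impI)
 have *: "integrable (Leb K) f" if K: "compact K & K \<subseteq> V" and f: "sqint MV f" for K and f :: "real^3 => 'z::euclidean_space"
 proof -
 have Ks: "K \<in> sets lebesgue" using K by (simp add: lmeasurable_compact fmeasurableD)
 have "integrable MV (%x. norm (f x) * norm (1::real))"
 by (rule integrable_norm_mult[OF f]) (intro sqint_continuous continuous_intros)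
 then have "integrable MV f" using sqintD(1)[OF f] by (simp add: integrable_norm_iff)
 then have "integrable lebesgue (%x. indicator V x *\<^sub>R f x)"
 using V_lmeasurable by (simp add: integrable_restrict_space)
 from integrable_mult_indicator[OF Ks this]
 have "integrable lebesgue (%x. indicator K x *\<^sub>R (indicator V x *\<^sub>R f x))" .
 also have "(%x. indicator K x *\<^sub>R (indicator V x *\<^sub>R f x)) = (%x. indicator K x *\<^sub>R f x)"
 using K by (auto simp: indicator_def fun_eq_iff)
 finally show ?thesis using Ks by (simp add: integrable_restrict_space)
 qed
 fix K assume K: "compact K & K \<subseteq> V"
 show "integrable (Leb K) u" "integrable (Leb K) g" by (intro * K u g)+
next
 fix psi :: "real^3 => real" and i j :: 3 assume t: "test_function V psi"
 have st: "smooth psi" using t by (rule test_function_smooth)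
 have "(%n. \<integral>x. phi n x $ i * pd (axis j 1) psi x \<partial>MV) ----> (LINT x|MV. u x $ i * pd (axis j 1) psi x)"
 by (rule l2_tendsto_integral[where L = "%z. z $ i"])
 (use lu u phi(2) st smooth_continuous[OF smooth_pd[OF st axis_Basis]] in \<open>auto intro: component_le_norm_cart bounded_linear.linear[OF bounded_linear_vec_nth]\<close>)
 moreover have "(%n. \<integral>x. G n x $ i $ j * psi x \<partial>MV) ----> (LINT x|MV. g x $ i $ j * psi x)"
 proof (rule l2_tendsto_integral[where L = "%z. z $ i $ j"])
 show "linear (%z :: real^3^3. z $ i $ j)" by (rule linearI) auto
 show "\<bar>z $ i $ j\<bar> <= norm z" for z :: "real^3^3"
 using component_le_norm_cart[of "z $ i" j] Finite_Cartesian_Product.norm_nth_le[of z i] by linarith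
 qed (use lg g phi(3) smooth_continuous[OF st] in auto)
 then have "(%n. - (LINT x|MV. G n x $ i $ j * psi x)) ----> - (LINT x|MV. g x $ i $ j * psi x)"
 by (rule tendsto_minus)
 moreover have "(LINT x|MV. phi n x $ i * pd (axis j 1) psi x) = - (LINT x|MV. G n x $ i $ j * psi x)" for n
 by (rule is_weak_gradientD(3)[OF phi(1) t])
 ultimately have "(LINT x|MV. u x $ i * pd (axis j 1) psi x) = - (LINT x|MV. g x $ i $ j * psi x)"
 by (simp add: LIMSEQ_unique)
 then show "(LINT x|MV. u x $ i * frechet_derivative psi (at x) (axis j 1)) = - (LINT x|MV. g x $ i $ j * psi x)"
 by (simp add: pd_def)
qed

lemma H12_W12: "u \<in> H12 S ==> u \<in> W12 V" by (simp add: H12_def)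

lemma H12_D:
 assumes "u \<in> H12 S"
 shows "sqint MV u" "is_weak_gradient V u (Gd u)" "sqint MV (Gd u)" "sqint MV (Dd u)"
 using W12_D[OF H12_W12[OF assms]] by auto

lemma H12_approx:
 assumes u: "u \<in> H12 S"
 obtains phi where "!!n. phi n \<in> D_R S" "(%n. l2 MV (%x. phi n x - u x)) ----> 0"
 "(%n. l2 MV (%x. Gd (phi n) x - Gd u x)) ----> 0"
proof -
 obtain phi where phi: "!!n. phi n \<in> D_R S" "(%n. norm12 S (%x. phi n x - u x)) ----> 0"
 using u by (auto simp: H12_def)
 note W = D_R_W12[OF phi(1)] and uW = H12_W12[OF u]
 have l: "(%n. l2 MV (%x. phi n x - u x)) ----> 0"
 proof (rule l2_tendsto_zero_sandwich)
 show "l2 MV (%x. phi n x - u x) <= norm12 S (%x. phi n x - u x) / sqrt dmin" for n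
 using l2_le_norm2[OF sqint_diff[OF W12_D(1)[OF W] W12_D(1)[OF uW]], of n] norm2_le_norm12[of "%x. phi n x - u x"] dens_bounds(3)
 by (meson divide_right_mono order_trans real_sqrt_ge_zero less_imp_le)
 show "(%n. norm12 S (%x. phi n x - u x) / sqrt dmin) ----> 0"
 using tendsto_divide[OF phi(2) tendsto_const[of "sqrt dmin"]] dens_bounds(3) by simp
 qed simp
 have D: "(%n. l2 MV (%x. Dd (phi n) x - Dd u x)) ----> 0"
 proof (rule l2_tendsto_zero_sandwich)
 show "l2 MV (%x. Dd (phi n) x - Dd u x) <= norm12 S (%x. phi n x - u x) / sqrt (2 * viscosity S)" for n
 using Dd_le_norm12[of "%x. phi n x - u x"] l2_Dd_diff[OF W uW] by simp
 show "(%n. norm12 S (%x. phi n x - u x) / sqrt (2 * viscosity S)) ----> 0"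
 using tendsto_divide[OF phi(2) tendsto_const[of "sqrt (2 * viscosity S)"]] pos by simp
 qed simp
 have cauchy: "EX N. \<forall>m\<ge>N. \<forall>n\<ge>N. l2 MV (%x. Gd (phi m) x - Gd (phi n) x) < e" if e: "0 < e" for e
 proof -
 obtain N where N: "!!n. n \<ge> N ==> l2 MV (%x. Dd (phi n) x - Dd u x) < e / 4"
 using order_tendstoD(2)[OF D, of "e / 4"] e by (auto simp: eventually_sequentially)
 have "l2 MV (%x. Gd (phi m) x - Gd (phi n) x) < e" if mn: "m \<ge> N" "n \<ge> N" for m n
 proof -
 have dm: "(%x. phi m x - phi n x) \<in> D_R S" by (rule D_R_diff[OF phi(1) phi(1)])
 have "l2 MV (%x. Dd (phi m) x - Dd (phi n) x) <= l2 MV (%x. Dd (phi m) x - Dd u x) + l2 MV (%x. Dd u x - Dd (phi n) x)"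
 by (rule l2_triangle3[OF W12_D(4)[OF W] W12_D(4)[OF uW] W12_D(4)[OF W]])
 also have "... < e / 2" using N[OF mn(1)] N[OF mn(2)] l2_minus_commute[of MV "Dd u" "Dd (phi n)"] by simp
 finally have "l2 MV (Dd (%x. phi m x - phi n x)) < e / 2" using l2_Dd_diff[OF W W] by simp
 then have "(l2 MV (Dd (%x. phi m x - phi n x)))\<^sup>2 < (e / 2)\<^sup>2" by (intro power_strict_mono) auto
 then have "(l2 MV (Dd (%x. phi m x - phi n x)))\<^sup>2 < e\<^sup>2 / 4" by (simp only: power_divide) simp
 moreover have "0 < e\<^sup>2" using e by simp
 ultimately have "(l2 MV (Gd (%x. phi m x - phi n x)))\<^sup>2 < e\<^sup>2"
 unfolding korn_test[OF dm] by linarith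
 then have "l2 MV (Gd (%x. phi m x - phi n x)) < e" by (rule power_less_imp_less_base) (use e in simp)
 then show ?thesis using l2_Gd_diff[OF W W] by simp
 qed
 then show ?thesis by (intro exI[of _ N]) simp
 qed
 have "EX g. sqint MV g & (%n. l2 MV (%x. Gd (phi n) x - g x)) ----> 0"
 by (rule l2_complete[OF finite_MV W12_D(3)[OF W] cauchy])
 then obtain g where g: "sqint MV g" "(%n. l2 MV (%x. Gd (phi n) x - g x)) ----> 0" by (elim exE conjE)
 have "is_weak_gradient V u g"
 by (rule is_weak_gradient_limit[OF W12_D(2)[OF W] W12_D(1)[OF W] W12_D(3)[OF W] W12_D(1)[OF uW] g(1) l g(2)])
 then have ae: "AE x in MV. Gd u x = g x" by (rule AE_Gd_eq)
 have "l2 MV (%x. Gd (phi n) x - Gd u x) = l2 MV (%x. Gd (phi n) x - g x)" for n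
 by (rule sqint_cong_AE_MV(2)[OF sqint_diff[OF W12_D(3)[OF W] g(1)]]) (use ae in \<open>eventually_elim, simp\<close>)
 with g(2) have "(%n. l2 MV (%x. Gd (phi n) x - Gd u x)) ----> 0" by simp
 with phi(1) l show ?thesis by (rule that)
qed

lemma norm12_le: "u \<in> W12 V ==> norm12 S u <= sqrt dmax * l2 MV u + sqrt (2 * viscosity S) * l2 MV (Gd u)"
proof -
 assume u: "u \<in> W12 V"
 have "(norm12 S u)\<^sup>2 <= (norm2 S u)\<^sup>2 + (sqrt (2 * viscosity S) * l2 MV (Gd u))\<^sup>2"
 using norm12_power2[of u] power_mono[OF l2_Dd_le[OF u], of 2] pos by (simp add: power_mult_distrib)
 also have "... <= (norm2 S u + sqrt (2 * viscosity S) * l2 MV (Gd u))\<^sup>2"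
 using pos by (simp add: power2_sum)
 finally have "norm12 S u <= norm2 S u + sqrt (2 * viscosity S) * l2 MV (Gd u)"
 by (rule power2_le_imp_le) (use pos in auto)
 then show ?thesis using norm2_le_l2[OF W12_D(1)[OF u]] by linarith
qed

lemma H12_I:
 assumes u: "u \<in> W12 V" and phi: "!!n. phi n \<in> D_R S" "(%n. l2 MV (%x. phi n x - u x)) ----> 0"
 "(%n. l2 MV (%x. Gd (phi n) x - Gd u x)) ----> 0"
 shows "u \<in> H12 S"
proof -
 have "(%n. norm12 S (%x. phi n x - u x)) ----> 0"
 proof (rule l2_tendsto_zero_sandwich)
 show "norm12 S (%x. phi n x - u x) <= sqrt dmax * l2 MV (%x. phi n x - u x) + sqrt (2 * viscosity S) * l2 MV (%x. Gd (phi n) x - Gd u x)" for n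
 using norm12_le[OF W12_diff(1)[OF D_R_W12[OF phi(1)] u], of n] l2_Gd_diff[OF D_R_W12[OF phi(1)] u, of n] by simp
 show "(%n. sqrt dmax * l2 MV (%x. phi n x - u x) + sqrt (2 * viscosity S) * l2 MV (%x. Gd (phi n) x - Gd u x)) ----> 0"
 using tendsto_add[OF tendsto_mult[OF tendsto_const phi(2)] tendsto_mult[OF tendsto_const phi(3)], of "sqrt dmax" "sqrt (2 * viscosity S)"] by simp
 qed simp
 with u phi(1) show ?thesis by (auto simp: H12_def)
qed

lemma D_R_H12: "u \<in> D_R S ==> u \<in> H12 S"
 by (rule H12_I[OF D_R_W12, where phi = "%n. u"]) (auto simp: l2_def)

lemma H12_diff:
 assumes u: "u \<in> H12 S" and w: "w \<in> H12 S" shows "(%x. u x - w x) \<in> H12 S"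
proof -
 obtain phi where phi: "!!n. phi n \<in> D_R S" "(%n. l2 MV (%x. phi n x - u x)) ----> 0"
 "(%n. l2 MV (%x. Gd (phi n) x - Gd u x)) ----> 0" using H12_approx[OF u] by blast
 obtain psi where psi: "!!n. psi n \<in> D_R S" "(%n. l2 MV (%x. psi n x - w x)) ----> 0"
 "(%n. l2 MV (%x. Gd (psi n) x - Gd w x)) ----> 0" using H12_approx[OF w] by blast
 have W: "(%x. u x - w x) \<in> W12 V" by (intro W12_diff H12_W12 u w)
 have dist: "l2 MV (%x. (f x - g x) - (h x - k x)) <= l2 MV (%x. f x - h x) + l2 MV (%x. g x - k x)"
 if "sqint MV f" "sqint MV g" "sqint MV h" "sqint MV k" for f g h k :: "real^3 => 'z::euclidean_space"
 using l2_triangle_diff[OF sqint_diff[OF that(1,3)] sqint_diff[OF that(2,4)]] by (simp add: algebra_simps)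
 show ?thesis
 proof (rule H12_I[OF W, where phi = "%n x. phi n x - psi n x"])
 show "(%x. phi n x - psi n x) \<in> D_R S" for n by (rule D_R_diff[OF phi(1) psi(1)])
 show "(%n. l2 MV (%x. (phi n x - psi n x) - (u x - w x))) ----> 0"
 by (rule l2_tendsto_zero_sandwich[OF _ dist[OF sqint_D_R[OF phi(1)] sqint_D_R[OF psi(1)] H12_D(1)[OF u] H12_D(1)[OF w]]])
 (use tendsto_add[OF phi(2) psi(2)] in auto)
 have "l2 MV (%x. Gd (%x. phi n x - psi n x) x - Gd (%x. u x - w x) x)
 = l2 MV (%x. (Gd (phi n) x - Gd (psi n) x) - (Gd u x - Gd w x))" for n
 by (rule sqint_cong_AE_MV(2)[OF sqint_diff[OF sqint_diff[OF W12_D(3) W12_D(3)] sqint_diff[OF W12_D(3) W12_D(3)]]])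
 (use W12_diff(2)[OF D_R_W12[OF phi(1)[of n]] D_R_W12[OF psi(1)[of n]]] W12_diff(2)[OF H12_W12[OF u] H12_W12[OF w]] in
 \<open>auto intro: D_R_W12 phi psi H12_W12 u w elim!: AE_mp\<close>)
 moreover have "(%n. l2 MV (%x. (Gd (phi n) x - Gd (psi n) x) - (Gd u x - Gd w x))) ----> 0"
 by (rule l2_tendsto_zero_sandwich[OF _ dist[OF W12_D(3)[OF D_R_W12[OF phi(1)]] W12_D(3)[OF D_R_W12[OF psi(1)]] H12_D(3)[OF u] H12_D(3)[OF w]]])
 (use tendsto_add[OF phi(3) psi(3)] in auto)
 ultimately show "(%n. l2 MV (%x. Gd (%x. phi n x - psi n x) x - Gd (%x. u x - w x) x)) ----> 0" by simp
 qed
qed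

lemma l2_tendsto:
 fixes f :: "nat => real^3 => 'b::euclidean_space"
 assumes "!!n. sqint MV (f n)" "sqint MV g" "(%n. l2 MV (%x. f n x - g x)) ----> 0"
 shows "(%n. l2 MV (f n)) ----> l2 MV g"
proof -
 have "\<bar>l2 MV (f n) - l2 MV g\<bar> <= l2 MV (%x. f n x - g x)" for n
 using l2_le_diff[OF assms(1)[of n] assms(2)] l2_le_diff[OF assms(2) assms(1)[of n]] l2_minus_commute[of MV g "f n"] by linarith
 then have "(%n. l2 MV (f n) - l2 MV g) ----> 0"
 by (intro Lim_null_comparison[OF always_eventually assms(3)]) auto
 then show ?thesis by (simp add: LIM_zero_iff)
qed

lemma korn:
 assumes u: "u \<in> H12 S" shows "(l2 MV (Gd u))\<^sup>2 = 2 * (l2 MV (Dd u))\<^sup>2"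
proof -
 obtain phi where phi: "!!n. phi n \<in> D_R S" "(%n. l2 MV (%x. phi n x - u x)) ----> 0"
 "(%n. l2 MV (%x. Gd (phi n) x - Gd u x)) ----> 0" using H12_approx[OF u] by blast
 note W = D_R_W12[OF phi(1)]
 have "(%n. l2 MV (%x. Dd (phi n) x - Dd u x)) ----> 0"
 proof (rule l2_tendsto_zero_sandwich[OF _ _ phi(3)])
 show "l2 MV (%x. Dd (phi n) x - Dd u x) <= l2 MV (%x. Gd (phi n) x - Gd u x)" for n
 by (rule l2_mono[OF sqint_diff[OF W12_D(4)[OF W] H12_D(4)[OF u]] sqint_diff[OF W12_D(3)[OF W] H12_D(3)[OF u]]])
 (simp add: Dd_eq norm_msym_le flip: msym_diff)
 qed simp
 from l2_tendsto[OF W12_D(4)[OF W] H12_D(4)[OF u] this]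
 have "(%n. 2 * (l2 MV (Dd (phi n)))\<^sup>2) ----> 2 * (l2 MV (Dd u))\<^sup>2" by (intro tendsto_intros)
 moreover from l2_tendsto[OF W12_D(3)[OF W] H12_D(3)[OF u] phi(3)]
 have "(%n. (l2 MV (Gd (phi n)))\<^sup>2) ----> (l2 MV (Gd u))\<^sup>2" by (intro tendsto_intros)
 ultimately show ?thesis using korn_test[OF phi(1)] by (simp add: LIMSEQ_unique)
qed

lemma l2_MB_le: "sqint MV f ==> l2 MB f <= l2 MV f" "sqint MV f ==> l2 Ml f <= l2 MV f"
proof -
 assume f: "sqint MV f"
 show "l2 MB f <= l2 MV f" "l2 Ml f <= l2 MV f"
 using sqint_split(3)[OF f] by (auto intro: power2_le_imp_le)
qed

text \<open>A rigid motion does not dissipate, hence the dissipation over the liquid is that over the cavity.\<close>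

lemma Dd_ball:
 assumes u: "u \<in> H12 S" shows "l2 MB (Dd u) = 0"
proof -
 obtain phi where phi: "!!n. phi n \<in> D_R S" "(%n. l2 MV (%x. phi n x - u x)) ----> 0"
 "(%n. l2 MV (%x. Gd (phi n) x - Gd u x)) ----> 0" using H12_approx[OF u] by blast
 note W = D_R_W12[OF phi(1)]
 have sB: "sqint MB (Dd (phi n))" "sqint MB (Dd u)" for n
 using sqint_split(2)[OF W12_D(4)[OF W]] sqint_split(2)[OF H12_D(4)[OF u]] by auto
 have z: "l2 MB (Dd (phi n)) = 0" for n
 proof -
 have "AE x in lebesgue. x \<in> V --> Gd (phi n) x = grad (phi n) x"
 using Gd_test[OF phi(1)] V_lmeasurable by (simp add: AE_restrict_space_iff)
 then have "AE x in lebesgue. x \<in> cball 0 R --> Dd (phi n) x = 0"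
 by eventually_elim (use V(3) Dd_test_ball[OF phi(1)] in \<open>auto simp: Dd_eq\<close>)
 then have "AE x in MB. Dd (phi n) x = 0" by (simp add: AE_restrict_space_iff)
 then have "l2 MB (Dd (phi n)) = l2 MB (%x. 0 :: real^3^3)"
 by (intro l2_cong_AE sqintD(1)[OF sB(1)]) auto
 then show ?thesis by (simp add: l2_def)
 qed
 have "l2 MB (Dd u) <= l2 MV (%x. Gd (phi n) x - Gd u x)" for n
 proof -
 have "l2 MB (Dd u) <= l2 MB (%x. Dd u x - Dd (phi n) x) + l2 MB (Dd (phi n))" by (rule l2_le_diff[OF sB(2) sB(1)])
 also have "... = l2 MB (%x. Dd (phi n) x - Dd u x)" using z l2_minus_commute[of MB "Dd u" "Dd (phi n)"] by simp
 also have "... <= l2 MV (%x. Dd (phi n) x - Dd u x)" by (intro l2_MB_le sqint_diff W12_D(4)[OF W] H12_D(4)[OF u])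
 also have "... <= l2 MV (%x. Gd (phi n) x - Gd u x)"
 by (rule l2_mono[OF sqint_diff[OF W12_D(4)[OF W] H12_D(4)[OF u]] sqint_diff[OF W12_D(3)[OF W] H12_D(3)[OF u]]])
 (simp add: Dd_eq norm_msym_le flip: msym_diff)
 finally show ?thesis .
 qed
 then have "l2 MB (Dd u) <= 0" by (intro LIMSEQ_le_const[OF phi(3)]) auto
 then show ?thesis using l2_nonneg[of MB "Dd u"] by linarith
qed

lemma Dd_liquid: "u \<in> H12 S ==> l2 Ml (Dd u) = l2 MV (Dd u)"
 by (rule power2_eq_imp_eq) (use sqint_split(3)[OF H12_D(4)] Dd_ball in auto)

lemma l2_imp_AE_subseq:
 fixes f :: "nat => real^3 => 'b::euclidean_space"
 assumes f: "!!n. sqint MV (f n)" and l: "(%n. l2 MV (f n)) ----> 0"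
 shows "EX r. strict_mono r & (AE x in MV. (%n. f (r n) x) ----> 0)"
proof (rule tendsto_L1_AE_subseq)
 have one: "sqint MV (%x. 1::real)" by (intro sqint_continuous continuous_intros)
 have i: "integrable MV (f n)" and le: "(LINT x|MV. norm (f n x)) <= l2 MV (f n) * l2 MV (%x. 1::real)" for n
 using integrable_norm_mult[OF f[of n] one] l2_cauchy_schwarz[OF f[of n] one] sqintD(1)[OF f[of n]]
 by (auto simp: integrable_norm_iff)
 show "integrable MV (f n)" for n by (rule i)
 show "(%n. \<integral>x. norm (f n x) \<partial>MV) ----> 0"
 by (rule l2_tendsto_zero_sandwich[OF _ le]) (use tendsto_mult[OF l tendsto_const] in auto)
qed

lemma sobolev:
 assumes u: "u \<in> H12 S"
 shows "integrable MV (%x. (norm (u x)) ^ 6)" "(LINT x|MV. (norm (u x)) ^ 6) <= 110592 * (l2 MV (Gd u)) ^ 6"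
proof -
 obtain phi where phi: "!!n. phi n \<in> D_R S" "(%n. l2 MV (%x. phi n x - u x)) ----> 0"
 "(%n. l2 MV (%x. Gd (phi n) x - Gd u x)) ----> 0" using H12_approx[OF u] by blast
 note W = D_R_W12[OF phi(1)]
 obtain r where r: "strict_mono r" "AE x in MV. (%n. phi (r n) x - u x) ----> 0"
 using l2_imp_AE_subseq[OF sqint_diff[OF sqint_D_R[OF phi(1)] H12_D(1)[OF u]] phi(2)] by blast
 have lim: "AE x in MV. (%n. (norm (phi (r n) x)) ^ 6) ----> (norm (u x)) ^ 6"
 using r(2) by eventually_elim (intro tendsto_intros, simp add: LIM_zero_iff)
 have B: "(%n. 110592 * (l2 MV (Gd (phi (r n)))) ^ 6) ----> 110592 * (l2 MV (Gd u)) ^ 6"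
 using LIMSEQ_subseq_LIMSEQ[OF l2_tendsto[OF W12_D(3)[OF W] H12_D(3)[OF u] phi(3)] r(1)]
 by (intro tendsto_intros) (simp add: o_def)
 have m: "(%x. (norm (u x)) ^ 6) \<in> borel_measurable MV" using sqintD(1)[OF H12_D(1)[OF u]] by measurable
 show "integrable MV (%x. (norm (u x)) ^ 6)" "(LINT x|MV. (norm (u x)) ^ 6) <= 110592 * (l2 MV (Gd u)) ^ 6"
 by (rule fatou_real[OF sobolev_test(1)[OF phi(1)] _ sobolev_test(2)[OF phi(1)] B m lim]; simp)+
qed

end

section \<open>The convective form on the energy space\<close>

lemma norm_matrix_vector_le: "norm (A *v (x :: real^3)) <= norm (A :: real^3^3) * norm x"
proof (rule power2_le_imp_le)
 have "(norm (A *v x))\<^sup>2 = (\<Sum>i\<in>UNIV. (A $ i \<bullet> x)\<^sup>2)"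
 by (simp add: norm_vec3_power2 matrix_vector_mult_def inner_vec_def)
 also have "... <= (\<Sum>i\<in>UNIV. (norm (A $ i))\<^sup>2 * (norm x)\<^sup>2)"
 by (intro sum_mono) (metis Cauchy_Schwarz_ineq power2_norm_eq_inner)
 also have "... = (norm A * norm x)\<^sup>2"
 by (simp add: power_mult_distrib norm_matrix_power2 norm_vec3_power2 flip: sum_distrib_right)
 finally show "(norm (A *v x))\<^sup>2 <= (norm A * norm x)\<^sup>2" .
qed simp

context gap
begin

definition h1 :: "field3 => real" where "h1 u = l2 MV u + l2 MV (Gd u)"

lemma h1_nonneg [simp]: "0 <= h1 u" by (simp add: h1_def)

lemma h1_bounds: "l2 MV u <= h1 u" "l2 MV (Gd u) <= h1 u"
 by (auto simp: h1_def)

lemma sqint_cube: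
 assumes "a \<in> H12 S" shows "sqint MV (%x. (norm (a x)) ^ 3)" "l2 MV (%x. (norm (a x)) ^ 3) <= 333 * (l2 MV (Gd a)) ^ 3"
proof -
 have [measurable]: "a \<in> borel_measurable MV" using H12_D(1)[OF assms] by (rule sqintD)
 have e: "(norm ((norm (a x)) ^ 3))\<^sup>2 = (norm (a x)) ^ 6" for x by (simp flip: power_mult)
 show s: "sqint MV (%x. (norm (a x)) ^ 3)"
 unfolding sqint_def e using sobolev(1)[OF assms] by simp
 show "l2 MV (%x. (norm (a x)) ^ 3) <= 333 * (l2 MV (Gd a)) ^ 3"
 proof (rule power2_le_imp_le)
 have "(l2 MV (%x. (norm (a x)) ^ 3))\<^sup>2 <= 110592 * (l2 MV (Gd a)) ^ 6"
 unfolding l2_power2 e by (rule sobolev(2)[OF assms])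
 also have "... <= 110889 * (l2 MV (Gd a)) ^ 6" by (intro mult_right_mono) auto
 also have "... = (333 * (l2 MV (Gd a)) ^ 3)\<^sup>2" by (simp add: power_mult_distrib flip: power_mult)
 finally show "(l2 MV (%x. (norm (a x)) ^ 3))\<^sup>2 <= (333 * (l2 MV (Gd a)) ^ 3)\<^sup>2" .
 qed simp
qed

lemma sqint_square:
 assumes "a \<in> H12 S" shows "sqint MV (%x. (norm (a x))\<^sup>2)" "l2 MV (%x. (norm (a x))\<^sup>2) <= 19 * (h1 a)\<^sup>2"
proof -
 have [measurable]: "a \<in> borel_measurable MV" using H12_D(1)[OF assms] by (rule sqintD)
 have e: "(norm ((norm (a x))\<^sup>2))\<^sup>2 = norm (a x) * norm ((norm (a x)) ^ 3)" for x
 by (simp add: power_numeral_reduce)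
 show s: "sqint MV (%x. (norm (a x))\<^sup>2)"
 unfolding sqint_def e using integrable_norm_mult[OF H12_D(1)[OF assms] sqint_cube(1)[OF assms]] by simp
 show "l2 MV (%x. (norm (a x))\<^sup>2) <= 19 * (h1 a)\<^sup>2"
 proof (rule power2_le_imp_le)
 have "(l2 MV (%x. (norm (a x))\<^sup>2))\<^sup>2 <= l2 MV a * l2 MV (%x. (norm (a x)) ^ 3)"
 unfolding l2_power2 e by (rule l2_cauchy_schwarz[OF H12_D(1)[OF assms] sqint_cube(1)[OF assms]])
 also have "... <= h1 a * (333 * (h1 a) ^ 3)"
 using sqint_cube(2)[OF assms] power_mono[OF h1_bounds(2)[of a], of 3]
 by (intro mult_mono h1_bounds order_trans[OF sqint_cube(2)[OF assms]] mult_left_mono) auto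
 also have "... <= (19 * (h1 a)\<^sup>2)\<^sup>2"
 using zero_le_power[OF h1_nonneg[of a], of 4] by (simp add: power_mult_distrib power_numeral_reduce)
 finally show "(l2 MV (%x. (norm (a x))\<^sup>2))\<^sup>2 <= (19 * (h1 a)\<^sup>2)\<^sup>2" .
 qed simp
qed

lemma sqint_prod:
 assumes a: "a \<in> H12 S" and w: "w \<in> H12 S"
 shows "sqint MV (%x. norm (a x) * norm (w x))" "l2 MV (%x. norm (a x) * norm (w x)) <= 19 * (h1 a * h1 w)"
proof -
 have [measurable]: "a \<in> borel_measurable MV" "w \<in> borel_measurable MV"
 using H12_D(1)[OF a] H12_D(1)[OF w] by (auto dest: sqintD)
 have e: "(norm (norm (a x) * norm (w x)))\<^sup>2 = norm ((norm (a x))\<^sup>2) * norm ((norm (w x))\<^sup>2)" for x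
 by (simp add: power_mult_distrib)
 show s: "sqint MV (%x. norm (a x) * norm (w x))"
 unfolding sqint_def e using integrable_norm_mult[OF sqint_square(1)[OF a] sqint_square(1)[OF w]] by simp
 show "l2 MV (%x. norm (a x) * norm (w x)) <= 19 * (h1 a * h1 w)"
 proof (rule power2_le_imp_le)
 have "(l2 MV (%x. norm (a x) * norm (w x)))\<^sup>2 <= l2 MV (%x. (norm (a x))\<^sup>2) * l2 MV (%x. (norm (w x))\<^sup>2)"
 unfolding l2_power2 e by (rule l2_cauchy_schwarz[OF sqint_square(1)[OF a] sqint_square(1)[OF w]])
 also have "... <= (19 * (h1 a)\<^sup>2) * (19 * (h1 w)\<^sup>2)"
 by (intro mult_mono sqint_square a w) auto
 finally show "(l2 MV (%x. norm (a x) * norm (w x)))\<^sup>2 <= (19 * (h1 a * h1 w))\<^sup>2"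
 by (simp add: power_mult_distrib)
 qed simp
qed

lemma measurable_tri:
 assumes [measurable]: "a \<in> borel_measurable MV" "G \<in> borel_measurable MV" "w \<in> borel_measurable MV"
 shows "(%x. ((G x :: real^3^3) *v (a x :: real^3)) \<bullet> (w x :: real^3)) \<in> borel_measurable MV"
proof -
 have "(%x. G x $ i $ j) \<in> borel_measurable MV" for i j
 using borel_measurable_continuous_on[OF linear_continuous_on[OF bounded_linear_compose[OF bounded_linear_vec_nth bounded_linear_vec_nth]] assms(2)] by simp
 moreover have "(%x. f x $ j) \<in> borel_measurable MV" if "f \<in> borel_measurable MV" for j and f :: "real^3 => real^3"
 using borel_measurable_continuous_on[OF linear_continuous_on[OF bounded_linear_vec_nth] that] by simp
 ultimately show ?thesis
 unfolding matrix_vector_mult_def inner_vec_def using assms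
 by (simp add: borel_measurable_sum borel_measurable_times)
qed

lemma tri_integrand_le: "\<bar>(G *v a) \<bullet> w\<bar> <= norm (G :: real^3^3) * (norm (a::real^3) * norm w)"
proof -
 have "\<bar>(G *v a) \<bullet> w\<bar> <= norm (G *v a) * norm w" by (rule Cauchy_Schwarz_ineq2)
 also have "... <= (norm G * norm a) * norm w" by (intro mult_right_mono norm_matrix_vector_le) auto
 finally show ?thesis by (simp add: mult.assoc)
qed

lemma tri_general:
 assumes a: "a \<in> borel_measurable MV" and w: "w \<in> borel_measurable MV" and p: "sqint MV (%x. norm (a x) * norm (w x))"
 and u: "u \<in> H12 S"
 shows "integrable MV (%x. dens x * ((Gd u x *v a x) \<bullet> w x))"
 "\<bar>tri a u w\<bar> <= dmax * (l2 MV (Gd u) * l2 MV (%x. norm (a x) * norm (w x)))"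
proof -
 have g: "sqint MV (Gd u)" by (rule H12_D(3)[OF u])
 have m: "(%x. (Gd u x *v a x) \<bullet> w x) \<in> borel_measurable MV" by (rule measurable_tri[OF a sqintD(1)[OF g] w])
 have i: "integrable MV (%x. norm (Gd u x) * norm (norm (a x) * norm (w x)))" by (rule integrable_norm_mult[OF g p])
 have le: "\<bar>(Gd u x *v a x) \<bullet> w x\<bar> <= norm (Gd u x) * norm (norm (a x) * norm (w x))" for x
 using tri_integrand_le[of "Gd u x" "a x" "w x"] by simp
 show "integrable MV (%x. dens x * ((Gd u x *v a x) \<bullet> w x))"
 by (intro integrable_dens Bochner_Integration.integrable_bound[OF i m]) (use le in \<open>auto intro!: AE_I2\<close>)
 have "\<bar>tri a u w\<bar> <= dmax * (LINT x|MV. norm (Gd u x) * norm (norm (a x) * norm (w x)))"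
 unfolding tri_def by (rule integral_dens_bound[OF m i le])
 also have "... <= dmax * (l2 MV (Gd u) * l2 MV (%x. norm (a x) * norm (w x)))"
 using dens_bounds(4) by (intro mult_left_mono l2_cauchy_schwarz g p) auto
 finally show "\<bar>tri a u w\<bar> <= dmax * (l2 MV (Gd u) * l2 MV (%x. norm (a x) * norm (w x)))" .
qed

lemma tri_H12:
 assumes a: "a \<in> H12 S" and u: "u \<in> H12 S" and w: "w \<in> H12 S"
 shows "integrable MV (%x. dens x * ((Gd u x *v a x) \<bullet> w x))"
 "\<bar>tri a u w\<bar> <= 19 * dmax * (l2 MV (Gd u) * (h1 a * h1 w))"
proof -
 note g = tri_general[OF sqintD(1)[OF H12_D(1)[OF a]] sqintD(1)[OF H12_D(1)[OF w]] sqint_prod(1)[OF a w] u]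
 show "integrable MV (%x. dens x * ((Gd u x *v a x) \<bullet> w x))" by (rule g)
 have "dmax * (l2 MV (Gd u) * l2 MV (%x. norm (a x) * norm (w x))) <= dmax * (l2 MV (Gd u) * (19 * (h1 a * h1 w)))"
 using dens_bounds(4) by (intro mult_left_mono sqint_prod a w) auto
 with g(2) show "\<bar>tri a u w\<bar> <= 19 * dmax * (l2 MV (Gd u) * (h1 a * h1 w))" by (simp add: mult_ac)
qed

lemma tri_diff:
 assumes a: "a \<in> H12 S" and b: "b \<in> H12 S" and u: "u \<in> H12 S"
 shows "u' \<in> H12 S ==> tri (%x. a x - b x) u u' = tri a u u' - tri b u u'"
 "u' \<in> H12 S ==> tri u (%x. a x - b x) u' = tri u a u' - tri u b u'"
 "u' \<in> H12 S ==> tri u u' (%x. a x - b x) = tri u u' a - tri u u' b"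
proof -
 assume u': "u' \<in> H12 S"
 have ab: "(%x. a x - b x) \<in> H12 S" by (rule H12_diff[OF a b])
 show "tri (%x. a x - b x) u u' = tri a u u' - tri b u u'"
 unfolding tri_def using tri_H12(1)[OF a u u'] tri_H12(1)[OF b u u']
 by (simp add: matrix_vector_mult_diff_distrib inner_diff_left right_diff_distrib)
 show "tri u u' (%x. a x - b x) = tri u u' a - tri u u' b"
 unfolding tri_def using tri_H12(1)[OF u u' a] tri_H12(1)[OF u u' b]
 by (simp add: inner_diff_right right_diff_distrib)
 have "tri u (%x. a x - b x) u' = (LINT x|MV. dens x * ((Gd a x *v u x) \<bullet> u' x) - dens x * ((Gd b x *v u x) \<bullet> u' x))"
 unfolding tri_def
 proof (rule integral_cong_AE)
 show "(%x. dens x * ((Gd (%x. a x - b x) x *v u x) \<bullet> u' x)) \<in> borel_measurable MV"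
 by (rule borel_measurable_integrable[OF tri_H12(1)[OF u ab u']])
 show "(%x. dens x * ((Gd a x *v u x) \<bullet> u' x) - dens x * ((Gd b x *v u x) \<bullet> u' x)) \<in> borel_measurable MV"
 by (intro borel_measurable_diff borel_measurable_integrable[OF tri_H12(1)[OF u a u']] borel_measurable_integrable[OF tri_H12(1)[OF u b u']])
 show "AE x in MV. dens x * ((Gd (%x. a x - b x) x *v u x) \<bullet> u' x) = dens x * ((Gd a x *v u x) \<bullet> u' x) - dens x * ((Gd b x *v u x) \<bullet> u' x)"
 using W12_diff(2)[OF H12_W12[OF a] H12_W12[OF b]]
 by eventually_elim (simp add: matrix_vector_mult_diff_rdistrib inner_diff_left right_diff_distrib)
 qed
 then show "tri u (%x. a x - b x) u' = tri u a u' - tri u b u'"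
 unfolding tri_def using tri_H12(1)[OF u a u'] tri_H12(1)[OF u b u'] by simp
qed

lemma h1_diff_eq: "u \<in> H12 S ==> w \<in> H12 S ==> h1 (%x. u x - w x) = l2 MV (%x. u x - w x) + l2 MV (%x. Gd u x - Gd w x)"
 by (simp add: h1_def l2_Gd_diff H12_W12)

lemma H12_approx_h1:
 assumes u: "u \<in> H12 S"
 obtains phi where "!!n. phi n \<in> D_R S" "(%n. h1 (%x. phi n x - u x)) ----> 0"
proof -
 obtain phi where phi: "!!n. phi n \<in> D_R S" "(%n. l2 MV (%x. phi n x - u x)) ----> 0"
 "(%n. l2 MV (%x. Gd (phi n) x - Gd u x)) ----> 0" using H12_approx[OF u] by blast
 have "(%n. h1 (%x. phi n x - u x)) ----> 0"
 using tendsto_add[OF phi(2,3)] by (simp add: h1_diff_eq[OF D_R_H12[OF phi(1)] u])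
 with phi(1) show ?thesis by (rule that)
qed

text \<open>A functional that is additive and bounded in the \<open>h1\<close> norm vanishes if it vanishes on test fields.\<close>

lemma density_zero_H12:
 assumes B: "!!u w. u \<in> H12 S ==> w \<in> H12 S ==> B (%x. u x - w x) = B u - (B w :: real)"
 and K: "!!u. u \<in> H12 S ==> \<bar>B u\<bar> <= K * h1 u" and z: "!!u. u \<in> D_R S ==> B u = 0"
 and u: "u \<in> H12 S"
 shows "B u = 0"
proof -
 obtain phi where phi: "!!n. phi n \<in> D_R S" "(%n. h1 (%x. phi n x - u x)) ----> 0" using H12_approx_h1[OF u] by blast
 have "\<bar>B u\<bar> <= K * h1 (%x. phi n x - u x)" for n
 using K[OF H12_diff[OF D_R_H12[OF phi(1)] u], of n] B[OF D_R_H12[OF phi(1)] u, of n] z[OF phi(1), of n] by simp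
 moreover have "(%n. K * h1 (%x. phi n x - u x)) ----> K * 0" by (intro tendsto_intros phi(2))
 ultimately have "\<bar>B u\<bar> <= K * 0" by (intro LIMSEQ_le_const) auto
 then show ?thesis by simp
qed

text \<open>Both sides are continuous in the \<open>h1\<close> norm, so that the identity for test fields extends.\<close>

lemma tri_skew:
 assumes a: "a \<in> H12 S" and u: "u \<in> H12 S" and w: "w \<in> H12 S"
 shows "tri a u w = - tri a w u"
proof -
 let ?B = "%a u w. tri a u w + tri a w u"
 have bound: "\<bar>?B a u w\<bar> <= 38 * dmax * (h1 a * h1 u * h1 w)" if a: "a \<in> H12 S" and u: "u \<in> H12 S" and w: "w \<in> H12 S" for a u w
 proof -
 have "\<bar>tri a u w\<bar> <= 19 * dmax * (h1 u * (h1 a * h1 w))" if u: "u \<in> H12 S" and w: "w \<in> H12 S" for u w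
 using tri_H12(2)[OF a u w] mult_right_mono[OF h1_bounds(2)[of u], of "h1 a * h1 w"] dens_bounds(4)
 by (meson h1_nonneg mult_left_mono mult_nonneg_nonneg order_trans less_imp_le zero_le_numeral)
 from this[OF u w] this[OF w u] show ?thesis by (simp add: mult_ac)
 qed
 have 1: "?B a u w = 0" if a: "a \<in> D_R S" and u: "u \<in> D_R S" and w: "w \<in> H12 S" for a u w
 proof (rule density_zero_H12[where B = "?B a u" and K = "38 * dmax * (h1 a * h1 u)", OF _ _ _ w])
 note H = D_R_H12[OF a] D_R_H12[OF u]
 show "?B a u (%x. f x - g x) = ?B a u f - ?B a u g" if "f \<in> H12 S" "g \<in> H12 S" for f g
 using tri_diff(2,3)[OF that H(1) H(2)] by simp
 show "\<bar>?B a u f\<bar> <= 38 * dmax * (h1 a * h1 u) * h1 f" if "f \<in> H12 S" for f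
 using bound[OF H that] by (simp add: mult_ac)
 show "?B a u f = 0" if "f \<in> D_R S" for f using tri_test[OF a u that] by simp
 qed
 have 2: "?B a u w = 0" if a: "a \<in> D_R S" and u: "u \<in> H12 S" and w: "w \<in> H12 S" for a u w
 proof (rule density_zero_H12[where B = "%u. ?B a u w" and K = "38 * dmax * (h1 a * h1 w)", OF _ _ _ u])
 note H = D_R_H12[OF a]
 show "?B a (%x. f x - g x) w = ?B a f w - ?B a g w" if "f \<in> H12 S" "g \<in> H12 S" for f g
 using tri_diff(2,3)[OF that H w] by simp
 show "\<bar>?B a f w\<bar> <= 38 * dmax * (h1 a * h1 w) * h1 f" if "f \<in> H12 S" for f
 using bound[OF H that w] by (simp add: mult_ac)
 show "?B a f w = 0" if "f \<in> D_R S" for f using 1[OF a that w] by simp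
 qed
 have "?B a u w = 0"
 proof (rule density_zero_H12[where B = "%a. ?B a u w" and K = "38 * dmax * (h1 u * h1 w)", OF _ _ _ a])
 show "?B (%x. f x - g x) u w = ?B f u w - ?B g u w" if "f \<in> H12 S" "g \<in> H12 S" for f g
 using tri_diff(1)[OF that u w] tri_diff(1)[OF that w u] by simp
 show "\<bar>?B f u w\<bar> <= 38 * dmax * (h1 u * h1 w) * h1 f" if "f \<in> H12 S" for f
 using bound[OF that u w] by (simp add: mult_ac)
 show "?B f u w = 0" if "f \<in> D_R S" for f by (rule 2[OF that u w])
 qed
 then show ?thesis by simp
qed

section \<open>The estimate under Serrin's condition\<close>

lemma Lq_space_D: "w \<in> Lq_space q A ==> w \<in> borel_measurable (Leb A)" "w \<in> Lq_space q A ==> integrable (Leb A) (%x. norm (w x) powr q)"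
 by (auto simp: Lq_space_def)

lemma Lq_norm_nonneg [simp]: "0 <= Lq_norm q A w" by (simp add: Lq_norm_def)

text \<open>Hoelder's inequality with the exponents \<open>q\<close>, 2 and 6 interpolates \<open>a\<close> between \<open>L\<^sup>2\<close> and \<open>L\<^sup>6\<close>; the Sobolev
 inequality produces the power \<open>3/q\<close> of the gradient.\<close>

lemma product_bound:
 assumes q: "3 < q" and a: "a \<in> H12 S" and w: "w \<in> Lq_space q (liquid S)"
 shows "sqint Ml (%x. norm (a x) * norm (w x))"
 "l2 Ml (%x. norm (a x) * norm (w x)) <= 333 * (l2 MV a powr (1 - 3 / q) * l2 MV (Gd a) powr (3 / q) * Lq_norm q (liquid S) w)"
proof -
 let ?a = "(q - 3) / q" and ?b = "1 / q" and ?c = "2 / q"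
 have e: "0 < ?a" "0 < ?b" "0 < ?c" "?a + ?b + ?c = 1" using q by (auto simp: field_simps)
 have [measurable]: "a \<in> borel_measurable Ml" "w \<in> borel_measurable Ml"
 using sqintD(1)[OF sqint_split(1)[OF H12_D(1)[OF a]]] Lq_space_D(1)[OF w] by auto
 have i2: "integrable Ml (%x. (norm (a x))\<^sup>2)" by (rule sqintD(2)[OF sqint_split(1)[OF H12_D(1)[OF a]]])
 have i6: "integrable Ml (%x. (norm (a x)) ^ 6)" by (rule integral_split(1)[OF sobolev(1)[OF a]])
 have le6: "(LINT x|Ml. (norm (a x)) ^ 6) <= (333 * (l2 MV (Gd a)) ^ 3)\<^sup>2"
 proof -
 have "(LINT x|Ml. (norm (a x)) ^ 6) <= (LINT x|MV. (norm (a x)) ^ 6)"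
 using integral_split(3)[OF sobolev(1)[OF a]] Bochner_Integration.integral_nonneg[of MB "%x. (norm (a x)) ^ 6"] by simp
 also have "... = (l2 MV (%x. (norm (a x)) ^ 3))\<^sup>2" unfolding l2_power2 by (simp flip: power_mult)
 also have "... <= (333 * (l2 MV (Gd a)) ^ 3)\<^sup>2" by (intro power_mono sqint_cube a) auto
 finally show ?thesis .
 qed
 have le2: "(LINT x|Ml. (norm (a x))\<^sup>2) <= (l2 MV a)\<^sup>2"
 using l2_MB_le(2)[OF H12_D(1)[OF a]] by (metis l2_nonneg l2_power2 power_mono)
 have pt: "((norm (a x))\<^sup>2) powr ?a * ((norm (a x)) ^ 6) powr ?b * (norm (w x) powr q) powr ?c = (norm (norm (a x) * norm (w x)))\<^sup>2" for x
 proof (cases "a x = 0 \<or> w x = 0")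
 case False
 then have n: "0 < norm (a x)" "0 < norm (w x)" by auto
 have "((norm (a x))\<^sup>2) powr ?a * ((norm (a x)) ^ 6) powr ?b = norm (a x) powr (2 * ?a + 6 * ?b)"
 using n by (simp add: powr_realpow[symmetric] powr_powr powr_add del: powr_numeral)
 also have "2 * ?a + 6 * ?b = 2" using q by (simp add: field_simps)
 finally show ?thesis using n q by (simp add: powr_powr power_mult_distrib powr_numeral)
 qed (use q in auto)
 note H = Hoelder3[OF i2 i6 Lq_space_D(2)[OF w] _ _ _ e]
 show s: "sqint Ml (%x. norm (a x) * norm (w x))"
 unfolding sqint_def using H(1) by (simp only: pt) auto
 show "l2 Ml (%x. norm (a x) * norm (w x)) <= 333 * (l2 MV a powr (1 - 3 / q) * l2 MV (Gd a) powr (3 / q) * Lq_norm q (liquid S) w)"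
 proof (rule power2_le_imp_le)
 have "(l2 Ml (%x. norm (a x) * norm (w x)))\<^sup>2
 <= (LINT x|Ml. (norm (a x))\<^sup>2) powr ?a * (LINT x|Ml. (norm (a x)) ^ 6) powr ?b * (LINT x|Ml. norm (w x) powr q) powr ?c"
 unfolding l2_power2 using H(2) by (simp only: pt) auto
 also have "... <= ((l2 MV a)\<^sup>2) powr ?a * ((333 * (l2 MV (Gd a)) ^ 3)\<^sup>2) powr ?b * (LINT x|Ml. norm (w x) powr q) powr ?c"
 using e le2 le6 by (intro mult_right_mono mult_mono powr_mono2) (auto intro: Bochner_Integration.integral_nonneg)
 also have "((l2 MV a)\<^sup>2) powr ?a = (l2 MV a powr (1 - 3 / q))\<^sup>2"
 using q by (cases "l2 MV a = 0") (auto simp: powr_powr diff_divide_distrib mult.commute less_le simp flip: powr_numeral)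
 also have "((333 * (l2 MV (Gd a)) ^ 3)\<^sup>2) powr ?b = (333 powr (1 / q) * l2 MV (Gd a) powr (3 / q))\<^sup>2"
 proof -
 have "((l2 MV (Gd a)) ^ 3) powr ?b = l2 MV (Gd a) powr (3 / q)"
 using q by (cases "l2 MV (Gd a) = 0") (auto simp: powr_powr less_le simp flip: powr_numeral)
 then have "(333 * (l2 MV (Gd a)) ^ 3) powr ?b = 333 powr (1 / q) * l2 MV (Gd a) powr (3 / q)"
 by (simp only: powr_mult)
 moreover have "(x\<^sup>2) powr ?b = (x powr ?b)\<^sup>2" for x :: real
 by (simp only: power2_eq_square powr_mult)
 ultimately show ?thesis by (simp only:)
 qed
 also have "(LINT x|Ml. norm (w x) powr q) powr ?c = (Lq_norm q (liquid S) w)\<^sup>2"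
 unfolding Lq_norm_def
 by (cases "(LINT x|Ml. norm (w x) powr q) = 0") (auto simp: powr_powr simp flip: powr_numeral)
 also have "(l2 MV a powr (1 - 3 / q))\<^sup>2 * (333 powr (1 / q) * l2 MV (Gd a) powr (3 / q))\<^sup>2 * (Lq_norm q (liquid S) w)\<^sup>2
 <= (l2 MV a powr (1 - 3 / q))\<^sup>2 * (333 * l2 MV (Gd a) powr (3 / q))\<^sup>2 * (Lq_norm q (liquid S) w)\<^sup>2"
 proof -
 have "(333::real) powr (1 / q) <= 333 powr 1" using q by (intro powr_mono) auto
 then show ?thesis by (intro mult_right_mono mult_left_mono power_mono) auto
 qed
 finally show "(l2 Ml (%x. norm (a x) * norm (w x)))\<^sup>2
 <= (333 * (l2 MV a powr (1 - 3 / q) * l2 MV (Gd a) powr (3 / q) * Lq_norm q (liquid S) w))\<^sup>2"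
 by (simp add: power_mult_distrib mult_ac)
 qed simp
qed

lemma norm_cross_le: "norm (cross3 a b) <= norm a * norm b"
proof (rule power2_le_imp_le)
 show "(norm (cross3 a b))\<^sup>2 <= (norm a * norm b)\<^sup>2"
 using norm_cross_dot[of a b] by (metis le_add_same_cancel1 zero_le_power2)
qed simp

text \<open>On the liquid this is \<open>product_bound\<close>; on the ball \<open>w\<close> is a rotation and bounded by \<open>R |\<omega>|\<close>.\<close>

lemma serrin_bound:
 assumes q: "3 < q" and a: "a \<in> H12 S" and u: "u \<in> H12 S" and w: "w \<in> H12 S" "w \<in> Lq_space q (liquid S)"
 and omega: "!!x. x \<in> cball 0 R ==> w x = cross3 omega x"
 shows "\<bar>tri a u w\<bar> <= dmax * (l2 MV (Gd u) * (333 * (l2 MV a powr (1 - 3 / q) * l2 MV (Gd a) powr (3 / q) * Lq_norm q (liquid S) w)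
 + R * norm omega * l2 MV a))"
proof -
 let ?p = "%x. norm (a x) * norm (w x)"
 note p = sqint_prod(1)[OF a w(1)]
 have "l2 MB ?p <= l2 MB (%x. (R * norm omega) *\<^sub>R a x)"
 proof (rule l2_mono[OF sqint_split(2)[OF p] sqint_scaleR[OF sqint_split(2)[OF H12_D(1)[OF a]]]], intro AE_I2)
 fix x assume "x \<in> space MB"
 then have x: "x \<in> cball 0 R" by simp
 have "norm (w x) <= norm omega * R"
 using norm_cross_le[of omega x] omega[OF x] mult_left_mono[of "norm x" R "norm omega"] x by simp
 then have "norm (a x) * norm (w x) <= norm (a x) * (norm omega * R)" by (intro mult_left_mono) auto
 then show "norm (?p x) <= norm ((R * norm omega) *\<^sub>R a x)" using pos(1) by (simp add: mult_ac)
 qed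
 also have "... = R * norm omega * l2 MB a" using pos(1) by (subst l2_scaleR) simp
 also have "... <= R * norm omega * l2 MV a" using pos(1) l2_MB_le(1)[OF H12_D(1)[OF a]] by (intro mult_left_mono) auto
 finally have B: "l2 MB ?p <= R * norm omega * l2 MV a" .
 have "l2 MV ?p <= l2 Ml ?p + l2 MB ?p"
 by (rule power2_le_imp_le) (use sqint_split(3)[OF p] in \<open>auto simp: power2_sum\<close>)
 also have "... <= 333 * (l2 MV a powr (1 - 3 / q) * l2 MV (Gd a) powr (3 / q) * Lq_norm q (liquid S) w) + R * norm omega * l2 MV a"
 by (intro add_mono product_bound q a w B)
 finally have "dmax * (l2 MV (Gd u) * l2 MV ?p) <= dmax * (l2 MV (Gd u) * (333 * (l2 MV a powr (1 - 3 / q) * l2 MV (Gd a) powr (3 / q) * Lq_norm q (liquid S) w)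
 + R * norm omega * l2 MV a))"
 using dens_bounds(4) by (intro mult_left_mono) auto
 with tri_general(2)[OF sqintD(1)[OF H12_D(1)[OF a]] sqintD(1)[OF H12_D(1)[OF w(1)]] p u] show ?thesis by linarith
qed

lemma l2_le_Lq:
 assumes q: "3 < q"
 shows "\<exists>C>0. \<forall>w \<in> Lq_space q (liquid S). sqint Ml w & l2 Ml w <= C * Lq_norm q (liquid S) w"
proof -
 let ?a = "(1 - 2 / q) / 2"
 have e: "0 < ?a" "0 < ?a" "0 < 2 / q" "?a + ?a + 2 / q = 1" using q by (auto simp: field_simps)
 have one: "integrable Ml (%x. 1 :: real)"
 using sqintD(2)[OF sqint_split(1)[OF sqint_continuous[OF continuous_on_const[of UNIV "1::real"]]]] by simp
 define c where "c = (LINT x|Ml. 1) powr ?a * (LINT x|Ml. 1) powr ?a"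
 have c0: "0 <= c" by (simp add: c_def)
 have "sqint Ml w & l2 Ml w <= (sqrt c + 1) * Lq_norm q (liquid S) w" if w: "w \<in> Lq_space q (liquid S)" for w
 proof -
 note H = Hoelder3[OF one one Lq_space_D(2)[OF w] _ _ _ e]
 have pt: "1 powr ?a * 1 powr ?a * (norm (w x) powr q) powr (2 / q) = (norm (w x))\<^sup>2" for x
 using q by (cases "w x = 0") (auto simp: powr_powr)
 have s: "sqint Ml w" using H(1) Lq_space_D(1)[OF w] unfolding sqint_def pt by simp
 have "l2 Ml w <= sqrt c * Lq_norm q (liquid S) w"
 proof (rule power2_le_imp_le)
 have "(l2 Ml w)\<^sup>2 <= c * (LINT x|Ml. norm (w x) powr q) powr (2 / q)"
 using H(2) unfolding pt l2_power2 c_def by simp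
 also have "(LINT x|Ml. norm (w x) powr q) powr (2 / q) = (Lq_norm q (liquid S) w)\<^sup>2"
 unfolding Lq_norm_def
 by (cases "(LINT x|Ml. norm (w x) powr q) = 0") (auto simp: powr_powr simp flip: powr_numeral)
 finally show "(l2 Ml w)\<^sup>2 <= (sqrt c * Lq_norm q (liquid S) w)\<^sup>2" using c0 by (simp add: power_mult_distrib)
 qed (use c0 in simp)
 also have "... <= (sqrt c + 1) * Lq_norm q (liquid S) w" by (intro mult_right_mono) auto
 finally show ?thesis using s by simp
 qed
 moreover have "0 < sqrt c + 1" using c0 by (intro add_nonneg_pos) auto
 ultimately show ?thesis by blast
qed

end

section \<open>Functions of time with values in a seminormed space\<close>

text \<open>Only what the Bochner spaces need: fields are functions, so that a seminorm suffices, and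
 differences are the only linear operation used.\<close>

definition seminormed :: "field3 set => (field3 => real) => bool" where
 "seminormed X N \<longleftrightarrow> (%x. 0) \<in> X & N (%x. 0) = 0 &
 (ALL f:X. ALL g:X. (%x. f x - g x) \<in> X & N (%x. f x - g x) <= N f + N g & 0 <= N f)"

lemma seminormedD:
 assumes "seminormed X N"
 shows "(%x. 0) \<in> X" "N (%x. 0) = 0" "f \<in> X ==> g \<in> X ==> (%x. f x - g x) \<in> X"
 "f \<in> X ==> g \<in> X ==> N (%x. f x - g x) <= N f + N g" "f \<in> X ==> 0 <= N f"
 "f \<in> X ==> g \<in> X ==> N (%x. f x - g x) = N (%x. g x - f x)"
 "f \<in> X ==> g \<in> X ==> h \<in> X ==> N (%x. f x - h x) <= N (%x. f x - g x) + N (%x. g x - h x)"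
 "f \<in> X ==> g \<in> X ==> N f <= N (%x. f x - g x) + N g"
proof -
 note D = assms[unfolded seminormed_def]
 show z: "(%x. 0) \<in> X" "N (%x. 0) = 0" using D by auto
 show d: "(%x. f x - g x) \<in> X" if "f \<in> X" "g \<in> X" for f g using D that by blast
 show t: "N (%x. f x - g x) <= N f + N g" if "f \<in> X" "g \<in> X" for f g using D that by blast
 show "f \<in> X ==> 0 <= N f" using D by blast
 have le: "N (%x. g x - f x) <= N (%x. f x - g x)" if "f \<in> X" "g \<in> X" for f g
 using t[OF z(1) d[OF that]] z(2) by simp
 show sym: "N (%x. f x - g x) = N (%x. g x - f x)" if "f \<in> X" "g \<in> X" for f g
 using le[OF that] le[OF that(2,1)] by simp
 show tr: "N (%x. f x - h x) <= N (%x. f x - g x) + N (%x. g x - h x)" if "f \<in> X" "g \<in> X" "h \<in> X" for f g h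
 using t[OF d[OF that(1,2)] d[OF that(3,2)]] sym[OF that(3,2)] by simp
 show "N f <= N (%x. f x - g x) + N g" if "f \<in> X" "g \<in> X"
 using tr[OF that z(1)] by simp
qed

lemma simple_level_sets:
 fixes s :: "real => field3"
 assumes "finite (s ` J)" "!!y. {t \<in> J. s t = y} \<in> sets lebesgue" "!!z. {t \<in> J. P z t} \<in> sets lebesgue"
 shows "{t \<in> J. P (s t) t} \<in> sets lebesgue"
proof -
 have "{t \<in> J. P (s t) t} = (\<Union>z\<in>s ` J. {t \<in> J. s t = z} \<inter> {t \<in> J. P z t})" by auto
 also have "... \<in> sets lebesgue" by (intro sets.finite_UN sets.Int assms)
 finally show ?thesis .
qed

lemma tendsto_bound_null:
 fixes a :: "nat => real"
 assumes "!!n. \<bar>a n - b\<bar> <= c n" "c ----> 0" shows "a ----> b"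
proof -
 have "(%n. a n - b) ----> 0"
 by (rule Lim_null_comparison[OF _ assms(2)]) (simp add: assms(1))
 then show ?thesis by (simp add: LIM_zero_iff)
qed

text \<open>A sequentially continuous functional of two strongly measurable functions is measurable, being an almost
 everywhere limit of its values on simple functions.\<close>

lemma strongly_measurable_pair:
 fixes u w :: "real => field3"
 assumes J: "J \<in> sets lebesgue" and u: "strongly_measurable J X N u" "AE t in Leb J. u t \<in> X"
 and w: "strongly_measurable J Y M w" "AE t in Leb J. w t \<in> Y"
 and Q: "!!f x g y. (!!n. f n \<in> X) ==> x \<in> X ==> (!!n. g n \<in> Y) ==> y \<in> Y ==>
 (%n. N (%z. f n z - x z)) ----> 0 ==> (%n. M (%z. g n z - y z)) ----> 0 ==> (%n. Q (f n) (g n)) ----> Q x y"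
 shows "(%t. Q (u t) (w t) :: real) \<in> borel_measurable (Leb J)"
proof -
 obtain s where s: "!!n::nat. finite (s n ` J)" "!!n. s n ` J \<subseteq> X" "!!n y. {t \<in> J. s n t = y} \<in> sets lebesgue"
 "AE t in Leb J. (%n. N (%x. s n t x - u t x)) ----> 0"
 using u(1) unfolding strongly_measurable_def by blast
 obtain r where r: "!!n::nat. finite (r n ` J)" "!!n. r n ` J \<subseteq> Y" "!!n y. {t \<in> J. r n t = y} \<in> sets lebesgue"
 "AE t in Leb J. (%n. M (%x. r n t x - w t x)) ----> 0"
 using w(1) unfolding strongly_measurable_def by blast
 have m[measurable]: "(%t. Q (s n t) (r n t)) \<in> borel_measurable (Leb J)" for n
 proof (rule measurableI)
 fix A :: "real set" assume "A \<in> sets borel"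
 have "{t \<in> J. Q (s n t) (r n t) \<in> A} \<in> sets lebesgue"
 proof (rule simple_level_sets[OF s(1,3), where P = "%z t. Q z (r n t) \<in> A"])
 fix z
 show "{t \<in> J. Q z (r n t) \<in> A} \<in> sets lebesgue"
 by (rule simple_level_sets[OF r(1,3), where P = "%y t. Q z y \<in> A"]) (use J in auto)
 qed
 moreover have "(%t. Q (s n t) (r n t)) -` A \<inter> space (Leb J) = {t \<in> J. Q (s n t) (r n t) \<in> A}" by auto
 ultimately show "(%t. Q (s n t) (r n t)) -` A \<inter> space (Leb J) \<in> sets (Leb J)"
 using J by (auto simp: sets_restrict_space_iff)
 qed auto
 have "(%t. lim (%n. Q (s n t) (r n t))) \<in> borel_measurable (Leb J)" by measurable
 moreover have "AE t in Leb J. lim (%n. Q (s n t) (r n t)) = Q (u t) (w t)"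
 using s(4) r(4) u(2) w(2) AE_space[of "Leb J"]
 proof eventually_elim
 case (elim t)
 have "(%n. Q (s n t) (r n t)) ----> Q (u t) (w t)"
 by (rule Q[OF _ elim(3) _ elim(4,1,2)])
 (use elim(5) subsetD[OF s(2) imageI] subsetD[OF r(2) imageI] in auto)
 then show ?case by (rule limI)
 qed
 ultimately show ?thesis by (rule borel_measurable_lebesgue_on_AE[OF J])
qed

lemma bochner_subset:
 assumes u: "u \<in> Bochner_Lp p J X N" and J: "J \<in> sets lebesgue" and I: "I \<in> sets lebesgue" "I \<subseteq> J"
 shows "u \<in> Bochner_Lp p I X N"
proof -
 have ae: "AE t in Leb I. P t" if "AE t in Leb J. P t" for P
 using that J I by (auto simp: AE_restrict_space_iff elim!: eventually_mono)
 obtain s where s: "!!n::nat. finite (s n ` J)" "!!n. s n ` J \<subseteq> X" "!!n y. {t \<in> J. s n t = y} \<in> sets lebesgue"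
 "AE t in Leb J. (%n. N (%x. s n t x - u t x)) ----> 0"
 using u unfolding Bochner_Lp_def strongly_measurable_def by blast
 have "strongly_measurable I X N u"
 unfolding strongly_measurable_def
 proof (intro exI[of _ s] conjI allI)
 fix n y
 show "finite (s n ` I)" using s(1) I(2) by (meson finite_subset image_mono)
 show "s n ` I \<subseteq> X" using s(2) I(2) by blast
 have "{t \<in> I. s n t = y} = I \<inter> {t \<in> J. s n t = y}" using I(2) by auto
 then show "{t \<in> I. s n t = y} \<in> sets lebesgue" using s(3) I(1) by auto
 show "AE t in Leb I. (%n. N (%x. s n t x - u t x)) ----> 0" by (rule ae[OF s(4)])
 qed
 moreover have "integrable (Leb I) (%t. N (u t) powr p)"
 proof -
 have "integrable lebesgue (%t. indicator J t *\<^sub>R (N (u t) powr p))"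
 using u J by (simp add: Bochner_Lp_def integrable_restrict_space)
 from integrable_mult_indicator[OF I(1) this]
 have "integrable lebesgue (%t. indicator I t *\<^sub>R (indicator J t *\<^sub>R (N (u t) powr p)))" .
 also have "(%t. indicator I t *\<^sub>R (indicator J t *\<^sub>R (N (u t) powr p))) = (%t. indicator I t *\<^sub>R (N (u t) powr p))"
 using I(2) by (auto simp: indicator_def fun_eq_iff)
 finally show ?thesis using I by (simp add: integrable_restrict_space)
 qed
 ultimately show ?thesis using u ae by (auto simp: Bochner_Lp_def)
qed

lemma powr_sum3_le:
 fixes a b c :: real
 assumes "0 <= a" "0 <= b" "0 <= c" "0 < p"
 shows "(a + b + c) powr p <= 3 powr p * (a powr p + b powr p + c powr p)"
proof -
 define m where "m = max a (max b c)"
 have m: "0 <= m" "a + b + c <= 3 * m" using assms by (auto simp: m_def)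
 have "(a + b + c) powr p <= (3 * m) powr p" using assms m by (intro powr_mono2) auto
 also have "... = 3 powr p * m powr p" using m by (simp add: powr_mult)
 also have "m powr p <= a powr p + b powr p + c powr p" by (auto simp: m_def max_def)
 finally show ?thesis by simp
qed

lemma simple_modulus:
 fixes g :: "real => field3"
 assumes J: "J \<in> sets lebesgue" "bounded J" and g: "finite (g ` J)" "!!y. {t \<in> J. g t = y} \<in> sets lebesgue" and e: "0 < e"
 obtains B h where "B \<in> sets lebesgue" "B \<subseteq> J" "emeasure lebesgue B <= ennreal e" "0 < h"
 "!!s t. s \<in> J - B ==> t \<in> J - B ==> \<bar>s - t\<bar> < h ==> g s = g t"
proof (cases "J = {}")
 case True
 then show ?thesis by (intro that[of "{}" 1]) auto
next
 case False
 define Y where "Y = g ` J"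
 have Y: "finite Y" "Y ~= {}" "0 < card Y" using g(1) False by (auto simp: Y_def card_gt_0_iff)
 define d where "d = e / card Y"
 have d: "0 < d" using e Y by (simp add: d_def)
 have "ALL y. EX K. closed K & K \<subseteq> {t \<in> J. g t = y} & {t \<in> J. g t = y} - K \<in> sets lebesgue & emeasure lebesgue ({t \<in> J. g t = y} - K) < ennreal d"
 proof
 fix y
 obtain T where "closed T" "T \<subseteq> {t \<in> J. g t = y}" "{t \<in> J. g t = y} - T \<in> lmeasurable"
 "emeasure lebesgue ({t \<in> J. g t = y} - T) < ennreal d"
 by (rule sets_lebesgue_inner_closed[OF g(2)[of y] d])
 then show "EX K. closed K & K \<subseteq> {t \<in> J. g t = y} & {t \<in> J. g t = y} - K \<in> sets lebesgue & emeasure lebesgue ({t \<in> J. g t = y} - K) < ennreal d"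
 by (intro exI[of _ T] conjI fmeasurableD)
 qed
 from choice[OF this] obtain K where K': "ALL y. closed (K y) & K y \<subseteq> {t \<in> J. g t = y} & {t \<in> J. g t = y} - K y \<in> sets lebesgue & emeasure lebesgue ({t \<in> J. g t = y} - K y) < ennreal d"
 by blast
 have K: "!!y. closed (K y)" "!!y. K y \<subseteq> {t \<in> J. g t = y}" "!!y. {t \<in> J. g t = y} - K y \<in> sets lebesgue"
 "!!y. emeasure lebesgue ({t \<in> J. g t = y} - K y) < ennreal d" using K' by (blast, blast, blast, blast)
 have comp: "compact (K y)" for y
 using K(1,2)[of y] J(2) by (auto simp: compact_eq_bounded_closed intro: bounded_subset)
 define B where "B = (\<Union>y\<in>Y. {t \<in> J. g t = y} - K y)"
 have "ALL p:Y \<times> Y. \<exists>h>0. fst p ~= snd p --> (ALL s:K (fst p). ALL t:K (snd p). h <= dist s t)"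
 proof (intro ballI)
 fix p assume "p \<in> Y \<times> Y"
 show "\<exists>h>0. fst p ~= snd p --> (ALL s:K (fst p). ALL t:K (snd p). h <= dist s t)"
 proof (cases "fst p = snd p")
 case False
 have "K (fst p) \<inter> K (snd p) = {}"
 proof (rule equals0I)
 fix x assume "x \<in> K (fst p) \<inter> K (snd p)"
 then have "g x = fst p" "g x = snd p" using subsetD[OF K(2)[of "fst p"]] subsetD[OF K(2)[of "snd p"]] by blast+
 with False show False by simp
 qed
 from separate_compact_closed[OF comp K(1) this] show ?thesis by blast
 qed (auto intro: exI[of _ 1])
 qed
 from bchoice[OF this] obtain hh where hh': "ALL p:Y \<times> Y. 0 < hh p & (fst p ~= snd p --> (ALL s:K (fst p). ALL t:K (snd p). hh p <= dist s t))"
 by blast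
 have hh: "!!p. p \<in> Y \<times> Y ==> 0 < hh p"
 "!!p s t. p \<in> Y \<times> Y ==> fst p ~= snd p ==> s \<in> K (fst p) ==> t \<in> K (snd p) ==> hh p <= dist s t"
 using hh' by (blast, blast)
 define h where "h = Min (hh ` (Y \<times> Y))"
 have fin: "finite (hh ` (Y \<times> Y))" "hh ` (Y \<times> Y) ~= {}" using Y by auto
 show ?thesis
 proof (rule that[of B h])
 show "B \<in> sets lebesgue" unfolding B_def using K(3) Y(1) by (intro sets.finite_UN) auto
 show "B \<subseteq> J" by (auto simp: B_def)
 have "emeasure lebesgue B <= (\<Sum>y\<in>Y. emeasure lebesgue ({t \<in> J. g t = y} - K y))"
 unfolding B_def using K(3) Y(1) by (intro emeasure_subadditive_finite) auto
 also have "... <= (\<Sum>y\<in>Y. ennreal d)" using K(4) by (intro sum_mono) (auto intro: less_imp_le)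
 also have "... = ennreal e" using d Y by (simp add: d_def ennreal_of_nat_eq_real_of_nat ennreal_mult[symmetric])
 finally show "emeasure lebesgue B <= ennreal e" .
 show "0 < h" unfolding h_def using fin hh(1) by (subst Min_gr_iff) auto
 fix s t assume s: "s \<in> J - B" and t: "t \<in> J - B" and st: "\<bar>s - t\<bar> < h"
 show "g s = g t"
 proof (rule ccontr)
 assume ne: "g s ~= g t"
 have Y: "g s \<in> Y" "g t \<in> Y" using s t by (auto simp: Y_def)
 then have "s \<in> K (g s)" "t \<in> K (g t)" using s t by (auto simp: B_def)
 then have "hh (g s, g t) <= dist s t" using Y ne by (intro hh(2)) auto
 moreover have "h <= hh (g s, g t)" unfolding h_def using fin Y by (intro Min_le) auto
 ultimately show False using st by (simp add: dist_real_def)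
 qed
 qed
qed

text \<open>A Bochner function is approximated in the mean by a simple one, whose level sets are exhausted
 by compact sets. These have positive distances, so that off a set of small measure the simple
 function is constant on short intervals; the remaining error is collected in the integrable function \<open>k\<close>.\<close>

lemma bochner_modulus:
 assumes X: "seminormed X N" and J: "J \<in> sets lebesgue" "bounded J" and u: "u \<in> Bochner_Lp p J X N" and p: "0 < p" and e: "0 < e"
 obtains k h Z where "integrable (Leb J) k" "!!t. 0 <= k t" "(LINT t|Leb J. k t) <= e" "0 < h" "Z \<in> null_sets lebesgue"
 "!!s t. s \<in> J - Z ==> t \<in> J - Z ==> \<bar>s - t\<bar> < h ==> u s \<in> X & N (%x. u s x - u t x) powr p <= k s + k t"
proof -
 note XD = seminormedD[OF X]
 have uX: "AE t in Leb J. u t \<in> X" and us: "strongly_measurable J X N u" and ui: "integrable (Leb J) (%t. N (u t) powr p)"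
 using u by (auto simp: Bochner_Lp_def)
 obtain s where s: "!!n::nat. finite (s n ` J)" "!!n. s n ` J \<subseteq> X" "!!n y. {t \<in> J. s n t = y} \<in> sets lebesgue"
 "AE t in Leb J. (%n. N (%x. s n t x - u t x)) ----> 0"
 using us unfolding strongly_measurable_def by blast
 define nf where "nf t = (N (u t) powr p) powr (1 / p)" for t
 have [measurable]: "nf \<in> borel_measurable (Leb J)" unfolding nf_def[abs_def] using ui by measurable
 have nfN: "nf t = N (u t)" if "u t \<in> X" for t using XD(5)[OF that] p by (cases "N (u t) = 0") (auto simp: nf_def powr_powr)
 have nf0: "0 <= nf t" for t by (simp add: nf_def)
 have lev: "{t \<in> J. c <= 2 * nf t} \<in> sets lebesgue" for c
 proof -
 have "{t \<in> space (Leb J). c <= 2 * nf t} \<in> sets (Leb J)" by measurable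
 then show ?thesis using J(1) by (simp add: sets_restrict_space_iff)
 qed
 \<comment> \<open>truncated simple functions\<close>
 define g where "g n t = (if N (s n t) <= 2 * nf t then s n t else (%x. 0))" for n t
 have gX: "g n t \<in> X" if "t \<in> J" for n t using s(2)[of n] that XD(1) by (auto simp: g_def)
 have gfin: "finite (g n ` J)" for n
 by (rule finite_subset[of _ "insert (%x. 0) (s n ` J)"]) (use s(1) in \<open>auto simp: g_def\<close>)
 have glev: "{t \<in> J. g n t = y} \<in> sets lebesgue" for n y
 unfolding g_def
 proof (rule simple_level_sets[OF s(1,3), where P = "%z t. (if N z <= 2 * nf t then z else (%x. 0)) = y"])
 fix z
 have "{t \<in> J. (if N z <= 2 * nf t then z else (%x. 0)) = y} =
 (if z = y then {t \<in> J. N z <= 2 * nf t} else {}) \<union> (if (%x. 0) = y then J - {t \<in> J. N z <= 2 * nf t} else {})" by auto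
 then show "{t \<in> J. (if N z <= 2 * nf t then z else (%x. 0)) = y} \<in> sets lebesgue" using lev[of "N z"] J(1) by auto
 qed
 have gs: "strongly_measurable J X N (g n)" for n
 unfolding strongly_measurable_def
 by (intro exI[of _ "%_. g n"]) (use gfin glev gX XD(2) in auto)
 have [measurable]: "(%t. N (%x. g n t x - u t x)) \<in> borel_measurable (Leb J)" for n
 proof (rule strongly_measurable_pair[OF J(1) gs _ us uX])
 show "AE t in Leb J. g n t \<in> X" using gX by auto
 fix f x h y assume f: "!!n. f n \<in> X" "x \<in> X" "!!n. h n \<in> X" "y \<in> X"
 "(%n. N (%z. f n z - x z)) ----> 0" "(%n. N (%z. h n z - y z)) ----> 0"
 have "\<bar>N (%z. f n z - h n z) - N (%z. x z - y z)\<bar> <= N (%z. f n z - x z) + N (%z. h n z - y z)" for n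
 using XD(7)[OF f(1)[of n] f(2) f(3)[of n]] XD(7)[OF f(2) f(4) f(3)[of n]]
 XD(7)[OF f(2) f(1)[of n] f(4)] XD(7)[OF f(1)[of n] f(3)[of n] f(4)] XD(6)[OF f(1)[of n] f(2)] XD(6)[OF f(3)[of n] f(4)]
 by linarith
 moreover have "(%n. N (%z. f n z - x z) + N (%z. h n z - y z)) ----> 0" using tendsto_add[OF f(5,6)] by simp
 ultimately show "(%n. N (%z. f n z - h n z)) ----> N (%z. x z - y z)" by (rule tendsto_bound_null)
 qed
 have lim: "AE t in Leb J. (%n. N (%x. g n t x - u t x) powr p) ----> 0"
 using s(4) uX AE_space[of "Leb J"]
 proof eventually_elim
 case (elim t)
 have sX: "s n t \<in> X" for n using s(2) elim by auto
 have "(%n. N (%x. g n t x - u t x)) ----> 0"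
 proof (cases "N (u t) = 0")
 case True
 have "N (%x. g n t x - u t x) = 0" for n
 using XD(4)[OF gX[of t n] elim(2)] XD(5)[OF XD(3)[OF gX[of t n] elim(2)]] elim True nfN[OF elim(2)] XD(2) XD(5)[OF sX[of n]]
 by (auto simp: g_def split: if_splits)
 then show ?thesis by simp
 next
 case False
 then have pos: "0 < N (u t)" using XD(5)[OF elim(2)] by simp
 have "\<forall>\<^sub>F n in sequentially. N (%x. s n t x - u t x) < N (u t)" using order_tendstoD(2)[OF elim(1) pos] .
 then have "\<forall>\<^sub>F n in sequentially. N (%x. s n t x - u t x) = N (%x. g n t x - u t x)"
 proof eventually_elim
 case (elim n)
 have "N (s n t) <= 2 * nf t" using XD(8)[OF sX[of n] \<open>u t \<in> X\<close>] elim nfN[OF \<open>u t \<in> X\<close>] by simp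
 then show ?case by (simp add: g_def)
 qed
 from Lim_transform_eventually[OF elim(1) this] show ?thesis .
 qed
 then show ?case using tendsto_zero_powrI[OF _ tendsto_const[of p], of "%n. N (%x. g n t x - u t x)"] p XD(5)[OF XD(3)[OF gX elim(2)]] elim(3)
 by (auto intro!: tendsto_zero_powrI)
 qed
 have dom: "AE t in Leb J. norm (N (%x. g n t x - u t x) powr p) <= 3 powr p * (N (u t) powr p)" for n
 using uX AE_space[of "Leb J"]
 proof eventually_elim
 case (elim t)
 have sX: "s n t \<in> X" using s(2) elim by auto
 have "N (%x. g n t x - u t x) <= N (g n t) + N (u t)" by (rule XD(4)[OF gX]) (use elim in auto)
 also have "N (g n t) <= 2 * N (u t)" using nfN[OF elim(1)] XD(2) XD(5)[OF elim(1)] by (auto simp: g_def)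
 finally have "N (%x. g n t x - u t x) <= 3 * N (u t)" by simp
 then have "N (%x. g n t x - u t x) powr p <= (3 * N (u t)) powr p"
 using p XD(5)[OF XD(3)[OF gX elim(1)]] elim(2) by (intro powr_mono2) auto
 then show ?case using XD(5)[OF elim(1)] by (simp add: powr_mult)
 qed
 have "(%n. \<integral>t. N (%x. g n t x - u t x) powr p \<partial>Leb J) ----> (LINT t|Leb J. 0)"
 by (rule integral_dominated_convergence[where w = "%t. 3 powr p * (N (u t) powr p)"])
 (use ui lim dom in auto)
 then have "(%n. \<integral>t. N (%x. g n t x - u t x) powr p \<partial>Leb J) ----> 0" by simp
 moreover define c where "c = 3 powr p"
 have c: "0 < c" by (simp add: c_def)
 ultimately have "\<forall>\<^sub>F n in sequentially. (LINT t|Leb J. N (%x. g n t x - u t x) powr p) < e / (2 * c)"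
 using e by (intro order_tendstoD) auto
 then obtain n where n: "(LINT t|Leb J. N (%x. g n t x - u t x) powr p) < e / (2 * c)"
 by (auto simp: eventually_sequentially)
 define D where "D = (\<Sum>y\<in>g n ` J. \<Sum>z\<in>g n ` J. N (%x. y x - z x) powr p) + 1"
 have D1: "1 <= D" by (auto simp: D_def intro!: sum_nonneg)
 have Dle: "N (%x. g n a x - g n b x) powr p <= D" if "a \<in> J" "b \<in> J" for a b
 proof -
 have "N (%x. g n a x - g n b x) powr p <= (\<Sum>z\<in>g n ` J. N (%x. g n a x - z x) powr p)"
 using gfin that by (intro member_le_sum[where f = "%z. N (%x. g n a x - z x) powr p"]) auto
 also have "... <= (\<Sum>y\<in>g n ` J. \<Sum>z\<in>g n ` J. N (%x. y x - z x) powr p)"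
 using gfin that by (intro member_le_sum[where f = "%y. \<Sum>z\<in>g n ` J. N (%x. y x - z x) powr p"]) (auto intro: sum_nonneg)
 finally show ?thesis by (simp add: D_def)
 qed
 have eB: "0 < e / (2 * c * D)" using e c D1 by simp
 obtain B h where B: "B \<in> sets lebesgue" "B \<subseteq> J" "emeasure lebesgue B <= ennreal (e / (2 * c * D))" "0 < h"
 "!!s t. s \<in> J - B ==> t \<in> J - B ==> \<bar>s - t\<bar> < h ==> g n s = g n t"
 by (rule simple_modulus[OF J gfin glev eB, of n]) blast
 have "AE t in lebesgue. t \<in> J --> u t \<in> X" using uX J(1) by (simp add: AE_restrict_space_iff)
 then obtain Z where Z: "Z \<in> null_sets lebesgue" "!!t. t ~: Z ==> t \<in> J ==> u t \<in> X"
 unfolding completion.AE_iff_null_sets by auto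
 have Bfin: "emeasure lebesgue B < \<infinity>" using B(3) by (auto intro: le_less_trans)
 have Bm: "measure lebesgue B <= e / (2 * c * D)" using B(3) eB by (simp add: measure_def enn2real_leI)
 have iB: "integrable (Leb J) (indicator B :: real => real)" "(LINT t|Leb J. indicator B t) = measure lebesgue B"
 proof -
 have eq: "(%t. indicator J t *\<^sub>R (indicator B t :: real)) = indicator B" using B(2) by (auto simp: indicator_def fun_eq_iff)
 show "integrable (Leb J) (indicator B :: real => real)"
 using J(1) B(1) Bfin eq by (simp add: integrable_restrict_space)
 show "(LINT t|Leb J. indicator B t) = measure lebesgue B"
 using J(1) B(2) by (simp add: Int_absorb2 measure_restrict_space)
 qed
 define k where "k t = c * (N (%x. g n t x - u t x) powr p + D * indicator B t)" for t
 have ig: "integrable (Leb J) (%t. N (%x. g n t x - u t x) powr p)"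
 by (rule Bochner_Integration.integrable_bound[where f = "%t. 3 powr p * (N (u t) powr p)"])
 (use ui dom[of n] in \<open>auto elim!: eventually_mono\<close>)
 show ?thesis
 proof (rule that[of k h Z])
 show "integrable (Leb J) k" unfolding k_def[abs_def] using ig iB by auto
 show "0 <= k t" for t unfolding k_def using c D1 by (intro mult_nonneg_nonneg add_nonneg_nonneg) auto
 have "(LINT t|Leb J. k t) = c * ((LINT t|Leb J. N (%x. g n t x - u t x) powr p) + D * measure lebesgue B)"
 unfolding k_def using ig iB by simp
 also have "... <= c * (e / (2 * c) + D * (e / (2 * c * D)))"
 using n Bm c D1 by (intro mult_left_mono add_mono) auto
 also have "... = e" using c D1 by (simp add: field_simps)
 finally show "(LINT t|Leb J. k t) <= e" .
 fix a b assume a: "a \<in> J - Z" and b: "b \<in> J - Z" and ab: "\<bar>a - b\<bar> < h"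
 have aX: "u a \<in> X" "u b \<in> X" "g n a \<in> X" "g n b \<in> X" using a b Z(2) gX by auto
 have "N (%x. u a x - u b x) <= N (%x. g n a x - u a x) + N (%x. g n a x - g n b x) + N (%x. g n b x - u b x)"
 using XD(7)[OF aX(1,3,2)] XD(7)[OF aX(3,4,2)] XD(6)[OF aX(1,3)] by linarith
 then have "N (%x. u a x - u b x) powr p <= (N (%x. g n a x - u a x) + N (%x. g n a x - g n b x) + N (%x. g n b x - u b x)) powr p"
 using p XD(5)[OF XD(3)[OF aX(1,2)]] by (intro powr_mono2) auto
 also have "... <= c * (N (%x. g n a x - u a x) powr p + N (%x. g n a x - g n b x) powr p + N (%x. g n b x - u b x) powr p)"
 unfolding c_def by (intro powr_sum3_le p XD(5)[OF XD(3)] aX)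
 also have "N (%x. g n a x - g n b x) powr p <= D * indicator B a + D * indicator B b"
 proof (cases "a \<in> B \<or> b \<in> B")
 case True
 have "D <= D * indicator B a + D * indicator B b" using True D1 by (auto simp: indicator_def)
 then show ?thesis using Dle[of a b] a b by auto
 next
 case False
 then have "g n a = g n b" using a b ab by (intro B(5)) auto
 then show ?thesis using XD(2) False by simp
 qed
 finally have "N (%x. u a x - u b x) powr p <= k a + k b"
 unfolding k_def using c by (simp add: algebra_simps)
 with aX show "u a \<in> X & N (%x. u a x - u b x) powr p <= k a + k b" by simp
 qed (use B Z in auto)
qed

section \<open>Telescoping in the mean and Gronwall's inequality\<close>

lemma integrable_subset:
 fixes f :: "'a::euclidean_space => 'b::euclidean_space"
 assumes f: "integrable (Leb A) f" and A: "A \<in> sets lebesgue" and B: "B \<in> sets lebesgue" "B \<subseteq> A"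
 shows "integrable (Leb B) f"
proof -
 have "integrable lebesgue (%t. indicator A t *\<^sub>R f t)"
 using f A by (simp add: integrable_restrict_space)
 from integrable_mult_indicator[OF B(1) this]
 have "integrable lebesgue (%t. indicator B t *\<^sub>R (indicator A t *\<^sub>R f t))" .
 also have "(%t. indicator B t *\<^sub>R (indicator A t *\<^sub>R f t)) = (%t. indicator B t *\<^sub>R f t)"
 using B(2) by (auto simp: indicator_def fun_eq_iff)
 finally show ?thesis using B by (simp add: integrable_restrict_space)
qed

lemma integral_subset_le:
 fixes f :: "'a::euclidean_space => real"
 assumes f: "integrable (Leb A) f" and A: "A \<in> sets lebesgue" and B: "B \<in> sets lebesgue" "B \<subseteq> A" and nn: "!!t. 0 <= f t"
 shows "(LINT t|Leb B. f t) <= (LINT t|Leb A. f t)"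
proof -
 have i: "integrable lebesgue (%t. indicator A t *\<^sub>R f t)" "integrable lebesgue (%t. indicator B t *\<^sub>R f t)"
 using f integrable_subset[OF f A B] A B by (simp_all add: integrable_restrict_space)
 have "(LINT t|lebesgue. indicator B t *\<^sub>R f t) <= (LINT t|lebesgue. indicator A t *\<^sub>R f t)"
 by (rule integral_mono[OF i(2,1)]) (use B(2) nn in \<open>auto simp: indicator_def\<close>)
 then show ?thesis using A B by (simp add: integral_restrict_space)
qed

lemma integrable_Icc_Ioo:
 fixes f :: "real => 'b::euclidean_space"
 shows "integrable (Leb {a..b}) f \<longleftrightarrow> integrable (Leb {a<..<b}) f"
 using absolutely_integrable_on_Icc_iff_Ioo[where f = f and a = a and b = b] by (simp add: set_integrable_def integrable_restrict_space)

lemma integral_Icc_Ioo: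
 fixes f :: "real => real"
 assumes f: "integrable (Leb {a..b}) f"
 shows "(LINT t|Leb {a..b}. f t) = (LINT t|Leb {a<..<b}. f t)"
proof -
 have i: "integrable lebesgue (%t. indicator {a..b} t *\<^sub>R f t)" "integrable lebesgue (%t. indicator {a<..<b} t *\<^sub>R f t)"
 using f integrable_Icc_Ioo[of a b f] by (simp_all add: integrable_restrict_space)
 have "AE t in lebesgue. t ~: {a, b}" by (rule AE_not_in) (simp add: negligible_iff_null_sets[symmetric])
 then have "AE t in lebesgue. indicator {a..b} t *\<^sub>R f t = indicator {a<..<b} t *\<^sub>R f t"
 by eventually_elim (auto simp: indicator_def)
 then have "(LINT t|lebesgue. indicator {a..b} t *\<^sub>R f t) = (LINT t|lebesgue. indicator {a<..<b} t *\<^sub>R f t)"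
 by (rule integral_cong_AE[OF borel_measurable_integrable[OF i(1)] borel_measurable_integrable[OF i(2)]])
 then show ?thesis by (simp add: integral_restrict_space)
qed

text \<open>Averaging over the offset turns a Riemann sum of an integrable function into its integral.\<close>

lemma sum_shifted_integral_le:
 fixes f :: "real => real"
 assumes f: "integrable lebesgue f" and nn: "!!t. 0 <= f t" and d: "0 < d"
 shows "integrable (Leb {0<..<d}) (%s. \<Sum>k<m. f (s + real k * d))"
 "(LINT s|Leb {0<..<d}. (\<Sum>k<m. f (s + real k * d))) <= (LINT t|lebesgue. f t)"
proof -
 let ?I = "%k. {real k * d<..<real k * d + d}"
 have iI: "integrable lebesgue (%x. indicator (?I k) x * f x)" for k
 using integrable_mult_indicator[OF _ f, of "?I k"] by simp
 have sh: "(%s. indicator {0<..<d} s * f (s + real k * d)) = (%s. indicator (?I k) (real k * d + 1 * s) * f (real k * d + 1 * s))" for k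
 by (auto simp: indicator_def fun_eq_iff add.commute)
 have ik: "integrable lebesgue (%s. indicator {0<..<d} s * f (s + real k * d))" for k
 unfolding sh using iI[of k] by (subst lebesgue_integrable_real_affine_iff[of 1]) auto
 have ek: "(LINT s|lebesgue. indicator {0<..<d} s * f (s + real k * d)) = (LINT x|lebesgue. indicator (?I k) x * f x)" for k
 unfolding sh using lebesgue_integral_real_affine[of 1 "%x. indicator (?I k) x * f x" "real k * d"] by simp
 have sum: "indicator {0<..<d} s *\<^sub>R (\<Sum>k<m. f (s + real k * d)) = (\<Sum>k<m. indicator {0<..<d} s * f (s + real k * d))" for s
 by (simp add: sum_distrib_left)
 show "integrable (Leb {0<..<d}) (%s. \<Sum>k<m. f (s + real k * d))"
 by (subst integrable_restrict_space) (simp, unfold sum, intro Bochner_Integration.integrable_sum ik)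
 have "(LINT s|Leb {0<..<d}. (\<Sum>k<m. f (s + real k * d))) = (LINT s|lebesgue. (\<Sum>k<m. indicator {0<..<d} s * f (s + real k * d)))"
 by (subst integral_restrict_space) (simp, unfold sum, rule refl)
 also have "... = (\<Sum>k<m. \<integral>x. indicator (?I k) x * f x \<partial>lebesgue)"
 by (subst Bochner_Integration.integral_sum[OF ik]) (simp only: ek)
 also have "... = (LINT x|lebesgue. (\<Sum>k<m. indicator (?I k) x * f x))"
 by (rule Bochner_Integration.integral_sum[symmetric]) (rule iI)
 also have "... <= (LINT t|lebesgue. f t)"
 proof (rule integral_mono[OF _ f])
 show "integrable lebesgue (%x. \<Sum>k<m. indicator (?I k) x * f x)" by (intro Bochner_Integration.integrable_sum iI)
 fix x
 have "(\<Sum>k<m. indicator (?I k) x :: real) <= 1"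
 proof (cases "\<exists>k<m. x \<in> ?I k")
 case False
 then have "(\<Sum>k<m. indicator (?I k) x :: real) = 0" by (intro sum.neutral) (auto simp: indicator_def)
 then show ?thesis by simp
 next
 case True
 then obtain k where k: "k < m" "x \<in> ?I k" by blast
 have "x ~: ?I j" if jk: "j ~= k" for j
 proof
 assume j: "x \<in> ?I j"
 consider "j + 1 <= k" | "k + 1 <= j" using jk by linarith
 then show False
 proof cases
 case 1
 then have "(real j + 1) * d <= real k * d" using d by (intro mult_right_mono) auto
 then show False using j k by (simp add: algebra_simps)
 next
 case 2
 then have "(real k + 1) * d <= real j * d" using d by (intro mult_right_mono) auto
 then show False using j k by (simp add: algebra_simps)
 qed
 qed
 then have "(\<Sum>j<m. indicator (?I j) x :: real) = (\<Sum>j<m. if j = k then 1 else 0)"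
 using k by (intro sum.cong) (auto simp: indicator_def)
 then show ?thesis using k by simp
 qed
 then have "(\<Sum>k<m. indicator (?I k) x) * f x <= 1 * f x" by (intro mult_right_mono nn)
 then show "(\<Sum>k<m. indicator (?I k) x * f x) <= f x" by (simp add: sum_distrib_right)
 qed
 finally show "(LINT s|Leb {0<..<d}. (\<Sum>k<m. f (s + real k * d))) <= (LINT t|lebesgue. f t)" .
qed

lemma null_set_shift:
 fixes Z :: "real set"
 assumes "Z \<in> null_sets lebesgue" shows "{s. s + c \<in> Z} \<in> null_sets lebesgue"
proof -
 have "{s. s + c \<in> Z} = (+) (- c) ` Z"
 by (force simp: image_iff)
 then show ?thesis using negligible_translation[of Z "- c"] assms by (simp add: negligible_iff_null_sets)
qed

text \<open>The hypothesis bounds an increment by an integral over the interval and by the values at its ends.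
 The latter may be large at single points, but for a suitable offset of a grid their
 Riemann sum is at most a multiple of the integral, which is as small as desired. The end points of
 the grid are the only times at which nothing can be said; hence \<open>r\<close> and \<open>s\<close> near \<open>0\<close> and \<open>t\<close>.\<close>

lemma almost_constant:
 fixes P :: "real => real"
 assumes incr: "!!epsilon. 0 < epsilon ==> EX f h Z. integrable (Leb {0<..<T}) f & (ALL t. 0 <= f t) & (LINT t|Leb {0<..<T}. f t) <= epsilon & 0 < h &
 Z \<in> null_sets lebesgue & (ALL r t. 0 < r --> r < t --> t < T --> r ~: Z --> t ~: Z --> t - r < h -->
 \<bar>P t - P r\<bar> <= (LINT tau|Leb {r..t}. f tau) + (t - r) * (f t + f r))"
 and t: "0 < t" "t < T" and e: "0 < e"
 shows "EX r s. 0 < r & r < e & t - e < s & s < t & r <= s & \<bar>P s - P r\<bar> <= e"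
proof -
 obtain f h Z where f: "integrable (Leb {0<..<T}) f" "!!t. 0 <= f t" "(LINT t|Leb {0<..<T}. f t) <= e / 5"
 and h: "0 < h" and Z: "Z \<in> null_sets lebesgue"
 and inc: "!!r t. 0 < r ==> r < t ==> t < T ==> r ~: Z ==> t ~: Z ==> t - r < h ==>
 \<bar>P t - P r\<bar> <= (LINT tau|Leb {r..t}. f tau) + (t - r) * (f t + f r)"
 using incr[of "e / 5"] e by auto
 define f0 where "f0 t = indicator {0<..<T} t * f t" for t
 have f0: "integrable lebesgue f0" "!!t. 0 <= f0 t" "(LINT t|lebesgue. f0 t) <= e / 5"
 using f by (auto simp: f0_def[abs_def] integrable_restrict_space integral_restrict_space)
 obtain m' :: nat where m': "t / min h e < real m'" using reals_Archimedean2 by blast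
 define m where "m = Suc m'"
 define d where "d = t / real m"
 have m: "0 < m" "t / min h e < real m" using m' by (auto simp: m_def)
 have d: "0 < d" "d < h" "d < e" "real m * d = t"
 proof -
 show "0 < d" "real m * d = t" using t m by (auto simp: d_def)
 have "t < real m * min h e" using m(2) h e by (simp add: pos_divide_less_eq)
 then have "d < min h e" unfolding d_def using m(1) by (subst pos_divide_less_eq) (auto simp only: mult.commute of_nat_0_less_iff)
 then show "d < h" "d < e" by auto
 qed
 define F where "F s = (\<Sum>k<m. f0 (s + real k * d))" for s
 have F: "integrable (Leb {0<..<d}) F" "(LINT s|Leb {0<..<d}. F s) <= e / 5"
 using sum_shifted_integral_le[OF f0(1,2) d(1), of m] f0(3) unfolding F_def[abs_def] by auto
 define B where "B = (\<Union>k<m. {s. s + real k * d \<in> Z})"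
 have B: "B \<in> null_sets lebesgue" unfolding B_def by (intro null_sets_UN' countable_finite null_set_shift Z) auto
 have "\<exists>s\<in>{0<..<d} - B. d * F s <= 2 * e / 5"
 proof (rule ccontr)
 assume neg: "\<not> (\<exists>s\<in>{0<..<d} - B. d * F s <= 2 * e / 5)"
 have big: "2 * e / 5 / d <= F s" if "s \<in> {0<..<d}" "s ~: B" for s
 proof -
 have "2 * e / 5 < d * F s" using neg that by (meson DiffI not_le)
 then show ?thesis using d(1) by (simp add: pos_divide_le_eq mult_ac)
 qed
 have "AE s in lebesgue. s \<in> {0<..<d} --> 2 * e / 5 / d <= F s"
 using AE_not_in[OF B] by eventually_elim (use big in blast)
 then have ae: "AE s in Leb {0<..<d}. 2 * e / 5 / d <= F s"
 by (subst AE_restrict_space_iff) auto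
 have "(LINT s|Leb {0<..<d}. 2 * e / 5 / d) <= (LINT s|Leb {0<..<d}. F s)"
 by (rule integral_mono_AE[OF finite_measure.integrable_const[OF finite_measure_lebesgue_on] F(1) ae])
 (use lmeasurable_interval(2)[of 0 d] in simp)
 moreover have "(LINT s|Leb {0<..<d}. 2 * e / 5 / d) = 2 * e / 5"
 using d(1) by (simp add: measure_restrict_space)
 ultimately have "2 * e / 5 <= (LINT s|Leb {0<..<d}. F s)" by (simp only:)
 then show False using F(2) e by linarith
 qed
 then obtain \<sigma> where \<sigma>: "0 < \<sigma>" "\<sigma> < d" "\<sigma> ~: B" "d * F \<sigma> <= 2 * e / 5" by auto
 define p where "p k = \<sigma> + real k * d" for k
 have p0: "0 < p k" "p k < T" "p k ~: Z" "p k < t" if "k < m" for k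
 proof -
 show "0 < p k" using \<sigma> d by (simp add: p_def add_pos_nonneg)
 show "p k ~: Z" using \<sigma>(3) that by (auto simp: B_def p_def)
 have "p k < d + real k * d" using \<sigma> by (simp add: p_def)
 also have "... = real (Suc k) * d" by (simp add: algebra_simps)
 also have "... <= real m * d" using that d(1) by (intro mult_right_mono) auto
 finally show "p k < t" using d(4) by simp
 then show "p k < T" using t by simp
 qed
 have step: "\<bar>P (p (Suc k)) - P (p k)\<bar> <= (LINT tau|Leb {p k..p (Suc k)}. f tau) + d * (f0 (p (Suc k)) + f0 (p k))" if "Suc k < m" for k
 proof -
 have diff: "p (Suc k) - p k = d" by (simp add: p_def algebra_simps)
 have "k < m" using that by simp
 have ff: "f0 (p j) = f (p j)" if "j < m" for j using p0[OF that] by (simp add: f0_def)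
 show ?thesis
 using inc[of "p k" "p (Suc k)"] p0[OF that] p0[OF \<open>k < m\<close>] diff d ff[OF that] ff[OF \<open>k < m\<close>] by simp
 qed
 have intf: "integrable (Leb {p 0..p k}) f" if "k < m" for k
 by (rule integrable_subset[OF f(1)]) (use p0[OF that] p0[of 0] m in auto)
 have tele: "\<bar>P (p k) - P (p 0)\<bar> <= (LINT tau|Leb {p 0..p k}. f tau) + d * ((\<Sum>j<k. f0 (p (Suc j))) + (\<Sum>j<k. f0 (p j)))" if "k < m" for k
 using that
 proof (induction k)
 case 0
 then show ?case by (auto intro: Bochner_Integration.integral_nonneg f(2))
 next
 case (Suc k)
 have "(LINT tau|Leb {p 0..p (Suc k)}. f tau) = (LINT tau|Leb {p 0..p k}. f tau) + (LINT tau|Leb {p k..p (Suc k)}. f tau)"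
 by (rule integral_combine[OF intf[OF Suc.prems]]) (use d in \<open>auto simp: p_def\<close>)
 then show ?case using Suc.IH Suc.prems step[OF Suc.prems] by (simp add: algebra_simps)
 qed
 let ?k = "m - 1"
 have k: "?k < m" using m by simp
 have "(\<Sum>j<?k. f0 (p (Suc j))) <= F \<sigma>"
 proof -
 have "(\<Sum>j<?k. f0 (p (Suc j))) = (\<Sum>j\<in>Suc ` {..<?k}. f0 (p j))" by (simp add: sum.reindex)
 also have "... <= (\<Sum>j<m. f0 (p j))" by (intro sum_mono2) (auto simp: f0(2))
 finally show ?thesis by (simp add: F_def p_def)
 qed
 moreover have "(\<Sum>j<?k. f0 (p j)) <= F \<sigma>"
 proof -
 have "(\<Sum>j<?k. f0 (p j)) <= (\<Sum>j<m. f0 (p j))" by (intro sum_mono2) (auto simp: f0(2))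
 then show ?thesis by (simp add: F_def p_def)
 qed
 ultimately have "d * ((\<Sum>j<?k. f0 (p (Suc j))) + (\<Sum>j<?k. f0 (p j))) <= d * (F \<sigma> + F \<sigma>)"
 using d(1) by (intro mult_left_mono add_mono) auto
 also have "... <= 4 * e / 5" using \<sigma>(4) by (simp add: distrib_left)
 finally have "\<bar>P (p ?k) - P (p 0)\<bar> <= (LINT tau|Leb {p 0..p ?k}. f tau) + 4 * e / 5"
 using tele[OF k] by linarith
 also have "(LINT tau|Leb {p 0..p ?k}. f tau) <= e / 5"
 by (rule order_trans[OF integral_subset_le[OF f(1)] f(3)]) (use p0[OF k] p0[of 0] m f(2) in auto)
 finally have fin: "\<bar>P (p ?k) - P (p 0)\<bar> <= e" by simp
 have pk: "p ?k = \<sigma> + t - d" using d(4) m by (simp add: p_def of_nat_diff algebra_simps)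
 have ends: "t - e < p ?k" "p ?k < t" using pk \<sigma>(1,2) d(3) by linarith+
 have start: "0 < p 0" "p 0 < e" using \<sigma>(1,2) d(3) by (auto simp: p_def)
 have "p 0 <= p ?k" using d(1) by (simp add: p_def)
 then show ?thesis
 by (intro exI[of _ "p 0"] exI[of _ "p ?k"] conjI start ends fin)
qed

text \<open>A Gronwall inequality for an integrable kernel: while the integral of the kernel grows by one half, the bound at most doubles.\<close>

lemma gronwall_doubling:
 fixes y g :: "real => real"
 assumes g: "integrable (Leb {0..T}) g" "!!t. 0 <= g t" and gy: "integrable (Leb {0..T}) (%t. g t * y t)"
 and y: "!!t. 0 <= y t" "0 <= y0" and bound: "!!t. 0 <= t ==> t < T ==> y t <= y0 + (LINT tau|Leb {0..t}. g tau * y tau)"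
 and t: "0 <= t" "t < T" and n: "(LINT tau|Leb {0..t}. g tau) <= real n / 2"
 shows "y t <= 2 ^ n * y0"
proof -
 define G where "G t = (LINT tau|Leb {0..t}. g tau)" for t
 define K where "K t = y0 + (LINT tau|Leb {0..t}. g tau * y tau)" for t
 have gi: "integrable (Leb {a..b}) g" "integrable (Leb {a..b}) (%t. g t * y t)" if "0 <= a" "b < T" for a b
 using integrable_subset[OF g(1)] integrable_subset[OF gy] that by auto
 have Gadd: "G t = G r + (LINT tau|Leb {r..t}. g tau)" if "0 <= r" "r <= t" "t < T" for r t
 unfolding G_def by (rule integral_combine[OF gi(1)]) (use that in auto)
 have Kadd: "K t = K r + (LINT tau|Leb {r..t}. g tau * y tau)" if "0 <= r" "r <= t" "t < T" for r t
 unfolding K_def using integral_combine[OF gi(2)[of 0 t], of r] that by simp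
 have mono: "K r <= K t" if "0 <= r" "r <= t" "t < T" for r t
 using Kadd[OF that] Bochner_Integration.integral_nonneg[of "Leb {r..t}" "%tau. g tau * y tau"] g(2) y(1) by simp
 have yK: "y t <= K t" if "0 <= t" "t < T" for t using bound[OF that] by (simp add: K_def)
 have incr: "K t <= K r + K t * (G t - G r)" if "0 <= r" "r <= t" "t < T" for r t
 proof -
 have "(LINT tau|Leb {r..t}. g tau * y tau) <= (LINT tau|Leb {r..t}. g tau * K t)"
 proof (rule integral_mono)
 show "integrable (Leb {r..t}) (%t. g t * y t)" using gi(2) that by auto
 show "integrable (Leb {r..t}) (%tau. g tau * K t)" using gi(1) that by auto
 show "g tau * y tau <= g tau * K t" if "tau \<in> space (Leb {r..t})" for tau
 using that \<open>0 <= r\<close> \<open>t < T\<close> yK[of tau] mono[of tau t] by (intro mult_left_mono g(2)) auto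
 qed
 then show ?thesis using Kadd[OF that] Gadd[OF that] by (simp add: mult.commute)
 qed
 have Gcont: "continuous_on {0..t} G" if "t < T" for t
 unfolding G_def[abs_def] by (rule indefinite_integral_continuous_real[OF gi(1)]) (use that in auto)
 have G0: "G 0 = 0" unfolding G_def
 by (simp add: integral_restrict_space integral_eq_zero_AE AE_restrict_space_iff) (rule integral_eq_zero_AE, rule AE_mp[OF AE_not_in[of "{0::real}" lebesgue]], auto simp: indicator_def)
 have "K t <= 2 ^ n * y0" if "0 <= t" "t < T" "G t <= real n / 2" for t n
 using that
 proof (induction n arbitrary: t)
 case 0
 have "0 <= K t" using yK[of t] y(1)[of t] 0 by simp
 then have "K t * (G t - G 0) <= 0" using 0 G0 by (simp add: mult_le_0_iff)
 then have "K t <= K 0" using incr[of 0 t] 0 by simp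
 moreover have "K 0 = y0" unfolding K_def
 by (simp add: integral_restrict_space) (rule integral_eq_zero_AE, rule AE_mp[OF AE_not_in[of "{0::real}" lebesgue]], auto simp: indicator_def)
 ultimately show ?case by simp
 next
 case (Suc n)
 show ?case
 proof (cases "G t <= real n / 2")
 case True
 then have "K t <= 2 ^ n * y0" using Suc by simp
 also have "... <= 2 ^ Suc n * y0" using y(2) by simp
 finally show ?thesis .
 next
 case False
 obtain r where r: "0 <= r" "r <= t" "G r = real n / 2"
 using IVT'[of G 0 "real n / 2" t] G0 False Suc.prems Gcont[OF Suc.prems(2)] by auto
 have Kr: "K r <= 2 ^ n * y0" using Suc.IH[of r] r Suc.prems by simp
 have "0 <= K t" using yK[of t] y(1)[of t] Suc.prems by simp
 then have "K t * (G t - G r) <= K t * (1 / 2)"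
 using Suc.prems r by (intro mult_left_mono) (auto simp: add_divide_distrib)
 then have "K t <= 2 * K r" using incr[of r t] r Suc.prems by linarith
 then show ?thesis using Kr by simp
 qed
 qed
 then have "K t <= 2 ^ n * y0" using t n by (simp add: G_def)
 then show ?thesis using yK[OF t] by linarith
qed

section \<open>Norms and forms on the energy space\<close>

lemma convex_powr_combination:
 fixes a b p :: real
 assumes "1 <= q" "0 <= s" "s <= 1" "0 <= a" "0 <= b"
 shows "(s * a + (1 - s) * b) powr q <= s * a powr q + (1 - s) * b powr q"
proof -
 have small: "(s * a) powr q <= s * a powr q" if "0 <= s" "s <= 1" "0 <= a" for s a :: real
 proof -
 have "s powr q <= s powr 1" using that assms(1) by (intro powr_mono') auto
 then show ?thesis using that by (simp add: powr_mult mult_right_mono)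
 qed
 consider "a = 0" | "b = 0" | "0 < a" "0 < b" using assms by linarith
 then show ?thesis
 proof cases
 case 1
 then show ?thesis using small[of "1 - s" b] assms by simp
 next
 case 2
 then show ?thesis using small[of s a] assms by simp
 next
 case 3
 then show ?thesis
 using convex_onD[OF powr_convex[OF assms(1)], of "1 - s" a b] assms by (simp add: algebra_simps)
 qed
qed

lemma Lq_minkowski:
 fixes f g :: "'a::euclidean_space => 'b::euclidean_space"
 assumes q: "1 <= q" and f: "f \<in> Lq_space q A" and g: "g \<in> Lq_space q A"
 shows "(%x. f x - g x) \<in> Lq_space q A" "Lq_norm q A (%x. f x - g x) <= Lq_norm q A f + Lq_norm q A g"
proof -
 let ?M = "Leb A"
 have [measurable]: "f \<in> borel_measurable ?M" "g \<in> borel_measurable ?M"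
 and i: "integrable ?M (%x. norm (f x) powr q)" "integrable ?M (%x. norm (g x) powr q)"
 using f g by (auto simp: Lq_space_def)
 define a b where "a = Lq_norm q A f" and "b = Lq_norm q A g"
 have ab: "0 <= a" "0 <= b" by (auto simp: a_def b_def Lq_norm_def)
 have pw: "a powr q = (LINT x|?M. norm (f x) powr q)" "b powr q = (LINT x|?M. norm (g x) powr q)"
 using q by (auto simp: a_def b_def Lq_norm_def powr_powr Bochner_Integration.integral_nonneg)
 \<comment> \<open>the pointwise bound with weights \<open>a / (a + b)\<close> and \<open>b / (a + b)\<close>, perturbed to be positive\<close>
 have main: "integrable ?M (%x. norm (f x - g x) powr q) & (LINT x|?M. norm (f x - g x) powr q) <= (a + b + 2 * e) powr q" if e: "0 < e" for e
 proof -
 define A' B' where "A' = a + e" and "B' = b + e"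
 have pos: "0 < A'" "0 < B'" using ab e by (auto simp: A'_def B'_def)
 let ?s = "A' / (A' + B')"
 let ?k = "%x. (A' + B') powr q * (?s * (norm (f x) powr q / A' powr q) + (1 - ?s) * (norm (g x) powr q / B' powr q))"
 have le: "norm (f x - g x) powr q <= ?k x" for x
 proof -
 have 1: "norm (f x - g x) <= (A' + B') * (?s * (norm (f x) / A') + (1 - ?s) * (norm (g x) / B'))"
 proof -
 have "1 - ?s = B' / (A' + B')" using pos by (simp add: field_simps)
 then have "(A' + B') * (?s * (norm (f x) / A') + (1 - ?s) * (norm (g x) / B')) = norm (f x) + norm (g x)"
 using pos by (simp add: distrib_left)
 then show ?thesis using norm_triangle_ineq4[of "f x" "g x"] by simp
 qed
 have s: "0 <= ?s" "?s <= 1" using pos by auto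
 have "norm (f x - g x) powr q <= ((A' + B') * (?s * (norm (f x) / A') + (1 - ?s) * (norm (g x) / B'))) powr q"
 using q 1 by (intro powr_mono2) auto
 also have "... = (A' + B') powr q * (?s * (norm (f x) / A') + (1 - ?s) * (norm (g x) / B')) powr q"
 by (rule powr_mult)
 also have "... <= (A' + B') powr q * (?s * (norm (f x) / A') powr q + (1 - ?s) * (norm (g x) / B') powr q)"
 using pos s q by (intro mult_left_mono convex_powr_combination) auto
 also have "... = ?k x" using pos by (simp add: powr_divide)
 finally show ?thesis .
 qed
 have ik: "integrable ?M ?k" using i by simp
 have int: "integrable ?M (%x. norm (f x - g x) powr q)"
 by (rule Bochner_Integration.integrable_bound[OF ik]) (use le in \<open>auto intro!: AE_I2 intro: order_trans[OF _ abs_ge_self]\<close>)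
 have "(LINT x|?M. norm (f x - g x) powr q) <= (LINT x|?M. ?k x)" by (rule integral_mono[OF int ik le])
 also have "... = (A' + B') powr q * (?s * (a powr q / A' powr q) + (1 - ?s) * (b powr q / B' powr q))"
 using i by (simp add: pw)
 also have "... <= (A' + B') powr q * (?s * 1 + (1 - ?s) * 1)"
 proof -
 have "a powr q / A' powr q <= 1" "b powr q / B' powr q <= 1"
 using pos ab e q by (auto simp: A'_def B'_def intro!: powr_mono2)
 then show ?thesis using pos by (intro mult_left_mono add_mono) auto
 qed
 also have "... = (a + b + 2 * e) powr q" by (simp add: A'_def B'_def add_ac)
 finally show ?thesis using int by simp
 qed
 show "(%x. f x - g x) \<in> Lq_space q A" using main[of 1] by (simp add: Lq_space_def)
 have "Lq_norm q A (%x. f x - g x) <= a + b + 2 * e" if e: "0 < e" for e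
 proof -
 have "Lq_norm q A (%x. f x - g x) <= ((a + b + 2 * e) powr q) powr (1 / q)"
 unfolding Lq_norm_def using main[OF e] q by (intro powr_mono2) (auto intro: Bochner_Integration.integral_nonneg)
 also have "... = a + b + 2 * e" using q ab e by (simp add: powr_powr)
 finally show ?thesis .
 qed
 note half = this
 have "Lq_norm q A (%x. f x - g x) <= a + b"
 proof (rule field_le_epsilon)
 fix d :: real assume "0 < d"
 then show "Lq_norm q A (%x. f x - g x) <= a + b + d" using half[of "d / 2"] by simp
 qed
 then show "Lq_norm q A (%x. f x - g x) <= Lq_norm q A f + Lq_norm q A g" by (simp add: a_def b_def)
qed

lemma seminormed_Lq: "1 <= q ==> seminormed (Lq_space q A) (Lq_norm q A)"
 unfolding seminormed_def
 by (intro conjI ballI Lq_minkowski) (simp_all add: Lq_space_def Lq_norm_def)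

context gap
begin

lemma norm12_triangle:
 assumes u: "u \<in> H12 S" and w: "w \<in> H12 S"
 shows "norm12 S (%x. u x - w x) <= norm12 S u + norm12 S w"
proof -
 define c where "c z x = (sqrt (dens x) *\<^sub>R z x, sqrt (2 * viscosity S) *\<^sub>R Dd z x)" for z :: field3 and x
 have sq: "(norm (c z x))\<^sup>2 = dens x * (z x \<bullet> z x) + 2 * viscosity S * (norm (Dd z x))\<^sup>2" for z x
 using dens_bounds(5)[of x] pos by (simp add: c_def norm_Pair power_mult_distrib power2_norm_eq_inner)
 have s: "sqint MV (c z)" "norm12 S z = l2 MV (c z)" if z: "z \<in> H12 S" for z
 proof -
 note zs = H12_D(1)[OF z] H12_D(4)[OF z]
 have [measurable]: "z \<in> borel_measurable MV" "Dd z \<in> borel_measurable MV" using zs by (auto dest: sqintD)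
 have i: "integrable MV (%x. dens x * (z x \<bullet> z x))" "integrable MV (%x. (norm (Dd z x))\<^sup>2)"
 using inner2_integrable[OF zs(1) zs(1)] sqintD(2)[OF zs(2)] by auto
 have "c z \<in> borel_measurable MV" unfolding c_def[abs_def] by measurable
 then show "sqint MV (c z)" unfolding sqint_def sq using i by simp
 show "norm12 S z = l2 MV (c z)"
 by (rule power2_eq_imp_eq) (use i in \<open>simp_all add: l2_power2 sq norm12_power2 norm2_power2 inner2_def\<close>)
 qed
 note uw = H12_diff[OF u w]
 have "l2 MV (c (%x. u x - w x)) = l2 MV (%x. c u x - c w x)"
 by (rule sqint_cong_AE_MV(2)[OF sqint_diff[OF s(1)[OF u] s(1)[OF w]]])
 (use W12_diff(3)[OF H12_W12[OF u] H12_W12[OF w]] in \<open>eventually_elim, simp add: c_def scaleR_diff_right\<close>)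
 then show ?thesis using s(2)[OF uw] s(2)[OF u] s(2)[OF w] l2_triangle_diff[OF s(1)[OF u] s(1)[OF w]] by simp
qed

lemma zero_H12: "(%x. 0) \<in> H12 S" "norm12 S (%x. 0) = 0"
proof -
 have "test_function V (%x. 0 :: real^3)" by (rule test_functionI[where K = "{}"]) (auto simp: smooth_const)
 then have "(%x. 0) \<in> D_R S"
 unfolding D_R_def by (auto simp: trace_def jacobian_def matrix_def intro!: exI[of _ 0] exI[of _ UNIV])
 then show z: "(%x. 0) \<in> H12 S" by (rule D_R_H12)
 have "AE x in MV. Dd (%x. 0) x = 0"
 using W12_diff(3)[OF H12_W12[OF z] H12_W12[OF z]] by eventually_elim simp
 then have "l2 MV (Dd (%x. 0)) = l2 MV (%x. 0 :: real^3^3)" by (rule sqint_cong_AE_MV(2)[OF sqint_zero])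
 then have "(norm12 S (%x. 0))\<^sup>2 = 0" unfolding norm12_power2 norm2_power2 by (simp add: l2_def inner2_def)
 then show "norm12 S (%x. 0) = 0" by simp
qed

lemma seminormed_H12: "seminormed (H12 S) (norm12 S)"
 unfolding seminormed_def using zero_H12 H12_diff norm12_triangle by auto

definition cH :: real where "cH = 1 / sqrt dmin + 1 / sqrt (viscosity S)"

lemma cH_pos: "0 < cH" using pos dens_bounds(3) by (simp add: cH_def add_pos_pos)

lemma l2_Gd_eq: "u \<in> H12 S ==> l2 MV (Gd u) = sqrt 2 * l2 MV (Dd u)"
 by (rule power2_eq_imp_eq) (auto simp: korn power_mult_distrib)

lemma h1_le_norm12: "u \<in> H12 S ==> h1 u <= cH * norm12 S u"
proof -
 assume u: "u \<in> H12 S"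
 have "l2 MV u <= norm12 S u / sqrt dmin"
 using l2_le_norm2[OF H12_D(1)[OF u]] norm2_le_norm12[of u] dens_bounds(3)
 by (meson divide_right_mono order_trans real_sqrt_ge_zero less_imp_le)
 moreover have "l2 MV (Gd u) <= norm12 S u / sqrt (viscosity S)"
 proof -
 have "sqrt 2 * l2 MV (Dd u) <= sqrt 2 * (norm12 S u / sqrt (2 * viscosity S))"
 by (intro mult_left_mono Dd_le_norm12) auto
 also have "... = norm12 S u / sqrt (viscosity S)" by (simp add: real_sqrt_mult)
 finally show ?thesis using l2_Gd_eq[OF u] by simp
 qed
 ultimately show ?thesis by (simp add: h1_def cH_def distrib_right)
qed

lemma h1_tendsto:
 assumes "!!n. f n \<in> H12 S" "x \<in> H12 S" "(%n. norm12 S (%z. f n z - x z)) ----> 0"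
 shows "(%n. h1 (%z. f n z - x z)) ----> 0" "(%n. h1 (f n)) ----> h1 x"
proof -
 show z: "(%n. h1 (%z. f n z - x z)) ----> 0"
 proof (rule l2_tendsto_zero_sandwich)
 show "h1 (%z. f n z - x z) <= cH * norm12 S (%z. f n z - x z)" for n by (intro h1_le_norm12 H12_diff assms)
 show "(%n. cH * norm12 S (%z. f n z - x z)) ----> 0" using tendsto_mult_right_zero[OF assms(3)] .
 qed simp
 show "(%n. h1 (f n)) ----> h1 x"
 proof (rule tendsto_bound_null[OF _ z])
 fix n
 have "\<bar>l2 MV (f n) - l2 MV x\<bar> <= l2 MV (%z. f n z - x z)"
 using l2_le_diff[OF H12_D(1)[OF assms(1)[of n]] H12_D(1)[OF assms(2)]] l2_le_diff[OF H12_D(1)[OF assms(2)] H12_D(1)[OF assms(1)[of n]]]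
 l2_minus_commute[of MV x "f n"] by linarith
 moreover have "\<bar>l2 MV (Gd (f n)) - l2 MV (Gd x)\<bar> <= l2 MV (%z. Gd (f n) z - Gd x z)"
 using l2_le_diff[OF H12_D(3)[OF assms(1)[of n]] H12_D(3)[OF assms(2)]] l2_le_diff[OF H12_D(3)[OF assms(2)] H12_D(3)[OF assms(1)[of n]]]
 l2_minus_commute[of MV "Gd x" "Gd (f n)"] by linarith
 ultimately show "\<bar>h1 (f n) - h1 x\<bar> <= h1 (%z. f n z - x z)"
 unfolding h1_diff_eq[OF assms(1,2)] unfolding h1_def by linarith
 qed
qed

lemma bilinear_continuous:
 assumes d: "!!a b c. a \<in> H12 S ==> b \<in> H12 S ==> c \<in> H12 S ==> B (%x. a x - b x) c = B a c - (B b c :: real)"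
 "!!a b c. a \<in> H12 S ==> b \<in> H12 S ==> c \<in> H12 S ==> B c (%x. a x - b x) = B c a - B c b"
 and K: "!!a b. a \<in> H12 S ==> b \<in> H12 S ==> \<bar>B a b\<bar> <= K * (h1 a * h1 b)"
 and f: "!!n. f n \<in> H12 S" "x \<in> H12 S" "!!n. g n \<in> H12 S" "y \<in> H12 S"
 "(%n. norm12 S (%z. f n z - x z)) ----> 0" "(%n. norm12 S (%z. g n z - y z)) ----> 0"
 shows "(%n. B (f n) (g n)) ----> B x y"
proof (rule tendsto_bound_null)
 note F = h1_tendsto[OF f(1,2,5)] and G = h1_tendsto[OF f(3,4,6)]
 show "\<bar>B (f n) (g n) - B x y\<bar> <= K * (h1 (%z. f n z - x z) * h1 (g n)) + K * (h1 x * h1 (%z. g n z - y z))" for n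
 proof -
 have "B (f n) (g n) - B x y = B (%z. f n z - x z) (g n) + B x (%z. g n z - y z)"
 using d(1)[OF f(1)[of n] f(2) f(3)[of n]] d(2)[OF f(3)[of n] f(4) f(2)] by simp
 then show ?thesis using K[OF H12_diff[OF f(1)[of n] f(2)] f(3)[of n]] K[OF f(2) H12_diff[OF f(3)[of n] f(4)]] by linarith
 qed
 have "(%n. K * (h1 (%z. f n z - x z) * h1 (g n)) + K * (h1 x * h1 (%z. g n z - y z))) ----> K * (0 * h1 y) + K * (h1 x * 0)"
 by (intro tendsto_intros F G)
 then show "(%n. K * (h1 (%z. f n z - x z) * h1 (g n)) + K * (h1 x * h1 (%z. g n z - y z))) ----> 0" by simp
qed

lemma tri_bound: "a \<in> H12 S ==> u \<in> H12 S ==> w \<in> H12 S ==> \<bar>tri a u w\<bar> <= 19 * dmax * (h1 a * h1 u * h1 w)"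
proof -
 assume H: "a \<in> H12 S" "u \<in> H12 S" "w \<in> H12 S"
 have "19 * dmax * (l2 MV (Gd u) * (h1 a * h1 w)) <= 19 * dmax * (h1 u * (h1 a * h1 w))"
 using dens_bounds(4) h1_bounds(2)[of u] by (intro mult_left_mono mult_right_mono) auto
 then show ?thesis using tri_H12(2)[OF H] by (simp add: mult_ac)
qed

lemma tri_continuous:
 assumes f: "!!n. f n \<in> H12 S" "x \<in> H12 S" "!!n. g n \<in> H12 S" "y \<in> H12 S"
 "(%n. norm12 S (%z. f n z - x z)) ----> 0" "(%n. norm12 S (%z. g n z - y z)) ----> 0"
 shows "(%n. tri (f n) (f n) (g n)) ----> tri x x y"
proof (rule tendsto_bound_null)
 note F = h1_tendsto[OF f(1,2,5)] and G = h1_tendsto[OF f(3,4,6)]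
 let ?c = "19 * dmax" and ?d = "%n. h1 (%z. f n z - x z)" and ?e = "%n. h1 (%z. g n z - y z)"
 show "\<bar>tri (f n) (f n) (g n) - tri x x y\<bar> <= ?c * (?d n * h1 (f n) * h1 (g n)) + ?c * (h1 x * ?d n * h1 (g n)) + ?c * (h1 x * h1 x * ?e n)" for n
 proof -
 note D = H12_diff[OF f(1)[of n] f(2)] H12_diff[OF f(3)[of n] f(4)]
 have "tri (f n) (f n) (g n) - tri x x y = tri (%z. f n z - x z) (f n) (g n) + tri x (%z. f n z - x z) (g n) + tri x x (%z. g n z - y z)"
 using tri_diff(1)[OF f(1)[of n] f(2) f(1)[of n] f(3)[of n]] tri_diff(2)[OF f(1)[of n] f(2) f(2) f(3)[of n]]
 tri_diff(3)[OF f(3)[of n] f(4) f(2) f(2)] by simp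
 then show ?thesis
 using tri_bound[OF D(1) f(1)[of n] f(3)[of n]] tri_bound[OF f(2) D(1) f(3)[of n]] tri_bound[OF f(2) f(2) D(2)] by linarith
 qed
 have "(%n. ?c * (?d n * h1 (f n) * h1 (g n)) + ?c * (h1 x * ?d n * h1 (g n)) + ?c * (h1 x * h1 x * ?e n))
 ----> ?c * (0 * h1 x * h1 y) + ?c * (h1 x * 0 * h1 y) + ?c * (h1 x * h1 x * 0)"
 by (intro tendsto_intros F G)
 then show "(%n. ?c * (?d n * h1 (f n) * h1 (g n)) + ?c * (h1 x * ?d n * h1 (g n)) + ?c * (h1 x * h1 x * ?e n)) ----> 0" by simp
qed

definition dis :: "field3 => field3 => real" where "dis u w = (LINT x|MV. Dd u x \<bullet> Dd w x)"

lemma dis_facts: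
 assumes "a \<in> H12 S" "b \<in> H12 S" "c \<in> H12 S"
 shows "dis (%x. a x - b x) c = dis a c - dis b c" "dis c (%x. a x - b x) = dis c a - dis c b"
 "\<bar>dis a b\<bar> <= l2 MV (Dd a) * l2 MV (Dd b)" "dis a a = (l2 MV (Dd a))\<^sup>2"
proof -
 note sa = H12_D(4)[OF assms(1)] and sb = H12_D(4)[OF assms(2)] and sc = H12_D(4)[OF assms(3)]
 show "\<bar>dis a b\<bar> <= l2 MV (Dd a) * l2 MV (Dd b)" unfolding dis_def by (rule abs_integral_inner_le[OF sa sb])
 show "dis a a = (l2 MV (Dd a))\<^sup>2" by (simp add: dis_def l2_power2 power2_norm_eq_inner)
 have e: "dis (%x. a x - b x) c = (LINT x|MV. Dd a x \<bullet> Dd c x - Dd b x \<bullet> Dd c x)"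
 unfolding dis_def
 proof (rule integral_cong_AE)
 show "(%x. Dd (%x. a x - b x) x \<bullet> Dd c x) \<in> borel_measurable MV"
 by (rule borel_measurable_integrable[OF integrable_inner[OF H12_D(4)[OF H12_diff[OF assms(1,2)]] sc]])
 show "(%x. Dd a x \<bullet> Dd c x - Dd b x \<bullet> Dd c x) \<in> borel_measurable MV"
 by (intro borel_measurable_diff borel_measurable_integrable[OF integrable_inner] sa sb sc)
 show "AE x in MV. Dd (%x. a x - b x) x \<bullet> Dd c x = Dd a x \<bullet> Dd c x - Dd b x \<bullet> Dd c x"
 using W12_diff(3)[OF H12_W12[OF assms(1)] H12_W12[OF assms(2)]] by eventually_elim (simp add: inner_diff_left)
 qed
 then show "dis (%x. a x - b x) c = dis a c - dis b c"
 unfolding dis_def using integrable_inner[OF sa sc] integrable_inner[OF sb sc] by simp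
 then show "dis c (%x. a x - b x) = dis c a - dis c b" by (simp add: dis_def inner_commute)
qed

text \<open>The Coriolis form. Being linear in the angular velocity, it is measurable in time componentwise.\<close>

definition cor :: "real^3 => field3 => field3 => real" where
 "cor beta u w = inner2 S (%x. cross3 beta (u x)) w"

lemma sqint_cross: "sqint MV u ==> sqint MV (%x. cross3 beta (u x))"
 by (rule sqint_linear_image[OF linear_cross(2)])

lemma cor_bound: "sqint MV u ==> sqint MV w ==> \<bar>cor beta u w\<bar> <= dmax * norm beta * (l2 MV u * l2 MV w)"
proof -
 assume u: "sqint MV u" and w: "sqint MV w"
 have "l2 MV (%x. cross3 beta (u x)) <= l2 MV (%x. norm beta *\<^sub>R u x)"
 by (rule l2_mono[OF sqint_cross[OF u] sqint_scaleR[OF u]]) (simp add: norm_cross_le)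
 then have "l2 MV (%x. cross3 beta (u x)) <= norm beta * l2 MV u" by (simp add: l2_scaleR)
 then have "dmax * (l2 MV (%x. cross3 beta (u x)) * l2 MV w) <= dmax * (norm beta * l2 MV u * l2 MV w)"
 using dens_bounds(4) by (intro mult_left_mono mult_right_mono) auto
 then show ?thesis using inner2_bound[OF sqint_cross[OF u] w, of beta] unfolding cor_def by (simp add: mult_ac)
qed

lemma cor_diff:
 assumes "sqint MV u" "sqint MV w" "sqint MV z"
 shows "cor beta (%x. u x - w x) z = cor beta u z - cor beta w z" "cor beta z (%x. u x - w x) = cor beta z u - cor beta z w"
 "cor (beta - \<gamma>) u w = cor beta u w - cor \<gamma> u w" "cor beta u w = - cor beta w u" "cor beta u w = (\<Sum>i\<in>UNIV. beta $ i * cor (axis i 1) u w)"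
proof -
 have eq: "(%x. cross3 beta (u x - w x)) = (%x. cross3 beta (u x) - cross3 beta (w x))"
 by (simp add: Cross3.right_diff_distrib)
 show "cor beta (%x. u x - w x) z = cor beta u z - cor beta w z"
 unfolding cor_def eq by (rule inner2_diff[OF sqint_cross[OF assms(1)] sqint_cross[OF assms(2)] assms(3)])
 show "cor beta z (%x. u x - w x) = cor beta z u - cor beta z w"
 unfolding cor_def using inner2_diff[OF assms(1,2) sqint_cross[OF assms(3)], of beta]
 by (simp add: inner2_commute[of "%x. cross3 beta (z x)"])
 have "(%x. cross3 (beta - \<gamma>) (u x)) = (%x. cross3 beta (u x) - cross3 \<gamma> (u x))"
 by (simp add: Cross3.left_diff_distrib)
 then show "cor (beta - \<gamma>) u w = cor beta u w - cor \<gamma> u w"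
 unfolding cor_def using inner2_diff[OF sqint_cross[OF assms(1), of beta] sqint_cross[OF assms(1), of \<gamma>] assms(2)] by simp
 have "cross3 beta (u x) \<bullet> w x = - (cross3 beta (w x) \<bullet> u x)" for x by (simp add: cross3_simps)
 then show "cor beta u w = - cor beta w u" by (simp add: cor_def inner2_def)
 have "dens x * (cross3 beta (u x) \<bullet> w x) = (\<Sum>i\<in>UNIV. beta $ i * (dens x * (cross3 (axis i 1) (u x) \<bullet> w x)))" for x
 by (simp add: sum_3 cross3_simps axis_def)
 then show "cor beta u w = (\<Sum>i\<in>UNIV. beta $ i * cor (axis i 1) u w)"
 unfolding cor_def inner2_def using inner2_integrable[OF sqint_cross[OF assms(1)] assms(2)] by simp
qed

lemma H2_D:
 assumes "u \<in> H2 S"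
 shows "sqint MV u" "EX phi. (\<forall>n::nat. phi n \<in> D_R S) & (%n. l2 MV (%x. phi n x - u x)) ----> 0"
proof -
 show u: "sqint MV u" using assms by (simp add: H2_def Lq_space_2_iff)
 obtain phi where phi: "!!n::nat. phi n \<in> D_R S" "(%n. norm2 S (%x. phi n x - u x)) ----> 0"
 using assms by (auto simp: H2_def)
 have "(%n. l2 MV (%x. phi n x - u x)) ----> 0"
 proof (rule l2_tendsto_zero_sandwich)
 show "l2 MV (%x. phi n x - u x) <= norm2 S (%x. phi n x - u x) / sqrt dmin" for n
 by (intro l2_le_norm2 sqint_diff sqint_D_R phi u)
 show "(%n. norm2 S (%x. phi n x - u x) / sqrt dmin) ----> 0"
 using tendsto_divide[OF phi(2) tendsto_const[of "sqrt dmin"]] dens_bounds(3) by simp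
 qed simp
 with phi(1) show "EX phi. (\<forall>n::nat. phi n \<in> D_R S) & (%n. l2 MV (%x. phi n x - u x)) ----> 0" by blast
qed

lemma inner_B_bound: "\<exists>C>0. ALL u w. sqint MV u --> sqint MV w --> \<bar>inner_B S u w\<bar> <= C * (l2 MV u * l2 MV w)"
proof -
 obtain Cb where Cb: "0 < Cb" "!!w. sqint MV w ==> norm (b_vec S w) <= Cb * l2 MV w" using b_vec_bound by blast
 obtain CJ where CJ: "0 < CJ" "!!beta. norm (J *v beta) <= CJ * norm beta" using J_bound by blast
 have "\<bar>inner_B S u w\<bar> <= (dmax + Cb * CJ * Cb) * (l2 MV u * l2 MV w)" if u: "sqint MV u" and w: "sqint MV w" for u w
 proof -
 have "\<bar>b_vec S u \<bullet> (J *v b_vec S w)\<bar> <= norm (b_vec S u) * norm (J *v b_vec S w)" by (rule Cauchy_Schwarz_ineq2)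
 also have "... <= (Cb * l2 MV u) * (CJ * (Cb * l2 MV w))"
 using CJ Cb(1) Cb(2)[OF u] Cb(2)[OF w] order_trans[OF CJ(2)[of "b_vec S w"] mult_left_mono[OF Cb(2)[OF w]]]
 by (intro mult_mono) auto
 finally have "\<bar>b_vec S u \<bullet> (J *v b_vec S w)\<bar> <= Cb * CJ * Cb * (l2 MV u * l2 MV w)" by (simp add: mult_ac)
 then show ?thesis using inner2_bound[OF u w] unfolding inner_B_def distrib_right by linarith
 qed
 moreover have "0 < dmax + Cb * CJ * Cb" using dens_bounds(4) Cb CJ by (simp add: add_pos_pos)
 ultimately show ?thesis by blast
qed

lemma energy_nonneg: "sqint MV w ==> 0 <= energy S w"
proof -
 assume w: "sqint MV w"
 obtain c where c: "0 < c" "!!w. sqint MV w ==> c * (l2 MV w)\<^sup>2 <= energy S w" using energy_coercive by blast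
 have "0 <= c * (l2 MV w)\<^sup>2" using c(1) by simp
 with c(2)[OF w] show ?thesis by linarith
qed

lemma energy_diff: "sqint MV u ==> sqint MV w ==> energy S (%x. u x - w x) = energy S u - 2 * inner_B S u w + energy S w"
 using inner_B_diff[of u w "%x. u x - w x"] inner_B_diff[of u w u] inner_B_diff[of u w w]
 inner_B_commute[of u "%x. u x - w x"] inner_B_commute[of w "%x. u x - w x"] inner_B_commute[of w u] sqint_diff[of MV u w]
 unfolding energy_eq by linarith

end

section \<open>A single weak solution\<close>

locale wsol = gap +
 fixes v :: "real => field3" and om1 om :: "real => real^3"
 assumes ws: "weak_solution S v om1 om"
begin

definition u :: "real => field3" where "u = extend S v om"
definition W :: "real => real^3" where "W = Omega S v om1 om"
definition c :: "real => real^3" where "c t = cross3 (om1 t) (J *v W t)"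
text \<open>All terms under the time integral of the momentum identity, as one form in the test field.\<close>

definition F :: "real => field3 => real" where
 "F t w = 2 * viscosity S * dis (u t) w + b_vec S w \<bullet> c t + tri (u t) (u t) w + 2 * cor (om1 t) (u t) w"

lemma ws_unfolded:
 "weakly_continuous_H2 S u" "u \<in> Bochner_Lp 2 {0<..} (H12 S) (norm12 S)" "continuous_on {0..} W"
 "momentum_identities S u W" "t \<ge> 0 ==> energy_inequality S u W 0 t"
 using ws by (simp_all add: weak_solution_def Let_def u_def W_def)

lemma om1_eq: "om1 t = W t + b_vec S (u t)"
 by (simp add: W_def Omega_def u_def)

lemma u_ball: "x \<in> cball 0 R ==> u t x = cross3 (om t) x"
 by (simp add: u_def extend_def)

lemma u_liquid: "x \<in> liquid S ==> u t x = v t x"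
 by (simp add: u_def extend_def liquid_def)

lemma u_H2: "0 <= t ==> u t \<in> H2 S"
 using ws_unfolded(1) by (simp add: weakly_continuous_H2_def)

lemma u_sq: "0 <= t ==> sqint MV (u t)"
 by (rule H2_D(1)[OF u_H2])

lemma u_bochner: "u \<in> Bochner_Lp 2 {0<..<T} (H12 S) (norm12 S)"
 by (rule bochner_subset[OF ws_unfolded(2)]) auto

lemma u_strong: "strongly_measurable {0<..<T} (H12 S) (norm12 S) u" "AE t in Leb {0<..<T}. u t \<in> H12 S"
 using u_bochner[of T] by (auto simp: Bochner_Lp_def)

lemma integrable_norm12: "integrable (Leb {0<..<T}) (%t. (norm12 S (u t))\<^sup>2)"
 using u_bochner[of T] by (simp add: Bochner_Lp_def powr_numeral)

lemma bounded: "\<exists>B\<ge>0. \<forall>t\<ge>0. l2 MV (u t) <= B"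
proof -
 obtain k where k: "0 < k" "!!w. sqint MV w ==> k * (l2 MV w)\<^sup>2 <= energy S w" using energy_coercive by blast
 define E where "E = energy S (u 0) + W 0 \<bullet> (J *v W 0)"
 have "l2 MV (u t) <= sqrt (E / k)" if t: "0 <= t" for t
 proof (rule real_le_rsqrt)
 have "0 <= 4 * viscosity S * (LINT tau|Leb {0..t}. (Lq_norm 2 (liquid S) (Dd (u tau)))\<^sup>2)"
 using pos by (intro mult_nonneg_nonneg Bochner_Integration.integral_nonneg) auto
 moreover have "0 <= W t \<bullet> (J *v W t)" using J_lower[of "W t"] pos by (simp add: order_trans[rotated])
 ultimately have "energy S (u t) <= E" using ws_unfolded(5)[OF t] by (simp add: energy_inequality_def E_def)
 then have "k * (l2 MV (u t))\<^sup>2 <= E" using k(2)[OF u_sq[OF t]] by simp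
 then show "(l2 MV (u t))\<^sup>2 <= E / k" using k(1) by (simp add: pos_le_divide_eq mult.commute)
 qed
 moreover have "0 <= sqrt (E / k)" using calculation[of 0] by (metis l2_nonneg order_refl order_trans)
 ultimately show ?thesis by blast
qed

lemma W_bounded: "\<exists>B\<ge>0. \<forall>t\<in>{0..T}. norm (W t) <= B"
proof -
 have "bounded (W ` {0..T})"
 by (intro compact_imp_bounded compact_continuous_image continuous_on_subset[OF ws_unfolded(3)]) auto
 then obtain B where "\<forall>t\<in>{0..T}. norm (W t) <= B" by (auto simp: bounded_iff)
 then show ?thesis by (intro exI[of _ "\<bar>B\<bar>"]) auto
qed

lemma om1_bounded: "\<exists>B\<ge>0. \<forall>t\<in>{0..T}. norm (om1 t) <= B"
proof -
 obtain B where B: "0 <= B" "\<forall>t\<in>{0..T}. norm (W t) <= B" using W_bounded by blast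
 obtain B' where B': "0 <= B'" "!!t. 0 <= t ==> l2 MV (u t) <= B'" using bounded by blast
 obtain Cb where Cb: "0 < Cb" "!!w. sqint MV w ==> norm (b_vec S w) <= Cb * l2 MV w" using b_vec_bound by blast
 have "norm (om1 t) <= B + Cb * B'" if t: "t \<in> {0..T}" for t
 proof -
 have "norm (b_vec S (u t)) <= Cb * l2 MV (u t)" using t by (intro Cb u_sq) auto
 also have "... <= Cb * B'" using t Cb by (intro mult_left_mono B') auto
 finally have "norm (b_vec S (u t)) <= Cb * B'" .
 moreover have "norm (W t) <= B" using B(2) t by (rule bspec)
 ultimately show ?thesis using norm_triangle_ineq[of "W t" "b_vec S (u t)"] unfolding om1_eq[of t] by linarith
 qed
 moreover have "0 <= B + Cb * B'" using B B' Cb by simp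
 ultimately show ?thesis by (intro exI[of _ "B + Cb * B'"]) simp
qed

lemma c_bounded: "\<exists>B\<ge>0. \<forall>t\<in>{0..T}. norm (c t) <= B"
proof -
 obtain B where B: "0 <= B" "\<forall>t\<in>{0..T}. norm (W t) <= B" using W_bounded by blast
 obtain B' where B': "0 <= B'" "\<forall>t\<in>{0..T}. norm (om1 t) <= B'" using om1_bounded by blast
 obtain CJ where CJ: "0 < CJ" "!!beta. norm (J *v beta) <= CJ * norm beta" using J_bound by blast
 have "norm (c t) <= B' * (CJ * B)" if t: "t \<in> {0..T}" for t
 proof -
 have "norm (J *v W t) <= CJ * B" using CJ(1) B(2) t by (intro order_trans[OF CJ(2)] mult_left_mono) auto
 then show ?thesis unfolding c_def using B' B CJ t by (intro order_trans[OF norm_cross_le] mult_mono) auto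
 qed
 moreover have "0 <= B' * (CJ * B)" using B B' CJ by simp
 ultimately show ?thesis by (intro exI[of _ "B' * (CJ * B)"]) simp
qed

lemma measurable_time_pair:
 assumes w: "strongly_measurable {0<..<T} (H12 S) (norm12 S) w" "AE t in Leb {0<..<T}. w t \<in> H12 S"
 shows "(%t. dis (u t) (w t)) \<in> borel_measurable (Leb {0<..<T})"
 "(%t. tri (u t) (u t) (w t)) \<in> borel_measurable (Leb {0<..<T})"
 "(%t. cor beta (u t) (w t)) \<in> borel_measurable (Leb {0<..<T})"
 "(%t. inner_B S (u t) (w t)) \<in> borel_measurable (Leb {0<..<T})"
 "(%t. b_vec S (w t) $ i) \<in> borel_measurable (Leb {0<..<T})"
proof -
 have I: "{0<..<T} \<in> sets lebesgue" by simp
 have bil: "(%t. B (u t) (w t)) \<in> borel_measurable (Leb {0<..<T})"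
 if d: "!!a b c. a \<in> H12 S ==> b \<in> H12 S ==> c \<in> H12 S ==> B (%x. a x - b x) c = B a c - B b c"
 "!!a b c. a \<in> H12 S ==> b \<in> H12 S ==> c \<in> H12 S ==> B c (%x. a x - b x) = B c a - B c b"
 "!!a b. a \<in> H12 S ==> b \<in> H12 S ==> \<bar>B a b\<bar> <= K * (h1 a * h1 b)"
 for B :: "field3 => field3 => real" and K
 by (rule strongly_measurable_pair[OF I u_strong w, where Q = B]) (rule bilinear_continuous[where B = B, OF d])
 show "(%t. tri (u t) (u t) (w t)) \<in> borel_measurable (Leb {0<..<T})"
 by (rule strongly_measurable_pair[OF I u_strong w, where Q = "%a b. tri a a b"]) (rule tri_continuous)
 show "(%t. dis (u t) (w t)) \<in> borel_measurable (Leb {0<..<T})"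
 proof (rule bil[where B = "dis" and K = "1"])
 show "\<bar>dis a b\<bar> <= 1 * (h1 a * h1 b)" if "a \<in> H12 S" "b \<in> H12 S" for a b
 proof -
 have "\<bar>dis a b\<bar> <= l2 MV (Dd a) * l2 MV (Dd b)" by (rule dis_facts[OF that that(1)])
 also have "... <= h1 a * h1 b"
 by (intro mult_mono order_trans[OF l2_Dd_le[OF H12_W12[OF that(1)]] h1_bounds(2)] order_trans[OF l2_Dd_le[OF H12_W12[OF that(2)]] h1_bounds(2)]) auto
 finally show ?thesis by simp
 qed
 qed (rule dis_facts, assumption+)+
 show "(%t. cor beta (u t) (w t)) \<in> borel_measurable (Leb {0<..<T})"
 proof (rule bil[where B = "cor beta" and K = "dmax * norm beta"])
 show "\<bar>cor beta a b\<bar> <= (dmax * norm beta) * (h1 a * h1 b)" if "a \<in> H12 S" "b \<in> H12 S" for a b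
 proof -
 have "\<bar>cor beta a b\<bar> <= dmax * norm beta * (l2 MV a * l2 MV b)" by (intro cor_bound H12_D that)
 also have "... <= (dmax * norm beta) * (h1 a * h1 b)"
 using dens_bounds(4) by (intro mult_left_mono mult_mono h1_bounds) auto
 finally show ?thesis .
 qed
 qed (rule cor_diff; rule H12_D; assumption)+
 obtain CB where CB: "0 < CB" "!!u w. sqint MV u ==> sqint MV w ==> \<bar>inner_B S u w\<bar> <= CB * (l2 MV u * l2 MV w)" using inner_B_bound by blast
 show "(%t. inner_B S (u t) (w t)) \<in> borel_measurable (Leb {0<..<T})"
 proof (rule bil[where B = "inner_B S" and K = "CB"])
 show "\<bar>inner_B S a b\<bar> <= CB * (h1 a * h1 b)" if "a \<in> H12 S" "b \<in> H12 S" for a b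
 proof -
 have "\<bar>inner_B S a b\<bar> <= CB * (l2 MV a * l2 MV b)" by (intro CB H12_D that)
 also have "... <= CB * (h1 a * h1 b)" using CB(1) by (intro mult_left_mono mult_mono h1_bounds) auto
 finally show ?thesis .
 qed
 show "inner_B S f (%x. a x - b x) = inner_B S f a - inner_B S f b" if "a \<in> H12 S" "b \<in> H12 S" "f \<in> H12 S" for a b f
 using inner_B_diff[OF H12_D(1)[OF that(1)] H12_D(1)[OF that(2)] H12_D(1)[OF that(3)]]
 by (simp add: inner_B_commute[of f])
 qed (rule inner_B_diff; rule H12_D; assumption)
 obtain Cb where Cb: "0 < Cb" "!!w. sqint MV w ==> norm (b_vec S w) <= Cb * l2 MV w" using b_vec_bound by blast
 show "(%t. b_vec S (w t) $ i) \<in> borel_measurable (Leb {0<..<T})"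
 proof (rule strongly_measurable_pair[OF I u_strong w, where Q = "%a b. b_vec S b $ i"])
 fix f x g y assume H: "!!n::nat. g n \<in> H12 S" "y \<in> H12 S" "(%n. norm12 S (%z. g n z - y z)) ----> 0"
 show "(%n. b_vec S (g n) $ i) ----> b_vec S y $ i"
 proof (rule tendsto_bound_null)
 show "\<bar>b_vec S (g n) $ i - b_vec S y $ i\<bar> <= Cb * h1 (%z. g n z - y z)" for n
 proof -
 have "\<bar>b_vec S (g n) $ i - b_vec S y $ i\<bar> = \<bar>b_vec S (%z. g n z - y z) $ i\<bar>"
 by (simp add: b_vec_diff H12_D H)
 also have "... <= norm (b_vec S (%z. g n z - y z))" by (rule component_le_norm_cart)
 also have "... <= Cb * l2 MV (%z. g n z - y z)" by (intro Cb sqint_diff H12_D H)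
 also have "... <= Cb * h1 (%z. g n z - y z)" using Cb(1) by (intro mult_left_mono h1_bounds) auto
 finally show ?thesis .
 qed
 show "(%n. Cb * h1 (%z. g n z - y z)) ----> 0" by (rule tendsto_mult_right_zero[OF h1_tendsto(1)[OF H]])
 qed
 qed
qed

lemma measurable_vec_time:
 fixes f :: "real => real^3"
 assumes "!!i. (%t. f t $ i) \<in> borel_measurable M" shows "f \<in> borel_measurable M"
proof (rule borel_measurable_euclidean_space[THEN iffD2], rule ballI)
 fix b :: "real^3" assume "b \<in> Basis"
 then obtain i where "b = axis i 1" by (auto simp: Basis_vec_def)
 then show "(%t. f t \<bullet> b) \<in> borel_measurable M" using assms[of i] by (simp add: inner_axis)
qed

lemma measurable_component_time:
 fixes f :: "real => real^3"
 assumes "f \<in> borel_measurable M" shows "(%t. f t $ i) \<in> borel_measurable M"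
 using borel_measurable_continuous_on[OF linear_continuous_on[OF bounded_linear_vec_nth] assms] by simp

lemma measurable_c: "om1 \<in> borel_measurable (Leb {0<..<T})" "W \<in> borel_measurable (Leb {0<..<T})" "c \<in> borel_measurable (Leb {0<..<T})"
proof -
 let ?M = "Leb {0<..<T}"
 show W: "W \<in> borel_measurable ?M"
 by (rule continuous_imp_measurable_on_sets_lebesgue[OF continuous_on_subset[OF ws_unfolded(3)]]) auto
 have b: "(%t. b_vec S (u t)) \<in> borel_measurable ?M"
 by (rule measurable_vec_time[OF measurable_time_pair(5)[OF u_strong]])
 show o: "om1 \<in> borel_measurable ?M"
 using borel_measurable_add[OF W b] unfolding ext[of om1 "%t. W t + b_vec S (u t)", OF om1_eq, symmetric] .
 have JW: "(%t. J *v W t) \<in> borel_measurable ?M"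
 by (rule borel_measurable_continuous_on[OF linear_continuous_on[OF matrix_vector_mul_bounded_linear] W])
 note comp = measurable_component_time[OF o] measurable_component_time[OF JW]
 show "c \<in> borel_measurable ?M"
 proof (rule measurable_vec_time)
 fix i :: 3
 have "(%t. c t $ 1) \<in> borel_measurable ?M" "(%t. c t $ 2) \<in> borel_measurable ?M" "(%t. c t $ 3) \<in> borel_measurable ?M"
 unfolding c_def cross_components by (intro borel_measurable_diff borel_measurable_times comp)+
 then show "(%t. c t $ i) \<in> borel_measurable ?M" using exhaust_3[of i] by auto
 qed
qed

lemma measurable_rest:
 assumes w: "strongly_measurable {0<..<T} (H12 S) (norm12 S) w" "AE t in Leb {0<..<T}. w t \<in> H12 S"
 shows "(%t. b_vec S (w t) \<bullet> c t) \<in> borel_measurable (Leb {0<..<T})"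
 "(%t. cor (om1 t) (u t) (w t)) \<in> borel_measurable (Leb {0<..<T})"
 "(%t. F t (w t)) \<in> borel_measurable (Leb {0<..<T})"
proof -
 let ?M = "Leb {0<..<T}"
 have I: "{0<..<T} \<in> sets lebesgue" by simp
 show b: "(%t. b_vec S (w t) \<bullet> c t) \<in> borel_measurable ?M"
 by (intro borel_measurable_inner measurable_c measurable_vec_time measurable_time_pair(5)[OF w])
 have "(%t. \<Sum>i\<in>UNIV. om1 t $ i * cor (axis i 1) (u t) (w t)) \<in> borel_measurable ?M"
 by (intro borel_measurable_sum borel_measurable_times measurable_component_time measurable_c measurable_time_pair(3)[OF w])
 moreover have "AE t in ?M. (\<Sum>i\<in>UNIV. om1 t $ i * cor (axis i 1) (u t) (w t)) = cor (om1 t) (u t) (w t)"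
 using w(2) u_strong(2)[of T] by eventually_elim (rule cor_diff(5)[OF H12_D(1) H12_D(1) H12_D(1), symmetric])
 ultimately show co: "(%t. cor (om1 t) (u t) (w t)) \<in> borel_measurable ?M"
 by (rule borel_measurable_lebesgue_on_AE[OF I])
 show "(%t. F t (w t)) \<in> borel_measurable ?M"
 unfolding F_def by (intro borel_measurable_add borel_measurable_times borel_measurable_const b co measurable_time_pair(1,2)[OF w])
qed

lemma const_strong: "w \<in> H12 S ==> strongly_measurable {0<..<T} (H12 S) (norm12 S) (%t. w)"
 unfolding strongly_measurable_def by (intro exI[of _ "%_ _. w"]) (auto simp: zero_H12 image_constant_conv)

lemma rest_bound: "\<exists>C\<ge>0. \<forall>t\<in>{0..T}. ALL w. sqint MV w --> \<bar>b_vec S w \<bullet> c t\<bar> + 2 * \<bar>cor (om1 t) (u t) w\<bar> <= C * l2 MV w"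
proof -
 obtain Bc where Bc: "0 <= Bc" "\<forall>t\<in>{0..T}. norm (c t) <= Bc" using c_bounded by blast
 obtain Bo where Bo: "0 <= Bo" "\<forall>t\<in>{0..T}. norm (om1 t) <= Bo" using om1_bounded by blast
 obtain B where B: "0 <= B" "!!t. 0 <= t ==> l2 MV (u t) <= B" using bounded by blast
 obtain Cb where Cb: "0 < Cb" "!!w. sqint MV w ==> norm (b_vec S w) <= Cb * l2 MV w" using b_vec_bound by blast
 have "\<bar>b_vec S w \<bullet> c t\<bar> + 2 * \<bar>cor (om1 t) (u t) w\<bar> <= (Cb * Bc + 2 * (dmax * Bo * B)) * l2 MV w" if t: "t \<in> {0..T}" and w: "sqint MV w" for t w
 proof -
 have "\<bar>b_vec S w \<bullet> c t\<bar> <= norm (b_vec S w) * norm (c t)" by (rule Cauchy_Schwarz_ineq2)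
 also have "... <= (Cb * l2 MV w) * Bc" using Cb Bc t w by (intro mult_mono) auto
 finally have 1: "\<bar>b_vec S w \<bullet> c t\<bar> <= Cb * Bc * l2 MV w" by (simp add: mult_ac)
 have "\<bar>cor (om1 t) (u t) w\<bar> <= dmax * norm (om1 t) * (l2 MV (u t) * l2 MV w)" using t by (intro cor_bound u_sq w) auto
 also have "... <= dmax * Bo * (B * l2 MV w)" using t Bo B dens_bounds(4) by (intro mult_mono) auto
 finally show ?thesis using 1 by (simp add: algebra_simps)
 qed
 moreover have "0 <= Cb * Bc + 2 * (dmax * Bo * B)" using Cb Bc Bo B dens_bounds(4) by (intro add_nonneg_nonneg mult_nonneg_nonneg) auto
 ultimately show ?thesis by (intro exI[of _ "Cb * Bc + 2 * (dmax * Bo * B)"]) simp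
qed

lemma dis_bound: "a \<in> H12 S ==> w \<in> H12 S ==> 2 * viscosity S * \<bar>dis a w\<bar> <= norm12 S a * norm12 S w"
proof -
 assume H: "a \<in> H12 S" "w \<in> H12 S"
 have "\<bar>dis a w\<bar> <= (norm12 S a / sqrt (2 * viscosity S)) * (norm12 S w / sqrt (2 * viscosity S))"
 by (rule order_trans[OF dis_facts(3)[OF H H(1)]]) (intro mult_mono Dd_le_norm12; use pos in simp)
 also have "... = norm12 S a * norm12 S w / (2 * viscosity S)" using pos by simp
 finally show ?thesis using pos by (simp add: field_simps)
qed

lemma integrable_F_pieces:
 assumes w: "w \<in> H12 S"
 shows "integrable (Leb {0<..<T}) (%t. dis (u t) w)" "integrable (Leb {0<..<T}) (%t. tri (u t) (u t) w)"
 "integrable (Leb {0<..<T}) c" "integrable (Leb {0<..<T}) (%t. cor (om1 t) (u t) w)"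
 "integrable (Leb {0<..<T}) (%t. F t w)"
proof -
 let ?M = "Leb {0<..<T}"
 have wM: "strongly_measurable {0<..<T} (H12 S) (norm12 S) (%t. w)" "AE t in ?M. w \<in> H12 S" using const_strong[OF w] w by auto
 have fm: "finite_measure ?M" by (rule finite_measure_lebesgue_on) (use lmeasurable_interval(2)[of 0 T] in simp)
 then have const: "integrable ?M (%t. k)" for k :: real by (rule finite_measure.integrable_const)
 obtain C where C: "0 <= C" "!!t. t \<in> {0..T} ==> \<bar>b_vec S w \<bullet> c t\<bar> + 2 * \<bar>cor (om1 t) (u t) w\<bar> <= C * l2 MV w" using rest_bound[of T] H12_D(1)[OF w] by blast
 show d: "integrable ?M (%t. dis (u t) w)"
 proof (rule Bochner_Integration.integrable_bound[where f = "%t. ((norm12 S (u t))\<^sup>2 + 1) * (norm12 S w / (2 * viscosity S))"])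
 show "integrable ?M (%t. ((norm12 S (u t))\<^sup>2 + 1) * (norm12 S w / (2 * viscosity S)))"
 using integrable_norm12 const by auto
 show "(%t. dis (u t) w) \<in> borel_measurable ?M" by (rule measurable_time_pair(1)[OF wM])
 show "AE t in ?M. norm (dis (u t) w) <= norm (((norm12 S (u t))\<^sup>2 + 1) * (norm12 S w / (2 * viscosity S)))"
 using u_strong(2)
 proof eventually_elim
 case (elim t)
 have "norm12 S (u t) <= (norm12 S (u t))\<^sup>2 + 1"
 using sum_squares_bound[of "norm12 S (u t)" 1] norm12_nonneg(1)[of "u t"] unfolding mult_1_right one_power2 by linarith
 then have "norm12 S (u t) * norm12 S w <= ((norm12 S (u t))\<^sup>2 + 1) * norm12 S w" by (intro mult_right_mono) auto
 then have "\<bar>dis (u t) w\<bar> <= ((norm12 S (u t))\<^sup>2 + 1) * norm12 S w / (2 * viscosity S)"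
 using dis_bound[OF elim w] pos(3) by (simp add: pos_le_divide_eq mult.commute)
 then show ?case unfolding real_norm_def times_divide_eq_right by (rule order_trans[OF _ abs_ge_self])
 qed
 qed
 show t: "integrable ?M (%t. tri (u t) (u t) w)"
 proof (rule Bochner_Integration.integrable_bound[where f = "%t. (19 * dmax * cH\<^sup>2 * h1 w) * (norm12 S (u t))\<^sup>2"])
 show "integrable ?M (%t. (19 * dmax * cH\<^sup>2 * h1 w) * (norm12 S (u t))\<^sup>2)" using integrable_norm12 by auto
 show "(%t. tri (u t) (u t) w) \<in> borel_measurable ?M" by (rule measurable_time_pair(2)[OF wM])
 show "AE t in ?M. norm (tri (u t) (u t) w) <= norm ((19 * dmax * cH\<^sup>2 * h1 w) * (norm12 S (u t))\<^sup>2)"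
 using u_strong(2)
 proof eventually_elim
 case (elim t)
 have "h1 (u t) * h1 (u t) <= (cH * norm12 S (u t)) * (cH * norm12 S (u t))"
 using cH_pos by (intro mult_mono h1_le_norm12 elim) auto
 then have "19 * dmax * (h1 (u t) * h1 (u t) * h1 w) <= 19 * dmax * ((cH * norm12 S (u t)) * (cH * norm12 S (u t)) * h1 w)"
 using dens_bounds(4) by (intro mult_left_mono mult_right_mono) auto
 then have "\<bar>tri (u t) (u t) w\<bar> <= (19 * dmax * cH\<^sup>2 * h1 w) * (norm12 S (u t))\<^sup>2"
 using tri_bound[OF elim elim w] by (simp add: power2_eq_square mult_ac)
 then show ?case by simp
 qed
 qed
 obtain Bc where Bc: "0 <= Bc" "\<forall>t\<in>{0..T}. norm (c t) <= Bc" using c_bounded by blast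
 show ci: "integrable ?M c"
 by (rule Bochner_Integration.integrable_bound[OF const[of Bc] measurable_c(3)]) (use Bc in \<open>auto intro!: AE_I2\<close>)
 show co: "integrable ?M (%t. cor (om1 t) (u t) w)"
 proof (rule Bochner_Integration.integrable_bound[OF const[of "C * l2 MV w"] measurable_rest(2)[OF wM]], rule AE_I2)
 fix t assume "t \<in> space ?M"
 then have "\<bar>cor (om1 t) (u t) w\<bar> <= C * l2 MV w" using C(2)[of t] by auto
 then show "norm (cor (om1 t) (u t) w) <= norm (C * l2 MV w)" by simp
 qed
 show "integrable ?M (%t. F t w)"
 unfolding F_def using d t co integrable_inner_right[OF ci, of "b_vec S w"] by simp
qed

text \<open>The separate integrals of the definition may be added only because each of them converges for a
 fixed test field.\<close>

lemma momentum:
 assumes w: "w \<in> H12 S" and t: "0 <= t"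
 shows "integrable (Leb {0..t}) (%tau. F tau w)" "inner_B S (u t) w + (LINT tau|Leb {0..t}. F tau w) = inner_B S (u 0) w"
 "integrable (Leb {0..t}) c" "J *v W t + (LINT tau|Leb {0..t}. c tau) = J *v W 0"
proof -
 let ?M = "Leb {0..t}"
 note i = integrable_F_pieces[OF w, of t, folded integrable_Icc_Ioo]
 show "integrable ?M (%tau. F tau w)" "integrable ?M c" by (rule i)+
 have cc: "cross3 (W tau + b_vec S (u tau)) (J *v W tau) = c tau" for tau by (simp add: c_def flip: om1_eq)
 show "J *v W t + (LINT tau|Leb {0..t}. c tau) = J *v W 0"
 using ws_unfolded(4) t unfolding momentum_identities_def cc by blast
 have conv: "(LINT tau|?M. (LINT x|MV. dens x * ((Gd (u tau) x *v u tau x + 2 *\<^sub>R cross3 (W tau + b_vec S (u tau)) (u tau x)) \<bullet> w x)))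
 = (LINT tau|?M. tri (u tau) (u tau) w + 2 * cor (om1 tau) (u tau) w)" (is "(LINT tau|?M. ?L tau) = (LINT tau|?M. ?R tau)")
 proof -
 have R: "?R \<in> borel_measurable ?M" using i by auto
 have "AE tau in Leb {0<..<t}. ?R tau = ?L tau"
 using u_strong(2)
 proof eventually_elim
 case (elim tau)
 have "?L tau = (LINT x|MV. dens x * ((Gd (u tau) x *v u tau x) \<bullet> w x) + 2 * (dens x * (cross3 (om1 tau) (u tau x) \<bullet> w x)))"
 unfolding om1_eq[symmetric] by (simp add: inner_add_left distrib_left mult_ac)
 also have "... = ?R tau"
 unfolding tri_def cor_def inner2_def
 using tri_H12(1)[OF elim elim w] inner2_integrable[OF sqint_cross[OF H12_D(1)[OF elim]] H12_D(1)[OF w]] by simp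
 finally show ?case by simp
 qed
 then have "AE tau in lebesgue. tau \<in> {0<..<t} --> ?R tau = ?L tau" by (simp add: AE_restrict_space_iff)
 moreover have "AE tau in lebesgue. tau ~: {0, t}" by (rule AE_not_in) (simp add: negligible_iff_null_sets[symmetric])
 ultimately have "AE tau in lebesgue. tau \<in> {0..t} --> ?R tau = ?L tau" by eventually_elim auto
 then have ae: "AE tau in ?M. ?R tau = ?L tau" by (simp add: AE_restrict_space_iff)
 have L: "?L \<in> borel_measurable ?M" by (rule borel_measurable_lebesgue_on_AE[OF _ R ae]) simp
 show ?thesis by (rule integral_cong_AE[OF L R]) (use ae in \<open>rule eventually_mono, simp\<close>)
 qed
 have "inner_B S (u t) w + 2 * viscosity S * (LINT tau|?M. dis (u tau) w) + b_vec S w \<bullet> (LINT tau|?M. c tau)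
 + (LINT tau|?M. tri (u tau) (u tau) w + 2 * cor (om1 tau) (u tau) w) = inner_B S (u 0) w"
 using conjunct1[OF ws_unfolded(4)[unfolded momentum_identities_def], rule_format, OF w t] unfolding cc conv dis_def .
 moreover have "(LINT tau|?M. F tau w) = 2 * viscosity S * (LINT tau|?M. dis (u tau) w) + b_vec S w \<bullet> (LINT tau|?M. c tau)
 + (LINT tau|?M. tri (u tau) (u tau) w + 2 * cor (om1 tau) (u tau) w)"
 unfolding F_def using i integrable_inner_right[OF i(3), of "b_vec S w"] by (simp add: integral_inner_right)
 ultimately show "inner_B S (u t) w + (LINT tau|Leb {0..t}. F tau w) = inner_B S (u 0) w" by simp
qed

lemma increments:
 assumes w: "w \<in> H12 S" and rt: "0 <= r" "r <= t"
 shows "inner_B S (u t) w - inner_B S (u r) w = - (LINT tau|Leb {r..t}. F tau w)"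
 "beta \<bullet> (J *v W t) - beta \<bullet> (J *v W r) = - (LINT tau|Leb {r..t}. beta \<bullet> c tau)"
 "integrable (Leb {r..t}) (%tau. F tau w)" "integrable (Leb {r..t}) (%tau. beta \<bullet> c tau)"
proof -
 have t: "0 <= t" using rt by simp
 note mt = momentum[OF w t] and mr = momentum[OF w rt(1)]
 show "inner_B S (u t) w - inner_B S (u r) w = - (LINT tau|Leb {r..t}. F tau w)"
 using integral_combine[OF mt(1) rt] mt(2) mr(2) by simp
 have ic: "integrable (Leb {r..t}) c" by (rule integrable_subset[OF mt(3)]) (use rt in auto)
 then show "integrable (Leb {r..t}) (%tau. beta \<bullet> c tau)" by (rule integrable_inner_right)
 have "J *v W t - J *v W r = - (LINT tau|Leb {r..t}. c tau)"
 proof -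
 have "a + (b + d) = e ==> r + b = e ==> a - r = - d" for a b d e r :: "real^3"
 proof -
 assume "a + (b + d) = e" "r + b = e"
 moreover have "a - r = (a + (b + d)) - (r + b) - d" by simp
 ultimately show ?thesis by simp
 qed
 from this[OF _ mr(4)] show ?thesis using integral_combine[OF mt(3) rt] mt(4) by simp
 qed
 then show "beta \<bullet> (J *v W t) - beta \<bullet> (J *v W r) = - (LINT tau|Leb {r..t}. beta \<bullet> c tau)"
 using integral_inner_right[OF ic, of beta] by (simp flip: inner_diff_right)
 show "integrable (Leb {r..t}) (%tau. F tau w)" by (rule integrable_subset[OF mt(1)]) (use rt in auto)
qed

text \<open>Weak continuity in the inner product of the definition is recovered from the momentum identity for
 test fields and from density, since the solution is bounded.\<close>

lemma weak_continuity:
 assumes w: "w \<in> H2 S" and t: "!!n::nat. 0 <= t n" "0 <= s" "t ----> s"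
 shows "(%n. inner_B S (u (t n)) w) ----> inner_B S (u s) w"
proof -
 have H: "(%n. inner_B S (u (t n)) z) ----> inner_B S (u s) z" if z: "z \<in> H12 S" for z
 proof -
 obtain N where N: "!!n. t n <= N" using Bseq_def[of t] convergent_imp_Bseq[of t] t(3) by (auto simp: convergent_def abs_le_iff)
 have sN: "s <= N" using LIMSEQ_le_const2[OF t(3)] N by blast
 have N0: "0 <= N" using N[of 0] t(1)[of 0] by simp
 have "continuous_on {0..N} (%x. \<integral>tau. F tau z \<partial>Leb {0..x})"
 by (rule indefinite_integral_continuous_real[OF momentum(1)[OF z N0]])
 then have "(%n. \<integral>tau. F tau z \<partial>Leb {0..t n}) ----> (LINT tau|Leb {0..s}. F tau z)"
 by (rule continuous_on_tendsto_compose[OF _ t(3)]) (use t N sN in auto)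
 then have "(%n. inner_B S (u 0) z - (LINT tau|Leb {0..t n}. F tau z)) ----> inner_B S (u 0) z - (LINT tau|Leb {0..s}. F tau z)"
 by (intro tendsto_diff tendsto_const)
 moreover have "inner_B S (u 0) z - (LINT tau|Leb {0..x}. F tau z) = inner_B S (u x) z" if "0 <= x" for x
 using momentum(2)[OF z that] by simp
 ultimately show ?thesis using t by simp
 qed
 obtain CB where CB: "0 < CB" "!!u w. sqint MV u ==> sqint MV w ==> \<bar>inner_B S u w\<bar> <= CB * (l2 MV u * l2 MV w)" using inner_B_bound by blast
 obtain B where B: "0 <= B" "!!t. 0 <= t ==> l2 MV (u t) <= B" using bounded by blast
 obtain phi where phi: "!!n::nat. phi n \<in> D_R S" "(%n. l2 MV (%x. phi n x - w x)) ----> 0" using H2_D(2)[OF w] by blast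
 have close: "\<bar>inner_B S (u x) (phi k) - inner_B S (u x) w\<bar> <= CB * B * l2 MV (%x. phi k x - w x)" if x: "0 <= x" for x k
 proof -
 note sq = u_sq[OF x] sqint_D_R[OF phi(1)[of k]] H2_D(1)[OF w]
 have "inner_B S (u x) (phi k) - inner_B S (u x) w = inner_B S (u x) (%x. phi k x - w x)"
 using inner_B_diff[OF sq(2,3,1)] by (simp add: inner_B_commute[of "u x"])
 also have "\<bar>...\<bar> <= CB * (l2 MV (u x) * l2 MV (%x. phi k x - w x))" by (intro CB sq sqint_diff)
 also have "... <= CB * (B * l2 MV (%x. phi k x - w x))" using CB(1) by (intro mult_left_mono mult_right_mono B x) auto
 finally show ?thesis by (simp add: mult.assoc)
 qed
 show ?thesis
 proof (rule LIMSEQ_I)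
 fix e :: real assume e: "0 < e"
 have "(%k. CB * B * l2 MV (%x. phi k x - w x)) ----> 0" by (rule tendsto_mult_right_zero[OF phi(2)])
 then obtain k where k: "CB * B * l2 MV (%x. phi k x - w x) < e / 4"
 using order_tendstoD(2)[of _ 0 sequentially "e / 4"] e by (auto simp: eventually_sequentially)
 obtain no where no: "!!n. n \<ge> no ==> norm (inner_B S (u (t n)) (phi k) - inner_B S (u s) (phi k)) < e / 4"
 using LIMSEQ_D[OF H[OF D_R_H12[OF phi(1)]], of "e / 4" k] e by auto
 have "norm (inner_B S (u (t n)) w - inner_B S (u s) w) < e" if "n \<ge> no" for n
 using no[OF that] close[OF t(1)[of n], of k] close[OF t(2), of k] k unfolding real_norm_def by linarith
 then show "EX no. \<forall>n\<ge>no. norm (inner_B S (u (t n)) w - inner_B S (u s) w) < e" by (intro exI[of _ no]) simp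
 qed
qed

lemma W_tendsto: "(!!n::nat. 0 <= t n) ==> 0 <= s ==> t ----> s ==> (%n. W (t n)) ----> W s"
 by (rule continuous_on_tendsto_compose[OF ws_unfolded(3)]) auto

text \<open>Weak continuity and the energy inequality started at time 0 give convergence of the norms, hence
 strong convergence.\<close>

lemma strong_at_0:
 assumes t: "!!n::nat. 0 <= t n" "t ----> 0"
 shows "(%n. l2 MV (%x. u (t n) x - u 0 x)) ----> 0"
proof -
 obtain k where k: "0 < k" "!!w. sqint MV w ==> k * (l2 MV w)\<^sup>2 <= energy S w" using energy_coercive by blast
 let ?q = "%s. W s \<bullet> (J *v W s)"
 have q: "(%n. ?q (t n)) ----> ?q 0"
 by (intro tendsto_inner W_tendsto t bounded_linear.tendsto[OF matrix_vector_mul_bounded_linear]) auto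
 have i: "(%n. inner_B S (u (t n)) (u 0)) ----> inner_B S (u 0) (u 0)"
 by (rule weak_continuity) (use t u_H2 in auto)
 have le: "k * (l2 MV (%x. u (t n) x - u 0 x))\<^sup>2 <= 2 * energy S (u 0) + (?q 0 - ?q (t n)) - 2 * inner_B S (u (t n)) (u 0)" for n
 proof -
 have "0 <= 4 * viscosity S * (LINT tau|Leb {0..t n}. (Lq_norm 2 (liquid S) (Dd (u tau)))\<^sup>2)"
 using pos by (intro mult_nonneg_nonneg Bochner_Integration.integral_nonneg) auto
 then have "energy S (u (t n)) + ?q (t n) <= energy S (u 0) + ?q 0"
 using ws_unfolded(5)[OF t(1)[of n]] by (simp add: energy_inequality_def)
 moreover have "energy S (%x. u (t n) x - u 0 x) = energy S (u (t n)) - 2 * inner_B S (u (t n)) (u 0) + energy S (u 0)"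
 by (intro energy_diff u_sq t) simp
 moreover have "k * (l2 MV (%x. u (t n) x - u 0 x))\<^sup>2 <= energy S (%x. u (t n) x - u 0 x)"
 by (intro k(2) sqint_diff u_sq t) simp
 ultimately show ?thesis by linarith
 qed
 have "(%n. 2 * energy S (u 0) + (?q 0 - ?q (t n)) - 2 * inner_B S (u (t n)) (u 0)) ----> 2 * energy S (u 0) + (?q 0 - ?q 0) - 2 * inner_B S (u 0) (u 0)"
 by (intro tendsto_intros q i)
 then have "(%n. 2 * energy S (u 0) + (?q 0 - ?q (t n)) - 2 * inner_B S (u (t n)) (u 0)) ----> 0" by (simp add: energy_eq)
 then have "(%n. k * (l2 MV (%x. u (t n) x - u 0 x))\<^sup>2) ----> 0"
 by (rule l2_tendsto_zero_sandwich[rotated 2]) (use k le in auto)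
 from tendsto_mult_right_zero[OF this, of "1 / k"] have "(%n. (l2 MV (%x. u (t n) x - u 0 x))\<^sup>2) ----> 0" using k(1) by simp
 from tendsto_real_sqrt[OF this] show ?thesis by simp
qed

end

section \<open>Bounds of the form under Serrin's condition\<close>

lemma serrin_exponents:
 fixes p q :: real assumes "3 < q" "2 / p + 3 / q = 1"
 shows "2 < p" "1 / p = (1 - 3 / q) / 2" "(1 - 3 / q) * p = 2"
proof -
 have q: "0 < 3 / q" "3 / q < 1" using assms(1) by auto
 then have "0 < 2 / p" "2 / p < 1" using assms(2) by linarith+
 then show "2 < p" by (auto simp: zero_less_divide_iff divide_less_eq_1)
 then show "1 / p = (1 - 3 / q) / 2" "(1 - 3 / q) * p = 2" using assms(2) by (auto simp: field_simps)
qed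

lemma powr_mult_le_add:
 fixes X Y a b :: real assumes nn: "0 <= X" "0 <= Y" and a: "0 <= a" and b: "0 <= b" and ab: "a + b = 1"
 shows "X powr a * Y powr b <= X + Y"
proof -
 have "X powr a * Y powr b <= (max X Y) powr a * (max X Y) powr b"
 using nn a b by (intro mult_mono powr_mono2) auto
 also have "... = max X Y" using nn ab by (simp flip: powr_add)
 also have "... <= X + Y" using nn by simp
 finally show ?thesis .
qed

text \<open>The relation between \<open>p\<close> and \<open>q\<close> says precisely that the exponents \<open>(1 + 3/q)/2\<close> and \<open>1/p\<close> add up
 to 1.\<close>

lemma young_mixed:
 fixes p q eta :: real assumes q: "3 < q" and pq: "2 / p + 3 / q = 1" and eta: "0 < eta"
 shows "\<exists>c\<ge>0. \<forall>x\<ge>0. \<forall>y\<ge>0. x powr (1 + 3 / q) * y <= eta * x\<^sup>2 + c * y powr p"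
proof -
 define alpha where "alpha = (1 + 3 / q) / 2"
 note e = serrin_exponents[OF q pq]
 have alpha: "0 < alpha" "alpha + 1 / p = 1" unfolding e(2) using q by (auto simp: alpha_def add_pos_pos field_simps)
 define c where "c = eta powr (- (alpha * p))"
 have "x powr (1 + 3 / q) * y <= eta * x\<^sup>2 + c * y powr p" if x: "0 <= x" and y: "0 <= y" for x y
 proof -
 define X where "X = eta * x\<^sup>2"
 define Y where "Y = c * y powr p"
 have nn: "0 <= X" "0 <= Y" using eta by (auto simp: X_def Y_def c_def)
 have "X powr alpha = eta powr alpha * x powr (1 + 3 / q)"
 proof -
 have "x\<^sup>2 powr alpha = (x powr 2) powr alpha" using x by simp
 also have "... = x powr (2 * alpha)" by (rule powr_powr)
 also have "2 * alpha = 1 + 3 / q" using q by (simp add: alpha_def field_simps)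
 finally show ?thesis using eta x by (simp add: X_def powr_mult)
 qed
 moreover have "Y powr (1 / p) = eta powr (- alpha) * y"
 using eta y e(1) by (simp add: Y_def c_def powr_mult powr_powr)
 ultimately have "X powr alpha * Y powr (1 / p) = (eta powr alpha * eta powr (- alpha)) * (x powr (1 + 3 / q) * y)" by (simp add: mult_ac)
 also have "eta powr alpha * eta powr (- alpha) = 1" using eta by (simp add: powr_minus)
 finally have eq: "x powr (1 + 3 / q) * y = X powr alpha * Y powr (1 / p)" by simp
 also have "... <= X + Y" by (rule powr_mult_le_add[OF nn _ _ alpha(2)]) (use alpha(1) e(1) in auto)
 finally show ?thesis by (simp add: X_def Y_def)
 qed
 moreover have "0 <= c" by (simp add: c_def)
 ultimately show ?thesis by (intro exI[of _ c]) simp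
qed

context gap
begin

definition spinc :: real where "spinc = sqrt (8 / 15 * pi * R ^ 5)"

lemma spinc_pos: "0 < spinc" using pos by (simp add: spinc_def)

lemma l2_ball_spin:
 assumes "!!x. x \<in> cball 0 R ==> w x = cross3 omega x" shows "l2 MB w = spinc * norm omega"
proof (rule power2_eq_imp_eq)
 have "(l2 MB w)\<^sup>2 = (LINT x|MB. rot omega x \<bullet> rot omega x)"
 unfolding l2_power2 power2_norm_eq_inner by (intro Bochner_Integration.integral_cong) (auto simp: assms)
 also have "... = (spinc * norm omega)\<^sup>2"
 unfolding integral_ball_rot using pos by (simp add: spinc_def power_mult_distrib power2_norm_eq_inner)
 finally show "(l2 MB w)\<^sup>2 = (spinc * norm omega)\<^sup>2" .
qed (use spinc_pos in auto)

lemma H2_diff: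
 assumes u: "u \<in> H2 S" and w: "w \<in> H2 S" shows "(%x. u x - w x) \<in> H2 S"
proof -
 note su = H2_D(1)[OF u] and sw = H2_D(1)[OF w]
 obtain f where f: "!!n::nat. f n \<in> D_R S" "(%n. l2 MV (%x. f n x - u x)) ----> 0" using H2_D(2)[OF u] by blast
 obtain g where g: "!!n::nat. g n \<in> D_R S" "(%n. l2 MV (%x. g n x - w x)) ----> 0" using H2_D(2)[OF w] by blast
 let ?h = "%n x. f n x - g n x"
 have lim: "(%n. norm2 S (%x. ?h n x - (u x - w x))) ----> 0"
 proof (rule l2_tendsto_zero_sandwich)
 show "norm2 S (%x. ?h n x - (u x - w x)) <= sqrt dmax * (l2 MV (%x. f n x - u x) + l2 MV (%x. g n x - w x))" for n
 proof -
 have eq: "(%x. ?h n x - (u x - w x)) = (%x. (f n x - u x) - (g n x - w x))" by (simp add: fun_eq_iff)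
 note s = sqint_diff[OF sqint_D_R[OF f(1)] su] sqint_diff[OF sqint_D_R[OF g(1)] sw]
 have "norm2 S (%x. (f n x - u x) - (g n x - w x)) <= sqrt dmax * l2 MV (%x. (f n x - u x) - (g n x - w x))"
 by (rule norm2_le_l2[OF sqint_diff[OF s]])
 also have "... <= sqrt dmax * (l2 MV (%x. f n x - u x) + l2 MV (%x. g n x - w x))"
 using dens_bounds(4) by (intro mult_left_mono l2_triangle_diff s) auto
 finally show ?thesis unfolding eq .
 qed
 show "(%n. sqrt dmax * (l2 MV (%x. f n x - u x) + l2 MV (%x. g n x - w x))) ----> 0"
 using tendsto_mult_right_zero[OF tendsto_add_zero[OF f(2) g(2)]] .
 qed simp
 show ?thesis unfolding H2_def mem_Collect_eq
 by (intro conjI exI[of _ ?h] allI D_R_diff f g lim) (simp add: Lq_space_2_iff sqint_diff su sw)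
qed

end

context wsol
begin

text \<open>The equation of a general solution tested with a field of higher integrability.\<close>

lemma form_bound_regular:
 assumes q: "3 < q"
 shows "\<exists>C\<ge>0. \<forall>t\<in>{0..T}. u t \<in> H12 S --> (ALL w:H12 S. ALL omega. w \<in> Lq_space q (liquid S) --> (ALL x:cball 0 R. w x = cross3 omega x) -->
 \<bar>F t w\<bar> <= C * ((1 + norm12 S (u t)) * norm12 S w + norm12 S (u t) powr (1 + 3 / q) * Lq_norm q (liquid S) w))"
proof -
 obtain B where B: "0 <= B" "!!t. 0 <= t ==> l2 MV (u t) <= B" using bounded by blast
 obtain Cr where Cr: "0 <= Cr" "\<forall>t\<in>{0..T}. ALL w. sqint MV w --> \<bar>b_vec S w \<bullet> c t\<bar> + 2 * \<bar>cor (om1 t) (u t) w\<bar> <= Cr * l2 MV w" using rest_bound by blast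
 define C1 where "C1 = dmax * 333 * B powr (1 - 3 / q) * cH powr (1 + 3 / q)"
 define C2 where "C2 = dmax * cH * R * (cH / spinc) * B"
 define C where "C = 1 + Cr * cH + C1 + C2"
 have C12: "0 <= C1" "0 <= C2" "0 <= Cr * cH" using dens_bounds(4) cH_pos pos spinc_pos B Cr by (auto simp: C1_def C2_def)
 have main: "\<bar>F t w\<bar> <= C * ((1 + norm12 S (u t)) * norm12 S w + norm12 S (u t) powr (1 + 3 / q) * Lq_norm q (liquid S) w)"
 if t: "t \<in> {0..T}" and a: "u t \<in> H12 S" and w: "w \<in> H12 S" "w \<in> Lq_space q (liquid S)" and omega: "ALL x:cball 0 R. w x = cross3 omega x" for t w omega
 proof -
 define n where "n = norm12 S (u t)"
 define N where "N = norm12 S w"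
 define m where "m = Lq_norm q (liquid S) w"
 have nn: "0 <= n" "0 <= N" "0 <= m" by (simp_all add: n_def N_def m_def)
 have lw: "l2 MV w <= cH * N" using h1_le_norm12[OF w(1)] h1_bounds(1)[of w] unfolding N_def by linarith
 have G: "l2 MV (Gd (u t)) <= cH * n" using h1_le_norm12[OF a] h1_bounds(2)[of "u t"] unfolding n_def by linarith
 have lu: "l2 MV (u t) <= B" using B(2) t by simp
 have d: "\<bar>2 * viscosity S * dis (u t) w\<bar> <= n * N" using dis_bound[OF a w(1)] pos(3) by (simp add: n_def N_def abs_mult)
 have "Cr * l2 MV w <= Cr * (cH * N)" by (rule mult_left_mono[OF lw Cr(1)])
 then have r: "\<bar>b_vec S w \<bullet> c t\<bar> + 2 * \<bar>cor (om1 t) (u t) w\<bar> <= (Cr * cH) * N"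
 using Cr(2)[rule_format, OF t H12_D(1)[OF w(1)]] by simp
 have "spinc * norm omega = l2 MB w" using l2_ball_spin[of w omega] omega by simp
 also have "... <= cH * N" using l2_MB_le(1)[OF H12_D(1)[OF w(1)]] lw by simp
 finally have om: "norm omega <= cH / spinc * N" using spinc_pos by (simp add: pos_le_divide_eq mult.commute)
 have "\<bar>tri (u t) (u t) w\<bar> <= dmax * (l2 MV (Gd (u t)) * (333 * (l2 MV (u t) powr (1 - 3 / q) * l2 MV (Gd (u t)) powr (3 / q) * m) + R * norm omega * l2 MV (u t)))"
 unfolding m_def by (rule serrin_bound[OF q a a w]) (use omega in auto)
 also have "... <= dmax * ((cH * n) * (333 * (B powr (1 - 3 / q) * (cH * n) powr (3 / q) * m) + R * (cH / spinc * N) * B))"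
 using dens_bounds(4) cH_pos nn pos spinc_pos B(1) G lu om q
 by (intro mult_left_mono mult_mono add_mono powr_mono2) auto
 also have "... = C1 * (n powr (1 + 3 / q) * m) + C2 * (n * N)"
 proof -
 have cn: "(cH * n) powr (3 / q) * (cH * n) = cH powr (1 + 3 / q) * n powr (1 + 3 / q)"
 proof -
 have "(cH * n) powr (3 / q) * (cH * n) = (cH * n) powr (1 + 3 / q)"
 using nn cH_pos q by (cases "n = 0") (auto simp: powr_add)
 then show ?thesis using nn cH_pos by (simp add: powr_mult)
 qed
 have "dmax * ((cH * n) * (333 * (B powr (1 - 3 / q) * (cH * n) powr (3 / q) * m) + R * (cH / spinc * N) * B))
 = dmax * 333 * B powr (1 - 3 / q) * ((cH * n) powr (3 / q) * (cH * n)) * m + C2 * (n * N)"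
 by (simp add: C2_def algebra_simps)
 then show ?thesis unfolding cn C1_def by (simp add: mult_ac)
 qed
 finally have tr: "\<bar>tri (u t) (u t) w\<bar> <= C1 * (n powr (1 + 3 / q) * m) + C2 * (n * N)" .
 have p: "0 <= n powr (1 + 3 / q) * m" "0 <= n * N" using nn by auto
 have "\<bar>F t w\<bar> <= n * N + (Cr * cH) * N + (C1 * (n powr (1 + 3 / q) * m) + C2 * (n * N))"
 using d r tr unfolding F_def by linarith
 also have "... <= C * ((1 + n) * N + n powr (1 + 3 / q) * m)"
 proof -
 have "0 <= (1 + C1 + C2) * N + (Cr * cH + C1) * (n * N) + (1 + Cr * cH + C2) * (n powr (1 + 3 / q) * m)"
 using C12 nn p Cr(1) cH_pos by (intro add_nonneg_nonneg mult_nonneg_nonneg) auto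
 then show ?thesis unfolding C_def by (simp add: algebra_simps)
 qed
 finally show ?thesis by (simp add: n_def N_def m_def)
 qed
 have "0 <= C" using C12 by (simp add: C_def)
 then show ?thesis using main by (intro exI[of _ C] conjI ballI impI allI)
qed

text \<open>The equation of the regular solution tested with a general field: skew symmetry moves the
 derivative to the test field, so that the \<open>L\<^sup>q\<close> norm falls on the solution.\<close>

lemma form_bound_skew:
 assumes q: "3 < q"
 shows "\<exists>C\<ge>0. \<forall>t\<in>{0..T}. u t \<in> H12 S --> u t \<in> Lq_space q (liquid S) --> (\<forall>w\<in>H12 S.
 \<bar>F t w\<bar> <= C * ((1 + norm12 S (u t) + norm12 S (u t) powr (3 / q) * Lq_norm q (liquid S) (u t)) * norm12 S w))"
proof -
 obtain B where B: "0 <= B" "!!t. 0 <= t ==> l2 MV (u t) <= B" using bounded by blast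
 obtain Cr where Cr: "0 <= Cr" "\<forall>t\<in>{0..T}. ALL w. sqint MV w --> \<bar>b_vec S w \<bullet> c t\<bar> + 2 * \<bar>cor (om1 t) (u t) w\<bar> <= Cr * l2 MV w" using rest_bound by blast
 define C1 where "C1 = dmax * cH * 333 * B powr (1 - 3 / q) * cH powr (3 / q)"
 define C2 where "C2 = dmax * cH * R * (B / spinc) * B"
 define C where "C = 1 + Cr * cH + C1 + C2"
 have C12: "0 <= C1" "0 <= C2" "0 <= Cr * cH" using dens_bounds(4) cH_pos pos spinc_pos B Cr by (auto simp: C1_def C2_def)
 have main: "\<bar>F t w\<bar> <= C * ((1 + norm12 S (u t) + norm12 S (u t) powr (3 / q) * Lq_norm q (liquid S) (u t)) * norm12 S w)"
 if t: "t \<in> {0..T}" and a: "u t \<in> H12 S" "u t \<in> Lq_space q (liquid S)" and w: "w \<in> H12 S" for t w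
 proof -
 define n where "n = norm12 S (u t)"
 define N where "N = norm12 S w"
 define m where "m = Lq_norm q (liquid S) (u t)"
 have nn: "0 <= n" "0 <= N" "0 <= m" by (simp_all add: n_def N_def m_def)
 have lw: "l2 MV w <= cH * N" "l2 MV (Gd w) <= cH * N" using h1_le_norm12[OF w(1)] h1_bounds[of w] unfolding N_def by linarith+
 have G: "l2 MV (Gd (u t)) <= cH * n" using h1_le_norm12[OF a(1)] h1_bounds(2)[of "u t"] unfolding n_def by linarith
 have lu: "l2 MV (u t) <= B" using B(2) t by simp
 have d: "\<bar>2 * viscosity S * dis (u t) w\<bar> <= n * N" using dis_bound[OF a(1) w] pos(3) by (simp add: n_def N_def abs_mult)
 have "Cr * l2 MV w <= Cr * (cH * N)" by (rule mult_left_mono[OF lw(1) Cr(1)])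
 then have r: "\<bar>b_vec S w \<bullet> c t\<bar> + 2 * \<bar>cor (om1 t) (u t) w\<bar> <= (Cr * cH) * N"
 using Cr(2)[rule_format, OF t H12_D(1)[OF w(1)]] by simp
 have "spinc * norm (om t) = l2 MB (u t)" using l2_ball_spin[of "u t" "om t"] u_ball by simp
 also have "... <= B" using l2_MB_le(1)[OF H12_D(1)[OF a(1)]] lu by simp
 finally have om: "norm (om t) <= B / spinc" using spinc_pos by (simp add: pos_le_divide_eq mult.commute)
 have "\<bar>tri (u t) (u t) w\<bar> = \<bar>tri (u t) w (u t)\<bar>" using tri_skew[OF a(1) a(1) w] by simp
 also have "... <= dmax * (l2 MV (Gd w) * (333 * (l2 MV (u t) powr (1 - 3 / q) * l2 MV (Gd (u t)) powr (3 / q) * m) + R * norm (om t) * l2 MV (u t)))"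
 unfolding m_def by (rule serrin_bound[OF q a(1) w a]) (rule u_ball)
 also have "... <= dmax * ((cH * N) * (333 * (B powr (1 - 3 / q) * (cH * n) powr (3 / q) * m) + R * (B / spinc) * B))"
 using dens_bounds(4) cH_pos nn pos spinc_pos B(1) G lu om q lw
 by (intro mult_left_mono mult_mono add_mono powr_mono2) auto
 also have "(cH * n) powr (3 / q) = cH powr (3 / q) * n powr (3 / q)" using nn cH_pos by (simp add: powr_mult)
 finally have tr: "\<bar>tri (u t) (u t) w\<bar> <= C1 * (n powr (3 / q) * m * N) + C2 * N" by (simp add: C1_def C2_def algebra_simps)
 have p: "0 <= n powr (3 / q) * m * N" "0 <= n * N" using nn by auto
 have "\<bar>F t w\<bar> <= n * N + (Cr * cH) * N + (C1 * (n powr (3 / q) * m * N) + C2 * N)"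
 using d r tr unfolding F_def by linarith
 also have "... <= C * ((1 + n + n powr (3 / q) * m) * N)"
 proof -
 have "0 <= (1 + C1) * N + (Cr * cH + C1 + C2) * (n * N) + (1 + Cr * cH + C2) * (n powr (3 / q) * m * N)"
 using C12 nn p Cr(1) cH_pos by (intro add_nonneg_nonneg mult_nonneg_nonneg) auto
 then show ?thesis unfolding C_def by (simp add: algebra_simps)
 qed
 finally show ?thesis by (simp add: n_def N_def m_def)
 qed
 have "0 <= C" using C12 by (simp add: C_def)
 then show ?thesis using main by (intro exI[of _ C] conjI ballI impI allI)
qed

lemma F_linear:
 assumes "u t \<in> H12 S" "a \<in> H12 S" "b \<in> H12 S" shows "F t (%x. a x - b x) = F t a - F t b"
proof -
 let ?d = "%x. a x - b x"
 note sq = H12_D(1)[OF assms(2)] H12_D(1)[OF assms(3)] H12_D(1)[OF assms(1)]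
 have "b_vec S ?d \<bullet> c t = b_vec S a \<bullet> c t - b_vec S b \<bullet> c t" unfolding b_vec_diff[OF sq(1,2)] by (rule inner_diff_left)
 moreover have "2 * viscosity S * dis (u t) ?d = 2 * viscosity S * dis (u t) a - 2 * viscosity S * dis (u t) b"
 unfolding dis_facts(2)[OF assms(2,3,1)] by (rule right_diff_distrib)
 moreover have "tri (u t) (u t) ?d = tri (u t) (u t) a - tri (u t) (u t) b" by (rule tri_diff(3)[OF assms(2,3,1,1)])
 moreover have "cor (om1 t) (u t) ?d = cor (om1 t) (u t) a - cor (om1 t) (u t) b" by (rule cor_diff(2)[OF sq])
 ultimately show ?thesis unfolding F_def by linarith
qed

end

lemma young_square:
 fixes p q :: real assumes q: "3 < q" and pq: "2 / p + 3 / q = 1" and x: "0 <= x" and y: "0 <= y"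
 shows "(x powr (3 / q) * y)\<^sup>2 <= x\<^sup>2 + y powr p"
proof -
 note e = serrin_exponents[OF q pq]
 have "(x powr (3 / q) * y)\<^sup>2 = (x powr 2) powr (3 / q) * (y powr p) powr (2 / p)"
 proof -
 have "(x powr (3 / q))\<^sup>2 = (x powr 2) powr (3 / q)"
 using x by (simp add: powr_powr mult.commute flip: powr_numeral)
 moreover have "y\<^sup>2 = (y powr p) powr (2 / p)" using y e(1) by (simp add: powr_powr)
 ultimately show ?thesis by (simp add: power_mult_distrib)
 qed
 also have "... <= x powr 2 + y powr p"
 by (rule powr_mult_le_add) (use pq q e(1) in auto)
 finally show ?thesis using x by simp
qed

lemma mult_le_eta: "0 < eta ==> x * y <= eta * x\<^sup>2 + 1 / eta * (y::real)\<^sup>2"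
proof -
 assume eta: "0 < eta"
 have "0 <= (eta * x - y)\<^sup>2 + (eta * x)\<^sup>2 + y\<^sup>2" by simp
 then have "eta * (x * y) <= eta * (eta * x\<^sup>2 + 1 / eta * y\<^sup>2)"
 using eta by (simp add: power2_eq_square algebra_simps)
 then show ?thesis using eta by simp
qed

lemma AE_lebesgue_on_subset:
 assumes "AE t in Leb J. Q t" "J \<in> sets lebesgue" "I \<in> sets lebesgue" "I \<subseteq> J" shows "AE t in Leb I. Q t"
 using assms by (auto simp: AE_restrict_space_iff elim!: eventually_mono)

lemma AE_lebesgue_on_Icc:
 fixes a b :: real assumes "AE t in Leb {a<..<b}. Q t" shows "AE t in Leb {a..b}. Q t"
proof -
 have "AE t in lebesgue. t ~: {a, b}" by (rule AE_not_in) (simp add: negligible_iff_null_sets[symmetric])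
 moreover have "AE t in lebesgue. t \<in> {a<..<b} --> Q t" using assms by (simp add: AE_restrict_space_iff)
 ultimately have "AE t in lebesgue. t \<in> {a..b} --> Q t" by eventually_elim auto
 then show ?thesis by (simp add: AE_restrict_space_iff)
qed

lemma bochner_modulus_ex:
 assumes "seminormed X N" "J \<in> sets lebesgue" "bounded J" "u \<in> Bochner_Lp p J X N" "0 < p" "0 < e"
 shows "EX k h Z. integrable (Leb J) k & (ALL t. 0 <= k t) & (LINT t|Leb J. k t) <= e & 0 < h & Z \<in> null_sets lebesgue &
 (ALL s:J - Z. ALL t:J - Z. \<bar>s - t\<bar> < h --> N (%x. u s x - u t x) powr p <= k s + k t)"
proof (rule bochner_modulus[OF assms])
 fix k h Z assume a: "integrable (Leb J) k" "!!t. 0 <= k t" "(LINT t|Leb J. k t) <= e" "0 < h" "Z \<in> null_sets lebesgue"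
 "!!s t. s \<in> J - Z ==> t \<in> J - Z ==> \<bar>s - t\<bar> < h ==> u s \<in> X & N (%x. u s x - u t x) powr p <= k s + k t"
 show ?thesis by (intro exI[of _ k] exI[of _ h] exI[of _ Z] conjI allI ballI impI a(1-5) conjunct2[OF a(6)])
qed

section \<open>The cross term of two solutions\<close>

text \<open>The primed solution, with prefix \<open>B\<close>, is the one that satisfies Serrin's condition.\<close>

locale solution_pair = gap S + A: wsol S v om1 om + B: wsol S v' om1' om'
 for S v om1 om v' om1' om' +
 fixes T p q :: real
 assumes T: "0 < T" and q: "3 < q" and pq: "2 / p + 3 / q = 1"
 and serrin: "v' \<in> Bochner_Lp p {0<..<T} (Lq_space q (liquid S)) (Lq_norm q (liquid S))"
begin

abbreviation Lqs :: "field3 set" where "Lqs \<equiv> Lq_space q (liquid S)"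
abbreviation Nq :: "field3 => real" where "Nq \<equiv> Lq_norm q (liquid S)"
abbreviation MT :: "real measure" where "MT \<equiv> Leb {0<..<T}"

text \<open>An integrable majorant of everything that is known about the two solutions at time \<open>t\<close>.\<close>

definition E :: "real => real" where
 "E t = 1 + (norm12 S (A.u t))\<^sup>2 + (norm12 S (B.u t))\<^sup>2 + Nq (B.u t) powr p"
definition good :: "real => bool" where
 "good t \<longleftrightarrow> t \<in> {0<..<T} & A.u t \<in> H12 S & B.u t \<in> H12 S & B.u t \<in> Lqs"

lemma p_gt: "2 < p" by (rule serrin_exponents[OF q pq])

lemma Lq_extend:
 shows "Nq (%x. f x - B.u t x) = Nq (%x. f x - v' t x)" "Nq (B.u t) = Nq (v' t)" "B.u t \<in> Lqs \<longleftrightarrow> v' t \<in> Lqs"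
proof -
 have eq: "x \<in> space Ml ==> B.u t x = v' t x" for x using B.u_liquid[of x t] by simp
 show "Nq (%x. f x - B.u t x) = Nq (%x. f x - v' t x)" "Nq (B.u t) = Nq (v' t)"
 unfolding Lq_norm_def using eq by (auto intro!: arg_cong[where f = "%z. z powr (1 / q)"] Bochner_Integration.integral_cong)
 show "B.u t \<in> Lqs \<longleftrightarrow> v' t \<in> Lqs"
 unfolding Lq_space_def mem_Collect_eq
 by (intro arg_cong2[where f = "(\<and>)"] measurable_cong Bochner_Integration.integrable_cong) (auto simp: eq)
qed

lemma B_serrin: "B.u \<in> Bochner_Lp p {0<..<T} Lqs Nq"
 using serrin by (simp add: Bochner_Lp_def strongly_measurable_def Lq_extend)

lemma E_ge: "1 <= E t" "(norm12 S (A.u t))\<^sup>2 <= E t" "(norm12 S (B.u t))\<^sup>2 <= E t" "Nq (B.u t) powr p <= E t"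
 by (simp_all add: E_def add_nonneg_nonneg add_increasing)

lemma integrable_E: "integrable MT E"
proof -
 have "integrable MT (%t. Nq (B.u t) powr p)" using B_serrin by (simp add: Bochner_Lp_def)
 moreover have "integrable MT (%t. 1 :: real)" by (rule finite_measure.integrable_const[OF finite_measure_lebesgue_on]) simp
 ultimately show ?thesis unfolding E_def by (intro Bochner_Integration.integrable_add A.integrable_norm12 B.integrable_norm12)
qed

lemma good_AE: "AE t in MT. good t"
proof -
 have "AE t in MT. B.u t \<in> Lqs" using B_serrin by (simp add: Bochner_Lp_def)
 with A.u_strong(2)[of T] B.u_strong(2)[of T] AE_space[of MT] show ?thesis
 by eventually_elim (simp add: good_def)
qed

text \<open>Young's inequality with a free parameter: the majorant \<open>E\<close> gets a small factor, and the test field enters with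
 the powers that \<open>bochner_modulus\<close> controls.\<close>

lemma form_bounds:
 "\<exists>C\<ge>0. ALL eta. 0 < eta --> (\<exists>c\<ge>0. ALL t. good t -->
 (ALL w:H12 S. ALL omega. w \<in> Lqs --> (ALL x:cball 0 R. w x = cross3 omega x) --> \<bar>A.F t w\<bar> <= C * eta * E t + c * ((norm12 S w)\<^sup>2 + Nq w powr p)) &
 (ALL w:H12 S. \<bar>B.F t w\<bar> <= C * eta * E t + c * (norm12 S w)\<^sup>2))"
proof -
 obtain C1 where C1: "0 <= C1" "\<forall>t\<in>{0..T}. A.u t \<in> H12 S --> (ALL w:H12 S. ALL omega. w \<in> Lqs --> (ALL x:cball 0 R. w x = cross3 omega x) -->
 \<bar>A.F t w\<bar> <= C1 * ((1 + norm12 S (A.u t)) * norm12 S w + norm12 S (A.u t) powr (1 + 3 / q) * Nq w))"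
 using A.form_bound_regular[OF q, of T] by (elim exE conjE)
 obtain C2 where C2: "0 <= C2" "\<forall>t\<in>{0..T}. B.u t \<in> H12 S --> B.u t \<in> Lqs --> (\<forall>w\<in>H12 S.
 \<bar>B.F t w\<bar> <= C2 * ((1 + norm12 S (B.u t) + norm12 S (B.u t) powr (3 / q) * Nq (B.u t)) * norm12 S w))"
 using B.form_bound_skew[OF q, of T] by (elim exE conjE)
 define C where "C = 3 * C1 + 6 * C2"
 have C: "3 * C1 <= C" "6 * C2 <= C" "0 <= C" using C1(1) C2(1) by (auto simp: C_def)
 have main: "\<exists>c\<ge>0. ALL t. good t -->
 (ALL w:H12 S. ALL omega. w \<in> Lqs --> (ALL x:cball 0 R. w x = cross3 omega x) --> \<bar>A.F t w\<bar> <= C * eta * E t + c * ((norm12 S w)\<^sup>2 + Nq w powr p)) &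
 (ALL w:H12 S. \<bar>B.F t w\<bar> <= C * eta * E t + c * (norm12 S w)\<^sup>2)" if eta: "0 < eta" for eta
 proof -
 obtain c1 where c1: "0 <= c1" "\<forall>x\<ge>0. \<forall>y\<ge>0. x powr (1 + 3 / q) * y <= eta * x\<^sup>2 + c1 * y powr p"
 using young_mixed[OF q pq eta] by (elim exE conjE)
 define c where "c = (C1 + C2) * (1 / eta + c1)"
 have c: "0 <= c" "C1 * (1 / eta) <= c" "C1 * c1 <= c" "C2 * (1 / eta) <= c"
 unfolding c_def using C1(1) C2(1) c1(1) eta by (intro mult_nonneg_nonneg mult_mono; simp)+
 have 1: "\<bar>A.F t w\<bar> <= C * eta * E t + c * ((norm12 S w)\<^sup>2 + Nq w powr p)"
 if t: "good t" and w: "w \<in> H12 S" "w \<in> Lqs" "ALL x:cball 0 R. w x = cross3 omega x" for t w omega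
 proof -
 define n where "n = norm12 S (A.u t)"
 define N where "N = norm12 S w"
 define m where "m = Nq w"
 have nn: "0 <= n" "0 <= N" "0 <= m" by (simp_all add: n_def N_def m_def)
 have tt: "t \<in> {0..T}" "A.u t \<in> H12 S" using t by (auto simp: good_def)
 have a: "\<bar>A.F t w\<bar> <= C1 * ((1 + n) * N + n powr (1 + 3 / q) * m)"
 unfolding n_def N_def m_def by (rule C1(2)[rule_format, OF tt w(1,2)]) (use w(3) in auto)
 have e2: "(1 + n)\<^sup>2 <= 2 * E t"
 proof -
 have "1 + n\<^sup>2 <= E t" unfolding E_def n_def by (simp add: add_increasing2)
 then have "2 * (1 + n\<^sup>2) <= 2 * E t" by simp
 moreover have "(1 + n)\<^sup>2 <= 2 * (1 + n\<^sup>2)" using sum_squares_bound[of 1 n] by (simp add: power2_eq_square algebra_simps)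
 ultimately show ?thesis by (rule order_trans[rotated])
 qed
 have "(1 + n) * N <= eta * (1 + n)\<^sup>2 + 1 / eta * N\<^sup>2" by (rule mult_le_eta[OF eta])
 also have "... <= eta * (2 * E t) + 1 / eta * N\<^sup>2" using e2 eta by (intro add_right_mono mult_left_mono) auto
 finally have x: "(1 + n) * N <= eta * (2 * E t) + 1 / eta * N\<^sup>2" .
 have "n powr (1 + 3 / q) * m <= eta * n\<^sup>2 + c1 * m powr p" using c1(2) nn by blast
 also have "... <= eta * E t + c1 * m powr p" using E_ge(2)[of t] eta unfolding n_def by (intro add_right_mono mult_left_mono) auto
 finally have y: "n powr (1 + 3 / q) * m <= eta * E t + c1 * m powr p" .
 have "C1 * ((1 + n) * N + n powr (1 + 3 / q) * m) <= C1 * ((eta * (2 * E t) + 1 / eta * N\<^sup>2) + (eta * E t + c1 * m powr p))"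
 by (rule mult_left_mono[OF add_mono[OF x y] C1(1)])
 also have "... = (3 * C1) * (eta * E t) + (C1 * (1 / eta)) * N\<^sup>2 + (C1 * c1) * m powr p" by (simp add: algebra_simps)
 also have "... <= C * (eta * E t) + c * N\<^sup>2 + c * m powr p"
 using C(1) c eta E_ge(1)[of t] by (intro add_mono mult_right_mono) auto
 finally show ?thesis using a by (simp add: N_def m_def algebra_simps)
 qed
 have 2: "\<bar>B.F t w\<bar> <= C * eta * E t + c * (norm12 S w)\<^sup>2" if t: "good t" and w: "w \<in> H12 S" for t w
 proof -
 define n where "n = norm12 S (B.u t)"
 define N where "N = norm12 S w"
 define z where "z = n powr (3 / q) * Nq (B.u t)"
 have tt: "t \<in> {0..T}" "B.u t \<in> H12 S" "B.u t \<in> Lqs" using t by (auto simp: good_def)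
 have a: "\<bar>B.F t w\<bar> <= C2 * ((1 + n + z) * N)"
 unfolding n_def N_def z_def by (rule C2(2)[rule_format, OF tt w])
 have e2: "(1 + n + z)\<^sup>2 <= 6 * E t"
 proof -
 have "z\<^sup>2 <= n\<^sup>2 + Nq (B.u t) powr p" unfolding z_def by (rule young_square[OF q pq]) (simp_all add: n_def)
 moreover have "1 + n\<^sup>2 + Nq (B.u t) powr p <= E t" unfolding E_def n_def by simp
 moreover have "(1 + n + z)\<^sup>2 <= 3 * (1 + n\<^sup>2 + z\<^sup>2)"
 using sum_squares_bound[of 1 n] sum_squares_bound[of 1 z] sum_squares_bound[of n z] by (simp add: power2_eq_square algebra_simps)
 moreover have "n\<^sup>2 <= E t" unfolding n_def by (rule E_ge)
 ultimately have "z\<^sup>2 + 1 <= E t" and n: "n\<^sup>2 <= E t" and s: "(1 + n + z)\<^sup>2 <= 3 * (1 + n\<^sup>2 + z\<^sup>2)" by linarith+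
 then have "3 * (1 + n\<^sup>2 + z\<^sup>2) <= 6 * E t" by simp
 with s show ?thesis by (rule order_trans)
 qed
 have "(1 + n + z) * N <= eta * (1 + n + z)\<^sup>2 + 1 / eta * N\<^sup>2" by (rule mult_le_eta[OF eta])
 also have "... <= eta * (6 * E t) + 1 / eta * N\<^sup>2" using e2 eta by (intro add_right_mono mult_left_mono) auto
 finally have "C2 * ((1 + n + z) * N) <= C2 * (eta * (6 * E t) + 1 / eta * N\<^sup>2)" by (rule mult_left_mono[OF _ C2(1)])
 also have "... = (6 * C2) * (eta * E t) + (C2 * (1 / eta)) * N\<^sup>2" by (simp add: algebra_simps)
 also have "... <= C * (eta * E t) + c * N\<^sup>2"
 using C(2) c eta E_ge(1)[of t] by (intro add_mono mult_right_mono) auto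
 finally show ?thesis using a by (simp add: N_def algebra_simps)
 qed
 show ?thesis using c(1) 1 2 by (intro exI[of _ c] conjI allI impI ballI) assumption+
 qed
 show ?thesis by (rule exI[of _ C], rule conjI[OF C(3)], intro allI impI, rule main)
qed

definition H :: "real => real" where
 "H tau = A.F tau (B.u tau) + B.F tau (A.u tau) + B.W tau \<bullet> A.c tau + A.W tau \<bullet> B.c tau"

lemma inner_c_bound: "\<exists>K\<ge>0. \<forall>t\<in>{0..T}. ALL beta. \<bar>beta \<bullet> A.c t\<bar> <= K * norm beta & \<bar>beta \<bullet> B.c t\<bar> <= K * norm beta"
proof -
 obtain K where K: "0 <= K" "\<forall>t\<in>{0..T}. norm (A.c t) <= K" using A.c_bounded by blast
 obtain L where L: "0 <= L" "\<forall>t\<in>{0..T}. norm (B.c t) <= L" using B.c_bounded by blast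
 have "\<bar>beta \<bullet> A.c t\<bar> <= (K + L) * norm beta & \<bar>beta \<bullet> B.c t\<bar> <= (K + L) * norm beta" if t: "t \<in> {0..T}" for t beta
 proof -
 have "norm beta * norm (A.c t) <= norm beta * (K + L)" "norm beta * norm (B.c t) <= norm beta * (K + L)"
 using bspec[OF K(2) t] bspec[OF L(2) t] K(1) L(1) by (intro mult_left_mono; simp)+
 then show ?thesis using Cauchy_Schwarz_ineq2[of beta "A.c t"] Cauchy_Schwarz_ineq2[of beta "B.c t"] by (simp add: mult.commute)
 qed
 then show ?thesis using K(1) L(1) by (intro exI[of _ "K + L"]) simp
qed

lemma integrable_H: "integrable MT H"
proof -
 obtain C where C: "0 <= C" "ALL eta. 0 < eta --> (\<exists>c\<ge>0. ALL t. good t -->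
 (ALL w:H12 S. ALL omega. w \<in> Lqs --> (ALL x:cball 0 R. w x = cross3 omega x) --> \<bar>A.F t w\<bar> <= C * eta * E t + c * ((norm12 S w)\<^sup>2 + Nq w powr p)) &
 (ALL w:H12 S. \<bar>B.F t w\<bar> <= C * eta * E t + c * (norm12 S w)\<^sup>2))" using form_bounds by (elim exE conjE)
 obtain c where c: "0 <= c" and b: "ALL t. good t -->
 (ALL w:H12 S. ALL omega. w \<in> Lqs --> (ALL x:cball 0 R. w x = cross3 omega x) --> \<bar>A.F t w\<bar> <= C * 1 * E t + c * ((norm12 S w)\<^sup>2 + Nq w powr p)) &
 (ALL w:H12 S. \<bar>B.F t w\<bar> <= C * 1 * E t + c * (norm12 S w)\<^sup>2)" using C(2)[rule_format, OF zero_less_one] by (elim exE conjE)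
 obtain K where K: "0 <= K" "\<forall>t\<in>{0..T}. ALL beta. \<bar>beta \<bullet> A.c t\<bar> <= K * norm beta & \<bar>beta \<bullet> B.c t\<bar> <= K * norm beta" using inner_c_bound by blast
 obtain WA where WA: "0 <= WA" "\<forall>t\<in>{0..T}. norm (A.W t) <= WA" using A.W_bounded by blast
 obtain WB where WB: "0 <= WB" "\<forall>t\<in>{0..T}. norm (B.W t) <= WB" using B.W_bounded by blast
 define L where "L = 2 * C + 3 * c + K * WA + K * WB"
 have L: "0 <= L" using C(1) c K(1) WA(1) WB(1) by (simp add: L_def)
 show ?thesis
 proof (rule Bochner_Integration.integrable_bound[where f = "%t. L * E t"])
 show "integrable MT (%t. L * E t)" using integrable_E by simp
 show "H \<in> borel_measurable MT"
 unfolding H_def[abs_def]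
 by (intro borel_measurable_add borel_measurable_inner A.measurable_rest(3) B.measurable_rest(3) A.u_strong B.u_strong A.measurable_c B.measurable_c)
 show "AE t in MT. norm (H t) <= norm (L * E t)"
 using good_AE
 proof eventually_elim
 case (elim t)
 have tt: "t \<in> {0..T}" "A.u t \<in> H12 S" "B.u t \<in> H12 S" "B.u t \<in> Lqs" using elim by (auto simp: good_def)
 have a: "\<bar>A.F t (B.u t)\<bar> <= C * 1 * E t + c * ((norm12 S (B.u t))\<^sup>2 + Nq (B.u t) powr p)"
 by (rule conjunct1[OF b[rule_format, OF elim], rule_format, OF tt(3,4)]) (use B.u_ball in auto)
 have b': "\<bar>B.F t (A.u t)\<bar> <= C * 1 * E t + c * (norm12 S (A.u t))\<^sup>2"
 by (rule conjunct2[OF b[rule_format, OF elim], rule_format, OF tt(2)])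
 have "c * ((norm12 S (B.u t))\<^sup>2 + Nq (B.u t) powr p) <= c * (2 * E t)" using E_ge[of t] c by (intro mult_left_mono) auto
 moreover have "c * (norm12 S (A.u t))\<^sup>2 <= c * E t" using E_ge[of t] c by (intro mult_left_mono) auto
 moreover have "\<bar>B.W t \<bullet> A.c t\<bar> <= K * WB"
 using K(2)[rule_format, OF tt(1), of "B.W t"] mult_left_mono[OF bspec[OF WB(2) tt(1)] K(1)] by linarith
 moreover have "\<bar>A.W t \<bullet> B.c t\<bar> <= K * WA"
 using K(2)[rule_format, OF tt(1), of "A.W t"] mult_left_mono[OF bspec[OF WA(2) tt(1)] K(1)] by linarith
 ultimately have "\<bar>H t\<bar> <= 2 * (C * E t) + 3 * (c * E t) + (K * WA + K * WB)" using a b' unfolding H_def by simp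
 also have "... <= 2 * (C * E t) + 3 * (c * E t) + (K * WA + K * WB) * E t"
 using mult_left_mono[OF E_ge(1)[of t], of "K * WA + K * WB"] K(1) WA(1) WB(1) by simp
 also have "... = L * E t" by (simp add: L_def algebra_simps)
 finally have "\<bar>H t\<bar> <= L * E t" .
 then show "norm (H t) <= norm (L * E t)" unfolding real_norm_def by (rule order_trans[OF _ abs_ge_self])
 qed
 qed
qed

text \<open>The cross term corrected by its expected rate of change; the aim is that \<open>P\<close> is constant.\<close>

definition P :: "real => real" where
 "P t = inner_B S (A.u t) (B.u t) + B.W t \<bullet> (J *v A.W t) + (LINT tau|Leb {0..t}. H tau)"

lemma integrable_H_Icc: "0 <= r ==> t <= T ==> integrable (Leb {r..t}) H"
 by (rule integrable_subset[OF integrable_H[folded integrable_Icc_Ioo]]) auto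

text \<open>The rate \<open>H\<close> minus what the momentum identities give when the test fields are frozen at \<open>r\<close> and \<open>t\<close>.\<close>

definition G :: "real => real => real => real" where
 "G r t tau = H tau - A.F tau (B.u t) - B.F tau (A.u r) - B.W t \<bullet> A.c tau - A.W r \<bullet> B.c tau"

lemma P_increment:
 assumes r: "good r" and t: "good t" and rt: "r < t"
 shows "P t - P r = (LINT tau|Leb {r..t}. G r t tau)" "integrable (Leb {r..t}) (G r t)"
proof -
 have H: "B.u t \<in> H12 S" "A.u r \<in> H12 S" and tT: "0 <= r" "r <= t" "t <= T" "0 <= t" using r t rt by (auto simp: good_def)
 note a = A.increments[OF H(1) tT(1,2)] and b = B.increments[OF H(2) tT(1,2)]
 note i = integrable_H_Icc[OF tT(1,3)] a(3) b(3) a(4)[of "B.W t"] b(4)[of "A.W r"]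
 show "integrable (Leb {r..t}) (G r t)"
 unfolding G_def[abs_def] by (intro Bochner_Integration.integrable_diff i)
 have "(LINT tau|Leb {r..t}. G r t tau) = (LINT tau|Leb {r..t}. H tau) - (LINT tau|Leb {r..t}. A.F tau (B.u t))
 - (LINT tau|Leb {r..t}. B.F tau (A.u r)) - (LINT tau|Leb {r..t}. B.W t \<bullet> A.c tau) - (LINT tau|Leb {r..t}. A.W r \<bullet> B.c tau)"
 unfolding G_def using i by simp
 then show "P t - P r = (LINT tau|Leb {r..t}. G r t tau)"
 using integral_combine[OF integrable_H_Icc[OF order_refl tT(3)] tT(1,2)] a(1) b(1) a(2)[of "B.W t"] b(2)[of "A.W r"]
 inner_B_commute[of "B.u t" "A.u r"] inner_B_commute[of "B.u r" "A.u r"] J_sym[of "B.W t" "A.W r"] J_sym[of "B.W r" "A.W r"]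
 unfolding P_def by linarith
qed

lemma G_eq:
 assumes "good tau" "good r" "good t"
 shows "G r t tau = A.F tau (%x. B.u tau x - B.u t x) + B.F tau (%x. A.u tau x - A.u r x)
 + (B.W tau - B.W t) \<bullet> A.c tau + (A.W tau - A.W r) \<bullet> B.c tau"
proof -
 have "A.F tau (%x. B.u tau x - B.u t x) = A.F tau (B.u tau) - A.F tau (B.u t)" by (rule A.F_linear) (use assms in \<open>auto simp: good_def\<close>)
 moreover have "B.F tau (%x. A.u tau x - A.u r x) = B.F tau (A.u tau) - B.F tau (A.u r)" by (rule B.F_linear) (use assms in \<open>auto simp: good_def\<close>)
 ultimately show ?thesis unfolding G_def H_def inner_diff_left by linarith
qed

lemma W_modulus:
 assumes delta: "0 < delta"
 shows "\<exists>h>0. \<forall>s\<in>{0..T}. \<forall>t\<in>{0..T}. \<bar>s - t\<bar> < h --> norm (A.W s - A.W t) <= delta & norm (B.W s - B.W t) <= delta"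
proof -
 have u: "uniformly_continuous_on {0..T} A.W" "uniformly_continuous_on {0..T} B.W"
 by (intro compact_uniformly_continuous continuous_on_subset[OF A.ws_unfolded(3)] continuous_on_subset[OF B.ws_unfolded(3)]; simp)+
 obtain h1 where h1: "0 < h1" "\<forall>x\<in>{0..T}. \<forall>y\<in>{0..T}. dist y x < h1 --> dist (A.W y) (A.W x) < delta"
 using u(1)[unfolded uniformly_continuous_on_def, rule_format, OF delta] by (elim exE conjE)
 obtain h2 where h2: "0 < h2" "\<forall>x\<in>{0..T}. \<forall>y\<in>{0..T}. dist y x < h2 --> dist (B.W y) (B.W x) < delta"
 using u(2)[unfolded uniformly_continuous_on_def, rule_format, OF delta] by (elim exE conjE)
 have "norm (A.W s - A.W t) <= delta & norm (B.W s - B.W t) <= delta" if "s \<in> {0..T}" "t \<in> {0..T}" "\<bar>s - t\<bar> < min h1 h2" for s t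
 using h1(2)[rule_format, OF that(2,1)] h2(2)[rule_format, OF that(2,1)] that(3) by (simp add: dist_norm)
 then show ?thesis using h1(1) h2(1) by (intro exI[of _ "min h1 h2"]) simp
qed

text \<open>The hypothesis of \<open>almost_constant\<close>. The factors 6 and 9 distribute \<open>\<epsilon>\<close> over the majorant, the three moduli
 of continuity and the oscillation of the angular velocities.\<close>

lemma P_modulus:
 assumes epsilon: "0 < epsilon"
 shows "EX f h Z. integrable MT f & (ALL t. 0 <= f t) & (LINT t|MT. f t) <= epsilon & 0 < h &
 Z \<in> null_sets lebesgue & (ALL r t. 0 < r --> r < t --> t < T --> r ~: Z --> t ~: Z --> t - r < h -->
 \<bar>P t - P r\<bar> <= (LINT tau|Leb {r..t}. f tau) + (t - r) * (f t + f r))"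
proof -
 have J: "{0<..<T} \<in> sets lebesgue" "bounded {0<..<T}" by auto
 have p0: "0 < p" using p_gt by simp
 have sixth: "x * (epsilon / (6 * x)) = epsilon / 6" if "0 < x" for x using that by (simp add: field_simps)
 obtain C where C: "0 <= C" "ALL eta. 0 < eta --> (\<exists>c\<ge>0. ALL t. good t -->
 (ALL w:H12 S. ALL omega. w \<in> Lqs --> (ALL x:cball 0 R. w x = cross3 omega x) --> \<bar>A.F t w\<bar> <= C * eta * E t + c * ((norm12 S w)\<^sup>2 + Nq w powr p)) &
 (ALL w:H12 S. \<bar>B.F t w\<bar> <= C * eta * E t + c * (norm12 S w)\<^sup>2))" using form_bounds by (elim exE conjE)
 define I where "I = (LINT t|MT. E t)"
 have I0: "0 <= I" unfolding I_def by (rule Bochner_Integration.integral_nonneg) (use E_ge(1) in \<open>auto intro: order_trans[OF zero_le_one]\<close>)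
 define eta where "eta = epsilon / (6 * (C * I + 1))"
 have CI: "0 < C * I + 1" using C(1) I0 by (simp add: add_nonneg_pos)
 have eta: "0 < eta" using epsilon CI by (simp add: eta_def)
 obtain c where c: "0 <= c" and b: "ALL t. good t -->
 (ALL w:H12 S. ALL omega. w \<in> Lqs --> (ALL x:cball 0 R. w x = cross3 omega x) --> \<bar>A.F t w\<bar> <= C * eta * E t + c * ((norm12 S w)\<^sup>2 + Nq w powr p)) &
 (ALL w:H12 S. \<bar>B.F t w\<bar> <= C * eta * E t + c * (norm12 S w)\<^sup>2)" using C(2)[rule_format, OF eta] by (elim exE conjE)
 define e where "e = epsilon / (9 * (c + 1))"
 have e: "0 < e" using epsilon c by (simp add: e_def)
 obtain k1 h1 Z1 where k1: "integrable MT k1" "ALL t. 0 <= k1 t" "(LINT t|MT. k1 t) <= e" "0 < h1" "Z1 \<in> null_sets lebesgue"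
 "\<forall>s\<in>{0<..<T} - Z1. \<forall>t\<in>{0<..<T} - Z1. \<bar>s - t\<bar> < h1 --> norm12 S (%x. A.u s x - A.u t x) powr 2 <= k1 s + k1 t"
 using bochner_modulus_ex[OF seminormed_H12 J A.u_bochner zero_less_numeral e] by (elim exE conjE)
 obtain k2 h2 Z2 where k2: "integrable MT k2" "ALL t. 0 <= k2 t" "(LINT t|MT. k2 t) <= e" "0 < h2" "Z2 \<in> null_sets lebesgue"
 "\<forall>s\<in>{0<..<T} - Z2. \<forall>t\<in>{0<..<T} - Z2. \<bar>s - t\<bar> < h2 --> norm12 S (%x. B.u s x - B.u t x) powr 2 <= k2 s + k2 t"
 using bochner_modulus_ex[OF seminormed_H12 J B.u_bochner zero_less_numeral e] by (elim exE conjE)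
 have q1: "1 <= q" using q by simp
 obtain k3 h3 Z3 where k3: "integrable MT k3" "ALL t. 0 <= k3 t" "(LINT t|MT. k3 t) <= e" "0 < h3" "Z3 \<in> null_sets lebesgue"
 "\<forall>s\<in>{0<..<T} - Z3. \<forall>t\<in>{0<..<T} - Z3. \<bar>s - t\<bar> < h3 --> Nq (%x. B.u s x - B.u t x) powr p <= k3 s + k3 t"
 using bochner_modulus_ex[OF seminormed_Lq[OF q1] J B_serrin p0 e] by (elim exE conjE)
 obtain K where K: "0 <= K" "\<forall>t\<in>{0..T}. ALL beta. \<bar>beta \<bullet> A.c t\<bar> <= K * norm beta & \<bar>beta \<bullet> B.c t\<bar> <= K * norm beta" using inner_c_bound by blast
 define delta where "delta = epsilon / (6 * (K * T + 1))"
 have KT: "0 < K * T + 1" using K(1) T by (simp add: add_nonneg_pos)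
 have delta: "0 < delta" using epsilon KT by (simp add: delta_def)
 obtain h4 where h4: "0 < h4" "\<forall>s\<in>{0..T}. \<forall>t\<in>{0..T}. \<bar>s - t\<bar> < h4 --> norm (A.W s - A.W t) <= delta & norm (B.W s - B.W t) <= delta"
 using W_modulus[OF delta] by (elim exE conjE)
 define f where "f t = 2 * (C * eta * E t) + c * (k1 t + k2 t + k3 t) + 2 * (K * delta)" for t
 define h where "h = min (min h1 h2) (min h3 h4)"
 have "AE t in lebesgue. t \<in> {0<..<T} --> good t" using good_AE by (simp add: AE_restrict_space_iff)
 then obtain Z0 where Z0: "Z0 \<in> null_sets lebesgue" "{t \<in> space lebesgue. \<not> (t \<in> {0<..<T} --> good t)} \<subseteq> Z0"
 unfolding eventually_ae_filter by (elim bexE)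
 have Zg: "good t" if "0 < t" "t < T" "t ~: Z0" for t
 proof (rule ccontr)
 assume "\<not> good t"
 then have "t \<in> {t \<in> space lebesgue. \<not> (t \<in> {0<..<T} --> good t)}" using that by simp
 then show False using subsetD[OF Z0(2)] that(3) by simp
 qed
 define Z where "Z = Z0 \<union> Z1 \<union> Z2 \<union> Z3"
 have Z: "Z \<in> null_sets lebesgue" unfolding Z_def by (intro null_sets.Un Z0 k1 k2 k3)
 have E0: "0 <= E t" for t using E_ge(1)[of t] by simp
 have f0: "0 <= f t" for t unfolding f_def using C(1) eta c E0[of t] k1(2)[rule_format, of t] k2(2)[rule_format, of t] k3(2)[rule_format, of t] K(1) delta by simp
 have one: "integrable MT (%t. a :: real)" for a by (rule finite_measure.integrable_const[OF finite_measure_lebesgue_on]) simp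
 have fi: "integrable MT f" unfolding f_def by (intro Bochner_Integration.integrable_add integrable_mult_right one integrable_E k1 k2 k3)
 have fe: "(LINT t|MT. f t) <= epsilon"
 proof -
 have "(LINT t|MT. f t) = 2 * (C * eta * I) + c * ((LINT t|MT. k1 t) + (LINT t|MT. k2 t) + (LINT t|MT. k3 t)) + 2 * (K * delta) * T"
 unfolding f_def I_def using integrable_E k1(1) k2(1) k3(1) one T by (simp add: measure_restrict_space)
 moreover have "2 * (C * eta * I) <= epsilon / 3"
 proof -
 have "C * I * eta <= (C * I + 1) * eta" using eta by simp
 also have "... = epsilon / 6" unfolding eta_def by (rule sixth[OF CI])
 finally show ?thesis by (simp add: mult_ac)
 qed
 moreover have "c * ((LINT t|MT. k1 t) + (LINT t|MT. k2 t) + (LINT t|MT. k3 t)) <= epsilon / 3"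
 proof -
 have "c * ((LINT t|MT. k1 t) + (LINT t|MT. k2 t) + (LINT t|MT. k3 t)) <= c * (3 * e)"
 using k1(3) k2(3) k3(3) c by (intro mult_left_mono) auto
 also have "... <= (c + 1) * (3 * e)" using e by simp
 also have "... = epsilon / 3" using c by (simp add: e_def field_simps)
 finally show ?thesis .
 qed
 moreover have "2 * (K * delta) * T <= epsilon / 3"
 proof -
 have "K * T * delta <= (K * T + 1) * delta" using delta by simp
 also have "... = epsilon / 6" unfolding delta_def by (rule sixth[OF KT])
 finally show ?thesis by (simp add: mult_ac)
 qed
 ultimately show ?thesis by linarith
 qed
 have incr: "\<bar>P t - P r\<bar> <= (LINT tau|Leb {r..t}. f tau) + (t - r) * (f t + f r)"
 if rt: "0 < r" "r < t" "t < T" "r ~: Z" "t ~: Z" "t - r < h" for r t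
 proof -
 have g: "good r" "good t" using rt by (auto simp: Z_def intro!: Zg)
 have Gb: "\<bar>G r t tau\<bar> <= f tau + (f t + f r)" if tau: "r < tau" "tau < t" "tau ~: Z" for tau
 proof -
 have gt: "good tau" using tau rt by (auto simp: Z_def intro!: Zg)
 have H: "A.u tau \<in> H12 S" "A.u r \<in> H12 S" "B.u tau \<in> H12 S" "B.u t \<in> H12 S" "B.u tau \<in> Lqs" "B.u t \<in> Lqs"
 using g gt by (auto simp: good_def)
 have I: "tau \<in> {0<..<T} - Z1" "r \<in> {0<..<T} - Z1" "tau \<in> {0<..<T} - Z2" "t \<in> {0<..<T} - Z2" "tau \<in> {0<..<T} - Z3" "t \<in> {0<..<T} - Z3"
 using rt tau by (auto simp: Z_def)
 have d: "\<bar>tau - r\<bar> < h1" "\<bar>tau - t\<bar> < h2" "\<bar>tau - t\<bar> < h3" "\<bar>tau - r\<bar> < h4" "\<bar>tau - t\<bar> < h4" using tau rt by (auto simp: h_def)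
 let ?b = "%x. B.u tau x - B.u t x" and ?a = "%x. A.u tau x - A.u r x"
 have rotb: "ALL x:cball 0 R. ?b x = cross3 (om' tau - om' t) x" by (simp add: B.u_ball Cross3.left_diff_distrib)
 have 1: "\<bar>A.F tau ?b\<bar> <= C * eta * E tau + c * ((norm12 S ?b)\<^sup>2 + Nq ?b powr p)"
 using conjunct1[OF b[rule_format, OF gt], rule_format, OF H12_diff[OF H(3,4)] Lq_minkowski(1)[OF q1 H(5,6)]] rotb by blast
 have 2: "\<bar>B.F tau ?a\<bar> <= C * eta * E tau + c * (norm12 S ?a)\<^sup>2"
 by (rule conjunct2[OF b[rule_format, OF gt], rule_format, OF H12_diff[OF H(1,2)]])
 have n: "(norm12 S ?a)\<^sup>2 <= k1 tau + k1 r" "(norm12 S ?b)\<^sup>2 <= k2 tau + k2 t" "Nq ?b powr p <= k3 tau + k3 t"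
 using k1(6)[rule_format, OF I(1,2) d(1)] k2(6)[rule_format, OF I(3,4) d(2)] k3(6)[rule_format, OF I(5,6) d(3)] by (simp_all add: powr_numeral)
 have 3: "c * ((norm12 S ?b)\<^sup>2 + Nq ?b powr p) <= c * ((k2 tau + k2 t) + (k3 tau + k3 t))" by (rule mult_left_mono[OF add_mono[OF n(2,3)] c])
 have 4: "c * (norm12 S ?a)\<^sup>2 <= c * (k1 tau + k1 r)" by (rule mult_left_mono[OF n(1) c])
 have T3: "tau \<in> {0..T}" "r \<in> {0..T}" "t \<in> {0..T}" using rt tau by auto
 have 5: "\<bar>(B.W tau - B.W t) \<bullet> A.c tau\<bar> <= K * delta"
 by (rule order_trans[OF conjunct1[OF K(2)[rule_format, OF T3(1)]] mult_left_mono[OF conjunct2[OF h4(2)[rule_format, OF T3(1,3) d(5)]] K(1)]])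
 have 6: "\<bar>(A.W tau - A.W r) \<bullet> B.c tau\<bar> <= K * delta"
 by (rule order_trans[OF conjunct2[OF K(2)[rule_format, OF T3(1)]] mult_left_mono[OF conjunct1[OF h4(2)[rule_format, OF T3(1,2) d(4)]] K(1)]])
 have "c * ((k2 tau + k2 t) + (k3 tau + k3 t)) + c * (k1 tau + k1 r) + 2 * (C * eta * E tau) + 2 * (K * delta) <= f tau + (f t + f r)"
 proof -
 have "0 <= 2 * (C * eta * E t) + c * k1 t + 2 * (K * delta) + (2 * (C * eta * E r) + c * (k2 r + k3 r) + 2 * (K * delta))"
 using C(1) eta c E0 k1(2)[rule_format, of t] k2(2)[rule_format, of r] k3(2)[rule_format, of r] K(1) delta by (intro add_nonneg_nonneg mult_nonneg_nonneg) auto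
 then show ?thesis unfolding f_def by (simp add: algebra_simps)
 qed
 then show ?thesis unfolding G_eq[OF gt g] using 1 2 3 4 5 6 by linarith
 qed
 have "AE tau in lebesgue. tau ~: Z" by (rule AE_not_in[OF Z])
 then have "AE tau in lebesgue. tau \<in> {r<..<t} --> \<bar>G r t tau\<bar> <= f tau + (f t + f r)"
 by eventually_elim (use Gb in auto)
 then have ae: "AE tau in Leb {r..t}. norm (G r t tau) <= f tau + (f t + f r)"
 by (intro AE_lebesgue_on_Icc) (simp add: AE_restrict_space_iff)
 have fr: "integrable (Leb {r..t}) f" by (rule integrable_subset[OF fi]) (use rt in auto)
 have cr: "integrable (Leb {r..t}) (%tau. f t + f r)" by (rule finite_measure.integrable_const[OF finite_measure_lebesgue_on]) simp
 note G = P_increment[OF g rt(2)]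
 have "\<bar>P t - P r\<bar> <= (LINT tau|Leb {r..t}. norm (G r t tau))"
 unfolding G(1) using integral_norm_bound[of "Leb {r..t}" "G r t"] by simp
 also have "... <= (LINT tau|Leb {r..t}. f tau + (f t + f r))"
 by (rule integral_mono_AE[OF integrable_norm[OF G(2)] Bochner_Integration.integrable_add[OF fr cr] ae])
 also have "... = (LINT tau|Leb {r..t}. f tau) + (LINT tau|Leb {r..t}. f t + f r)"
 by (rule Bochner_Integration.integral_add[OF fr cr])
 also have "(LINT tau|Leb {r..t}. f t + f r) = (t - r) * (f t + f r)" using rt by (simp add: measure_restrict_space)
 finally show ?thesis .
 qed
 have h0: "0 < h" using k1(4) k2(4) k3(4) h4(1) by (simp add: h_def)
 show ?thesis
 by (intro exI[of _ f] exI[of _ h] exI[of _ Z] conjI allI impI fi f0 fe h0 Z incr) assumption+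
qed

end

context gap
begin

section \<open>Growth and coercivity\<close>

lemma l2_MV_le: "sqint MV w ==> l2 MV w <= l2 Ml w + l2 MB w"
proof -
 assume "sqint MV w"
 then have "(l2 MV w)\<^sup>2 <= (l2 Ml w + l2 MB w)\<^sup>2" using sqint_split(3)[of w] by (simp add: power2_sum)
 then show ?thesis by (rule power2_le_imp_le) simp
qed

lemma triple_product: "a \<bullet> cross3 b c = cross3 a b \<bullet> c"
 by (simp add: cross3_simps)

text \<open>The parameter \<open>\<eta>\<close> is chosen so that the terms with \<open>X\<^sup>2\<close> add up to the dissipation. The constant
 depends on the system and on the exponents alone, which the uniformity in the theorem requires.\<close>

lemma difference_form_bound:
 fixes p q :: real assumes q: "3 < q" and pq: "2 / p + 3 / q = 1"
 shows "\<exists>C0\<ge>0. ALL w:H12 S. ALL b:H12 S. ALL omega omega1 Z. b \<in> Lq_space q (liquid S) --> (ALL x:cball 0 R. b x = cross3 omega x) -->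
 2 * (cross3 omega1 (Z + b_vec S w) \<bullet> (J *v Z)) + 2 * tri w w b + 4 * cor (Z + b_vec S w) w b - 4 * viscosity S * dis w w
 <= C0 * (1 + norm omega1 + (norm omega)\<^sup>2 + Lq_norm q (liquid S) b powr p) * (energy S w + Z \<bullet> (J *v Z))"
proof -
 note e = serrin_exponents[OF q pq]
 obtain k where k: "0 < k" "!!w. sqint MV w ==> k * (l2 MV w)\<^sup>2 <= energy S w" using energy_coercive by blast
 obtain Cb where Cb: "0 < Cb" "!!w. sqint MV w ==> norm (b_vec S w) <= Cb * l2 MV w" using b_vec_bound by blast
 obtain CJ where CJ: "0 < CJ" "!!beta. norm (J *v beta) <= CJ * norm beta" using J_bound by blast
 obtain Cq where Cq: "0 < Cq" "!!w :: field3. w \<in> Lq_space q (liquid S) ==> l2 Ml w <= Cq * Lq_norm q (liquid S) w" using l2_le_Lq[OF q] by blast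
 define eta where "eta = viscosity S / (334 * dmax)"
 have eta: "0 < eta" "dmax * 334 * eta = viscosity S" using pos(3) dens_bounds(4) by (auto simp: eta_def)
 obtain c1 where c1: "0 <= c1" "\<forall>x\<ge>0. \<forall>y\<ge>0. x powr (1 + 3 / q) * y <= eta * x\<^sup>2 + c1 * y powr p"
 using young_mixed[OF q pq eta(1)] by (elim exE conjE)
 define L1 where "L1 = 2 * CJ * (1 + Cb)"
 define L2 where "L2 = 2 * dmax * (333 * c1 + 1 / eta * R\<^sup>2)"
 define L3 where "L3 = 4 * dmax * (1 + Cb) * (Cq + spinc)"
 define C0 where "C0 = (L1 + L2 + L3) * (1 / k + 1 / lam)"
 have L: "0 <= L1" "0 <= L2" "0 <= L3" "0 <= 1 / k + 1 / lam"
 using CJ(1) Cb(1) Cq(1) dens_bounds(4) c1(1) eta(1) spinc_pos k(1) pos by (auto simp: L1_def L2_def L3_def)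
 have main: "2 * (cross3 omega1 (Z + b_vec S w) \<bullet> (J *v Z)) + 2 * tri w w b + 4 * cor (Z + b_vec S w) w b - 4 * viscosity S * dis w w
 <= C0 * (1 + norm omega1 + (norm omega)\<^sup>2 + Lq_norm q (liquid S) b powr p) * (energy S w + Z \<bullet> (J *v Z))"
 if w: "w \<in> H12 S" and b: "b \<in> H12 S" "b \<in> Lq_space q (liquid S)" and omega: "ALL x:cball 0 R. b x = cross3 omega x" for w b omega omega1 Z
 proof -
 note sw = H12_D(1)[OF w] and sb = H12_D(1)[OF b(1)]
 define X where "X = l2 MV (Gd w)"
 define Y where "Y = l2 MV w"
 define m where "m = Lq_norm q (liquid S) b"
 define z where "z = norm Z"
 define Q where "Q = z\<^sup>2 + Y\<^sup>2"
 define Theta where "Theta = 1 + norm omega1 + (norm omega)\<^sup>2 + m powr p"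
 have nn: "0 <= X" "0 <= Y" "0 <= m" "0 <= z" "0 <= Q" by (simp_all add: X_def Y_def m_def z_def Q_def)
 have Theta: "norm omega1 <= Theta" "1 + (norm omega)\<^sup>2 + m powr p <= Theta" "(norm omega)\<^sup>2 <= Theta" "m powr p <= Theta" "0 <= Theta"
 by (simp_all add: Theta_def add_nonneg_nonneg add_increasing)
 have zY: "z * Y <= Q"
 proof -
 have "0 <= z * Y" using nn by simp
 then show ?thesis using sum_squares_bound[of z Y] unfolding Q_def by linarith
 qed
 have sp: "norm (Z + b_vec S w) <= z + Cb * Y"
 using norm_triangle_ineq[of Z "b_vec S w"] Cb(2)[OF sw] unfolding z_def Y_def by linarith
 have sz: "(z + Cb * Y) * z <= (1 + Cb) * Q"
 proof -
 have "(z + Cb * Y) * z = z\<^sup>2 + Cb * (z * Y)" by (simp add: power2_eq_square algebra_simps)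
 also have "... <= Q + Cb * Q" using zY Cb(1) by (intro add_mono mult_left_mono) (auto simp: Q_def)
 finally show ?thesis by (simp add: algebra_simps)
 qed
 have sY: "(z + Cb * Y) * Y <= (1 + Cb) * Q"
 proof -
 have "(z + Cb * Y) * Y = z * Y + Cb * Y\<^sup>2" by (simp add: power2_eq_square algebra_simps)
 also have "... <= Q + Cb * Q" using zY Cb(1) by (intro add_mono mult_left_mono) (auto simp: Q_def)
 finally show ?thesis by (simp add: algebra_simps)
 qed
 have t2: "2 * (cross3 omega1 (Z + b_vec S w) \<bullet> (J *v Z)) <= L1 * (Theta * Q)"
 proof -
 have "cross3 omega1 (Z + b_vec S w) \<bullet> (J *v Z) <= norm (cross3 omega1 (Z + b_vec S w)) * norm (J *v Z)" by (rule norm_cauchy_schwarz)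
 also have "... <= (norm omega1 * norm (Z + b_vec S w)) * (CJ * z)"
 unfolding z_def by (intro mult_mono norm_cross_le CJ(2)) auto
 also have "... <= (Theta * (z + Cb * Y)) * (CJ * z)"
 using Theta sp nn CJ(1) by (intro mult_right_mono mult_mono) auto
 also have "... = CJ * Theta * ((z + Cb * Y) * z)" by (simp add: mult_ac)
 also have "... <= CJ * Theta * ((1 + Cb) * Q)" using CJ(1) Theta(5) by (intro mult_left_mono sz) auto
 finally have "cross3 omega1 (Z + b_vec S w) \<bullet> (J *v Z) <= CJ * Theta * ((1 + Cb) * Q)" .
 moreover have "L1 * (Theta * Q) = 2 * (CJ * Theta * ((1 + Cb) * Q))" by (simp add: L1_def algebra_simps)
 ultimately show ?thesis by linarith
 qed
 have t3: "2 * tri w w b <= 2 * viscosity S * X\<^sup>2 + L2 * (Theta * Q)"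
 proof -
 have "tri w w b <= dmax * (X * (333 * (Y powr (1 - 3 / q) * X powr (3 / q) * m) + R * norm omega * Y))"
 unfolding X_def Y_def m_def by (rule order_trans[OF abs_ge_self serrin_bound[OF q w w b]]) (use omega in auto)
 also have "... = dmax * (333 * ((X powr (3 / q) * X) * (Y powr (1 - 3 / q) * m)) + X * (R * norm omega * Y))" by (simp add: algebra_simps)
 also have "X powr (3 / q) * X = X powr (1 + 3 / q)" using nn(1) q by (cases "X = 0") (auto simp: powr_add)
 also have "dmax * (333 * (X powr (1 + 3 / q) * (Y powr (1 - 3 / q) * m)) + X * (R * norm omega * Y))
 <= dmax * (333 * (eta * X\<^sup>2 + c1 * (Y\<^sup>2 * m powr p)) + (eta * X\<^sup>2 + 1 / eta * (R\<^sup>2 * (norm omega)\<^sup>2 * Y\<^sup>2)))"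
 proof -
 have "(Y powr (1 - 3 / q) * m) powr p = Y\<^sup>2 * m powr p"
 using nn e by (simp add: powr_mult powr_powr)
 then have "X powr (1 + 3 / q) * (Y powr (1 - 3 / q) * m) <= eta * X\<^sup>2 + c1 * (Y\<^sup>2 * m powr p)"
 using c1(2)[rule_format, of X "Y powr (1 - 3 / q) * m"] nn by simp
 moreover have "X * (R * norm omega * Y) <= eta * X\<^sup>2 + 1 / eta * (R\<^sup>2 * (norm omega)\<^sup>2 * Y\<^sup>2)"
 using mult_le_eta[OF eta(1), of X "R * norm omega * Y"] by (simp add: power_mult_distrib)
 ultimately show ?thesis using dens_bounds(4) by (intro mult_left_mono add_mono) auto
 qed
 also have "... = (dmax * 334 * eta) * X\<^sup>2 + dmax * (333 * c1 * (Y\<^sup>2 * m powr p) + 1 / eta * R\<^sup>2 * (Y\<^sup>2 * (norm omega)\<^sup>2))" by (simp add: algebra_simps)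
 also have "... <= viscosity S * X\<^sup>2 + dmax * (333 * c1 * (Q * Theta) + 1 / eta * R\<^sup>2 * (Q * Theta))"
 unfolding eta(2) using dens_bounds(4) c1(1) eta(1) Theta nn
 by (intro add_left_mono mult_left_mono add_mono mult_mono) (auto simp: Q_def)
 also have "... = viscosity S * X\<^sup>2 + L2 / 2 * (Theta * Q)" by (simp add: L2_def algebra_simps)
 finally show ?thesis by simp
 qed
 have t4: "4 * cor (Z + b_vec S w) w b <= L3 * (Theta * Q)"
 proof -
 have "l2 MV b <= l2 Ml b + l2 MB b" by (rule l2_MV_le[OF sb])
 also have "... <= Cq * m + spinc * norm omega" unfolding m_def using Cq(2)[OF b(2)] l2_ball_spin[of b omega] omega by simp
 also have "... <= Cq * Theta + spinc * Theta"
 proof (intro add_mono mult_left_mono)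
 have "m powr 1 <= m powr p" if "1 <= m" by (rule powr_mono) (use that e(1) in auto)
 then have "m <= 1 + m powr p" using nn(3) by (cases "1 <= m") (auto simp: add_increasing2)
 then show "m <= Theta" using Theta(2) zero_le_power2[of "norm omega"] by linarith
 have "norm omega <= 1 + (norm omega)\<^sup>2"
 proof -
 have "0 <= norm omega" by simp
 then show ?thesis using sum_squares_bound[of 1 "norm omega"] unfolding mult_1_right one_power2 by linarith
 qed
 then show "norm omega <= Theta" using Theta(2) powr_ge_zero[of m p] by linarith
 qed (use Cq(1) spinc_pos in auto)
 also have "... = (Cq + spinc) * Theta" by (simp add: algebra_simps)
 finally have lb: "l2 MV b <= (Cq + spinc) * Theta" .
 have "cor (Z + b_vec S w) w b <= dmax * norm (Z + b_vec S w) * (Y * l2 MV b)"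
 unfolding Y_def by (rule order_trans[OF abs_ge_self cor_bound[OF sw sb]])
 also have "... <= dmax * (z + Cb * Y) * (Y * ((Cq + spinc) * Theta))"
 using dens_bounds(4) sp lb nn Cb(1) by (intro mult_mono mult_left_mono) auto
 also have "... = dmax * (Cq + spinc) * Theta * ((z + Cb * Y) * Y)" by (simp add: mult_ac)
 also have "... <= dmax * (Cq + spinc) * Theta * ((1 + Cb) * Q)"
 using dens_bounds(4) Cq(1) spinc_pos Theta(5) by (intro mult_left_mono sY) auto
 finally have "cor (Z + b_vec S w) w b <= dmax * (Cq + spinc) * Theta * ((1 + Cb) * Q)" .
 moreover have "L3 * (Theta * Q) = 4 * (dmax * (Cq + spinc) * Theta * ((1 + Cb) * Q))" by (simp add: L3_def algebra_simps)
 ultimately show ?thesis by linarith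
 qed
 have d: "4 * viscosity S * dis w w = 2 * viscosity S * X\<^sup>2"
 unfolding dis_facts(4)[OF w w w] X_def korn[OF w] by simp
 have Qy: "Q <= (1 / k + 1 / lam) * (energy S w + Z \<bullet> (J *v Z))"
 proof -
 have Y2: "k * Y\<^sup>2 <= energy S w" unfolding Y_def by (rule k(2)[OF sw])
 have z2: "lam * z\<^sup>2 <= Z \<bullet> (J *v Z)" unfolding z_def by (rule J_lower)
 have "0 <= k * Y\<^sup>2" "0 <= lam * z\<^sup>2" using k(1) pos(4) by auto
 with Y2 z2 have nn2: "0 <= energy S w" "0 <= Z \<bullet> (J *v Z)" by linarith+
 have "Y\<^sup>2 <= 1 / k * energy S w" using Y2 k(1) by (simp add: pos_le_divide_eq mult.commute)
 moreover have "z\<^sup>2 <= 1 / lam * (Z \<bullet> (J *v Z))" using z2 pos(4) by (simp add: pos_le_divide_eq mult.commute)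
 moreover have "0 <= 1 / lam * energy S w" "0 <= 1 / k * (Z \<bullet> (J *v Z))" using nn2 k(1) pos(4) by auto
 ultimately show ?thesis unfolding Q_def ring_distribs by linarith
 qed
 have "2 * (cross3 omega1 (Z + b_vec S w) \<bullet> (J *v Z)) + 2 * tri w w b + 4 * cor (Z + b_vec S w) w b - 4 * viscosity S * dis w w
 <= L1 * (Theta * Q) + L2 * (Theta * Q) + L3 * (Theta * Q)" using t2 t3 t4 unfolding d by linarith
 also have "... = (L1 + L2 + L3) * Theta * Q" by (simp add: algebra_simps)
 also have "... <= (L1 + L2 + L3) * Theta * ((1 / k + 1 / lam) * (energy S w + Z \<bullet> (J *v Z)))"
 using L Theta(5) by (intro mult_left_mono Qy) auto
 also have "... = C0 * Theta * (energy S w + Z \<bullet> (J *v Z))" by (simp only: C0_def mult_ac)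
 finally show ?thesis unfolding Theta_def m_def .
 qed
 have "0 <= C0" unfolding C0_def by (rule mult_nonneg_nonneg[OF _ L(4)]) (intro add_nonneg_nonneg L)
 then show ?thesis by (intro exI[of _ C0] conjI) (assumption, intro ballI allI impI, rule main)
qed

lemma norm_equivalence:
 "\<exists>C>0. ALL w omega Z. sqint MV w --> (ALL x:cball 0 R. w x = cross3 omega x) -->
 l2 Ml w + norm (Z + b_vec S w) + norm omega <= C * sqrt (energy S w + Z \<bullet> (J *v Z)) &
 sqrt (energy S w + Z \<bullet> (J *v Z)) <= C * (l2 Ml w + norm (Z + b_vec S w) + norm omega)"
proof -
 obtain k where k: "0 < k" "!!w. sqint MV w ==> k * (l2 MV w)\<^sup>2 <= energy S w" using energy_coercive by blast
 obtain Cb where Cb: "0 < Cb" "!!w. sqint MV w ==> norm (b_vec S w) <= Cb * l2 MV w" using b_vec_bound by blast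
 obtain CJ where CJ: "0 < CJ" "!!beta. norm (J *v beta) <= CJ * norm beta" using J_bound by blast
 obtain CB where CB: "0 < CB" "!!u w. sqint MV u ==> sqint MV w ==> \<bar>inner_B S u w\<bar> <= CB * (l2 MV u * l2 MV w)" using inner_B_bound by blast
 define C1 where "C1 = (1 + Cb + 1 / spinc) / sqrt k + 1 / sqrt lam"
 define C2 where "C2 = (sqrt CB + sqrt CJ * Cb) * (1 + spinc) + sqrt CJ"
 have C: "0 < C1" "0 < C2" using k(1) Cb(1) CJ(1) CB(1) spinc_pos pos by (auto simp: C1_def C2_def add_pos_pos add_nonneg_pos)
 have main: "l2 Ml w + norm (Z + b_vec S w) + norm omega <= (C1 + C2) * sqrt (energy S w + Z \<bullet> (J *v Z)) &
 sqrt (energy S w + Z \<bullet> (J *v Z)) <= (C1 + C2) * (l2 Ml w + norm (Z + b_vec S w) + norm omega)"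
 if w: "sqint MV w" and omega: "ALL x:cball 0 R. w x = cross3 omega x" for w omega Z
 proof -
 define Y where "Y = l2 MV w"
 define y where "y = energy S w + Z \<bullet> (J *v Z)"
 define \<Sigma> where "\<Sigma> = l2 Ml w + norm (Z + b_vec S w) + norm omega"
 have spin: "l2 MB w = spinc * norm omega" using l2_ball_spin[of w omega] omega by simp
 have Y2: "k * Y\<^sup>2 <= energy S w" unfolding Y_def by (rule k(2)[OF w])
 have z2: "lam * (norm Z)\<^sup>2 <= Z \<bullet> (J *v Z)" by (rule J_lower)
 have "0 <= k * Y\<^sup>2" "0 <= lam * (norm Z)\<^sup>2" using k(1) pos(4) by auto
 with Y2 z2 have ky: "k * Y\<^sup>2 <= y" "lam * (norm Z)\<^sup>2 <= y" unfolding y_def by linarith+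
 have Y: "Y <= sqrt y / sqrt k"
 using real_le_rsqrt[of Y "y / k"] ky(1) k(1) by (simp add: pos_le_divide_eq mult.commute real_sqrt_divide)
 have z: "norm Z <= sqrt y / sqrt lam"
 using real_le_rsqrt[of "norm Z" "y / lam"] ky(2) pos(4) by (simp add: pos_le_divide_eq mult.commute real_sqrt_divide)
 have b: "norm (b_vec S w) <= Cb * Y" unfolding Y_def by (rule Cb(2)[OF w])
 have om: "norm omega <= 1 / spinc * Y"
 using l2_MB_le(1)[OF w] spinc_pos unfolding spin Y_def by (simp add: pos_le_divide_eq mult.commute)
 have "\<Sigma> <= Y + (norm Z + Cb * Y) + 1 / spinc * Y"
 using l2_MB_le(2)[OF w] norm_triangle_ineq[of Z "b_vec S w"] b om unfolding \<Sigma>_def Y_def by linarith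
 also have "... = (1 + Cb + 1 / spinc) * Y + norm Z" by (simp add: algebra_simps)
 also have "... <= (1 + Cb + 1 / spinc) * (sqrt y / sqrt k) + sqrt y / sqrt lam"
 using Cb(1) spinc_pos by (intro add_mono mult_left_mono Y z) auto
 also have "... = C1 * sqrt y" by (simp add: C1_def algebra_simps add_divide_distrib)
 finally have 1: "\<Sigma> <= C1 * sqrt y" .
 have y0: "0 <= y" using ky(1) \<open>0 <= k * Y\<^sup>2\<close> by linarith
 have \<Sigma>0: "0 <= \<Sigma>" by (simp add: \<Sigma>_def)
 have "Y <= l2 Ml w + spinc * norm omega" using l2_MV_le[OF w] unfolding Y_def spin .
 also have "... <= 1 * \<Sigma> + spinc * \<Sigma>" using spinc_pos by (intro add_mono mult_left_mono) (auto simp: \<Sigma>_def)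
 finally have Y\<Sigma>: "Y <= (1 + spinc) * \<Sigma>" by (simp add: algebra_simps)
 have "norm Z <= norm (Z + b_vec S w) + norm (b_vec S w)" using norm_triangle_ineq4[of "Z + b_vec S w" "b_vec S w"] by simp
 then have z\<Sigma>: "norm Z <= \<Sigma> + Cb * Y" using b l2_nonneg[of Ml w] norm_ge_zero[of omega] unfolding \<Sigma>_def by linarith
 have "y <= CB * Y\<^sup>2 + CJ * (norm Z)\<^sup>2"
 proof -
 have "energy S w <= CB * Y\<^sup>2" using CB(2)[OF w w] unfolding energy_eq Y_def by (simp add: power2_eq_square)
 moreover have "Z \<bullet> (J *v Z) <= norm Z * norm (J *v Z)" by (rule norm_cauchy_schwarz)
 moreover have "norm Z * norm (J *v Z) <= norm Z * (CJ * norm Z)" by (rule mult_left_mono[OF CJ(2)]) simp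
 ultimately show ?thesis unfolding y_def by (simp add: power2_eq_square mult_ac)
 qed
 then have "sqrt y <= sqrt (CB * Y\<^sup>2 + CJ * (norm Z)\<^sup>2)" by simp
 also have "... <= sqrt (CB * Y\<^sup>2) + sqrt (CJ * (norm Z)\<^sup>2)" by (rule sqrt_add_le_add_sqrt) (use CB(1) CJ(1) in auto)
 also have "... = sqrt CB * Y + sqrt CJ * norm Z" by (simp add: real_sqrt_mult Y_def)
 also have "... <= sqrt CB * Y + sqrt CJ * (\<Sigma> + Cb * Y)" using CJ(1) z\<Sigma> by (intro add_left_mono mult_left_mono) auto
 also have "... = (sqrt CB + sqrt CJ * Cb) * Y + sqrt CJ * \<Sigma>" by (simp add: algebra_simps)
 also have "... <= (sqrt CB + sqrt CJ * Cb) * ((1 + spinc) * \<Sigma>) + sqrt CJ * \<Sigma>"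
 using CB(1) CJ(1) Cb(1) Y\<Sigma> by (intro add_right_mono mult_left_mono) auto
 also have "... = C2 * \<Sigma>" by (simp add: C2_def algebra_simps)
 finally have 2: "sqrt y <= C2 * \<Sigma>" .
 have "0 <= C2 * sqrt y" "0 <= C1 * \<Sigma>" using C y0 \<Sigma>0 by auto
 with 1 2 have "\<Sigma> <= (C1 + C2) * sqrt y" "sqrt y <= (C1 + C2) * \<Sigma>" unfolding distrib_right by linarith+
 then show ?thesis unfolding \<Sigma>_def y_def by (rule conjI)
 qed
 show ?thesis using C by (intro exI[of _ "C1 + C2"] conjI allI impI main[THEN conjunct1] main[THEN conjunct2]) auto
qed

end

context wsol
begin

lemma integrable_dis: "integrable (Leb {0<..<T}) (%t. dis (u t) (u t))"
proof (rule Bochner_Integration.integrable_bound[where f = "%t. (norm12 S (u t))\<^sup>2 / (2 * viscosity S)"])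
 show "integrable (Leb {0<..<T}) (%t. (norm12 S (u t))\<^sup>2 / (2 * viscosity S))" using integrable_norm12 by simp
 show "(%t. dis (u t) (u t)) \<in> borel_measurable (Leb {0<..<T})" by (rule measurable_time_pair(1)[OF u_strong])
 show "AE t in Leb {0<..<T}. norm (dis (u t) (u t)) <= norm ((norm12 S (u t))\<^sup>2 / (2 * viscosity S))"
 using u_strong(2)
 proof eventually_elim
 case (elim t)
 then show ?case using dis_bound[OF elim elim] pos(3) by (simp add: pos_le_divide_eq power2_eq_square mult.commute)
 qed
qed

lemma energy_bound:
 assumes t: "0 <= t"
 shows "energy S (u t) + W t \<bullet> (J *v W t) + 4 * viscosity S * (LINT tau|Leb {0..t}. dis (u tau) (u tau)) <= energy S (u 0) + W 0 \<bullet> (J *v W 0)"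
proof -
 let ?M = "Leb {0..t}"
 have "AE tau in Leb {0<..<t}. dis (u tau) (u tau) = (Lq_norm 2 (liquid S) (Dd (u tau)))\<^sup>2"
 using u_strong(2) by eventually_elim (simp add: Lq_norm_2 Dd_liquid dis_facts(4))
 then have ae: "AE tau in ?M. dis (u tau) (u tau) = (Lq_norm 2 (liquid S) (Dd (u tau)))\<^sup>2" by (rule AE_lebesgue_on_Icc)
 have m: "(%tau. dis (u tau) (u tau)) \<in> borel_measurable ?M"
 using integrable_dis[of t, folded integrable_Icc_Ioo] by (rule borel_measurable_integrable)
 have "(LINT tau|?M. dis (u tau) (u tau)) = (LINT tau|?M. (Lq_norm 2 (liquid S) (Dd (u tau)))\<^sup>2)"
 by (rule integral_cong_AE[OF m borel_measurable_lebesgue_on_AE[OF _ m ae] ae]) simp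
 then show ?thesis using ws_unfolded(5)[OF t] by (simp add: energy_inequality_def)
qed

lemma om_bounded: "\<exists>B\<ge>0. \<forall>t\<ge>0. norm (om t) <= B"
proof -
 obtain B where B: "0 <= B" "!!t. 0 <= t ==> l2 MV (u t) <= B" using bounded by blast
 have "norm (om t) <= B / spinc" if t: "0 <= t" for t
 proof -
 have "spinc * norm (om t) = l2 MB (u t)" using l2_ball_spin[of "u t" "om t"] u_ball by simp
 also have "... <= B" using l2_MB_le(1)[OF u_sq[OF t]] B(2)[OF t] by simp
 finally show ?thesis using spinc_pos by (simp add: pos_le_divide_eq mult.commute)
 qed
 then show ?thesis using B(1) spinc_pos by (intro exI[of _ "B / spinc"]) simp
qed

end

context solution_pair
begin

section \<open>The energy of the difference\<close>

definition w :: "real => field3" where "w t = (%x. A.u t x - B.u t x)"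
definition Z :: "real => real^3" where "Z t = A.W t - B.W t"
definition y :: "real => real" where "y t = energy S (w t) + Z t \<bullet> (J *v Z t)"
definition K :: "real => real" where
 "K tau = 2 * H tau - 4 * viscosity S * (dis (A.u tau) (A.u tau) + dis (B.u tau) (B.u tau))"

lemma w_H2: "0 <= t ==> w t \<in> H2 S" unfolding w_def by (rule H2_diff[OF A.u_H2 B.u_H2])
lemma w_sq: "0 <= t ==> sqint MV (w t)" by (rule H2_D(1)[OF w_H2])

lemma w_ball: "x \<in> cball 0 R ==> w t x = cross3 (om t - om' t) x"
 unfolding w_def A.u_ball B.u_ball by (simp add: Cross3.left_diff_distrib)

lemma zeta_eq: "0 <= t ==> om1 t - om1' t = Z t + b_vec S (w t)"
 unfolding w_def Z_def A.om1_eq[of t] B.om1_eq[of t] by (simp add: b_vec_diff[OF A.u_sq B.u_sq])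

lemma y_nonneg: "0 <= t ==> 0 <= y t"
proof -
 assume t: "0 <= t"
 have "0 <= lam * (norm (Z t))\<^sup>2" using pos(4) by simp
 then show ?thesis using energy_nonneg[OF w_sq[OF t]] J_lower[of "Z t"] unfolding y_def by linarith
qed

lemma y_eq:
 assumes t: "0 <= t"
 shows "y t = (energy S (A.u t) + A.W t \<bullet> (J *v A.W t)) + (energy S (B.u t) + B.W t \<bullet> (J *v B.W t))
 - 2 * (inner_B S (A.u t) (B.u t) + B.W t \<bullet> (J *v A.W t))"
proof -
 have "Z t \<bullet> (J *v Z t) = A.W t \<bullet> (J *v A.W t) - 2 * (B.W t \<bullet> (J *v A.W t)) + B.W t \<bullet> (J *v B.W t)"
 unfolding Z_def using J_sym[of "A.W t" "B.W t"]
 by (simp add: inner_diff_left inner_diff_right matrix_vector_mult_diff_distrib)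
 then show ?thesis unfolding y_def w_def energy_diff[OF A.u_sq[OF t] B.u_sq[OF t]] by simp
qed

lemma integrable_K: "0 <= r ==> t <= T ==> integrable (Leb {r..t}) K"
proof -
 have i: "integrable (Leb {0..T}) K"
 unfolding K_def[abs_def] integrable_Icc_Ioo using integrable_H A.integrable_dis B.integrable_dis by simp
 show "0 <= r ==> t <= T ==> integrable (Leb {r..t}) K" by (rule integrable_subset[OF i]) auto
qed

lemma y_upper:
 assumes t: "0 <= t" "t <= T"
 shows "y t <= y 0 + 2 * (P 0 - P t) + (LINT tau|Leb {0..t}. K tau)"
proof -
 have i: "integrable (Leb {0..t}) (%tau. dis (A.u tau) (A.u tau))" "integrable (Leb {0..t}) (%tau. dis (B.u tau) (B.u tau))"
 using A.integrable_dis[of t] B.integrable_dis[of t] by (simp_all add: integrable_Icc_Ioo)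
 have "(LINT tau|Leb {0..t}. K tau) = 2 * (LINT tau|Leb {0..t}. H tau)
 - 4 * viscosity S * (LINT tau|Leb {0..t}. dis (A.u tau) (A.u tau)) - 4 * viscosity S * (LINT tau|Leb {0..t}. dis (B.u tau) (B.u tau))"
 unfolding K_def using integrable_H_Icc[OF order_refl t(2)] i by (simp add: distrib_left)
 moreover have "(LINT tau|Leb {0..0}. H tau) = 0"
 proof -
 have "AE tau in lebesgue. tau ~: {0::real}" by (rule AE_not_in) (simp add: negligible_iff_null_sets[symmetric])
 then have "AE tau in lebesgue. tau \<in> {0::real..0} --> H tau = 0" by eventually_elim auto
 then have "AE tau in Leb {0::real..0}. H tau = 0" by (subst AE_restrict_space_iff) simp_all
 then show ?thesis by (rule integral_eq_zero_AE)
 qed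
 ultimately show ?thesis using A.energy_bound[OF t(1)] B.energy_bound[OF t(1)] y_eq[OF t(1)] y_eq[OF order_refl] unfolding P_def by (simp add: algebra_simps)
qed

lemma y_lower: "0 <= s ==> 0 <= t ==> 2 * (inner_B S (A.u s) (w t) - inner_B S (B.u s) (w t)) - energy S (w t) + Z s \<bullet> (J *v Z s) <= y s"
proof -
 assume s: "0 <= s" and t: "0 <= t"
 have "0 <= energy S (%x. w s x - w t x)" by (rule energy_nonneg[OF sqint_diff[OF w_sq[OF s] w_sq[OF t]]])
 then have "2 * inner_B S (w s) (w t) - energy S (w t) <= energy S (w s)" unfolding energy_diff[OF w_sq[OF s] w_sq[OF t]] by simp
 moreover have "inner_B S (w s) (w t) = inner_B S (A.u s) (w t) - inner_B S (B.u s) (w t)"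
 unfolding w_def[of s] by (rule inner_B_diff[OF A.u_sq[OF s] B.u_sq[OF s] w_sq[OF t]])
 ultimately show ?thesis unfolding y_def by simp
qed

text \<open>Lower semicontinuity of \<open>y\<close> along sequences, in the form of a convergent lower bound. It replaces the
 continuity in the strong sense that weak solutions do not have.\<close>

lemma y_lower_tendsto:
 assumes s: "!!n::nat. 0 <= s n" and t: "0 <= t" and lim: "s ----> t"
 shows "(%n. 2 * (inner_B S (A.u (s n)) (w t) - inner_B S (B.u (s n)) (w t)) - energy S (w t) + Z (s n) \<bullet> (J *v Z (s n))) ----> y t"
proof -
 have Zl: "(%n. Z (s n)) ----> Z t" unfolding Z_def by (intro tendsto_diff A.W_tendsto B.W_tendsto s t lim)
 have "(%n. 2 * (inner_B S (A.u (s n)) (w t) - inner_B S (B.u (s n)) (w t)) - energy S (w t) + Z (s n) \<bullet> (J *v Z (s n)))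
 ----> 2 * (inner_B S (A.u t) (w t) - inner_B S (B.u t) (w t)) - energy S (w t) + Z t \<bullet> (J *v Z t)"
 by (intro tendsto_add tendsto_diff tendsto_mult tendsto_const A.weak_continuity B.weak_continuity w_H2 s t lim
 tendsto_inner Zl bounded_linear.tendsto[OF matrix_vector_mul_bounded_linear])
 moreover have "inner_B S (A.u t) (w t) - inner_B S (B.u t) (w t) = energy S (w t)"
 unfolding energy_eq using inner_B_diff[OF A.u_sq[OF t] B.u_sq[OF t] w_sq[OF t]] by (simp add: w_def)
 ultimately show ?thesis by (simp add: y_def)
qed

lemma P_at_0:
 assumes r: "!!n::nat. 0 <= r n" "!!n. r n <= T" "r ----> 0"
 shows "(%n. P (r n)) ----> P 0"
proof -
 obtain CB where CB: "0 < CB" "!!u w. sqint MV u ==> sqint MV w ==> \<bar>inner_B S u w\<bar> <= CB * (l2 MV u * l2 MV w)" using inner_B_bound by blast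
 obtain Bd where Bd: "0 <= Bd" "!!t. 0 <= t ==> l2 MV (A.u t) <= Bd" using A.bounded by blast
 let ?d = "%n x. B.u (r n) x - B.u 0 x"
 have z: "(%n. inner_B S (A.u (r n)) (?d n)) ----> 0"
 proof (rule tendsto_bound_null)
 show "\<bar>inner_B S (A.u (r n)) (?d n) - 0\<bar> <= CB * Bd * l2 MV (?d n)" for n
 proof -
 have "\<bar>inner_B S (A.u (r n)) (?d n)\<bar> <= CB * (l2 MV (A.u (r n)) * l2 MV (?d n))" by (intro CB A.u_sq sqint_diff B.u_sq r) simp
 also have "... <= CB * (Bd * l2 MV (?d n))" using CB(1) by (intro mult_left_mono mult_right_mono Bd r) auto
 finally show ?thesis by (simp add: mult.assoc)
 qed
 show "(%n. CB * Bd * l2 MV (?d n)) ----> 0" by (rule tendsto_mult_right_zero[OF B.strong_at_0[OF r(1,3)]])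
 qed
 have w0: "(%n. inner_B S (A.u (r n)) (B.u 0)) ----> inner_B S (A.u 0) (B.u 0)"
 by (rule A.weak_continuity[OF B.u_H2 r(1) _ r(3)]) auto
 have sp: "inner_B S (A.u (r n)) (?d n) + inner_B S (A.u (r n)) (B.u 0) = inner_B S (A.u (r n)) (B.u (r n))" for n
 using inner_B_diff[OF B.u_sq[OF r(1)[of n]] B.u_sq[OF order_refl] A.u_sq[OF r(1)[of n]]]
 by (simp add: inner_B_commute[of "A.u (r n)"])
 have 1: "(%n. inner_B S (A.u (r n)) (B.u (r n))) ----> inner_B S (A.u 0) (B.u 0)"
 using tendsto_add[OF z w0] unfolding sp by simp
 have 2: "(%n. B.W (r n) \<bullet> (J *v A.W (r n))) ----> B.W 0 \<bullet> (J *v A.W 0)"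
 by (intro tendsto_inner A.W_tendsto B.W_tendsto r order_refl bounded_linear.tendsto[OF matrix_vector_mul_bounded_linear])
 have 3: "(%n. \<integral>tau. H tau \<partial>Leb {0..r n}) ----> (LINT tau|Leb {0..0}. H tau)"
 by (rule continuous_on_tendsto_compose[OF indefinite_integral_continuous_real[OF integrable_H_Icc[OF order_refl order_refl]] r(3)])
 (use r T in auto)
 show ?thesis unfolding P_def by (intro tendsto_add 1 2 3)
qed

lemma P_close: "0 < t ==> t < T ==> 0 < e ==> EX r s. 0 < r & r < e & t - e < s & s < t & r <= s & \<bar>P s - P r\<bar> <= e"
 by (rule almost_constant[OF P_modulus])

text \<open>The balance holds between times \<open>r\<close> close to 0 and \<open>s\<close> close to \<open>t\<close>. At 0 the cross term converges because
 of \<open>strong_at_0\<close>, and at \<open>t\<close> lower semicontinuity suffices.\<close>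

lemma energy_difference:
 assumes t: "0 < t" "t < T"
 shows "y t <= y 0 + (LINT tau|Leb {0..t}. K tau)"
proof -
 let ?e = "%n::nat. min (inverse (real (Suc n))) t"
 have e: "0 < ?e n" for n using t by simp
 have "ALL n. EX x. 0 < fst x & fst x < ?e n & t - ?e n < snd x & snd x < t & fst x <= snd x & \<bar>P (snd x) - P (fst x)\<bar> <= ?e n"
 proof
 fix n
 obtain r s where "0 < r & r < ?e n & t - ?e n < s & s < t & r <= s & \<bar>P s - P r\<bar> <= ?e n"
 using P_close[OF t e[of n]] by (elim exE)
 then show "EX x. 0 < fst x & fst x < ?e n & t - ?e n < snd x & snd x < t & fst x <= snd x & \<bar>P (snd x) - P (fst x)\<bar> <= ?e n"
 by (intro exI[of _ "(r, s)"]) simp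
 qed
 from choice[OF this] obtain x where x: "ALL n. 0 < fst (x n) & fst (x n) < ?e n & t - ?e n < snd (x n) & snd (x n) < t & fst (x n) <= snd (x n) & \<bar>P (snd (x n)) - P (fst (x n))\<bar> <= ?e n"
 by (elim exE)
 define r where "r n = fst (x n)" for n
 define s where "s n = snd (x n)" for n
 have rs: "0 < r n" "r n < ?e n" "t - ?e n < s n" "s n < t" "r n <= s n" "\<bar>P (s n) - P (r n)\<bar> <= ?e n" for n
 using x[rule_format, of n] by (simp_all add: r_def s_def)
 have i0: "(%n. inverse (real (Suc n))) ----> 0" by (rule LIMSEQ_inverse_real_of_nat)
 have r0: "r ----> 0"
 by (rule tendsto_bound_null[OF _ i0]) (use rs(1,2) in \<open>simp add: less_imp_le\<close>)
 have st: "s ----> t"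
 proof (rule tendsto_bound_null[OF _ i0])
 show "\<bar>s n - t\<bar> <= inverse (real (Suc n))" for n using rs(3,4)[of n] by linarith
 qed
 have sn: "0 <= s n" "s n <= T" "r n <= T" "0 <= r n" for n using rs(1,4,5)[of n] t(2) by linarith+
 have Pr: "(%n. P (r n)) ----> P 0" by (rule P_at_0[OF sn(4,3) r0])
 have Psr: "(%n. P (s n) - P (r n)) ----> 0"
 proof (rule tendsto_bound_null[OF _ i0])
 show "\<bar>P (s n) - P (r n) - 0\<bar> <= inverse (real (Suc n))" for n using rs(6)[of n] by linarith
 qed
 have Ps: "(%n. P (s n)) ----> P 0" using tendsto_add[OF Psr Pr] by simp
 have Ks: "(%n. \<integral>tau. K tau \<partial>Leb {0..s n}) ----> (LINT tau|Leb {0..t}. K tau)"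
 by (rule continuous_on_tendsto_compose[OF indefinite_integral_continuous_real[OF integrable_K[OF order_refl order_refl]] st])
 (use sn t in auto)
 have up: "(%n. y 0 + 2 * (P 0 - P (s n)) + (LINT tau|Leb {0..s n}. K tau)) ----> y 0 + 2 * (P 0 - P 0) + (LINT tau|Leb {0..t}. K tau)"
 by (intro tendsto_add tendsto_mult tendsto_diff tendsto_const Ps Ks)
 have t0: "0 <= t" using t by simp
 have "y t <= y 0 + 2 * (P 0 - P 0) + (LINT tau|Leb {0..t}. K tau)"
 proof (rule LIMSEQ_le[OF y_lower_tendsto[OF sn(1) t0 st] up], intro exI[of _ 0] allI impI)
 fix n :: nat
 show "2 * (inner_B S (A.u (s n)) (w t) - inner_B S (B.u (s n)) (w t)) - energy S (w t) + Z (s n) \<bullet> (J *v Z (s n))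
 <= y 0 + 2 * (P 0 - P (s n)) + (LINT tau|Leb {0..s n}. K tau)"
 by (rule order_trans[OF y_lower[OF sn(1) t0] y_upper[OF sn(1,2)]])
 qed
 then show ?thesis by simp
qed

text \<open>By skew symmetry all terms that are not quadratic in the difference cancel.\<close>

lemma K_eq:
 assumes g: "good tau"
 shows "K tau = 2 * (cross3 (om1' tau) (Z tau + b_vec S (w tau)) \<bullet> (J *v Z tau)) + 2 * tri (w tau) (w tau) (B.u tau)
 + 4 * cor (Z tau + b_vec S (w tau)) (w tau) (B.u tau) - 4 * viscosity S * dis (w tau) (w tau)"
proof -
 have a: "A.u tau \<in> H12 S" and b: "B.u tau \<in> H12 S" and tau: "0 <= tau" using g by (auto simp: good_def)
 have ww: "w tau \<in> H12 S" unfolding w_def by (rule H12_diff[OF a b])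
 note sa = H12_D(1)[OF a] and sb = H12_D(1)[OF b] and sw = H12_D(1)[OF ww]
 have c1: "b_vec S (B.u tau) \<bullet> A.c tau + B.W tau \<bullet> A.c tau = cross3 (om1' tau) (om1 tau) \<bullet> (J *v A.W tau)"
 unfolding A.c_def triple_product[symmetric] B.om1_eq[of tau] by (simp add: inner_add_left)
 have c2: "b_vec S (A.u tau) \<bullet> B.c tau + A.W tau \<bullet> B.c tau = cross3 (om1 tau) (om1' tau) \<bullet> (J *v B.W tau)"
 unfolding B.c_def triple_product[symmetric] A.om1_eq[of tau] by (simp add: inner_add_left)
 have "cross3 (om1' tau) (Z tau + b_vec S (w tau)) = cross3 (om1' tau) (om1 tau)"
 unfolding zeta_eq[OF tau, symmetric] by (simp add: Cross3.right_diff_distrib)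
 moreover have "cross3 (om1 tau) (om1' tau) = - cross3 (om1' tau) (om1 tau)" by (rule cross_skew)
 ultimately have c3: "cross3 (om1' tau) (Z tau + b_vec S (w tau)) \<bullet> (J *v Z tau) =
 cross3 (om1' tau) (om1 tau) \<bullet> (J *v A.W tau) + cross3 (om1 tau) (om1' tau) \<bullet> (J *v B.W tau)"
 unfolding Z_def[of tau] by (simp add: matrix_vector_mult_diff_distrib inner_diff_right)
 have t: "tri (w tau) (w tau) (B.u tau) = tri (A.u tau) (A.u tau) (B.u tau) + tri (B.u tau) (B.u tau) (A.u tau)"
 proof -
 have "tri (w tau) (w tau) (B.u tau) = tri (w tau) (A.u tau) (B.u tau) - tri (w tau) (B.u tau) (B.u tau)"
 unfolding w_def by (rule tri_diff(2)[OF a b ww[unfolded w_def] b])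
 moreover have "tri (w tau) (B.u tau) (B.u tau) = 0" using tri_skew[OF ww b b] by simp
 moreover have "tri (w tau) (A.u tau) (B.u tau) = tri (A.u tau) (A.u tau) (B.u tau) - tri (B.u tau) (A.u tau) (B.u tau)"
 unfolding w_def by (rule tri_diff(1)[OF a b a b])
 moreover have "tri (B.u tau) (A.u tau) (B.u tau) = - tri (B.u tau) (B.u tau) (A.u tau)" by (rule tri_skew[OF b a b])
 ultimately show ?thesis by linarith
 qed
 have co: "cor (Z tau + b_vec S (w tau)) (w tau) (B.u tau) = cor (om1 tau) (A.u tau) (B.u tau) + cor (om1' tau) (B.u tau) (A.u tau)"
 proof -
 let ?z = "om1 tau - om1' tau"
 have "cor ?z (w tau) (B.u tau) = cor ?z (A.u tau) (B.u tau) - cor ?z (B.u tau) (B.u tau)"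
 unfolding w_def by (rule cor_diff(1)[OF sa sb sb])
 moreover have "cor ?z (B.u tau) (B.u tau) = 0" using cor_diff(4)[OF sb sb sb, of ?z] by simp
 moreover have "cor ?z (A.u tau) (B.u tau) = cor (om1 tau) (A.u tau) (B.u tau) - cor (om1' tau) (A.u tau) (B.u tau)" by (rule cor_diff(3)[OF sa sb sb])
 moreover have "cor (om1' tau) (A.u tau) (B.u tau) = - cor (om1' tau) (B.u tau) (A.u tau)" by (rule cor_diff(4)[OF sa sb sb])
 ultimately show ?thesis unfolding zeta_eq[OF tau, symmetric] by linarith
 qed
 have d: "dis (w tau) (w tau) = dis (A.u tau) (A.u tau) - dis (A.u tau) (B.u tau) - dis (B.u tau) (A.u tau) + dis (B.u tau) (B.u tau)"
 using dis_facts(1)[OF a b ww] dis_facts(2)[OF a b a] dis_facts(2)[OF a b b] unfolding w_def by linarith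
 have dv: "viscosity S * dis (w tau) (w tau) = viscosity S * dis (A.u tau) (A.u tau) - viscosity S * dis (A.u tau) (B.u tau)
 - viscosity S * dis (B.u tau) (A.u tau) + viscosity S * dis (B.u tau) (B.u tau)"
 unfolding d by (simp add: algebra_simps)
 show ?thesis
 unfolding K_def H_def A.F_def B.F_def c3 t co using c1 c2 dv by (simp add: algebra_simps)
qed

text \<open>The end point \<open>T\<close> is reached by lower semicontinuity.\<close>

lemma gronwall:
 assumes C0: "0 <= C0" "ALL w:H12 S. ALL b:H12 S. ALL omega omega1 Z. b \<in> Lqs --> (ALL x:cball 0 R. b x = cross3 omega x) -->
 2 * (cross3 omega1 (Z + b_vec S w) \<bullet> (J *v Z)) + 2 * tri w w b + 4 * cor (Z + b_vec S w) w b - 4 * viscosity S * dis w w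
 <= C0 * (1 + norm omega1 + (norm omega)\<^sup>2 + Nq b powr p) * (energy S w + Z \<bullet> (J *v Z))"
 and a: "0 <= a3" "0 <= a4" "!!s. s \<in> {0..T} ==> norm (om1' s) <= a3" "!!s. s \<in> {0..T} ==> norm (om' s) <= a4"
 and n: "2 * (C0 * ((1 + a3 + a4\<^sup>2) * T + (LINT s|MT. Nq (v' s) powr p))) <= real n"
 and t: "t \<in> {0..T}"
 shows "y t <= 2 ^ n * y 0"
proof -
 define g where "g s = C0 * ((1 + a3 + a4\<^sup>2) + Nq (B.u s) powr p)" for s
 define Y where "Y s = (if s \<in> {0..T} then y s else 0)" for s
 have g0: "0 <= g s" for s unfolding g_def using C0(1) a(1) by (intro mult_nonneg_nonneg add_nonneg_nonneg) auto
 have one: "integrable MT (%t. z :: real)" for z by (rule finite_measure.integrable_const[OF finite_measure_lebesgue_on]) simp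
 have mi: "integrable MT (%s. Nq (B.u s) powr p)" using B_serrin by (simp add: Bochner_Lp_def)
 have gi: "integrable MT g" unfolding g_def[abs_def] by (intro integrable_mult_right Bochner_Integration.integrable_add one mi)
 have gint: "(LINT s|MT. g s) = C0 * ((1 + a3 + a4\<^sup>2) * T + (LINT s|MT. Nq (v' s) powr p))"
 unfolding g_def using mi one T by (simp add: measure_restrict_space Lq_extend(2))
 have ymeas: "y \<in> borel_measurable MT"
 proof -
 have "(%s. (inner_B S (A.u s) (A.u s) + A.W s \<bullet> (J *v A.W s)) + (inner_B S (B.u s) (B.u s) + B.W s \<bullet> (J *v B.W s))
 - 2 * (inner_B S (A.u s) (B.u s) + B.W s \<bullet> (J *v A.W s))) \<in> borel_measurable MT"
 by (intro borel_measurable_add borel_measurable_diff borel_measurable_times borel_measurable_const borel_measurable_inner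
 A.measurable_time_pair(4)[OF A.u_strong] A.measurable_time_pair(4)[OF B.u_strong] B.measurable_time_pair(4)[OF B.u_strong]
 A.measurable_c(2) B.measurable_c(2)
 borel_measurable_continuous_on[OF linear_continuous_on[OF matrix_vector_mul_bounded_linear] A.measurable_c(2)]
 borel_measurable_continuous_on[OF linear_continuous_on[OF matrix_vector_mul_bounded_linear] B.measurable_c(2)])
 then show ?thesis by (rule measurable_cong[THEN iffD1, rotated]) (simp add: y_eq energy_eq)
 qed
 obtain M where M: "!!s. s \<in> {0..T} ==> y s <= M"
 proof -
 have "y s <= (energy S (A.u 0) + A.W 0 \<bullet> (J *v A.W 0)) * 2 + (energy S (B.u 0) + B.W 0 \<bullet> (J *v B.W 0)) * 2" if s: "s \<in> {0..T}" for s
 proof -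
 have s0: "0 <= s" using s by simp
 have di: "0 <= dis x x" for x unfolding dis_def by (rule Bochner_Integration.integral_nonneg) simp
 have A: "energy S (A.u s) + A.W s \<bullet> (J *v A.W s) <= energy S (A.u 0) + A.W 0 \<bullet> (J *v A.W 0)"
 using A.energy_bound[OF s0] Bochner_Integration.integral_nonneg[of "Leb {0..s}" "%tau. dis (A.u tau) (A.u tau)", OF di] pos(3)
 mult_nonneg_nonneg[of "4 * viscosity S" "\<integral>tau. dis (A.u tau) (A.u tau) \<partial>Leb {0..s}"] by linarith
 have B: "energy S (B.u s) + B.W s \<bullet> (J *v B.W s) <= energy S (B.u 0) + B.W 0 \<bullet> (J *v B.W 0)"
 using B.energy_bound[OF s0] Bochner_Integration.integral_nonneg[of "Leb {0..s}" "%tau. dis (B.u tau) (B.u tau)", OF di] pos(3)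
 mult_nonneg_nonneg[of "4 * viscosity S" "\<integral>tau. dis (B.u tau) (B.u tau) \<partial>Leb {0..s}"] by linarith
 have sq: "sqint MV (%x. - B.u s x)" using sqint_scaleR[OF B.u_sq[OF s0], of "-1"] by simp
 have "0 <= energy S (%x. A.u s x - (- B.u s x))" by (rule energy_nonneg[OF sqint_diff[OF A.u_sq[OF s0] sq]])
 moreover have "inner_B S (A.u s) (%x. - B.u s x) = - inner_B S (A.u s) (B.u s)"
 using inner_B_diff[OF sqint_zero B.u_sq[OF s0] A.u_sq[OF s0]] inner_B_diff[OF sqint_zero sqint_zero A.u_sq[OF s0]]
 by (simp add: inner_B_commute[of "A.u s"])
 moreover have "energy S (%x. - B.u s x) = energy S (B.u s)"
 using energy_diff[OF sqint_zero B.u_sq[OF s0]] inner_B_diff[OF sqint_zero sqint_zero B.u_sq[OF s0]]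
 inner_B_diff[OF sqint_zero sqint_zero sqint_zero] by (simp add: energy_eq)
 ultimately have m1: "- 2 * inner_B S (A.u s) (B.u s) <= energy S (A.u s) + energy S (B.u s)"
 unfolding energy_diff[OF A.u_sq[OF s0] sq] by linarith
 have m2: "- 2 * (B.W s \<bullet> (J *v A.W s)) <= A.W s \<bullet> (J *v A.W s) + B.W s \<bullet> (J *v B.W s)"
 proof -
 have "0 <= lam * (norm (A.W s + B.W s))\<^sup>2" using pos(4) by simp
 then have "0 <= (A.W s + B.W s) \<bullet> (J *v (A.W s + B.W s))" using J_lower[of "A.W s + B.W s"] by linarith
 then show ?thesis using J_sym[of "A.W s" "B.W s"] by (simp add: inner_add_left inner_add_right matrix_vector_right_distrib)
 qed
 have "(ea + qa) + (eb + qb) - 2 * (i + j) <= x * 2 + z * 2"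
 if "ea + qa <= x" "eb + qb <= z" "- 2 * i <= ea + eb" "- 2 * j <= qa + qb" for ea qa eb qb i j x z :: real
 using that by (simp add: algebra_simps)
 from this[OF A B m1 m2] show ?thesis unfolding y_eq[OF s0] .
 qed
 then show ?thesis by (rule that)
 qed
 have M0: "0 <= M" using M[of 0] y_nonneg[of 0] T by simp
 have gYi: "integrable MT (%s. g s * Y s)"
 proof (rule Bochner_Integration.integrable_bound[where f = "%s. M * g s"])
 show "integrable MT (%s. M * g s)" using gi by simp
 have "Y \<in> borel_measurable MT" using ymeas by (rule measurable_cong[THEN iffD1, rotated]) (simp add: Y_def)
 then show "(%s. g s * Y s) \<in> borel_measurable MT" using gi by (intro borel_measurable_times) auto
 show "AE s in MT. norm (g s * Y s) <= norm (M * g s)"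
 proof (rule AE_I2)
 fix s assume "s \<in> space MT"
 then have s: "s \<in> {0..T}" by simp
 then have "0 <= Y s" "Y s <= M" using M[OF s] y_nonneg[of s] by (auto simp: Y_def)
 then have "g s * Y s <= g s * M" "0 <= g s * Y s" using g0[of s] by (auto intro: mult_left_mono)
 then show "norm (g s * Y s) <= norm (M * g s)" by (simp add: mult.commute)
 qed
 qed
 have Ky: "AE s in MT. K s <= g s * Y s"
 using good_AE
 proof eventually_elim
 case (elim s)
 have s: "s \<in> {0..T}" "A.u s \<in> H12 S" "B.u s \<in> H12 S" "B.u s \<in> Lqs" "0 <= s" using elim by (auto simp: good_def)
 have ww: "w s \<in> H12 S" unfolding w_def by (rule H12_diff[OF s(2,3)])
 have "K s <= C0 * (1 + norm (om1' s) + (norm (om' s))\<^sup>2 + Nq (B.u s) powr p) * y s"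
 unfolding K_eq[OF elim] y_def by (rule C0(2)[rule_format, OF ww s(3,4)]) (rule B.u_ball)
 also have "... <= g s * y s"
 proof (rule mult_right_mono[OF _ y_nonneg[OF s(5)]])
 have "(norm (om' s))\<^sup>2 <= a4\<^sup>2" by (rule power_mono[OF a(4)[OF s(1)]]) simp
 then show "C0 * (1 + norm (om1' s) + (norm (om' s))\<^sup>2 + Nq (B.u s) powr p) <= g s"
 unfolding g_def using a(3)[OF s(1)] C0(1) by (intro mult_left_mono) auto
 qed
 finally show ?case using s(1) by (simp add: Y_def)
 qed
 have bound: "Y r <= y 0 + (LINT s|Leb {0..r}. g s * Y s)" if r: "0 <= r" "r < T" for r
 proof -
 have i: "integrable (Leb {0..r}) (%s. g s * Y s)"
 by (rule integrable_subset[OF gYi[folded integrable_Icc_Ioo]]) (use r in auto)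
 have "AE s in Leb {0<..<r}. K s <= g s * Y s" by (rule AE_lebesgue_on_subset[OF Ky]) (use r in auto)
 then have ae: "AE s in Leb {0..r}. K s <= g s * Y s" by (rule AE_lebesgue_on_Icc)
 show ?thesis
 proof (cases "r = 0")
 case True
 have "0 <= (LINT s|Leb {0..r}. g s * Y s)"
 by (rule Bochner_Integration.integral_nonneg) (use g0 y_nonneg in \<open>auto simp: Y_def\<close>)
 then show ?thesis using True T by (simp add: Y_def)
 next
 case False
 have "y r <= y 0 + (LINT s|Leb {0..r}. K s)" using energy_difference[of r] r False by simp
 also have "... <= y 0 + (LINT s|Leb {0..r}. g s * Y s)"
 using integral_mono_AE[OF integrable_K[OF order_refl] i ae] r by simp
 finally show ?thesis using r by (simp add: Y_def)
 qed
 qed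
 have Y0: "0 <= Y s" for s using y_nonneg[of s] by (simp add: Y_def)
 have y00: "0 <= y 0" by (rule y_nonneg) simp
 have step: "y r <= 2 ^ n * y 0" if r: "0 <= r" "r < T" for r
 proof -
 have "(LINT s|Leb {0..r}. g s) <= (LINT s|Leb {0..T}. g s)"
 by (rule integral_subset_le[OF gi[folded integrable_Icc_Ioo]]) (use r g0 in auto)
 also have "... = (LINT s|MT. g s)" by (rule integral_Icc_Ioo[OF gi[folded integrable_Icc_Ioo]])
 also have "... <= real n / 2" unfolding gint using n by simp
 finally have gn: "(LINT s|Leb {0..r}. g s) <= real n / 2" .
 have "Y r <= 2 ^ n * y 0"
 by (rule gronwall_doubling[OF gi[folded integrable_Icc_Ioo] g0 gYi[folded integrable_Icc_Ioo] Y0 y00 bound r gn])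
 then show ?thesis using r by (simp add: Y_def)
 qed
 show ?thesis
 proof (cases "t = T")
 case True
 have tT: "0 <= T" using T by simp
 define s where "s m = T - T * inverse (real (Suc m))" for m
 have s: "0 <= s m" "s m < T" for m
 proof -
 have "inverse (real (Suc m)) <= 1" "0 < inverse (real (Suc m))" by (auto simp: field_simps)
 then show "0 <= s m" "s m < T" using T mult_left_mono[of "inverse (real (Suc m))" 1 T] by (auto simp: s_def)
 qed
 have "s ----> T - T * 0" unfolding s_def by (intro tendsto_diff tendsto_mult tendsto_const LIMSEQ_inverse_real_of_nat)
 then have sl: "s ----> T" by simp
 have "y T <= 2 ^ n * y 0"
 by (rule LIMSEQ_le_const2[OF y_lower_tendsto[OF s(1) tT sl]])
 (intro exI[of _ 0] allI impI order_trans[OF y_lower[OF s(1) tT] step[OF s]])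
 then show ?thesis using True by simp
 next
 case False
 then show ?thesis using step[of t] t by simp
 qed
qed

end

context solution_pair
begin

lemma l2_liquid_eq:
 assumes t: "0 <= t" and f: "AE x in Ml. v t x - v' t x = f x"
 shows "l2 Ml (w t) = l2 Ml f"
proof -
 have m: "w t \<in> borel_measurable Ml" by (rule sqintD(1)[OF sqint_split(1)[OF w_sq[OF t]]])
 have ae: "AE x in Ml. w t x = f x"
 using f AE_space[of Ml] by eventually_elim (simp add: w_def A.u_liquid B.u_liquid)
 show ?thesis by (rule l2_cong_AE[OF m borel_measurable_lebesgue_on_AE[OF liquid(2) m ae] ae])
qed

lemma l2_liquid_zero:
 assumes t: "0 <= t" and z: "l2 Ml (w t) = 0"
 shows "AE x in Ml. v t x = v' t x"
proof -
 have "(LINT x|Ml. (norm (w t x))\<^sup>2) = 0" using z l2_power2[of Ml "w t"] by simp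
 then have "AE x in Ml. (norm (w t x))\<^sup>2 = 0"
 using integral_nonneg_eq_0_iff_AE[OF sqintD(2)[OF sqint_split(1)[OF w_sq[OF t]]]] by simp
 then show ?thesis using AE_space[of Ml] by eventually_elim (simp add: w_def A.u_liquid B.u_liquid)
qed

lemma stability:
 assumes C0: "0 <= C0" "ALL w:H12 S. ALL b:H12 S. ALL omega omega1 Z. b \<in> Lqs --> (ALL x:cball 0 R. b x = cross3 omega x) -->
 2 * (cross3 omega1 (Z + b_vec S w) \<bullet> (J *v Z)) + 2 * tri w w b + 4 * cor (Z + b_vec S w) w b - 4 * viscosity S * dis w w
 <= C0 * (1 + norm omega1 + (norm omega)\<^sup>2 + Nq b powr p) * (energy S w + Z \<bullet> (J *v Z))"
 and Ce: "0 < Ce" "ALL w omega Z. sqint MV w --> (ALL x:cball 0 R. w x = cross3 omega x) -->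
 l2 Ml w + norm (Z + b_vec S w) + norm omega <= Ce * sqrt (energy S w + Z \<bullet> (J *v Z)) &
 sqrt (energy S w + Z \<bullet> (J *v Z)) <= Ce * (l2 Ml w + norm (Z + b_vec S w) + norm omega)"
 and t: "t \<in> {0..T}"
 shows "l2 Ml (w t) + norm (om1 t - om1' t) + norm (om t - om' t)
 <= Ce * Ce * sqrt (2 ^ nat \<lceil>2 * (C0 * ((1 + \<bar>SUP s\<in>{0..T}. norm (om1' s)\<bar> + (SUP s\<in>{0..T}. norm (om' s))\<^sup>2) * T + \<bar>Bochner_Lp_norm p {0<..<T} Nq v'\<bar> powr p))\<rceil>)
 * (l2 Ml (w 0) + norm (om1 0 - om1' 0) + norm (om 0 - om' 0))"
proof -
 let ?a3 = "SUP s\<in>{0..T}. norm (om1' s)" and ?a4 = "SUP s\<in>{0..T}. norm (om' s)"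
 define n where "n = nat \<lceil>2 * (C0 * ((1 + \<bar>?a3\<bar> + ?a4\<^sup>2) * T + \<bar>Bochner_Lp_norm p {0<..<T} Nq v'\<bar> powr p))\<rceil>"
 have b3: "bdd_above ((%s. norm (om1' s)) ` {0..T})"
 proof -
 obtain L where "\<forall>t\<in>{0..T}. norm (om1' t) <= L" using B.om1_bounded[of T] by blast
 then show ?thesis by (intro bdd_aboveI2[of _ _ L]) simp
 qed
 have b4: "bdd_above ((%s. norm (om' s)) ` {0..T})"
 proof -
 obtain L where "\<forall>t\<ge>0. norm (om' t) <= L" using B.om_bounded by blast
 then show ?thesis by (intro bdd_aboveI2[of _ _ L]) simp
 qed
 have a3: "norm (om1' s) <= ?a3" and a4: "norm (om' s) <= ?a4" if "s \<in> {0..T}" for s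
 by (rule cSUP_upper[OF that b3], rule cSUP_upper[OF that b4])
 have T0: "0 \<in> {0..T}" using T by simp
 have nn: "0 <= ?a3" "0 <= ?a4" using order_trans[OF norm_ge_zero a3[OF T0]] order_trans[OF norm_ge_zero a4[OF T0]] by auto
 have i0: "0 <= (LINT s|MT. Nq (v' s) powr p)" by (rule Bochner_Integration.integral_nonneg) simp
 have a2: "\<bar>Bochner_Lp_norm p {0<..<T} Nq v'\<bar> powr p = (LINT s|MT. Nq (v' s) powr p)"
 unfolding Bochner_Lp_norm_def using p_gt i0 by (simp add: powr_powr)
 have n: "2 * (C0 * ((1 + ?a3 + ?a4\<^sup>2) * T + (LINT s|MT. Nq (v' s) powr p))) <= real n"
 unfolding n_def a2 abs_of_nonneg[OF nn(1)] by (rule real_nat_ceiling_ge)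
 have t0: "0 <= t" using t by simp
 have yn: "y t <= 2 ^ n * y 0" by (rule gronwall[OF C0 nn a3 a4 n t])
 have eqv: "l2 Ml (w r) + norm (om1 r - om1' r) + norm (om r - om' r) <= Ce * sqrt (y r)"
 "sqrt (y r) <= Ce * (l2 Ml (w r) + norm (om1 r - om1' r) + norm (om r - om' r))" if r: "0 <= r" for r
 using Ce(2)[rule_format, OF w_sq[OF r], of "om r - om' r" "Z r"] w_ball unfolding zeta_eq[OF r] y_def by auto
 have "l2 Ml (w t) + norm (om1 t - om1' t) + norm (om t - om' t) <= Ce * sqrt (y t)" by (rule eqv(1)[OF t0])
 also have "... <= Ce * sqrt (2 ^ n * y 0)" using yn Ce(1) by (intro mult_left_mono) auto
 also have "... = Ce * sqrt (2 ^ n) * sqrt (y 0)" by (simp add: real_sqrt_mult)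
 also have "... <= Ce * sqrt (2 ^ n) * (Ce * (l2 Ml (w 0) + norm (om1 0 - om1' 0) + norm (om 0 - om' 0)))"
 using Ce(1) by (intro mult_left_mono eqv(2)) auto
 finally show ?thesis unfolding n_def[symmetric] by (simp only: mult_ac)
qed

end

text \<open>The exceptional set is Lebesgue measurable, hence a Borel set up to a null set, and the theorem
 of Tonelli applies to the Borel part.\<close>

lemma AE_product_sections:
 fixes f g :: "real \<times> 'a::euclidean_space => 'b::euclidean_space"
 assumes A: "I \<times> L \<in> sets lebesgue" and f: "f \<in> borel_measurable (Leb (I \<times> L))" and g: "g \<in> borel_measurable (Leb (I \<times> L))"
 and L: "L \<in> sets lebesgue" and ae: "!!t. t \<in> I ==> AE x in Leb L. f (t, x) = g (t, x)"
 shows "AE z in Leb (I \<times> L). f z = g z"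
proof -
 let ?B = "{z \<in> space (Leb (I \<times> L)). f z ~= g z}"
 have "?B \<in> sets (Leb (I \<times> L))" using f g by measurable
 then have B: "?B \<in> sets (completion lborel)" using A by (simp add: sets_restrict_space_iff)
 obtain D N N' where D: "?B = D \<union> N" "N \<subseteq> N'" "N' \<in> null_sets lborel" "D \<in> sets lborel" using sets_completionE[OF B] .
 have Dp: "D \<in> sets (lborel \<Otimes>\<^sub>M (lborel :: 'a measure))" using D(4) by (simp only: lborel_prod)
 have sec: "emeasure lborel (Pair t -` D) = 0" for t
 proof (cases "t \<in> I")
 case True
 have Q: "Pair t -` D \<in> sets lborel" by (rule sets_Pair1[OF Dp])
 have "AE x in lebesgue. x \<in> L --> f (t, x) = g (t, x)" using ae[OF True] L by (simp add: AE_restrict_space_iff)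
 then have "AE x in lebesgue. x ~: Pair t -` D"
 proof eventually_elim
 case (elim x)
 show ?case
 proof
 assume "x \<in> Pair t -` D"
 then have "(t, x) \<in> ?B" using D(1) by blast
 then show False using elim by simp
 qed
 qed
 moreover have "Pair t -` D \<in> sets lebesgue" using Q by simp
 ultimately have "Pair t -` D \<in> null_sets lebesgue" by (subst AE_iff_null_sets)
 then show ?thesis using Q by (simp add: null_sets_def)
 next
 case False
 have "Pair t -` D = {}"
 proof (rule equals0I)
 fix x assume "x \<in> Pair t -` D"
 then have "(t, x) \<in> ?B" using D(1) by blast
 then show False using False by simp
 qed
 then show ?thesis by simp
 qed
 have "emeasure (lborel \<Otimes>\<^sub>M lborel) D = (\<integral>\<^sup>+t. emeasure lborel (Pair t -` D) \<partial>lborel)"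
 by (rule lborel.emeasure_pair_measure_alt[OF Dp])
 then have "emeasure lborel D = 0" unfolding sec lborel_prod by simp
 then have "D \<in> null_sets lebesgue" using D(4) by (intro null_sets_completionI) (simp add: null_sets_def)
 moreover have "N' \<in> null_sets lebesgue" by (rule null_sets_completionI[OF D(3)])
 ultimately have "AE z in lebesgue. z ~: D \<union> N'" by (intro AE_not_in null_sets.Un)
 then have "AE z in lebesgue. z \<in> I \<times> L --> f z = g z"
 proof eventually_elim
 case (elim z)
 show ?case
 proof (intro impI, rule ccontr)
 assume "z \<in> I \<times> L" "f z ~= g z"
 then have "z \<in> ?B" by simp
 then show False using elim D(1,2) by blast
 qed
 qed
 then show ?thesis using A by (simp add: AE_restrict_space_iff)
qed


text \<open>The constant is the square of the constant of \<open>norm_equivalence\<close> times the Gronwall factor; the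
 number of doublings is computed from the integral of the growth rate, in which only the bounds of
 the starred solution occur. For part b the pointwise statement at every time is turned into one on
 space-time by \<open>AE_product_sections\<close>.\<close>

theorem theorem5p7:
  fixes S :: gap_system and T p q :: real
  assumes "admissible S" and "0 < T" and "3 < q" and "2 / p + 3 / q = 1"
  shows
    "(\<exists>c :: real \<Rightarrow> real \<Rightarrow> real \<Rightarrow> real \<Rightarrow> real.
       (\<forall>a1 a2 a3 a4. 0 < c a1 a2 a3 a4) \<and>
       (\<forall>v \<omega>1 \<omega> v0 \<omega>10 \<omega>0 v' \<omega>1' \<omega>' v0' \<omega>10' \<omega>0'.
          weak_solution S v \<omega>1 \<omega> \<longrightarrow> has_initial_data S v \<omega>1 \<omega> v0 \<omega>10 \<omega>0 \<longrightarrow>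
          weak_solution S v' \<omega>1' \<omega>' \<longrightarrow> has_initial_data S v' \<omega>1' \<omega>' v0' \<omega>10' \<omega>0' \<longrightarrow>
          v' \<in> Bochner_Lp p {0<..<T} (Lq_space q (liquid S)) (Lq_norm q (liquid S)) \<longrightarrow>
          (\<forall>t\<in>{0..T}.
             Lq_norm 2 (liquid S) (\<lambda>x. v t x - v' t x) + norm (\<omega>1 t - \<omega>1' t) + norm (\<omega> t - \<omega>' t)
             \<le> c (Bochner_Linf_norm {0<..<T} (Lq_norm 2 (liquid S)) v')
                 (Bochner_Lp_norm p {0<..<T} (Lq_norm q (liquid S)) v')
                 (SUP s\<in>{0..T}. norm (\<omega>1' s))
                 (SUP s\<in>{0..T}. norm (\<omega>' s))
               * (Lq_norm 2 (liquid S) (\<lambda>x. v0 x - v0' x) + norm (\<omega>10 - \<omega>10') + norm (\<omega>0 - \<omega>0')))))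
     \<and>
     (\<forall>v \<omega>1 \<omega> v0 \<omega>10 \<omega>0 v' \<omega>1' \<omega>' v0' \<omega>10' \<omega>0'.
       weak_solution S v \<omega>1 \<omega> \<longrightarrow> has_initial_data S v \<omega>1 \<omega> v0 \<omega>10 \<omega>0 \<longrightarrow>
       weak_solution S v' \<omega>1' \<omega>' \<longrightarrow> has_initial_data S v' \<omega>1' \<omega>' v0' \<omega>10' \<omega>0' \<longrightarrow>
       v' \<in> Bochner_Lp p {0<..<T} (Lq_space q (liquid S)) (Lq_norm q (liquid S)) \<longrightarrow>
       (AE x in lebesgue_on (liquid S). v0 x = v0' x) \<longrightarrow> \<omega>10 = \<omega>10' \<longrightarrow> \<omega>0 = \<omega>0' \<longrightarrow>
       (AE t in lebesgue_on {0..T}.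
          (AE x in lebesgue_on (liquid S). v t x = v' t x) \<and> \<omega>1 t = \<omega>1' t \<and> \<omega> t = \<omega>' t) \<and>
       ((\<lambda>(t, x). v t x) \<in> borel_measurable (lebesgue_on ({0..T} \<times> liquid S)) \<longrightarrow>
        (\<lambda>(t, x). v' t x) \<in> borel_measurable (lebesgue_on ({0..T} \<times> liquid S)) \<longrightarrow>
        (AE (t, x) in lebesgue_on ({0..T} \<times> liquid S).
           v t x = v' t x \<and> \<omega>1 t = \<omega>1' t \<and> \<omega> t = \<omega>' t)))"
proof -
 interpret gap S by (rule gap.intro[OF assms(1)])
 obtain C0 where C0: "0 <= C0" "ALL w:H12 S. ALL b:H12 S. ALL omega omega1 Z. b \<in> Lq_space q (liquid S) --> (ALL x:cball 0 R. b x = cross3 omega x) -->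
 2 * (cross3 omega1 (Z + b_vec S w) \<bullet> (J *v Z)) + 2 * tri w w b + 4 * cor (Z + b_vec S w) w b - 4 * viscosity S * dis w w
 <= C0 * (1 + norm omega1 + (norm omega)\<^sup>2 + Lq_norm q (liquid S) b powr p) * (energy S w + Z \<bullet> (J *v Z))"
 using difference_form_bound[OF assms(3,4)] by (elim exE conjE)
 obtain Ce where Ce: "0 < Ce" "ALL w omega Z. sqint MV w --> (ALL x:cball 0 R. w x = cross3 omega x) -->
 l2 Ml w + norm (Z + b_vec S w) + norm omega <= Ce * sqrt (energy S w + Z \<bullet> (J *v Z)) &
 sqrt (energy S w + Z \<bullet> (J *v Z)) <= Ce * (l2 Ml w + norm (Z + b_vec S w) + norm omega)"
 using norm_equivalence by (elim exE conjE)
 define c :: "real => real => real => real => real" where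
 "c a1 a2 a3 a4 = Ce * Ce * sqrt (2 ^ nat \<lceil>2 * (C0 * ((1 + \<bar>a3\<bar> + a4\<^sup>2) * T + \<bar>a2\<bar> powr p))\<rceil>)" for a1 a2 a3 a4
 have cpos: "0 < c a1 a2 a3 a4" for a1 a2 a3 a4 using Ce(1) by (simp add: c_def)
 have est: "Lq_norm 2 (liquid S) (%x. v t x - v' t x) + norm (omega1 t - omega1' t) + norm (omega t - omega' t)
 <= c (Bochner_Linf_norm {0<..<T} (Lq_norm 2 (liquid S)) v')
 (Bochner_Lp_norm p {0<..<T} (Lq_norm q (liquid S)) v')
 (SUP s\<in>{0..T}. norm (omega1' s))
 (SUP s\<in>{0..T}. norm (omega' s))
 * (Lq_norm 2 (liquid S) (%x. v0 x - v0' x) + norm (omega10 - omega10') + norm (omega0 - omega0'))"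
 and zero: "Lq_norm 2 (liquid S) (%x. v t x - v' t x) = 0 ==> AE x in Ml. v t x = v' t x"
 if ws: "weak_solution S v omega1 omega" "has_initial_data S v omega1 omega v0 omega10 omega0"
 "weak_solution S v' omega1' omega'" "has_initial_data S v' omega1' omega' v0' omega10' omega0'"
 "v' \<in> Bochner_Lp p {0<..<T} (Lq_space q (liquid S)) (Lq_norm q (liquid S))" and t: "t \<in> {0..T}"
 for v omega1 omega v0 omega10 omega0 v' omega1' omega' v0' omega10' omega0' t
 proof -
 interpret sol: solution_pair S v omega1 omega v' omega1' omega' T p q
 by unfold_locales (use assms ws in auto)
 have t0: "0 <= t" using t by simp
 have d: "AE x in Ml. v 0 x = v0 x" "omega1 0 = omega10" "omega 0 = omega0" "AE x in Ml. v' 0 x = v0' x" "omega1' 0 = omega10'" "omega' 0 = omega0'"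
 using ws(2,4) by (auto simp: has_initial_data_def)
 have "AE x in Ml. v 0 x - v' 0 x = v0 x - v0' x" using d(1,4) by eventually_elim simp
 from sol.l2_liquid_eq[OF order_refl this] have l0: "l2 Ml (sol.w 0) = Lq_norm 2 (liquid S) (%x. v0 x - v0' x)" by (simp add: Lq_norm_2)
 have lt: "l2 Ml (sol.w t) = Lq_norm 2 (liquid S) (%x. v t x - v' t x)" using sol.l2_liquid_eq[OF t0, of "%x. v t x - v' t x"] by (simp add: Lq_norm_2)
 show "Lq_norm 2 (liquid S) (%x. v t x - v' t x) + norm (omega1 t - omega1' t) + norm (omega t - omega' t)
 <= c (Bochner_Linf_norm {0<..<T} (Lq_norm 2 (liquid S)) v')
 (Bochner_Lp_norm p {0<..<T} (Lq_norm q (liquid S)) v')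
 (SUP s\<in>{0..T}. norm (omega1' s))
 (SUP s\<in>{0..T}. norm (omega' s))
 * (Lq_norm 2 (liquid S) (%x. v0 x - v0' x) + norm (omega10 - omega10') + norm (omega0 - omega0'))"
 using sol.stability[OF C0 Ce t] unfolding c_def l0 lt d .
 show "AE x in Ml. v t x = v' t x" if "Lq_norm 2 (liquid S) (%x. v t x - v' t x) = 0"
 using sol.l2_liquid_zero[OF t0] that unfolding lt .
 qed
 have equal: "(AE x in Ml. v t x = v' t x) & omega1 t = omega1' t & omega t = omega' t"
 if ws: "weak_solution S v omega1 omega" "has_initial_data S v omega1 omega v0 omega10 omega0"
 "weak_solution S v' omega1' omega'" "has_initial_data S v' omega1' omega' v0' omega10' omega0'"
 "v' \<in> Bochner_Lp p {0<..<T} (Lq_space q (liquid S)) (Lq_norm q (liquid S))"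
 and eq: "AE x in Ml. v0 x = v0' x" "omega10 = omega10'" "omega0 = omega0'" and t: "t \<in> {0..T}"
 for v omega1 omega v0 omega10 omega0 v' omega1' omega' v0' omega10' omega0' t
 proof -
 have "AE x in Ml. (norm (v0 x - v0' x))\<^sup>2 = 0" using eq(1) by eventually_elim simp
 then have "Lq_norm 2 (liquid S) (%x. v0 x - v0' x) = 0" unfolding Lq_norm_2 l2_def by (simp add: integral_eq_zero_AE)
 then have "Lq_norm 2 (liquid S) (%x. v t x - v' t x) + norm (omega1 t - omega1' t) + norm (omega t - omega' t) <= 0"
 using est[OF ws t] eq(2,3) by simp
 moreover have "0 <= Lq_norm 2 (liquid S) (%x. v t x - v' t x)" "0 <= norm (omega1 t - omega1' t)" "0 <= norm (omega t - omega' t)" by (rule Lq_norm_nonneg norm_ge_zero)+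
 ultimately have "Lq_norm 2 (liquid S) (%x. v t x - v' t x) = 0" "norm (omega1 t - omega1' t) = 0" "norm (omega t - omega' t) = 0" by linarith+
 then show ?thesis using zero[OF ws t] by simp
 qed
 have box: "{0..T} \<times> liquid S \<in> sets lebesgue"
 proof -
 have "{0..T} \<times> liquid S \<in> sets borel" using liquid(1) by (intro borel_Times) auto
 then show ?thesis by simp
 qed
 show ?thesis
 proof (intro conjI exI[of _ c] allI impI ballI, goal_cases)
 case (1 a1 a2 a3 a4)
 show ?case by (rule cpos)
 next
 case (2 v omega1 omega v0 omega10 omega0 v' omega1' omega' v0' omega10' omega0' t)
 then show ?case by (intro est)
 next
 case (3 v omega1 omega v0 omega10 omega0 v' omega1' omega' v0' omega10' omega0')
 show ?case by (rule AE_I2, rule equal[OF 3]) simp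
 next
 case (4 v omega1 omega v0 omega10 omega0 v' omega1' omega' v0' omega10' omega0')
 note eq = equal[OF 4(1-8)]
 have "AE z in Leb ({0..T} \<times> liquid S). (case z of (t, x) => v t x) = (case z of (t, x) => v' t x)"
 by (rule AE_product_sections[OF box 4(9,10) liquid(2)]) (use eq in auto)
 then show ?case using AE_space[of "Leb ({0..T} \<times> liquid S)"]
 proof eventually_elim
 case (elim z)
 obtain t x where z: "z = (t, x)" by (rule prod.exhaust)
 have "t \<in> {0..T}" using elim(2) by (simp add: z)
 then show ?case using elim(1) eq[of t] by (simp add: z)
 qed
 qed
qed

end
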